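(* The process $\mathscr M$ satisfies, for every $s\in[0,1]$, $$\mathbf E[\mathscr M(s)]=\kappa\,(s(1-s))^\beta,\qquad \kappa=\frac{c}{\mathrm B(\beta+1,\beta+1)}=3.34443\ldots,$$ where $c=\frac{\sqrt\pi\,\Gamma(2\gamma-1/2)}{2\,\Gamma(\gamma)\,\Gamma^2(\gamma+1/2)}$ with $\gamma=\beta/2+1$. This identifies it uniquely: $\mathscr M$ is the unique (in distribution) solution of the fixed-point equation (FP) given in the context among all processes $X$ with càdlàg paths subject to $\mathbf E[\|X\|^2]<\infty$ and with this mean function, $\mathbf E[X(s)]=\kappa(s(1-s))^\beta$ for all $s\in[0,1]$.
   Context: Let $\beta=(\sqrt{17}-3)/2$, $\mathrm B(x,y)=\int_0^1t^{x-1}(1-t)^{y-1}\,dt$, $\Gamma$ the Gamma function, and $\|f\|=\sup_{s\in[0,1]}|f(s)|$. Càdlàg functions on $[0,1]$ are right-continuous with left limits and are also assumed continuous at $1$. Recursive lamination. Points $s\in[0,1]$ (with $0$ and $1$ glued) are identified with the points $\frac1{2\pi}e^{2\pi i s}$ of the circle $\mathscr C=\{z\in\mathbb C:2\pi|z|=1\}$. Let $(U_i',V_i')_{i\ge1}$ be independent pairs of independent uniform random variables on $[0,1]$. At step $n=1,2,\dots$ the straight chord joining $U_n'$ and $V_n'$ is inserted if it does not intersect any previously inserted chord, and is discarded otherwise. $\mathfrak L_n$ denotes the collection of chords inserted up to time $n$. $C_n(s)$ is the number of chords of $\mathfrak L_n$ which intersect the straight segment from $0$ to $s$, considered as a right-continuous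 step function; i.e. the number of inserted chords with endpoints $a<b$ in $(0,1)$ such that $a\le s<b$. Limit process. $\mathscr M$ denotes the continuous random process on $[0,1]$ which is the limit of $n^{-\beta/2}C_n$ as $n\to\infty$, uniformly on $[0,1]$, almost surely and in $L^m$ for all $m\in\mathbb N$. Fixed-point equation (FP). A process $X=(X(s))_{s\in[0,1]}$ is a solution of (FP) in distribution if the following holds: let $X^{(0)},X^{(1)}$ be independent copies of $X$ and let $(U,V)$, independent of $(X^{(0)},X^{(1)})$, have density $2\,\mathbf 1_{\{0\le u\le v\le 1\}}$ on $[0,1]^2$; then $X$ has the same distribution as the process $$s\mapsto\begin{cases}(1-(V-U))^\beta X^{(0)}\!\left(\frac{s}{1-(V-U)}\right), & s<U,\\ (1-(V-U))^\beta X^{(0)}\!\left(\frac{U}{1-(V-U)}\right)+(V-U)^\beta X^{(1)}\!\left(\frac{s-U}{V-U}\right), & U\le s<V,\\ (1-(V-U))^\beta X^{(0)}\!\left(\frac{s-(V-U)}{1-(V-U)}\right), & s\ge V.\end{cases}$$ *)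

theory Defs
  imports "HOL-Probability.Probability"
begin

definition lam_beta :: real where
  "lam_beta = (sqrt 17 - 3) / 2"

definition lam_gamma :: real where
  "lam_gamma = lam_beta / 2 + 1"

definition lam_c :: real where
  "lam_c = sqrt pi * Gamma (2 * lam_gamma - 1 / 2)
             / (2 * Gamma lam_gamma * (Gamma (lam_gamma + 1 / 2))\<^sup>2)"

text \<open>The library's Beta function is Euler's integral, by \<open>has_integral_Beta_real\<close>.\<close>

definition lam_kappa :: real where
  "lam_kappa = lam_c / Beta (lam_beta + 1) (lam_beta + 1)"

definition mean_profile :: "real \<Rightarrow> real" where
  "mean_profile s = lam_kappa * (s * (1 - s)) powr lam_beta"

definition circle_pt :: "real \<Rightarrow> complex" where
  "circle_pt s = exp (2 * of_real pi * \<i> * of_real s) / (2 * of_real pi)"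

definition chord :: "real \<Rightarrow> real \<Rightarrow> complex set" where
  "chord a b = closed_segment (circle_pt a) (circle_pt b)"

text \<open>
  The chords inserted up to time \<open>n\<close>, each recorded as the pair of its endpoints in
  increasing order. The sequences \<open>u\<close>, \<open>v\<close> are indexed from 1; their values at 0 are not used.
\<close>

primrec lamination :: "(nat \<Rightarrow> real) \<Rightarrow> (nat \<Rightarrow> real) \<Rightarrow> nat \<Rightarrow> (real \<times> real) set" where
  "lamination u v 0 = {}"
| "lamination u v (Suc n) =
     (if \<forall>(a, b) \<in> lamination u v n. chord (u (Suc n)) (v (Suc n)) \<inter> chord a b = {}
      then insert (min (u (Suc n)) (v (Suc n)), max (u (Suc n)) (v (Suc n))) (lamination u v n)
      else lamination u v n)"

definition chord_count :: "(nat \<Rightarrow> real) \<Rightarrow> (nat \<Rightarrow> real) \<Rightarrow> nat \<Rightarrow> real \<Rightarrow> nat" where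
  "chord_count u v n s = card {(a, b) \<in> lamination u v n. 0 < a \<and> a \<le> s \<and> s < b \<and> b < 1}"

locale lamination_input = prob_space P
  for P :: "'a measure" and U V :: "nat \<Rightarrow> 'a \<Rightarrow> real" +
  assumes indep_pairs: "indep_vars (\<lambda>_. borel \<Otimes>\<^sub>M borel) (\<lambda>i \<omega>. (U i \<omega>, V i \<omega>)) {1..}"
    and indep_within_pair: "\<And>i. i \<ge> 1 \<Longrightarrow> indep_var borel (U i) borel (V i)"
    and uniform_U: "\<And>i. i \<ge> 1 \<Longrightarrow> distr P borel (U i) = uniform_measure lborel {0..1}"
    and uniform_V: "\<And>i. i \<ge> 1 \<Longrightarrow> distr P borel (V i) = uniform_measure lborel {0..1}"

text \<open>
  A process is a map \<open>X :: 'a \<Rightarrow> real \<Rightarrow> real\<close> sending \<open>\<omega>\<close> to the path \<open>X \<omega>\<close>. Only the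
  values of paths on \<open>{0..1}\<close> matter; everything below ignores values outside.
\<close>

definition sup_norm :: "(real \<Rightarrow> real) \<Rightarrow> real" where
  "sup_norm f = (SUP s\<in>{0..1}. \<bar>f s\<bar>)"

definition real_process :: "'a measure \<Rightarrow> ('a \<Rightarrow> real \<Rightarrow> real) \<Rightarrow> bool" where
  "real_process P X \<longleftrightarrow> (\<forall>s\<in>{0..1}. (\<lambda>\<omega>. X \<omega> s) \<in> borel_measurable P)"

definition cadlag :: "(real \<Rightarrow> real) \<Rightarrow> bool" where
  "cadlag f \<longleftrightarrow>
     (\<forall>s\<in>{0..<1}. continuous (at_right s) f) \<and>
     (\<forall>s\<in>{0<..1}. \<exists>l. (f \<longlongrightarrow> l) (at_left s)) \<and>
     continuous (at_left 1) f"

text \<open>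
  The law of a process is its law on the product sigma-algebra, i.e. the sigma-algebra
  generated by the evaluations. Its trace on the space of cadlag functions is the Borel
  sigma-algebra of the Skorokhod topology.
\<close>

definition path_law :: "'a measure \<Rightarrow> ('a \<Rightarrow> real \<Rightarrow> real) \<Rightarrow> (real \<Rightarrow> real) measure" where
  "path_law P X = distr P (\<Pi>\<^sub>M s\<in>{0..1}. borel) (\<lambda>\<omega>. restrict (X \<omega>) {0..1})"

text \<open>For \<open>m = 0\<close> the moment below is constantly 1, so only \<open>m \<ge> 1\<close> is meaningful.\<close>

definition is_lamination_limit ::
  "'a measure \<Rightarrow> (nat \<Rightarrow> 'a \<Rightarrow> real) \<Rightarrow> (nat \<Rightarrow> 'a \<Rightarrow> real) \<Rightarrow> ('a \<Rightarrow> real \<Rightarrow> real) \<Rightarrow> bool" where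
  "is_lamination_limit P U V M \<longleftrightarrow>
     (let Z = (\<lambda>n \<omega> s. real n powr (- lam_beta / 2)
                 * real (chord_count (\<lambda>i. U i \<omega>) (\<lambda>i. V i \<omega>) n s))
      in real_process P M \<and>
         (\<forall>\<omega>\<in>space P. continuous_on {0..1} (M \<omega>)) \<and>
         (AE \<omega> in P. uniform_limit {0..1} (\<lambda>n. Z n \<omega>) (M \<omega>) sequentially) \<and>
         (\<forall>m::nat. m \<ge> 1 \<longrightarrow>
            (\<lambda>n. \<integral>\<^sup>+ \<omega>. ennreal (sup_norm (\<lambda>s. Z n \<omega> s - M \<omega> s) ^ m) \<partial>P) \<longlonglongrightarrow> 0))"

definition glue :: "(real \<Rightarrow> real) \<Rightarrow> (real \<Rightarrow> real) \<Rightarrow> real \<Rightarrow> real \<Rightarrow> real \<Rightarrow> real" where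
  "glue x0 x1 u v s =
     (if s < u then (1 - (v - u)) powr lam_beta * x0 (s / (1 - (v - u)))
      else if s < v then
        (1 - (v - u)) powr lam_beta * x0 (u / (1 - (v - u)))
          + (v - u) powr lam_beta * x1 ((s - u) / (v - u))
      else (1 - (v - u)) powr lam_beta * x0 ((s - (v - u)) / (1 - (v - u))))"

text \<open>
  The sample space is restricted to the unit square, where \<open>glue\<close> evaluates its
  arguments only at points of \<open>{0..1}\<close>.
\<close>

definition uv_law :: "(real \<times> real) measure" where
  "uv_law = density (restrict_space (lborel \<Otimes>\<^sub>M lborel) ({0..1} \<times> {0..1}))
              (\<lambda>(u, v). 2 * indicator {(u, v). 0 \<le> u \<and> u \<le> v \<and> v \<le> 1} (u, v))"

text \<open>
  The independent copies and the pair \<open>(U, V)\<close> are realised as coordinates of a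
  product space; the law of the resulting process depends only on the joint law of its inputs.
\<close>

definition solves_FP :: "'a measure \<Rightarrow> ('a \<Rightarrow> real \<Rightarrow> real) \<Rightarrow> bool" where
  "solves_FP P X \<longleftrightarrow>
     path_law P X
       = path_law (P \<Otimes>\<^sub>M P \<Otimes>\<^sub>M uv_law) (\<lambda>(\<omega>0, \<omega>1, u, v). glue (X \<omega>0) (X \<omega>1) u v)"

definition admissible :: "'a measure \<Rightarrow> ('a \<Rightarrow> real \<Rightarrow> real) \<Rightarrow> bool" where
  "admissible P X \<longleftrightarrow>
     real_process P X \<and>
     (\<forall>\<omega>\<in>space P. cadlag (X \<omega>)) \<and>
     integrable P (\<lambda>\<omega>. (sup_norm (X \<omega>))\<^sup>2) \<and>
     (\<forall>s\<in>{0..1}. prob_space.expectation P (\<lambda>\<omega>. X \<omega> s) = mean_profile s)"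

end

theory Submission imports Defs "HOL-Probability.Probability" "HOL-Real_Asymp.Real_Asymp" begin

text \<open>
  The first chord cuts the disc into two parts of lengths \<open>1 - l\<close> and \<open>l\<close>; a later pair survives only
  if both of its points fall into the same part, which happens with probabilities \<open>(1 - l)\<^sup>2\<close> and \<open>l\<^sup>2\<close>,
  and the surviving pairs form independent sequences of uniform pairs after rescaling. Hence the
  count splits into two independent smaller counts, and in the limit this is the fixed-point equation.

  For the mean, the same decomposition at a uniform point gives a recursion whose solution is a
  binomial sum with hypergeometric coefficients; its growth rate yields \<open>c\<close> as the total mass of the mean
  function. The mean function solves a linear integral equation, of which \<open>(s (1 - s))\<^sup>\<beta>\<close> is a
  solution; the integral operator preserves mass and improves positivity, so a continuous solution of mass
  zero vanishes, and the mean is determined by its mass.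

  For uniqueness, compare two solutions on smooth test functions of finitely many coordinates. As the means
  agree, the expectations differ by at most a constant times the square of the scale at which the test is
  applied. Replacing the two copies in the fixed-point equation one at a time, as in Lindeberg's
  method, multiplies this constant by the expectation of \<open>(1 - l) powr (2 * \<beta>) + l powr (2 * \<beta>)\<close>, which is
  smaller than 1 because \<open>\<beta> > 1 / 2\<close>.

  The numerical bounds come from Stirling's formula at arguments near 16, where the
  Stirling constants of the five Gamma factors in the numerator and in the denominator cancel.
\<close>

subsection \<open>Test functions and laws of paths\<close>

text \<open>The obstacle is that the numbers of later pairs on the two sides of the first chord are
  random and dependent, while the fixed-point equation asks for independent copies.
  \<open>nn_integral_select_fill\<close> removes it at finite time: once the selected pairs are
  continued by fresh uniform pairs, the two streams are independent of each other and of the pair of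
  counts, and for the counts a law of large numbers is enough. It is proved along square times,
  where Chebyshev bounds are summable; this suffices because the rescaled counts already converge.
  The recursion for the mean closes at a uniform point because collapsing an arc of length
  \<open>l\<close> sends such a point to a uniform point with probability \<open>1 - l\<close> and
  otherwise to the collapsed arc \<open>w\<close>, which is uniform as well and independent of
  \<open>l\<close>. Binomial thinning by \<open>p\<close> multiplies the coefficient of
  \<open>n choose j\<close> by \<open>p ^ j\<close>, so the recursion is diagonal in the binomial
  basis. The quadratic for \<open>lam_beta\<close> is the condition that the mean operator preserves
  mass; the exponent \<open>lam_beta / 2\<close> of time is half of \<open>lam_beta\<close> because
  survival probabilities are squares of lengths.\<close>

definition smooth_test :: "(real \<Rightarrow> real) \<Rightarrow> bool" where
  "smooth_test f \<longleftrightarrow> (\<forall>x. 0 \<le> f x \<and> f x \<le> 1) \<and>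
     (\<exists>K\<ge>0. (\<forall>x h. \<bar>f (x + h) - f x\<bar> \<le> K * \<bar>h\<bar>) \<and>
       (\<forall>x. \<exists>d. \<bar>d\<bar> \<le> K \<and> (\<forall>h. \<bar>f (x + h) - f x - d * h\<bar> \<le> K * h\<^sup>2)))"

lemma smooth_test_bounds:
  assumes "smooth_test f" shows "0 \<le> f x" "f x \<le> 1" "\<bar>f x\<bar> \<le> 1"
  using assms unfolding smooth_test_def by (auto simp: abs_le_iff intro: order_trans[of _ 0])

lemma smooth_test_continuous:
  assumes "smooth_test f" shows "continuous_on UNIV f"
proof -
  obtain K where K: "K \<ge> 0" "\<And>x h. \<bar>f (x + h) - f x\<bar> \<le> K * \<bar>h\<bar>"
    using assms unfolding smooth_test_def by blast
  have "K-lipschitz_on UNIV f"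
  proof (rule lipschitz_onI)
    fix x y :: real
    show "dist (f x) (f y) \<le> K * dist x y"
      using K(2)[of y "x - y"] by (simp add: dist_real_def)
  qed (use K in auto)
  then show ?thesis by (rule lipschitz_on_continuous_on)
qed

lemma smooth_test_measurable: "smooth_test f \<Longrightarrow> f \<in> borel_measurable borel"
  by (intro borel_measurable_continuous_onI smooth_test_continuous)

text \<open>Bounded first and second derivatives give both estimates with one constant; the
  remainder comes from the mean value bound for \<open>f y - f' x * y\<close> on the ball of radius
  |h|, where its derivative is at most \<open>K\<close> times |h|.\<close>

lemma smooth_testI:
  assumes bd: "\<And>x. 0 \<le> f x" "\<And>x. f x \<le> 1"
    and f': "\<And>x. (f has_real_derivative f' x) (at x)" "\<And>x. \<bar>f' x\<bar> \<le> K"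
    and f'': "\<And>x. (f' has_real_derivative f'' x) (at x)" "\<And>x. \<bar>f'' x\<bar> \<le> K"
  shows "smooth_test f"
proof -
  have K: "0 \<le> K" using f'(2)[of 0] by linarith
  have lip: "\<bar>f x - f y\<bar> \<le> K * \<bar>x - y\<bar>" for x y
    using field_differentiable_bound[of UNIV f f' K x y] f' by (auto intro: DERIV_subset)
  have lip': "\<bar>f' x - f' y\<bar> \<le> K * \<bar>x - y\<bar>" for x y
    using field_differentiable_bound[of UNIV f' f'' K x y] f'' by (auto intro: DERIV_subset)
  have quad: "\<bar>f (x + h) - f x - f' x * h\<bar> \<le> K * h\<^sup>2" for x h
  proof -
    have "\<bar>(f (x + h) - f' x * (x + h)) - (f x - f' x * x)\<bar> \<le> (K * \<bar>h\<bar>) * \<bar>(x + h) - x\<bar>"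
    proof (rule field_differentiable_bound[of "cball x \<bar>h\<bar>" "\<lambda>y. f y - f' x * y" "\<lambda>y. f' y - f' x" "K * \<bar>h\<bar>" "x + h" x, unfolded real_norm_def])
      show "\<bar>f' y - f' x\<bar> \<le> K * \<bar>h\<bar>" if "y \<in> cball x \<bar>h\<bar>" for y
        using lip'[of y x] mult_left_mono[OF _ K, of "\<bar>y - x\<bar>" "\<bar>h\<bar>"] that
        by (auto simp: dist_real_def abs_minus_commute)
      show "((\<lambda>y. f y - f' x * y) has_real_derivative f' y - f' x) (at y within cball x \<bar>h\<bar>)" for y
        by (rule derivative_eq_intros DERIV_subset[OF f'(1)] refl | simp)+
    qed (auto simp: dist_real_def)
    then show ?thesis by (simp add: power2_eq_square algebra_simps)
  qed
  have "\<bar>f (x + h) - f x\<bar> \<le> K * \<bar>h\<bar>" for x h using lip[of "x + h" x] by simp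
  moreover have "\<exists>d. \<bar>d\<bar> \<le> K \<and> (\<forall>h. \<bar>f (x + h) - f x - d * h\<bar> \<le> K * h\<^sup>2)" for x
    by (rule exI[of _ "f' x"]) (use quad f'(2) in auto)
  ultimately show ?thesis
    unfolding smooth_test_def using bd K by (intro conjI exI[where x = K and P = "\<lambda>K. 0 \<le> K \<and> _ K"]) simp_all
qed

text \<open>A smooth stand-in for the indicator of \<open>{..a}\<close>. The offset
  \<open>sqrt (real n)\<close> grows more slowly than the slope \<open>n\<close>: it forces the
  limit 1 at \<open>x = a\<close> itself and still leaves the limit 0 to the right of
  \<open>a\<close>.\<close>

definition soft_step :: "real \<Rightarrow> nat \<Rightarrow> real \<Rightarrow> real" where
  "soft_step a n x = 1 / 2 - arctan (real n * (x - a) - sqrt (real n)) / pi"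

lemma smooth_test_soft_step: "smooth_test (soft_step a n)"
proof -
  define y where "y = (\<lambda>x. real n * (x - a) - sqrt (real n))"
  \<comment> \<open>The first derivative is at most n and the second at most n^2, the latter because
    2|y| \<le> 1 + y^2.\<close>
  define K where "K = real n + (real n)\<^sup>2"
  have p: "pi \<ge> 1" using pi_ge_two by linarith
  have y': "(y has_real_derivative real n) (at x)" for x
    unfolding y_def by (auto intro!: derivative_eq_intros)
  have step_eq: "soft_step a n x = 1 / 2 - arctan (y x) / pi" for x by (simp add: soft_step_def y_def)
  have pos: "1 + (y x)\<^sup>2 \<noteq> 0" "1 + (y x)\<^sup>2 > 0" "1 + (y x)\<^sup>2 \<ge> 1" for x
    by (auto simp: add_nonneg_eq_0_iff add_pos_nonneg)
  show ?thesis
  proof (rule smooth_testI)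
    fix x
    show "0 \<le> soft_step a n x" "soft_step a n x \<le> 1"
      using arctan_bounded[of "y x"] pi_gt_zero unfolding step_eq by (auto simp: field_simps)
    show "(soft_step a n has_real_derivative - (real n / (pi * (1 + (y x)\<^sup>2)))) (at x)"
    proof -
      have "((\<lambda>x. arctan (y x)) has_real_derivative inverse (1 + (y x)\<^sup>2) * real n) (at x)"
        by (rule DERIV_chain2[OF DERIV_arctan y'])
      then have "((\<lambda>x. 1 / 2 - arctan (y x) / pi) has_real_derivative 0 - inverse (1 + (y x)\<^sup>2) * real n / pi) (at x)"
        by (intro DERIV_diff DERIV_const DERIV_cdivide)
      moreover have "0 - inverse (1 + (y x)\<^sup>2) * real n / pi = - (real n / (pi * (1 + (y x)\<^sup>2)))"
        by (simp add: divide_simps)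
      ultimately show ?thesis by (simp only: step_eq[abs_def])
    qed
    show "\<bar>- (real n / (pi * (1 + (y x)\<^sup>2)))\<bar> \<le> K"
    proof -
      have "real n / (pi * (1 + (y x)\<^sup>2)) \<le> real n / 1"
        using mult_mono[OF p pos(3)[of x]] by (intro divide_left_mono) auto
      moreover have "real n \<le> K" by (simp add: K_def)
      ultimately show ?thesis using pi_gt_zero pos(2)[of x] by (simp add: abs_mult)
    qed
    show "((\<lambda>x. - (real n / (pi * (1 + (y x)\<^sup>2)))) has_real_derivative
        (real n)\<^sup>2 * (2 * y x) / (pi * (1 + (y x)\<^sup>2)\<^sup>2)) (at x)"
    proof -
      have "((\<lambda>x. 1 + (y x)\<^sup>2) has_real_derivative 2 * y x * real n) (at x)"
        using y' by (auto intro!: derivative_eq_intros)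
      from DERIV_cmult[OF DERIV_inverse_fun[OF this pos(1)], of "- (real n / pi)"] show ?thesis
        by (simp add: field_simps power2_eq_square)
    qed
    have "2 * \<bar>y x\<bar> \<le> 1 + (y x)\<^sup>2" using zero_le_power2[of "1 - \<bar>y x\<bar>"] by (simp add: power2_diff)
    also have "\<dots> \<le> 1 * (1 + (y x)\<^sup>2)\<^sup>2" using pos(3)[of x] by (simp add: self_le_power)
    also have "\<dots> \<le> pi * (1 + (y x)\<^sup>2)\<^sup>2" using p by (intro mult_right_mono) auto
    finally have "2 * \<bar>y x\<bar> / (pi * (1 + (y x)\<^sup>2)\<^sup>2) \<le> 1"
      using divide_le_eq_1_pos[OF mult_pos_pos[OF pi_gt_zero zero_less_power[OF pos(2)[of x], of 2]]] by blast
    then have "(real n)\<^sup>2 * (2 * \<bar>y x\<bar> / (pi * (1 + (y x)\<^sup>2)\<^sup>2)) \<le> (real n)\<^sup>2 * 1" by (intro mult_left_mono) auto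
    also have "\<dots> \<le> K" by (simp add: K_def)
    finally show "\<bar>(real n)\<^sup>2 * (2 * y x) / (pi * (1 + (y x)\<^sup>2)\<^sup>2)\<bar> \<le> K"
      using pi_gt_zero by (simp add: abs_mult)
  qed
qed

lemma soft_step_tendsto: "(\<lambda>n. soft_step a n x) \<longlonglongrightarrow> indicator {..a} x"
proof (cases "x \<le> a")
  case True
  have "filterlim (\<lambda>n. real n * (x - a) - sqrt (real n)) at_bot sequentially"
  proof (rule filterlim_at_bot_mono)
    show "filterlim (\<lambda>n. - sqrt (real n)) at_bot sequentially" by real_asymp
    show "\<forall>\<^sub>F n in sequentially. real n * (x - a) - sqrt (real n) \<le> - sqrt (real n)"
      using True by (intro always_eventually) (auto simp: mult_nonneg_nonpos)
  qed
  then have "(\<lambda>n. arctan (real n * (x - a) - sqrt (real n))) \<longlonglongrightarrow> - (pi/2)"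
    by (rule filterlim_compose[OF tendsto_arctan_at_bot])
  then have "(\<lambda>n. soft_step a n x) \<longlonglongrightarrow> 1/2 - (- (pi/2)) / pi"
    unfolding soft_step_def by (intro tendsto_intros) auto
  then show ?thesis using True by simp
next
  case False
  define d where "d = x - a"
  have "d > 0" using False by (simp add: d_def)
  then have "filterlim (\<lambda>n. real n * d - sqrt (real n)) at_top sequentially" by real_asymp
  then have "(\<lambda>n. arctan (real n * d - sqrt (real n))) \<longlonglongrightarrow> pi/2"
    by (rule filterlim_compose[OF tendsto_arctan_at_top])
  then have "(\<lambda>n. soft_step a n x) \<longlonglongrightarrow> 1/2 - (pi/2) / pi"
    unfolding soft_step_def d_def by (intro tendsto_intros) auto
  then show ?thesis using False by simp
qed

text \<open>The coordinates in \<open>J0\<close> are upgraded one at a time from smooth tests to indicators.\<close>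

lemma expectation_prod_indicator_eq:
  fixes P :: "'a measure" and Q :: "'b measure"
  assumes P: "prob_space P" and Q: "prob_space Q"
    and X: "\<And>j. j \<in> J \<Longrightarrow> X j \<in> borel_measurable P"
    and Y: "\<And>j. j \<in> J \<Longrightarrow> Y j \<in> borel_measurable Q"
    and J: "finite J"
    and eq: "\<And>f. (\<And>j. j \<in> J \<Longrightarrow> smooth_test (f j)) \<Longrightarrow>
      (\<integral>\<omega>. (\<Prod>j\<in>J. f j (X j \<omega>)) \<partial>P) = (\<integral>\<omega>. (\<Prod>j\<in>J. f j (Y j \<omega>)) \<partial>Q)"
    and J0: "J0 \<subseteq> J"
    and f: "\<And>j. j \<in> J - J0 \<Longrightarrow> smooth_test (f j)"
    and A: "\<And>j. j \<in> J0 \<Longrightarrow> A j \<in> sets borel \<and> f j = indicator (A j)"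
  shows "(\<integral>\<omega>. (\<Prod>j\<in>J. f j (X j \<omega>)) \<partial>P) = (\<integral>\<omega>. (\<Prod>j\<in>J. f j (Y j \<omega>)) \<partial>Q)"
  using finite_subset[OF J0 J] J0 f A
proof (induction J0 arbitrary: f A rule: finite_induct)
  case empty
  then show ?case by (intro eq) auto
next
  case (insert i I)
  interpret P: prob_space P by fact
  interpret Q: prob_space Q by fact
  have i: "i \<in> J" "i \<notin> I" using insert by auto
  have fm: "f j \<in> borel_measurable borel" "\<And>x. 0 \<le> f j x \<and> f j x \<le> 1" if "j \<in> J" for j
    using insert.prems(2)[of j] insert.prems(3)[of j] that smooth_test_measurable[of "f j"] smooth_test_bounds[of "f j"]
    by (cases "j \<in> insert i I"; auto split: split_indicator)+
  define RX where "RX \<omega> = (\<Prod>j\<in>J-{i}. f j (X j \<omega>))" for \<omega>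
  define RY where "RY \<omega> = (\<Prod>j\<in>J-{i}. f j (Y j \<omega>))" for \<omega>
  have RX[measurable]: "RX \<in> borel_measurable P" unfolding RX_def
    by (intro borel_measurable_prod) (use X fm in \<open>auto intro: measurable_compose\<close>)
  have RY[measurable]: "RY \<in> borel_measurable Q" unfolding RY_def
    by (intro borel_measurable_prod) (use Y fm in \<open>auto intro: measurable_compose\<close>)
  have RXb: "0 \<le> RX \<omega> \<and> RX \<omega> \<le> 1" for \<omega> unfolding RX_def
    using fm by (auto intro!: prod_nonneg prod_le_1)
  have RYb: "0 \<le> RY \<omega> \<and> RY \<omega> \<le> 1" for \<omega> unfolding RY_def
    using fm by (auto intro!: prod_nonneg prod_le_1)
  note X[OF i(1), measurable] Y[OF i(1), measurable]
  have split: "(\<Prod>j\<in>J. (f(i := g)) j (X j \<omega>)) = g (X i \<omega>) * RX \<omega>"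
     "(\<Prod>j\<in>J. (f(i := g)) j (Y j \<omega>')) = g (Y i \<omega>') * RY \<omega>'" for g \<omega> \<omega>'
    unfolding RX_def RY_def using i J by (auto simp: prod.remove intro!: prod.cong)
  have smooth: "(\<integral>\<omega>. g (X i \<omega>) * RX \<omega> \<partial>P) = (\<integral>\<omega>. g (Y i \<omega>) * RY \<omega> \<partial>Q)" if "smooth_test g" for g
    unfolding split[symmetric]
    by (rule insert.IH[of "f(i := g)" A]) (use insert.prems insert.hyps that in auto)
  have Iic: "(\<integral>\<omega>. indicator {..a} (X i \<omega>) * RX \<omega> \<partial>P) = (\<integral>\<omega>. indicator {..a} (Y i \<omega>) * RY \<omega> \<partial>Q)" for a
  proof (rule LIMSEQ_unique)
    show "(\<lambda>n. \<integral>\<omega>. soft_step a n (X i \<omega>) * RX \<omega> \<partial>P) \<longlonglongrightarrow> (\<integral>\<omega>. indicator {..a} (X i \<omega>) * RX \<omega> \<partial>P)"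
    proof (rule integral_dominated_convergence[where w = "\<lambda>_. 1"])
      show "AE \<omega> in P. norm (soft_step a n (X i \<omega>) * RX \<omega>) \<le> 1" for n
        using RXb smooth_test_bounds[OF smooth_test_soft_step[of a n]]
        by (auto simp: abs_mult intro!: mult_le_one)
    qed (auto intro!: tendsto_mult soft_step_tendsto borel_measurable_times measurable_compose[OF _ smooth_test_measurable[OF smooth_test_soft_step]])
    show "(\<lambda>n. \<integral>\<omega>. soft_step a n (X i \<omega>) * RX \<omega> \<partial>P) \<longlonglongrightarrow> (\<integral>\<omega>. indicator {..a} (Y i \<omega>) * RY \<omega> \<partial>Q)"
      unfolding smooth[OF smooth_test_soft_step]
    proof (rule integral_dominated_convergence[where w = "\<lambda>_. 1"])
      show "AE \<omega> in Q. norm (soft_step a n (Y i \<omega>) * RY \<omega>) \<le> 1" for n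
        using RYb smooth_test_bounds[OF smooth_test_soft_step[of a n]]
        by (auto simp: abs_mult intro!: mult_le_one)
    qed (auto intro!: tendsto_mult soft_step_tendsto borel_measurable_times measurable_compose[OF _ smooth_test_measurable[OF smooth_test_soft_step]])
  qed
  \<comment> \<open>The law of coordinate \<open>i\<close>, weighted by the remaining factors. By
    \<open>Iic\<close> the two weighted laws agree on half-lines, an intersection-stable generator,
    hence on \<open>A i\<close>.\<close>
  define N where "N = distr (density P (\<lambda>\<omega>. ennreal (RX \<omega>))) borel (X i)"
  define N' where "N' = distr (density Q (\<lambda>\<omega>. ennreal (RY \<omega>))) borel (Y i)"
  have N: "emeasure N B = ennreal (\<integral>\<omega>. indicator B (X i \<omega>) * RX \<omega> \<partial>P)" if [measurable]: "B \<in> sets borel" for B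
  proof -
    have "emeasure N B = (\<integral>\<^sup>+\<omega>. ennreal (RX \<omega>) * indicator (X i -` B \<inter> space P) \<omega> \<partial>P)"
      unfolding N_def by (subst emeasure_distr) (auto simp: emeasure_density)
    also have "\<dots> = (\<integral>\<^sup>+\<omega>. ennreal (indicator B (X i \<omega>) * RX \<omega>) \<partial>P)"
      by (intro nn_integral_cong) (auto split: split_indicator)
    also have "\<dots> = ennreal (\<integral>\<omega>. indicator B (X i \<omega>) * RX \<omega> \<partial>P)"
      using RXb by (intro nn_integral_eq_integral P.integrable_const_bound[where B=1])
        (auto split: split_indicator)
    finally show ?thesis .
  qed
  have N': "emeasure N' B = ennreal (\<integral>\<omega>. indicator B (Y i \<omega>) * RY \<omega> \<partial>Q)" if [measurable]: "B \<in> sets borel" for B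
  proof -
    have "emeasure N' B = (\<integral>\<^sup>+\<omega>. ennreal (RY \<omega>) * indicator (Y i -` B \<inter> space Q) \<omega> \<partial>Q)"
      unfolding N'_def by (subst emeasure_distr) (auto simp: emeasure_density)
    also have "\<dots> = (\<integral>\<^sup>+\<omega>. ennreal (indicator B (Y i \<omega>) * RY \<omega>) \<partial>Q)"
      by (intro nn_integral_cong) (auto split: split_indicator)
    also have "\<dots> = ennreal (\<integral>\<omega>. indicator B (Y i \<omega>) * RY \<omega> \<partial>Q)"
      using RYb by (intro nn_integral_eq_integral Q.integrable_const_bound[where B=1])
        (auto split: split_indicator)
    finally show ?thesis .
  qed
  have "N = N'"
  proof (rule measure_eqI_generator_eq[where \<Omega> = UNIV and E = "range (\<lambda>a::real. {..a})" and A = "\<lambda>n. {..real n}"])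
    show "Int_stable (range (\<lambda>a::real. {..a}))"
      by (auto simp: Int_stable_def intro!: image_eqI[of _ _ "min _ _"])
    show "sets N = sigma_sets UNIV (range (\<lambda>a::real. {..a}))" "sets N' = sigma_sets UNIV (range (\<lambda>a::real. {..a}))"
      unfolding N_def N'_def by (simp_all add: borel_eq_atMost)
    show "(\<Union>i. {..real i}) = UNIV" by (auto simp: real_arch_simple)
  qed (auto simp: N N' Iic)
  then have "ennreal (\<integral>\<omega>. indicator (A i) (X i \<omega>) * RX \<omega> \<partial>P) = ennreal (\<integral>\<omega>. indicator (A i) (Y i \<omega>) * RY \<omega> \<partial>Q)"
    using N[of "A i"] N'[of "A i"] insert.prems(3)[of i] by simp
  then have "(\<integral>\<omega>. indicator (A i) (X i \<omega>) * RX \<omega> \<partial>P) = (\<integral>\<omega>. indicator (A i) (Y i \<omega>) * RY \<omega> \<partial>Q)"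
    using RXb RYb by (subst (asm) ennreal_inj) (auto intro!: integral_nonneg_AE)
  moreover have "f i = indicator (A i)" using insert.prems(3) by auto
  ultimately have "(\<integral>\<omega>. f i (X i \<omega>) * RX \<omega> \<partial>P) = (\<integral>\<omega>. f i (Y i \<omega>) * RY \<omega> \<partial>Q)"
    by (simp only:)
  moreover have "(\<Prod>j\<in>J. f j (X j \<omega>)) = f i (X i \<omega>) * RX \<omega>" for \<omega>
    using split(1)[of "f i"] unfolding fun_upd_triv .
  moreover have "(\<Prod>j\<in>J. f j (Y j \<omega>)) = f i (Y i \<omega>) * RY \<omega>" for \<omega>
    using split(2)[of "f i"] unfolding fun_upd_triv .
  ultimately show ?case by (simp only:)
qed

lemma real_process_restrict_measurable:
  "real_process P X \<Longrightarrow> (\<lambda>\<omega>. restrict (X \<omega>) {0..1}) \<in> measurable P (\<Pi>\<^sub>M s\<in>{0..1}. borel)"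
  unfolding real_process_def by (intro measurable_restrict) auto

lemma emeasure_path_law_prod_emb:
  assumes R: "prob_space R" and Z: "real_process R Z"
  and J: "finite J" "J \<subseteq> {0..1::real}" "\<And>j. j \<in> J \<Longrightarrow> A j \<in> sets borel"
  shows "emeasure (path_law R Z) (prod_emb {0..1} (\<lambda>_. borel) J (Pi\<^sub>E J A)) =
    ennreal (\<integral>\<omega>. (\<Prod>j\<in>J. indicator (A j) (Z \<omega> j)) \<partial>R)"
proof -
  interpret R: prob_space R by fact
  have Zm: "(\<lambda>\<omega>. Z \<omega> s) \<in> borel_measurable R" if "s \<in> {0..1}" for s using Z that by (auto simp: real_process_def)
  have "emeasure (path_law R Z) (prod_emb {0..1} (\<lambda>_. borel) J (Pi\<^sub>E J A)) =
    emeasure R ((\<lambda>\<omega>. restrict (Z \<omega>) {0..1}) -` prod_emb {0..1} (\<lambda>_. borel) J (Pi\<^sub>E J A) \<inter> space R)"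
    unfolding path_law_def
    by (subst emeasure_distr[OF real_process_restrict_measurable[OF Z]]) (use J in auto)
  also have "\<dots> = (\<integral>\<^sup>+\<omega>. indicator ((\<lambda>\<omega>. restrict (Z \<omega>) {0..1}) -` prod_emb {0..1} (\<lambda>_. borel) J (Pi\<^sub>E J A) \<inter> space R) \<omega> \<partial>R)"
    by (subst nn_integral_indicator)
       (use J in \<open>auto intro!: measurable_sets[OF real_process_restrict_measurable[OF Z]]\<close>)
  also have "\<dots> = (\<integral>\<^sup>+\<omega>. ennreal (\<Prod>j\<in>J. indicator (A j) (Z \<omega> j)) \<partial>R)"
  proof (intro nn_integral_cong)
    fix \<omega> assume "\<omega> \<in> space R"
    then have "\<omega> \<in> (\<lambda>\<omega>. restrict (Z \<omega>) {0..1}) -` prod_emb {0..1} (\<lambda>_. borel) J (Pi\<^sub>E J A) \<inter> space R \<longleftrightarrow> (\<forall>j\<in>J. Z \<omega> j \<in> A j)"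
      using J by (auto simp: prod_emb_def PiE_iff space_PiM subset_iff)
    moreover have "(\<Prod>j\<in>J. indicator (A j) (Z \<omega> j)) = (if \<forall>j\<in>J. Z \<omega> j \<in> A j then 1 else 0 :: real)"
      using J(1) by (auto intro!: prod_zero simp: indicator_def)
    ultimately show "indicator ((\<lambda>\<omega>. restrict (Z \<omega>) {0..1}) -` prod_emb {0..1} (\<lambda>_. borel) J (Pi\<^sub>E J A) \<inter> space R) \<omega> = ennreal (\<Prod>j\<in>J. indicator (A j) (Z \<omega> j))"
      by (simp only: indicator_def) simp
  qed
  also have "\<dots> = ennreal (\<integral>\<omega>. (\<Prod>j\<in>J. indicator (A j) (Z \<omega> j)) \<partial>R)"
    by (intro nn_integral_eq_integral R.integrable_const_bound[where B=1])
       (use J in \<open>auto intro!: prod_nonneg prod_le_1 borel_measurable_prod measurable_compose[OF Zm] simp: abs_prod subset_iff\<close>)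
  finally show ?thesis .
qed

text \<open>Finite-dimensional boxes generate the product sigma-algebra even over the uncountable
  index set, and \<open>expectation_prod_indicator_eq\<close> with all coordinates upgraded passes
  from smooth products to boxes.\<close>

theorem path_law_eqI:
  assumes P: "prob_space P" and Q: "prob_space Q"
    and X: "real_process P X" and Y: "real_process Q Y"
    and eq: "\<And>J f. finite J \<Longrightarrow> J \<subseteq> {0..1} \<Longrightarrow> (\<And>j. j \<in> J \<Longrightarrow> smooth_test (f j)) \<Longrightarrow>
      (\<integral>\<omega>. (\<Prod>j\<in>J. f j (X \<omega> j)) \<partial>P) = (\<integral>\<omega>. (\<Prod>j\<in>J. f j (Y \<omega> j)) \<partial>Q)"
  shows "path_law P X = path_law Q Y"
proof -
  interpret P: prob_space P by fact
  interpret Q: prob_space Q by fact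
  note mX = real_process_restrict_measurable[OF X] and mY = real_process_restrict_measurable[OF Y]
  have Xm: "(\<lambda>\<omega>. X \<omega> s) \<in> borel_measurable P" if "s \<in> {0..1}" for s using X that by (auto simp: real_process_def)
  have Ym: "(\<lambda>\<omega>. Y \<omega> s) \<in> borel_measurable Q" if "s \<in> {0..1}" for s using Y that by (auto simp: real_process_def)
  interpret DX: prob_space "path_law P X" unfolding path_law_def by (rule P.prob_space_distr) fact
  have box: "emeasure (path_law P X) (prod_emb {0..1} (\<lambda>_. borel) J (Pi\<^sub>E J A)) =
      emeasure (path_law Q Y) (prod_emb {0..1} (\<lambda>_. borel) J (Pi\<^sub>E J A))"
    if J: "finite J" "J \<subseteq> {0..1}" "\<And>i. i \<in> J \<Longrightarrow> A i \<in> sets borel" for A :: "real \<Rightarrow> real set" and J :: "real set"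
  proof -
    have "(\<integral>\<omega>. (\<Prod>j\<in>J. indicator (A j) (X \<omega> j)) \<partial>P) = ((\<integral>\<omega>. (\<Prod>j\<in>J. indicator (A j) (Y \<omega> j)) \<partial>Q) :: real)"
      by (rule expectation_prod_indicator_eq[OF P Q, where J = J and J0 = J and A = A and f = "\<lambda>j. indicator (A j)" and X = "\<lambda>j \<omega>. X \<omega> j" and Y = "\<lambda>j \<omega>. Y \<omega> j"])
         (use J Xm Ym eq in auto)
    then show ?thesis
      by (simp only: emeasure_path_law_prod_emb[OF P X J] emeasure_path_law_prod_emb[OF Q Y J])
  qed
  have "sets (path_law P X) = sets (\<Pi>\<^sub>M s\<in>{0..1}. borel)" "sets (path_law Q Y) = sets (\<Pi>\<^sub>M s\<in>{0..1}. borel)"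
    by (simp_all add: path_law_def)
  then show ?thesis
    by (rule measure_eqI_PiM_infinite[OF _ _ _ DX.finite_measure_axioms]) (rule box; assumption)
qed

text \<open>The constant must not depend on the base point \<open>y\<close>, since in the comparison
  of two solutions the base point is itself random. Only squares of single increments occur in the
  second bound; mixed products are absorbed by the inequality between arithmetic and geometric
  means.\<close>

lemma prod_smooth_test_taylor:
  assumes "finite J" and "\<And>j. j \<in> J \<Longrightarrow> smooth_test (f j)"
  shows "\<exists>C\<ge>0. \<forall>y. \<exists>d. \<forall>h.
    \<bar>(\<Prod>j\<in>J. f j (y j + h j)) - (\<Prod>j\<in>J. f j (y j))\<bar> \<le> C * (\<Sum>j\<in>J. \<bar>h j\<bar>) \<and>
    \<bar>(\<Prod>j\<in>J. f j (y j + h j)) - (\<Prod>j\<in>J. f j (y j)) - (\<Sum>j\<in>J. d j * h j)\<bar> \<le> C * (\<Sum>j\<in>J. (h j)\<^sup>2)"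
  using assms
proof (induction J rule: finite_induct)
  case empty
  then show ?case by (intro exI[of _ 0]) auto
next
  case (insert i J)
  then obtain C where C: "C \<ge> 0" and C': "\<forall>y. \<exists>d. \<forall>h.
    \<bar>(\<Prod>j\<in>J. f j (y j + h j)) - (\<Prod>j\<in>J. f j (y j))\<bar> \<le> C * (\<Sum>j\<in>J. \<bar>h j\<bar>) \<and>
    \<bar>(\<Prod>j\<in>J. f j (y j + h j)) - (\<Prod>j\<in>J. f j (y j)) - (\<Sum>j\<in>J. d j * h j)\<bar> \<le> C * (\<Sum>j\<in>J. (h j)\<^sup>2)"
    by auto
  have fi: "smooth_test (f i)" using insert by auto
  obtain K where K: "K \<ge> 0" "\<And>x h. \<bar>f i (x + h) - f i x\<bar> \<le> K * \<bar>h\<bar>"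
    and K2: "\<And>x. \<exists>d. \<bar>d\<bar> \<le> K \<and> (\<forall>h. \<bar>f i (x + h) - f i x - d * h\<bar> \<le> K * h\<^sup>2)"
    using fi unfolding smooth_test_def by blast
  \<comment> \<open>Large enough for both estimates: \<open>K\<close> and \<open>C\<close> serve the
    two factors separately, and the term with \<open>card J + 1\<close> pays for the mixed products
    of \<open>h i\<close> with the other increments.\<close>
  define C1 where "C1 = K * C * (real (card J) + 1) + K + C"
  have C1: "C1 \<ge> 0" using C K by (simp add: C1_def)
  have "\<exists>d. \<forall>h.
    \<bar>(\<Prod>j\<in>insert i J. f j (y j + h j)) - (\<Prod>j\<in>insert i J. f j (y j))\<bar> \<le> C1 * (\<Sum>j\<in>insert i J. \<bar>h j\<bar>) \<and>
    \<bar>(\<Prod>j\<in>insert i J. f j (y j + h j)) - (\<Prod>j\<in>insert i J. f j (y j)) - (\<Sum>j\<in>insert i J. d j * h j)\<bar> \<le> C1 * (\<Sum>j\<in>insert i J. (h j)\<^sup>2)" for y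
  proof -
    obtain d where d: "\<And>h. \<bar>(\<Prod>j\<in>J. f j (y j + h j)) - (\<Prod>j\<in>J. f j (y j))\<bar> \<le> C * (\<Sum>j\<in>J. \<bar>h j\<bar>)"
      "\<And>h. \<bar>(\<Prod>j\<in>J. f j (y j + h j)) - (\<Prod>j\<in>J. f j (y j)) - (\<Sum>j\<in>J. d j * h j)\<bar> \<le> C * (\<Sum>j\<in>J. (h j)\<^sup>2)"
      using C' by meson
    obtain di where di: "\<And>h. \<bar>f i (y i + h) - f i (y i) - di * h\<bar> \<le> K * h\<^sup>2" using K2 by blast
    define G where "G = (\<Prod>j\<in>J. f j (y j))"
    define b where "b = f i (y i)"
    define e where "e = (\<lambda>j. if j = i then G * di else b * d j)"
    have G1: "\<bar>G\<bar> \<le> 1" unfolding G_def abs_prod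
      by (rule prod_le_1) (use insert.prems smooth_test_bounds in auto)
    have b1: "\<bar>b\<bar> \<le> 1" unfolding b_def using smooth_test_bounds[OF fi] by auto
    have "\<bar>(\<Prod>j\<in>insert i J. f j (y j + h j)) - (\<Prod>j\<in>insert i J. f j (y j))\<bar> \<le> C1 * (\<Sum>j\<in>insert i J. \<bar>h j\<bar>) \<and>
      \<bar>(\<Prod>j\<in>insert i J. f j (y j + h j)) - (\<Prod>j\<in>insert i J. f j (y j)) - (\<Sum>j\<in>insert i J. e j * h j)\<bar> \<le> C1 * (\<Sum>j\<in>insert i J. (h j)\<^sup>2)" for h
    proof -
      define F where "F = (\<Prod>j\<in>J. f j (y j + h j))"
      define a where "a = f i (y i + h i)"
      define S where "S = (\<Sum>j\<in>J. \<bar>h j\<bar>)"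
      define S2 where "S2 = (\<Sum>j\<in>J. (h j)\<^sup>2)"
      define T where "T = (\<Sum>j\<in>J. d j * h j)"
      have F1: "\<bar>F\<bar> \<le> 1" unfolding F_def abs_prod
        by (rule prod_le_1) (use insert.prems smooth_test_bounds in auto)
      have S0: "S \<ge> 0" "S2 \<ge> 0" unfolding S_def S2_def by (auto intro!: sum_nonneg)
      have FG: "\<bar>F - G\<bar> \<le> C * S" and FGT: "\<bar>F - G - T\<bar> \<le> C * S2"
        unfolding F_def G_def S_def S2_def T_def using d[of h] by auto
      have ab: "\<bar>a - b\<bar> \<le> K * \<bar>h i\<bar>" "\<bar>a - b - di * h i\<bar> \<le> K * (h i)\<^sup>2"
        unfolding a_def b_def using K(2)[of "y i" "h i"] di[of "h i"] by auto
      have eT: "(\<Sum>j\<in>J. e j * h j) = b * T"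
        unfolding T_def sum_distrib_left using insert.hyps by (intro sum.cong) (auto simp: e_def)
      have split: "(\<Prod>j\<in>insert i J. f j (y j + h j)) = a * F" "(\<Prod>j\<in>insert i J. f j (y j)) = b * G"
        "(\<Sum>j\<in>insert i J. \<bar>h j\<bar>) = \<bar>h i\<bar> + S" "(\<Sum>j\<in>insert i J. (h j)\<^sup>2) = (h i)\<^sup>2 + S2"
        "(\<Sum>j\<in>insert i J. e j * h j) = G * di * h i + b * T"
        using insert.hyps unfolding sum.insert[OF insert.hyps] eT
        by (auto simp: a_def F_def b_def G_def S_def S2_def e_def)
      have "a * F - b * G = (a - b) * F + b * (F - G)" by (simp add: algebra_simps)
      then have "\<bar>a * F - b * G\<bar> \<le> \<bar>a - b\<bar> * \<bar>F\<bar> + \<bar>b\<bar> * \<bar>F - G\<bar>"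
        using abs_triangle_ineq[of "(a - b) * F" "b * (F - G)"] by (simp only: abs_mult)
      also have "\<dots> \<le> K * \<bar>h i\<bar> * 1 + 1 * (C * S)"
        using C K S0 by (intro add_mono mult_mono[OF ab(1) F1] mult_mono[OF b1 FG]) simp_all
      also have "\<dots> \<le> C1 * (\<bar>h i\<bar> + S)"
      proof -
        have "K * \<bar>h i\<bar> \<le> C1 * \<bar>h i\<bar>" "C * S \<le> C1 * S"
          using C K S0 by (auto intro!: mult_right_mono simp: C1_def)
        then show ?thesis by (simp add: algebra_simps)
      qed
      finally have 1: "\<bar>a * F - b * G\<bar> \<le> C1 * (\<bar>h i\<bar> + S)" .
      have "\<bar>h i\<bar> * S = (\<Sum>j\<in>J. \<bar>h i\<bar> * \<bar>h j\<bar>)" unfolding S_def by (simp add: sum_distrib_left)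
      also have "\<dots> \<le> (\<Sum>j\<in>J. (h i)\<^sup>2 + (h j)\<^sup>2)"
      proof (rule sum_mono)
        fix j
        have "0 \<le> (\<bar>h i\<bar> - \<bar>h j\<bar>)\<^sup>2" by simp
        then have "2 * (\<bar>h i\<bar> * \<bar>h j\<bar>) \<le> (h i)\<^sup>2 + (h j)\<^sup>2" by (simp add: power2_diff)
        moreover have "0 \<le> \<bar>h i\<bar> * \<bar>h j\<bar>" by simp
        ultimately show "\<bar>h i\<bar> * \<bar>h j\<bar> \<le> (h i)\<^sup>2 + (h j)\<^sup>2" by linarith
      qed
      also have "\<dots> = real (card J) * (h i)\<^sup>2 + S2" by (simp add: S2_def sum.distrib)
      finally have hS: "\<bar>h i\<bar> * S \<le> real (card J) * (h i)\<^sup>2 + S2" .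
      have tri: "\<bar>p + q + r\<bar> \<le> \<bar>p\<bar> + \<bar>q\<bar> + \<bar>r\<bar>" for p q r :: real by linarith
      \<comment> \<open>Exact splitting of the remainder of a product: the product of two
        first-order increments plus the second-order remainders of the two factors.\<close>
      have "a * F - b * G - (G * di * h i + b * T) = (a - b) * (F - G) + G * (a - b - di * h i) + b * (F - G - T)"
        by (simp add: algebra_simps)
      then have "\<bar>a * F - b * G - (G * di * h i + b * T)\<bar> \<le> \<bar>a - b\<bar> * \<bar>F - G\<bar> + \<bar>G\<bar> * \<bar>a - b - di * h i\<bar> + \<bar>b\<bar> * \<bar>F - G - T\<bar>"
        using tri[of "(a - b) * (F - G)" "G * (a - b - di * h i)" "b * (F - G - T)"] by (simp only: abs_mult)
      also have "\<dots> \<le> (K * \<bar>h i\<bar>) * (C * S) + 1 * (K * (h i)\<^sup>2) + 1 * (C * S2)"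
        using C K S0 by (intro add_mono mult_mono[OF ab(1) FG] mult_mono[OF G1 ab(2)] mult_mono[OF b1 FGT]) simp_all
      also have "\<dots> = K * C * (\<bar>h i\<bar> * S) + K * (h i)\<^sup>2 + C * S2" by simp
      also have "\<dots> \<le> K * C * (real (card J) * (h i)\<^sup>2 + S2) + K * (h i)\<^sup>2 + C * S2"
        using hS K C by (intro add_mono mult_left_mono) auto
      also have "\<dots> = (K * C * real (card J) + K) * (h i)\<^sup>2 + (K * C + C) * S2" by (simp add: algebra_simps)
      also have "\<dots> \<le> C1 * (h i)\<^sup>2 + C1 * S2"
        using C K S0 by (intro add_mono mult_right_mono) (auto simp: C1_def algebra_simps)
      finally have 2: "\<bar>a * F - b * G - (G * di * h i + b * T)\<bar> \<le> C1 * ((h i)\<^sup>2 + S2)" by (simp add: algebra_simps)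
      show ?thesis unfolding split using 1 2 by blast
    qed
    then show ?thesis by (intro exI[of _ e] allI)
  qed
  with C1 show ?case by (intro exI[where x = C1] conjI allI) auto
qed

section \<open>Cadlag paths: boundedness and joint measurability\<close>

text \<open>One-sided limits give a bound on a punctured neighbourhood on either side of each point,
  the value at the point is added by hand, and bisection (\<open>Bolzano\<close>) passes from local
  to global.\<close>

lemma cadlag_bounded:
  assumes f: "cadlag f"
  shows "\<exists>B. \<forall>s\<in>{0..1}. \<bar>f s\<bar> \<le> B"
proof -
  define R where "R = (\<lambda>a b. \<exists>B. \<forall>s\<in>{a..b} \<inter> {0..1}. \<bar>f s\<bar> \<le> B)"
  have ev: "\<exists>d>0. \<exists>B. \<forall>s. s \<in> S \<and> s \<noteq> x \<and> dist s x < d \<longrightarrow> \<bar>f s\<bar> \<le> B"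
    if "(f \<longlongrightarrow> l) (at x within S)" for l x S
  proof -
    have "eventually (\<lambda>s. \<bar>f s\<bar> < \<bar>l\<bar> + 1) (at x within S)"
      using order_tendstoD(2)[OF tendsto_rabs[OF that], of "\<bar>l\<bar> + 1"] by simp
    then show ?thesis unfolding eventually_at by (meson less_imp_le)
  qed
  have "R 0 1"
  proof (rule Bolzano[where a = 0 and b = 1])
    fix a b c assume ab: "R a b" and bc: "R b c"
    obtain B1 where B1: "\<forall>s\<in>{a..b} \<inter> {0..1}. \<bar>f s\<bar> \<le> B1" using ab R_def by blast
    obtain B2 where B2: "\<forall>s\<in>{b..c} \<inter> {0..1}. \<bar>f s\<bar> \<le> B2" using bc R_def by blast
    have "\<forall>s\<in>{a..c} \<inter> {0..1}. \<bar>f s\<bar> \<le> max B1 B2"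
    proof
      fix s assume "s \<in> {a..c} \<inter> {0..1}"
      then show "\<bar>f s\<bar> \<le> max B1 B2"
        using B1 B2 by (cases "s \<le> b") (auto simp: le_max_iff_disj)
    qed
    then show "R a c" unfolding R_def by blast
  next
    fix x :: real assume x: "0 \<le> x" "x \<le> 1"
    have "\<exists>d>0. \<exists>B. \<forall>s. s \<in> {x<..} \<inter> {0..1} \<and> s \<noteq> x \<and> dist s x < d \<longrightarrow> \<bar>f s\<bar> \<le> B"
    proof (cases "x < 1")
      case True
      then have "(f \<longlongrightarrow> f x) (at_right x)" using f x by (auto simp: cadlag_def continuous_within)
      from ev[OF this] show ?thesis by (metis Int_iff)
    next
      case False then show ?thesis using x by (intro exI[of _ 1]) auto
    qed
    then obtain d1 B1 where d10: "d1 > 0" and d1': "\<forall>s. s \<in> {x<..} \<inter> {0..1} \<and> s \<noteq> x \<and> dist s x < d1 \<longrightarrow> \<bar>f s\<bar> \<le> B1"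
      by blast
    have d1: "\<bar>f s\<bar> \<le> B1" if "x < s" "s \<in> {0..1}" "dist s x < d1" for s
      using d1' that by (metis Int_iff greaterThan_iff lessThan_iff less_irrefl)
    have "\<exists>d>0. \<exists>B. \<forall>s. s \<in> {..<x} \<inter> {0..1} \<and> s \<noteq> x \<and> dist s x < d \<longrightarrow> \<bar>f s\<bar> \<le> B"
    proof (cases "0 < x")
      case True
      then have "x \<in> {0<..1}" using x by simp
      then obtain l where "(f \<longlongrightarrow> l) (at_left x)" using f unfolding cadlag_def by blast
      from ev[OF this] show ?thesis by (metis Int_iff)
    next
      case False then show ?thesis using x by (intro exI[of _ 1]) auto
    qed
    then obtain d2 B2 where d20: "d2 > 0" and d2': "\<forall>s. s \<in> {..<x} \<inter> {0..1} \<and> s \<noteq> x \<and> dist s x < d2 \<longrightarrow> \<bar>f s\<bar> \<le> B2"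
      by blast
    have d2: "\<bar>f s\<bar> \<le> B2" if "s < x" "s \<in> {0..1}" "dist s x < d2" for s
      using d2' that by (metis Int_iff greaterThan_iff lessThan_iff less_irrefl)
    have "R a b" if "a \<le> x \<and> x \<le> b \<and> b - a < min d1 d2" for a b
      unfolding R_def
    proof (intro exI[of _ "max \<bar>f x\<bar> (max B1 B2)"] ballI)
      fix s assume s: "s \<in> {a..b} \<inter> {0..1}"
      then have "dist s x < d1" "dist s x < d2" using that by (auto simp: dist_real_def)
      with d1[of s] d2[of s] s show "\<bar>f s\<bar> \<le> max \<bar>f x\<bar> (max B1 B2)"
        by (cases s x rule: linorder_cases) (auto simp: le_max_iff_disj)
    qed
    then show "\<exists>d>0. \<forall>a b. a \<le> x \<and> x \<le> b \<and> b - a < d \<longrightarrow> R a b"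
      using d10 d20 by (intro exI[of _ "min d1 d2"]) auto
  qed auto
  then show ?thesis by (auto simp: R_def)
qed

lemma abs_le_sup_norm: "cadlag f \<Longrightarrow> s \<in> {0..1} \<Longrightarrow> \<bar>f s\<bar> \<le> sup_norm f"
  unfolding sup_norm_def
  by (intro cSUP_upper) (use cadlag_bounded in \<open>auto simp: bdd_above_def\<close>)

text \<open>Composing with the retraction onto \<open>{0..1}\<close> extends a path to the whole
  line without changing the values that matter, so measurability can be argued over
  \<open>borel\<close>.\<close>

definition clamp01 :: "real \<Rightarrow> real" where "clamp01 t = max 0 (min 1 t)"

lemma clamp01_in [simp]: "clamp01 t \<in> {0..1}" "0 \<le> clamp01 t" "clamp01 t \<le> 1"
  by (auto simp: clamp01_def)

lemma clamp01_id: "t \<in> {0..1} \<Longrightarrow> clamp01 t = t"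
  by (auto simp: clamp01_def)

lemma clamp01_measurable [measurable]: "clamp01 \<in> borel_measurable borel"
  unfolding clamp01_def[abs_def] by measurable

text \<open>The grid point strictly exceeds \<open>clamp01 t\<close> (hence the \<open>+ 1\<close>),
  so right-continuity alone gives the limit; at 1 the grid point is clamped back to 1 and the
  sequence is constant.\<close>

lemma cadlag_grid_tendsto:
  assumes f: "cadlag f"
  shows "(\<lambda>n. f (clamp01 (real_of_int (\<lfloor>real (Suc n) * clamp01 t\<rfloor> + 1) / real (Suc n)))) \<longlonglongrightarrow> f (clamp01 t)"
proof -
  define x where "x = clamp01 t"
  define r where "r n = real_of_int (\<lfloor>real (Suc n) * x\<rfloor> + 1) / real (Suc n)" for n
  have x: "0 \<le> x" "x \<le> 1" by (simp_all add: x_def)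
  have r: "x < r n" "r n \<le> x + 1 / real (Suc n)" for n
  proof -
    have "real (Suc n) * x < real_of_int (\<lfloor>real (Suc n) * x\<rfloor> + 1)" by linarith
    then show "x < r n" unfolding r_def by (simp add: field_simps)
    have "real_of_int (\<lfloor>real (Suc n) * x\<rfloor> + 1) \<le> real (Suc n) * x + 1" by linarith
    then have "r n \<le> (real (Suc n) * x + 1) / real (Suc n)" unfolding r_def by (rule divide_right_mono) simp
    also have "\<dots> = x + 1 / real (Suc n)" by (simp add: add_divide_distrib)
    finally show "r n \<le> x + 1 / real (Suc n)" .
  qed
  have lim: "(\<lambda>n. x + 1 / real (Suc n)) \<longlonglongrightarrow> x"
    using tendsto_add[OF tendsto_const[of x] LIMSEQ_inverse_real_of_nat] by (simp add: inverse_eq_divide)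
  have rx: "r \<longlonglongrightarrow> x"
    by (rule tendsto_sandwich[OF always_eventually always_eventually tendsto_const lim])
       (use r in \<open>auto intro: less_imp_le simp del: of_nat_Suc\<close>)
  have "(\<lambda>n. f (clamp01 (r n))) \<longlonglongrightarrow> f x"
  proof (cases "x < 1")
    case True
    have "(f \<longlongrightarrow> f x) (at_right x)" using f x True by (auto simp: cadlag_def continuous_within)
    moreover have "filterlim r (at_right x) sequentially"
      using rx r(1) by (auto simp: filterlim_at intro!: always_eventually less_imp_neq[symmetric])
    ultimately have "(\<lambda>n. f (r n)) \<longlonglongrightarrow> f x" by (rule filterlim_compose)
    moreover have "eventually (\<lambda>n. f (r n) = f (clamp01 (r n))) sequentially"
      using order_tendstoD(2)[OF rx True]
    proof (rule eventually_mono)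
      fix n assume "r n < 1"
      then show "f (r n) = f (clamp01 (r n))" using r(1)[of n] x by (subst clamp01_id) auto
    qed
    ultimately show ?thesis by (rule Lim_transform_eventually)
  next
    case False
    then have "clamp01 (r n) = x" for n using r(1)[of n] x by (auto simp: clamp01_def)
    then show ?thesis by simp
  qed
  then show ?thesis by (simp add: r_def x_def)
qed

text \<open>At grid level \<open>n\<close> the process depends on time only through an integer,
  which is a countable choice between evaluations at fixed points; the grid approximations then
  converge pointwise.\<close>

lemma cadlag_process_measurable:
  assumes X: "real_process P X" and c: "\<And>\<omega>. \<omega> \<in> space P \<Longrightarrow> cadlag (X \<omega>)"
  shows "(\<lambda>p. X (fst p) (clamp01 (snd p))) \<in> borel_measurable (P \<Otimes>\<^sub>M borel)"
proof (rule borel_measurable_LIMSEQ_real)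
  fix p assume "p \<in> space (P \<Otimes>\<^sub>M (borel :: real measure))"
  then show "(\<lambda>n. X (fst p) (clamp01 (real_of_int (\<lfloor>real (Suc n) * clamp01 (snd p)\<rfloor> + 1) / real (Suc n)))) \<longlonglongrightarrow> X (fst p) (clamp01 (snd p))"
    by (intro cadlag_grid_tendsto c) (auto simp: space_pair_measure)
next
  fix n
  have Xm: "(\<lambda>\<omega>. X \<omega> (clamp01 t)) \<in> borel_measurable P" for t
    using X by (auto simp: real_process_def)
  have [measurable]: "(\<lambda>p. X (fst p) (clamp01 (real_of_int (k + 1) / real (Suc n)))) \<in> borel_measurable (P \<Otimes>\<^sub>M (borel :: real measure))" for k :: int
    by (rule measurable_compose[OF measurable_fst Xm])
  have [measurable]: "(\<lambda>p. \<lfloor>real (Suc n) * clamp01 (snd p)\<rfloor>) \<in> measurable (P \<Otimes>\<^sub>M (borel :: real measure)) (count_space UNIV)"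
    by measurable
  show "(\<lambda>p. X (fst p) (clamp01 (real_of_int (\<lfloor>real (Suc n) * clamp01 (snd p)\<rfloor> + 1) / real (Suc n)))) \<in> borel_measurable (P \<Otimes>\<^sub>M (borel :: real measure))"
    by (rule measurable_compose_countable[where f = "\<lambda>k p. X (fst p) (clamp01 (real_of_int (k + 1) / real (Suc n)))" and g = "\<lambda>p. \<lfloor>real (Suc n) * clamp01 (snd p)\<rfloor>"]) measurable
qed

subsection \<open>The law of the first chord\<close>

lemma space_uv_law [simp]: "space uv_law = {0..1} \<times> {0..1}"
  by (simp add: uv_law_def space_restrict_space space_pair_measure)

lemma sets_uv_law: "sets uv_law = sets (restrict_space (borel \<Otimes>\<^sub>M borel) ({0..1} \<times> {0..1}))"
  unfolding uv_law_def sets_density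
  by (intro sets_restrict_space_cong sets_pair_measure_cong) auto

lemma measurable_uv_lawI [measurable_dest]:
  "f \<in> measurable (borel \<Otimes>\<^sub>M borel) M \<Longrightarrow> f \<in> measurable uv_law M"
  by (subst measurable_cong_sets[OF sets_uv_law refl]) (rule measurable_restrict_space1)

lemma fst_uv_law [measurable]: "fst \<in> borel_measurable uv_law"
  and snd_uv_law [measurable]: "snd \<in> borel_measurable uv_law"
  by (auto intro!: measurable_uv_lawI)

lemma ordered_pairs_measurable [measurable]: "{(u, v). 0 \<le> u \<and> u \<le> v \<and> v \<le> (1::real)} \<in> sets (borel \<Otimes>\<^sub>M borel)"
proof -
  have "{z \<in> space (borel \<Otimes>\<^sub>M borel). 0 \<le> fst z \<and> fst z \<le> snd z \<and> snd z \<le> (1::real)} \<in> sets (borel \<Otimes>\<^sub>M borel)"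
    by measurable
  then show ?thesis by (simp add: space_pair_measure split_beta')
qed

lemma nn_integral_uv_law_uv:
  assumes [measurable]: "f \<in> borel_measurable (borel \<Otimes>\<^sub>M borel)"
  shows "(\<integral>\<^sup>+z. f z \<partial>uv_law) = (\<integral>\<^sup>+u. \<integral>\<^sup>+v. f (u, v) * 2 * indicator {(u, v). 0 \<le> u \<and> u \<le> v \<and> v \<le> 1} (u, v) \<partial>lborel \<partial>lborel)"
proof -
  have Q: "{0..1} \<times> {0..1} \<in> sets (lborel \<Otimes>\<^sub>M lborel :: (real \<times> real) measure)"
    by auto
  have "(\<integral>\<^sup>+z. f z \<partial>uv_law) = (\<integral>\<^sup>+z. (case z of (u, v) \<Rightarrow> ennreal (2 * indicator {(u, v). 0 \<le> u \<and> u \<le> v \<and> v \<le> 1} (u, v))) * f z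
      \<partial>restrict_space (lborel \<Otimes>\<^sub>M lborel) ({0..1} \<times> {0..1}))"
    unfolding uv_law_def
    by (subst nn_integral_density) (auto intro!: measurable_restrict_space1 nn_integral_cong split: split_indicator)
  also have "\<dots> = (\<integral>\<^sup>+z. (case z of (u, v) \<Rightarrow> ennreal (2 * indicator {(u, v). 0 \<le> u \<and> u \<le> v \<and> v \<le> 1} (u, v))) * f z * indicator ({0..1} \<times> {0..1}) z \<partial>(lborel \<Otimes>\<^sub>M lborel))"
    by (subst nn_integral_restrict_space) (use Q in auto)
  also have "\<dots> = (\<integral>\<^sup>+z. (case z of (u, v) \<Rightarrow> f (u, v) * 2 * indicator {(u, v). 0 \<le> u \<and> u \<le> v \<and> v \<le> 1} (u, v)) \<partial>(lborel \<Otimes>\<^sub>M lborel))"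
    by (intro nn_integral_cong) (auto split: split_indicator simp: mult.commute)
  also have "\<dots> = (\<integral>\<^sup>+u. \<integral>\<^sup>+v. f (u, v) * 2 * indicator {(u, v). 0 \<le> u \<and> u \<le> v \<and> v \<le> 1} (u, v) \<partial>lborel \<partial>lborel)"
    by (subst lborel.nn_integral_fst[symmetric]) (auto simp: measurable_completion)
  finally show ?thesis .
qed

lemma nn_integral_uv_law_lu:
  assumes [measurable]: "f \<in> borel_measurable (borel \<Otimes>\<^sub>M borel)"
  shows "(\<integral>\<^sup>+z. f z \<partial>uv_law) = (\<integral>\<^sup>+l. \<integral>\<^sup>+u. f (u, u + l) * 2 * indicator {(u, v). 0 \<le> u \<and> u \<le> v \<and> v \<le> 1} (u, u + l) \<partial>lborel \<partial>lborel)"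
proof -
  have "(\<integral>\<^sup>+z. f z \<partial>uv_law) = (\<integral>\<^sup>+u. \<integral>\<^sup>+v. f (u, v) * 2 * indicator {(u, v). 0 \<le> u \<and> u \<le> v \<and> v \<le> 1} (u, v) \<partial>lborel \<partial>lborel)"
    by (rule nn_integral_uv_law_uv) fact
  also have "\<dots> = (\<integral>\<^sup>+u. \<integral>\<^sup>+l. f (u, u + l) * 2 * indicator {(u, v). 0 \<le> u \<and> u \<le> v \<and> v \<le> 1} (u, u + l) \<partial>lborel \<partial>lborel)"
  proof (rule nn_integral_cong)
    fix u :: real
    show "(\<integral>\<^sup>+v. f (u, v) * 2 * indicator {(u, v). 0 \<le> u \<and> u \<le> v \<and> v \<le> 1} (u, v) \<partial>lborel) =
      (\<integral>\<^sup>+l. f (u, u + l) * 2 * indicator {(u, v). 0 \<le> u \<and> u \<le> v \<and> v \<le> 1} (u, u + l) \<partial>lborel)"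
      by (subst nn_integral_real_affine[where c = 1 and t = u]) auto
  qed
  also have "\<dots> = (\<integral>\<^sup>+l. \<integral>\<^sup>+u. f (u, u + l) * 2 * indicator {(u, v). 0 \<le> u \<and> u \<le> v \<and> v \<le> 1} (u, u + l) \<partial>lborel \<partial>lborel)"
    by (rule lborel_pair.Fubini') simp
  finally show ?thesis .
qed

text \<open>Coordinates adapted to the chord: \<open>l\<close> is the length of the arc and
  \<open>w\<close> the position of the collapsed arc on the rescaled outer part. In them the law is
  a product: \<open>w\<close> is uniform and \<open>l\<close> has density
  \<open>2 * (1 - l)\<close>.\<close>

lemma nn_integral_uv_law:
  assumes [measurable]: "f \<in> borel_measurable (borel \<Otimes>\<^sub>M borel)"
  shows "(\<integral>\<^sup>+z. f z \<partial>uv_law) = (\<integral>\<^sup>+l. \<integral>\<^sup>+w. f (w * (1 - l), w * (1 - l) + l) * ennreal (2 * (1 - l)) * indicator {0..1} w * indicator {0..<1} l \<partial>lborel \<partial>lborel)"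
proof -
  have "(\<integral>\<^sup>+z. f z \<partial>uv_law) = (\<integral>\<^sup>+l. \<integral>\<^sup>+u. f (u, u + l) * 2 * indicator {(u, v). 0 \<le> u \<and> u \<le> v \<and> v \<le> 1} (u, u + l) \<partial>lborel \<partial>lborel)"
    by (rule nn_integral_uv_law_lu) fact
  also have "\<dots> = (\<integral>\<^sup>+l. \<integral>\<^sup>+w. f (w * (1 - l), w * (1 - l) + l) * ennreal (2 * (1 - l)) * indicator {0..1} w * indicator {0..<1} l \<partial>lborel \<partial>lborel)"
  proof (rule nn_integral_cong_AE, rule eventually_mono[OF AE_lborel_singleton[of 1]])
    fix l :: real assume l1: "l \<noteq> 1"
    show "(\<integral>\<^sup>+u. f (u, u + l) * 2 * indicator {(u, v). 0 \<le> u \<and> u \<le> v \<and> v \<le> 1} (u, u + l) \<partial>lborel) =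
       (\<integral>\<^sup>+w. f (w * (1 - l), w * (1 - l) + l) * ennreal (2 * (1 - l)) * indicator {0..1} w * indicator {0..<1} l \<partial>lborel)"
    proof (cases "0 \<le> l \<and> l < 1")
      case True
      have "(\<integral>\<^sup>+u. f (u, u + l) * 2 * indicator {(u, v). 0 \<le> u \<and> u \<le> v \<and> v \<le> 1} (u, u + l) \<partial>lborel) =
        ennreal (1 - l) * (\<integral>\<^sup>+w. f (w * (1 - l), w * (1 - l) + l) * 2 * indicator {(u, v). 0 \<le> u \<and> u \<le> v \<and> v \<le> 1} (w * (1 - l), w * (1 - l) + l) \<partial>lborel)"
        using True by (subst nn_integral_real_affine[where c = "1 - l" and t = 0]) (auto simp: mult.commute)
      also have "\<dots> = (\<integral>\<^sup>+w. ennreal (1 - l) * (f (w * (1 - l), w * (1 - l) + l) * 2 * indicator {(u, v). 0 \<le> u \<and> u \<le> v \<and> v \<le> 1} (w * (1 - l), w * (1 - l) + l)) \<partial>lborel)"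
        by (subst nn_integral_cmult) auto
      also have "\<dots> = (\<integral>\<^sup>+w. f (w * (1 - l), w * (1 - l) + l) * ennreal (2 * (1 - l)) * indicator {0..1} w * indicator {0..<1} l \<partial>lborel)"
      proof (rule nn_integral_cong)
        fix w
        have "0 \<le> w * (1 - l) \<and> w * (1 - l) \<le> w * (1 - l) + l \<and> w * (1 - l) + l \<le> 1 \<longleftrightarrow> 0 \<le> w \<and> w \<le> 1"
        proof -
          have "w * (1 - l) + l \<le> 1 \<longleftrightarrow> w * (1 - l) \<le> 1 * (1 - l)" by auto
          also have "\<dots> \<longleftrightarrow> w \<le> 1" using True by (subst mult_le_cancel_right) auto
          finally show ?thesis using True by (auto simp: zero_le_mult_iff)
        qed
        moreover have e2: "ennreal (2 * (1 - l)) = ennreal (1 - l) * 2"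
          using True ennreal_mult[of "1 - l" 2] by (simp add: mult.commute)
        ultimately show "ennreal (1 - l) * (f (w * (1 - l), w * (1 - l) + l) * 2 * indicator {(u, v). 0 \<le> u \<and> u \<le> v \<and> v \<le> 1} (w * (1 - l), w * (1 - l) + l))
          = f (w * (1 - l), w * (1 - l) + l) * ennreal (2 * (1 - l)) * indicator {0..1} w * indicator {0..<1} l"
          using True e2 by (auto simp: indicator_def mult_ac)
      qed
      finally show ?thesis .
    next
      case False
      then have "indicator {(u, v). 0 \<le> u \<and> u \<le> v \<and> v \<le> 1} (u, u + l) = (0::ennreal)" for u
        using l1 by (auto simp: indicator_def)
      then show ?thesis using False by simp
    qed
  qed
  finally show ?thesis .
qed

lemma nn_integral_Icc_01:
  assumes "\<And>x. x \<in> {0..1} \<Longrightarrow> f x \<ge> 0" and "(f has_integral r) {0..1::real}"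
    and "(\<lambda>x. f x * indicator {0..1} x) \<in> borel_measurable borel"
  shows "(\<integral>\<^sup>+x. ennreal (f x) * indicator {0..1} x \<partial>lborel) = ennreal r"
proof -
  have "(\<integral>\<^sup>+x. ennreal (f x * indicator {0..1} x) \<partial>lborel) = ennreal r"
  proof (rule nn_integral_has_integral_lborel)
    have "((\<lambda>x. if x \<in> {0..1} then f x else 0) has_integral r) UNIV"
      using assms(2) by (simp only: has_integral_restrict_UNIV)
    then show "((\<lambda>x. f x * indicator {0..1} x) has_integral r) UNIV"
      by (rule has_integral_eq[rotated]) auto
  qed (use assms in \<open>auto split: split_indicator\<close>)
  also have "(\<integral>\<^sup>+x. ennreal (f x * indicator {0..1} x) \<partial>lborel) = (\<integral>\<^sup>+x. ennreal (f x) * indicator {0..1} x \<partial>lborel)"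
    by (intro nn_integral_cong) (auto split: split_indicator)
  finally show ?thesis .
qed

lemma nn_integral_uv_law_length:
  assumes g: "\<And>l. l \<in> {0..1} \<Longrightarrow> g l \<ge> 0" and [measurable]: "g \<in> borel_measurable borel"
    and h: "((\<lambda>l. g l * (2 * (1 - l))) has_integral r) {0..1}"
  shows "(\<integral>\<^sup>+z. ennreal (g (snd z - fst z)) \<partial>uv_law) = ennreal r"
proof -
  have "(\<integral>\<^sup>+z. ennreal (g (snd z - fst z)) \<partial>uv_law) =
    (\<integral>\<^sup>+l. \<integral>\<^sup>+w. ennreal (g l) * ennreal (2 * (1 - l)) * indicator {0..1::real} w * indicator {0..<1::real} l \<partial>lborel \<partial>lborel)"
    by (subst nn_integral_uv_law) auto
  also have "\<dots> = (\<integral>\<^sup>+l. \<integral>\<^sup>+w. ennreal (g l) * ennreal (2 * (1 - l)) * indicator {0..<1::real} l * indicator {0..1::real} w \<partial>lborel \<partial>lborel)"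
    by (simp add: mult_ac)
  also have "\<dots> = (\<integral>\<^sup>+l. ennreal (g l) * ennreal (2 * (1 - l)) * indicator {0..<1} l \<partial>lborel)"
    by (subst nn_integral_cmult) auto
  also have "\<dots> = (\<integral>\<^sup>+l. ennreal (g l * (2 * (1 - l))) * indicator {0..1} l \<partial>lborel)"
    by (intro nn_integral_cong) (auto simp: indicator_def ennreal_mult g)
  also have "\<dots> = ennreal r"
    by (rule nn_integral_Icc_01) (use g h in auto)
  finally show ?thesis .
qed

lemma emeasure_uv_law_space: "emeasure uv_law (space uv_law) = 1"
proof -
  have "((\<lambda>l. 1 * (2 * (1 - l))) has_integral ((\<lambda>l. 2 * l - l\<^sup>2) 1 - (\<lambda>l. 2 * l - l\<^sup>2) 0)) {0..1::real}"
    by (intro fundamental_theorem_of_calculus)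
       (auto intro!: derivative_eq_intros simp: has_real_derivative_iff_has_vector_derivative[symmetric] algebra_simps)
  then have "(\<integral>\<^sup>+z. ennreal ((\<lambda>_. 1) (snd z - fst z :: real)) \<partial>uv_law) = ennreal 1"
    by (intro nn_integral_uv_law_length) auto
  then show ?thesis by simp
qed

lemma prob_space_uv_law: "prob_space uv_law"
  by (rule prob_spaceI) (rule emeasure_uv_law_space)

lemma AE_uv_law: "AE z in uv_law. 0 \<le> fst z \<and> fst z < snd z \<and> snd z \<le> 1 \<and> snd z - fst z < 1"
proof (rule AE_I)
  define B where "B = {z :: real \<times> real. \<not> (0 \<le> fst z \<and> fst z < snd z \<and> snd z \<le> 1 \<and> snd z - fst z < 1)}"
  have B[measurable]: "B \<in> sets (borel \<Otimes>\<^sub>M borel)"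
  proof -
    have "{z \<in> space (borel \<Otimes>\<^sub>M borel). \<not> (0 \<le> fst z \<and> fst z < snd z \<and> snd z \<le> (1::real) \<and> snd z - fst z < 1)} \<in> sets (borel \<Otimes>\<^sub>M borel)"
      by measurable
    then show ?thesis by (simp add: space_pair_measure B_def)
  qed
  have Bm: "space uv_law \<inter> B \<in> sets uv_law"
    by (simp add: sets_uv_law sets_restrict_space)
  show "{z \<in> space uv_law. \<not> (0 \<le> fst z \<and> fst z < snd z \<and> snd z \<le> 1 \<and> snd z - fst z < 1)} \<subseteq> space uv_law \<inter> B"
    by (auto simp: B_def)
  show "space uv_law \<inter> B \<in> sets uv_law" by fact
  have "emeasure uv_law (space uv_law \<inter> B) = (\<integral>\<^sup>+z. indicator B z \<partial>uv_law)"
    unfolding nn_integral_indicator[OF Bm, symmetric] by (intro nn_integral_cong) (auto split: split_indicator)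
  also have "\<dots> = (\<integral>\<^sup>+l. \<integral>\<^sup>+w. indicator B (w * (1 - l), w * (1 - l) + l) * ennreal (2 * (1 - l)) * indicator {0..1} w * indicator {0..<1} l \<partial>lborel \<partial>lborel)"
    by (subst nn_integral_uv_law) auto
  also have "\<dots> = (\<integral>\<^sup>+(l::real). \<integral>\<^sup>+(w::real). 0 \<partial>lborel \<partial>lborel)"
  proof (rule nn_integral_cong_AE, rule eventually_mono[OF AE_lborel_singleton[of 0]])
    fix l :: real assume l: "l \<noteq> 0"
    have "indicator B (w * (1 - l), w * (1 - l) + l) * ennreal (2 * (1 - l)) * indicator {0..1} w * indicator {0..<1} l = 0" for w
    proof (cases "0 \<le> w \<and> w \<le> 1 \<and> 0 \<le> l \<and> l < 1")
      case True
      then have "w * (1 - l) \<le> 1 * (1 - l)" by (intro mult_right_mono) auto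
      then have "w * (1 - l) + l \<le> 1" by (simp add: algebra_simps)
      then have "(w * (1 - l), w * (1 - l) + l) \<notin> B" using True l by (auto simp: B_def)
      then show ?thesis by simp
    qed (auto simp: indicator_def)
    then show "(\<integral>\<^sup>+w. indicator B (w * (1 - l), w * (1 - l) + l) * ennreal (2 * (1 - l)) * indicator {0..1} w * indicator {0..<1} l \<partial>lborel) =
        (\<integral>\<^sup>+(w::real). 0 \<partial>lborel)" by (simp only:)
  qed
  finally show "emeasure uv_law (space uv_law \<inter> B) = 0" by simp
qed

section \<open>The exponent and the contraction factor\<close>

text \<open>In this form the value of \<open>lam_beta\<close> enters twice: in the mass balance of
  \<open>nn_integral_mean_op\<close> and in the comparison of mixed derivatives in
  \<open>par_identity\<close>.\<close>

lemma lam_beta_root: "lam_beta\<^sup>2 + 3 * lam_beta - 2 = 0"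
  unfolding lam_beta_def by (simp add: power2_eq_square field_simps)

lemma lam_beta_gt_half: "lam_beta > 1 / 2"
proof -
  have "4 < sqrt (17::real)" by (rule real_less_rsqrt) simp
  then show ?thesis by (simp add: lam_beta_def)
qed

lemma lam_beta_pos: "lam_beta > 0"
  using lam_beta_gt_half by linarith

lemma lam_beta_less_1: "lam_beta < 1"
proof -
  have "sqrt 17 < (5::real)" by (rule real_less_lsqrt) simp_all
  then show ?thesis by (simp add: lam_beta_def)
qed

text \<open>The mean of \<open>(1 - l) powr (2 * lam_beta) + l powr (2 * lam_beta)\<close> under the
  density \<open>2 * (1 - l)\<close>; the parts with denominator \<open>2 * lam_beta + 2\<close>
  cancel.\<close>

definition fp_ratio :: real where "fp_ratio = 2 / (2 * lam_beta + 1)"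

lemma fp_ratio: "0 \<le> fp_ratio" "fp_ratio < 1"
  using lam_beta_gt_half by (auto simp: fp_ratio_def)

lemma has_integral_reflect_01:
  fixes f :: "real \<Rightarrow> real"
  assumes "(f has_integral r) {0..1}"
  shows "((\<lambda>x. f (1 - x)) has_integral r) {0..1}"
proof -
  have im: "(\<lambda>x. (1 / (- 1)) *\<^sub>R x + - ((1 / (- 1)) *\<^sub>R 1)) ` cbox 0 1 = {0..1::real}"
    by (auto simp: image_iff intro!: bexI[of _ "1 - _"])
  show ?thesis
    using has_integral_affinity[of f r 0 1 "-1" 1] assms unfolding im by simp
qed

lemma powr_has_integral_01: "a > -1 \<Longrightarrow> ((\<lambda>x. x powr a) has_integral 1 / (a + 1)) {0..1::real}"
  using has_integral_powr_from_0[of a 1] by simp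

lemma fp_ratio_integral:
  "(\<integral>\<^sup>+z. ennreal (((1 - (snd z - fst z)) powr lam_beta)\<^sup>2 + ((snd z - fst z) powr lam_beta)\<^sup>2) \<partial>uv_law) = ennreal fp_ratio"
proof -
  let ?b = "2 * lam_beta"
  have b: "?b > 0" using lam_beta_pos by simp
  have sq: "(x powr lam_beta)\<^sup>2 = x powr ?b" for x :: real by (simp add: power2_eq_square powr_add[symmetric])
  have 1: "((\<lambda>x. 2 * x powr (?b + 1)) has_integral 2 * (1 / (?b + 1 + 1))) {0..1::real}"
    using b by (intro has_integral_mult_right powr_has_integral_01) auto
  have "((\<lambda>x. 2 * (1 - x) powr (?b + 1)) has_integral 2 * (1 / (?b + 1 + 1))) {0..1::real}"
    by (rule has_integral_reflect_01[OF 1])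
  moreover have "2 * (1 - x) powr (?b + 1) = (1 - x) powr ?b * (2 * (1 - x))" if "x \<in> {0..1}" for x :: real
    using that by (simp add: powr_add)
  ultimately have A: "((\<lambda>x. (1 - x) powr ?b * (2 * (1 - x))) has_integral 2 * (1 / (?b + 1 + 1))) {0..1::real}"
    by (rule has_integral_eq[rotated])
  have "((\<lambda>x. 2 * x powr ?b - 2 * x powr (?b + 1)) has_integral 2 * (1 / (?b + 1)) - 2 * (1 / (?b + 1 + 1))) {0..1::real}"
    using b by (intro has_integral_diff has_integral_mult_right powr_has_integral_01) auto
  moreover have "2 * x powr ?b - 2 * x powr (?b + 1) = x powr ?b * (2 * (1 - x))" if "x \<in> {0..1}" for x :: real
    using that by (simp add: powr_add algebra_simps)
  ultimately have B: "((\<lambda>x. x powr ?b * (2 * (1 - x))) has_integral 2 * (1 / (?b + 1)) - 2 * (1 / (?b + 1 + 1))) {0..1::real}"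
    by (rule has_integral_eq[rotated])
  have "((\<lambda>l. (((1 - l) powr lam_beta)\<^sup>2 + (l powr lam_beta)\<^sup>2) * (2 * (1 - l))) has_integral fp_ratio) {0..1}"
    using has_integral_add[OF A B] by (simp add: sq distrib_right fp_ratio_def)
  then show ?thesis
    by (intro nn_integral_uv_law_length[where g = "\<lambda>l. ((1 - l) powr lam_beta)\<^sup>2 + (l powr lam_beta)\<^sup>2"]) auto
qed

subsection \<open>Uniqueness of solutions with a given mean\<close>

text \<open>Moves the last factor to the front, so that the chord becomes the outermost integral and
  the fixed-point equation can be evaluated chord by chord.\<close>

lemma distr_rotate_pair_measure:
  assumes P: "sigma_finite_measure P" and Q: "sigma_finite_measure Q" and N: "sigma_finite_measure N"
  shows "distr (N \<Otimes>\<^sub>M (P \<Otimes>\<^sub>M Q)) (P \<Otimes>\<^sub>M (Q \<Otimes>\<^sub>M N)) (\<lambda>x. (fst (snd x), snd (snd x), fst x)) = P \<Otimes>\<^sub>M (Q \<Otimes>\<^sub>M N)"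
proof (rule measure_eqI)
  interpret P: sigma_finite_measure P by fact
  interpret Q: sigma_finite_measure Q by fact
  interpret N: sigma_finite_measure N by fact
  interpret QN: pair_sigma_finite Q N ..
  interpret PQ: pair_sigma_finite P Q ..
  interpret PN: pair_sigma_finite P N ..
  fix A assume "A \<in> sets (distr (N \<Otimes>\<^sub>M (P \<Otimes>\<^sub>M Q)) (P \<Otimes>\<^sub>M (Q \<Otimes>\<^sub>M N)) (\<lambda>x. (fst (snd x), snd (snd x), fst x)))"
  then have A[measurable]: "A \<in> sets (P \<Otimes>\<^sub>M (Q \<Otimes>\<^sub>M N))" by simp
  have "emeasure (distr (N \<Otimes>\<^sub>M (P \<Otimes>\<^sub>M Q)) (P \<Otimes>\<^sub>M (Q \<Otimes>\<^sub>M N)) (\<lambda>x. (fst (snd x), snd (snd x), fst x))) A =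
    (\<integral>\<^sup>+x. indicator A (fst (snd x), snd (snd x), fst x) \<partial>(N \<Otimes>\<^sub>M (P \<Otimes>\<^sub>M Q)))"
    by (subst nn_integral_indicator[symmetric], simp, subst nn_integral_distr) auto
  also have "\<dots> = (\<integral>\<^sup>+z. \<integral>\<^sup>+p. indicator A (fst p, snd p, z) \<partial>(P \<Otimes>\<^sub>M Q) \<partial>N)"
    by (subst PQ.P.nn_integral_fst[symmetric]) auto
  also have "\<dots> = (\<integral>\<^sup>+z. \<integral>\<^sup>+a. \<integral>\<^sup>+b. indicator A (a, b, z) \<partial>Q \<partial>P \<partial>N)"
    by (intro nn_integral_cong, subst Q.nn_integral_fst[symmetric]) auto
  also have "\<dots> = (\<integral>\<^sup>+a. \<integral>\<^sup>+z. \<integral>\<^sup>+b. indicator A (a, b, z) \<partial>Q \<partial>N \<partial>P)"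
    by (rule PN.Fubini') measurable
  also have "\<dots> = (\<integral>\<^sup>+a. \<integral>\<^sup>+b. \<integral>\<^sup>+z. indicator A (a, b, z) \<partial>N \<partial>Q \<partial>P)"
    by (intro nn_integral_cong QN.Fubini') measurable
  also have "\<dots> = (\<integral>\<^sup>+a. \<integral>\<^sup>+y. indicator A (a, y) \<partial>(Q \<Otimes>\<^sub>M N) \<partial>P)"
    by (intro nn_integral_cong, subst N.nn_integral_fst[symmetric]) auto
  also have "\<dots> = emeasure (P \<Otimes>\<^sub>M (Q \<Otimes>\<^sub>M N)) A"
    by (subst QN.P.nn_integral_fst) auto
  finally show "emeasure (distr (N \<Otimes>\<^sub>M (P \<Otimes>\<^sub>M Q)) (P \<Otimes>\<^sub>M (Q \<Otimes>\<^sub>M N)) (\<lambda>x. (fst (snd x), snd (snd x), fst x))) A = emeasure (P \<Otimes>\<^sub>M (Q \<Otimes>\<^sub>M N)) A" .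
qed simp

lemma integral_rotate_pair_measure:
  fixes f :: "_ \<Rightarrow> real"
  assumes P: "prob_space P" and Q: "prob_space Q" and N: "prob_space N"
    and f: "integrable (P \<Otimes>\<^sub>M (Q \<Otimes>\<^sub>M N)) f"
  shows "(\<integral>x. f x \<partial>(P \<Otimes>\<^sub>M (Q \<Otimes>\<^sub>M N))) = (\<integral>z. \<integral>p. f (fst p, snd p, z) \<partial>(P \<Otimes>\<^sub>M Q) \<partial>N)"
    and "integrable N (\<lambda>z. \<integral>p. f (fst p, snd p, z) \<partial>(P \<Otimes>\<^sub>M Q))"
proof -
  interpret P: prob_space P by fact
  interpret Q: prob_space Q by fact
  interpret N: prob_space N by fact
  interpret PQ: pair_prob_space P Q ..
  interpret NPQ: pair_prob_space N "P \<Otimes>\<^sub>M Q" ..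
  have [measurable]: "f \<in> borel_measurable (P \<Otimes>\<^sub>M (Q \<Otimes>\<^sub>M N))" using f by auto
  note rot = distr_rotate_pair_measure[OF P.sigma_finite_measure_axioms Q.sigma_finite_measure_axioms N.sigma_finite_measure_axioms]
  have int: "integrable (N \<Otimes>\<^sub>M (P \<Otimes>\<^sub>M Q)) (\<lambda>x. f (fst (snd x), snd (snd x), fst x))"
    using f by (subst (asm) rot[symmetric]) (subst (asm) integrable_distr_eq; simp)
  have "(\<integral>x. f x \<partial>(P \<Otimes>\<^sub>M (Q \<Otimes>\<^sub>M N))) = (\<integral>x. f (fst (snd x), snd (snd x), fst x) \<partial>(N \<Otimes>\<^sub>M (P \<Otimes>\<^sub>M Q)))"
    by (subst rot[symmetric], subst integral_distr) auto
  also have "\<dots> = (\<integral>z. \<integral>p. f (fst p, snd p, z) \<partial>(P \<Otimes>\<^sub>M Q) \<partial>N)"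
    by (subst NPQ.integral_fst'[OF int, symmetric]) simp
  finally show "(\<integral>x. f x \<partial>(P \<Otimes>\<^sub>M (Q \<Otimes>\<^sub>M N))) = (\<integral>z. \<integral>p. f (fst p, snd p, z) \<partial>(P \<Otimes>\<^sub>M Q) \<partial>N)" .
  show "integrable N (\<lambda>z. \<integral>p. f (fst p, snd p, z) \<partial>(P \<Otimes>\<^sub>M Q))"
    using NPQ.integrable_fst'[OF int] by simp
qed

lemma integral_abs_le_integral:
  fixes f g :: "'a \<Rightarrow> real"
  assumes "integrable M f" "integrable M g" "\<And>x. x \<in> space M \<Longrightarrow> \<bar>f x\<bar> \<le> g x"
  shows "\<bar>\<integral>x. f x \<partial>M\<bar> \<le> (\<integral>x. g x \<partial>M)"
proof -
  have "\<bar>\<integral>x. f x \<partial>M\<bar> \<le> (\<integral>x. \<bar>f x\<bar> \<partial>M)" by (rule integral_abs_bound)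
  also have "\<dots> \<le> (\<integral>x. g x \<partial>M)" by (rule integral_mono) (use assms in auto)
  finally show ?thesis .
qed

lemma smooth_test_prod_measurable:
  assumes f: "\<And>j. j \<in> J \<Longrightarrow> smooth_test (f j)" and g: "\<And>j. j \<in> J \<Longrightarrow> g j \<in> borel_measurable M"
  shows "(\<lambda>x. \<Prod>j\<in>J. f j (g j x)) \<in> borel_measurable M"
  by (rule borel_measurable_prod, rule measurable_compose[OF g smooth_test_measurable[OF f]])

text \<open>Separating positions from weights turns the three cases of \<open>glue\<close> into the
  single formula \<open>glue_eq\<close>, linear in each copy. Geometrically, the arc from
  \<open>u\<close> to \<open>v\<close> is collapsed to a point and the rest is rescaled to unit
  length.\<close>

definition outer_pos :: "real \<Rightarrow> real \<Rightarrow> real \<Rightarrow> real" where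
  "outer_pos u v s = (if s < u then s / (1 - (v - u)) else if s < v then u / (1 - (v - u)) else (s - (v - u)) / (1 - (v - u)))"

text \<open>The value 0 off the arc is a default that keeps the position in \<open>{0..1}\<close>;
  it is harmless because \<open>inner_wt\<close> vanishes there.\<close>

definition inner_pos :: "real \<Rightarrow> real \<Rightarrow> real \<Rightarrow> real" where
  "inner_pos u v s = (if u \<le> s \<and> s < v then (s - u) / (v - u) else 0)"

definition inner_wt :: "real \<Rightarrow> real \<Rightarrow> real \<Rightarrow> real" where
  "inner_wt u v s = (if u \<le> s \<and> s < v then (v - u) powr lam_beta else 0)"

lemma glue_eq:
  "glue x0 x1 u v s = (1 - (v - u)) powr lam_beta * x0 (outer_pos u v s) + inner_wt u v s * x1 (inner_pos u v s)"
  by (auto simp: glue_def outer_pos_def inner_pos_def inner_wt_def)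

lemma outer_pos_in:
  assumes "u \<in> {0..1}" "v \<in> {0..1}" "s \<in> {0..1}" shows "outer_pos u v s \<in> {0..1}"
proof (cases "1 - (v - u) = 0")
  \<comment> \<open>For an arc of full length, division by zero yields 0, which still lies in
    \<open>{0..1}\<close>.\<close>
  case True then show ?thesis by (simp add: outer_pos_def)
next
  case False
  then have "1 - (v - u) > 0" using assms by auto
  then show ?thesis using assms by (auto simp: outer_pos_def field_simps)
qed

lemma inner_pos_in: "inner_pos u v s \<in> {0..1}"
  by (auto simp: inner_pos_def field_simps)

lemma outer_pos_measurable [measurable]: "(\<lambda>z. outer_pos (fst z) (snd z) s) \<in> borel_measurable (borel \<Otimes>\<^sub>M borel)"
  unfolding outer_pos_def by measurable

lemma inner_pos_measurable [measurable]: "(\<lambda>z. inner_pos (fst z) (snd z) s) \<in> borel_measurable (borel \<Otimes>\<^sub>M borel)"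
  unfolding inner_pos_def by measurable

lemma inner_wt_measurable [measurable]: "(\<lambda>z. inner_wt (fst z) (snd z) s) \<in> borel_measurable (borel \<Otimes>\<^sub>M borel)"
  unfolding inner_wt_def by measurable

locale cadlag_proc = prob_space P for P :: "'a measure" +
  fixes X :: "'a \<Rightarrow> real \<Rightarrow> real"
  assumes proc: "real_process P X" and paths: "\<omega> \<in> space P \<Longrightarrow> cadlag (X \<omega>)"
begin

lemma eval_clamp_measurable [measurable (raw)]:
  assumes [measurable]: "f \<in> measurable N P" "g \<in> borel_measurable N"
  shows "(\<lambda>x. X (f x) (clamp01 (g x))) \<in> borel_measurable N"
  using measurable_compose[OF _ cadlag_process_measurable[OF proc paths], of "\<lambda>x. (f x, g x)" N] by simp

lemma eval_measurable:
  assumes "s \<in> {0..1}" shows "(\<lambda>\<omega>. X \<omega> s) \<in> borel_measurable P"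
  using proc assms by (auto simp: real_process_def)

lemma glue_measurable:
  assumes s: "s \<in> {0..1}"
  shows "(\<lambda>(\<omega>0, \<omega>1, u, v). glue (X \<omega>0) (X \<omega>1) u v s) \<in> borel_measurable (P \<Otimes>\<^sub>M P \<Otimes>\<^sub>M uv_law)"
proof -
  have [measurable]: "(\<lambda>z. outer_pos (fst z) (snd z) s) \<in> borel_measurable uv_law"
    "(\<lambda>z. inner_pos (fst z) (snd z) s) \<in> borel_measurable uv_law"
    "(\<lambda>z. inner_wt (fst z) (snd z) s) \<in> borel_measurable uv_law"
    by (auto intro!: measurable_uv_lawI outer_pos_measurable inner_pos_measurable inner_wt_measurable)
  have "(\<lambda>x. (1 - (snd (snd (snd x)) - fst (snd (snd x)))) powr lam_beta * X (fst x) (clamp01 (outer_pos (fst (snd (snd x))) (snd (snd (snd x))) s))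
      + inner_wt (fst (snd (snd x))) (snd (snd (snd x))) s * X (fst (snd x)) (clamp01 (inner_pos (fst (snd (snd x))) (snd (snd (snd x))) s)))
    \<in> borel_measurable (P \<Otimes>\<^sub>M P \<Otimes>\<^sub>M uv_law)" (is "?g \<in> _")
    by measurable
  then show ?thesis
  proof (rule measurable_cong[THEN iffD1, rotated])
    fix x assume "x \<in> space (P \<Otimes>\<^sub>M P \<Otimes>\<^sub>M uv_law)"
    then have "fst (snd (snd x)) \<in> {0..1}" "snd (snd (snd x)) \<in> {0..1}" by (auto simp: space_pair_measure)
    then show "?g x = (case x of (\<omega>0, \<omega>1, u, v) \<Rightarrow> glue (X \<omega>0) (X \<omega>1) u v s)"
      using outer_pos_in[OF _ _ s] by (simp add: glue_eq split_beta clamp01_id[OF inner_pos_in] clamp01_id del: atLeastAtMost_iff)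
  qed
qed

text \<open>The equality of laws as an integral identity, conditioned on the chord. It is applied to
  bounded test products for uniqueness and to evaluation at a point for the mean. \<open>H\<close>
  sees restricted paths, because \<open>path_law\<close> is a law on functions on
  \<open>{0..1}\<close>.\<close>

lemma FP_integral:
  fixes H :: "(real \<Rightarrow> real) \<Rightarrow> real"
  assumes FP: "solves_FP P X" and H[measurable]: "H \<in> borel_measurable (\<Pi>\<^sub>M s\<in>{0..1}. borel)"
    and int: "integrable P (\<lambda>\<omega>. H (restrict (X \<omega>) {0..1}))"
  shows "(\<integral>\<omega>. H (restrict (X \<omega>) {0..1}) \<partial>P) =
      (\<integral>z. \<integral>p. H (restrict (glue (X (fst p)) (X (snd p)) (fst z) (snd z)) {0..1}) \<partial>(P \<Otimes>\<^sub>M P) \<partial>uv_law)"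
    and "integrable uv_law (\<lambda>z. \<integral>p. H (restrict (glue (X (fst p)) (X (snd p)) (fst z) (snd z)) {0..1}) \<partial>(P \<Otimes>\<^sub>M P))"
    and "integrable (P \<Otimes>\<^sub>M P \<Otimes>\<^sub>M uv_law) (\<lambda>(\<omega>0, \<omega>1, u, v). H (restrict (glue (X \<omega>0) (X \<omega>1) u v) {0..1}))"
proof -
  let ?G = "\<lambda>(\<omega>0, \<omega>1, u, v). glue (X \<omega>0) (X \<omega>1) u v"
  have G: "real_process (P \<Otimes>\<^sub>M P \<Otimes>\<^sub>M uv_law) ?G"
    unfolding real_process_def using glue_measurable by (simp add: split_beta')
  note mG[measurable] = real_process_restrict_measurable[OF G]
  note mX[measurable] = real_process_restrict_measurable[OF proc]
  have law: "distr P (\<Pi>\<^sub>M s\<in>{0..1}. borel) (\<lambda>\<omega>. restrict (X \<omega>) {0..1}) =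
      distr (P \<Otimes>\<^sub>M P \<Otimes>\<^sub>M uv_law) (\<Pi>\<^sub>M s\<in>{0..1}. borel) (\<lambda>\<omega>. restrict (?G \<omega>) {0..1})"
    using FP unfolding solves_FP_def path_law_def .
  have "integrable (distr P (\<Pi>\<^sub>M s\<in>{0..1}. borel) (\<lambda>\<omega>. restrict (X \<omega>) {0..1})) H"
    using int by (subst integrable_distr_eq) auto
  then have intG: "integrable (P \<Otimes>\<^sub>M P \<Otimes>\<^sub>M uv_law) (\<lambda>x. H (restrict (?G x) {0..1}))"
    unfolding law by (subst (asm) integrable_distr_eq) auto
  have "(\<integral>\<omega>. H (restrict (X \<omega>) {0..1}) \<partial>P) = (\<integral>x. H (restrict (?G x) {0..1}) \<partial>(P \<Otimes>\<^sub>M P \<Otimes>\<^sub>M uv_law))"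
    using integral_distr[OF mX H] integral_distr[OF mG H] law by simp
  also have "\<dots> = (\<integral>z. \<integral>p. H (restrict (?G (fst p, snd p, z)) {0..1}) \<partial>(P \<Otimes>\<^sub>M P) \<partial>uv_law)"
    by (rule integral_rotate_pair_measure[OF prob_space_axioms prob_space_axioms prob_space_uv_law intG])
  finally show "(\<integral>\<omega>. H (restrict (X \<omega>) {0..1}) \<partial>P) =
      (\<integral>z. \<integral>p. H (restrict (glue (X (fst p)) (X (snd p)) (fst z) (snd z)) {0..1}) \<partial>(P \<Otimes>\<^sub>M P) \<partial>uv_law)"
    by (simp add: split_beta)
  show "integrable uv_law (\<lambda>z. \<integral>p. H (restrict (glue (X (fst p)) (X (snd p)) (fst z) (snd z)) {0..1}) \<partial>(P \<Otimes>\<^sub>M P))"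
    using integral_rotate_pair_measure(2)[OF prob_space_axioms prob_space_axioms prob_space_uv_law intG] by (simp add: split_beta)
  show "integrable (P \<Otimes>\<^sub>M P \<Otimes>\<^sub>M uv_law) (\<lambda>(\<omega>0, \<omega>1, u, v). H (restrict (glue (X \<omega>0) (X \<omega>1) u v) {0..1}))"
    using intG by (simp add: split_beta')
qed

text \<open>Shifts \<open>c\<close> and scales \<open>a\<close> belong to the test so that the class
  is closed under the fixed-point equation: freezing one copy turns its contribution into a shift
  and changes the scale of the other. The positions \<open>s\<close> need not be distinct, as
  several points can share one image under \<open>outer_pos\<close>.\<close>

definition test_mean :: "(real \<Rightarrow> real \<Rightarrow> real) \<Rightarrow> real set \<Rightarrow> (real \<Rightarrow> real) \<Rightarrow> (real \<Rightarrow> real) \<Rightarrow> (real \<Rightarrow> real) \<Rightarrow> real" where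
  "test_mean f J s c a = (\<integral>\<omega>. (\<Prod>j\<in>J. f j (c j + a j * X \<omega> (s j))) \<partial>P)"

lemma test_prod_measurable:
  assumes "\<And>j. j \<in> J \<Longrightarrow> smooth_test (f j)" "\<And>j. j \<in> J \<Longrightarrow> s j \<in> {0..1}"
  shows "(\<lambda>\<omega>. \<Prod>j\<in>J. f j (c j + a j * X \<omega> (s j))) \<in> borel_measurable P"
  by (rule smooth_test_prod_measurable)
     (use assms in \<open>auto intro!: borel_measurable_add borel_measurable_times eval_measurable\<close>)

end

lemma smooth_test_prod_bounds:
  assumes "\<And>j. j \<in> J \<Longrightarrow> smooth_test (f j)"
  shows "0 \<le> (\<Prod>j\<in>J. f j (y j))" "(\<Prod>j\<in>J. f j (y j)) \<le> 1" "\<bar>\<Prod>j\<in>J. f j (y j)\<bar> \<le> 1"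
proof -
  show *: "0 \<le> (\<Prod>j\<in>J. f j (y j))" "(\<Prod>j\<in>J. f j (y j)) \<le> 1"
    using smooth_test_bounds[OF assms] by (auto intro!: prod_nonneg prod_le_1)
  then show "\<bar>\<Prod>j\<in>J. f j (y j)\<bar> \<le> 1" by simp
qed

locale two_solutions = X: cadlag_proc P X + Y: cadlag_proc Q Y
  for P :: "'a measure" and X and Q :: "'b measure" and Y +
  assumes FPX: "solves_FP P X" and FPY: "solves_FP Q Y"
    and sqX: "integrable P (\<lambda>\<omega>. (sup_norm (X \<omega>))\<^sup>2)" and sqY: "integrable Q (\<lambda>\<omega>. (sup_norm (Y \<omega>))\<^sup>2)"
    and mean_eq: "\<And>s. s \<in> {0..1} \<Longrightarrow> (\<integral>\<omega>. X \<omega> s \<partial>P) = (\<integral>\<omega>. Y \<omega> s \<partial>Q)"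

lemma (in cadlag_proc) second_moment_bound:
  assumes sq: "integrable P (\<lambda>\<omega>. (sup_norm (X \<omega>))\<^sup>2)" and s: "s \<in> {0..1}"
  shows "integrable P (\<lambda>\<omega>. (X \<omega> s)\<^sup>2)" "integrable P (\<lambda>\<omega>. X \<omega> s)"
    "(\<integral>\<omega>. (X \<omega> s)\<^sup>2 \<partial>P) \<le> (\<integral>\<omega>. (sup_norm (X \<omega>))\<^sup>2 \<partial>P)"
proof -
  note [measurable] = eval_measurable[OF s]
  have le: "(X \<omega> s)\<^sup>2 \<le> (sup_norm (X \<omega>))\<^sup>2" if "\<omega> \<in> space P" for \<omega>
    using abs_le_sup_norm[OF paths[OF that] s] by (metis abs_ge_zero power2_abs power_mono)
  show i: "integrable P (\<lambda>\<omega>. (X \<omega> s)\<^sup>2)"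
    by (rule Bochner_Integration.integrable_bound[OF sq]) (use le in auto)
  show "integrable P (\<lambda>\<omega>. X \<omega> s)"
    by (rule square_integrable_imp_integrable[OF eval_measurable[OF s] i])
  show "(\<integral>\<omega>. (X \<omega> s)\<^sup>2 \<partial>P) \<le> (\<integral>\<omega>. (sup_norm (X \<omega>))\<^sup>2 \<partial>P)"
    by (rule integral_mono[OF i sq]) (use le in auto)
qed

text \<open>Up to an error of order A^2 the test value is determined by \<open>c\<close>,
  \<open>a\<close> and the means, so it cancels between two processes with equal means.\<close>

lemma (in cadlag_proc) test_mean_expansion:
  assumes sq: "integrable P (\<lambda>\<omega>. (sup_norm (X \<omega>))\<^sup>2)"
    and J: "finite J" and f: "\<And>j. j \<in> J \<Longrightarrow> smooth_test (f j)" and s: "\<And>j. j \<in> J \<Longrightarrow> s j \<in> {0..1}"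
    and C: "C \<ge> 0" and d: "\<And>h. \<bar>(\<Prod>j\<in>J. f j (c j + h j)) - (\<Prod>j\<in>J. f j (c j)) - (\<Sum>j\<in>J. d j * h j)\<bar> \<le> C * (\<Sum>j\<in>J. (h j)\<^sup>2)"
    and a: "\<And>j. j \<in> J \<Longrightarrow> \<bar>a j\<bar> \<le> A" and A: "A \<ge> 0"
  shows "\<bar>test_mean f J s c a - (\<Prod>j\<in>J. f j (c j)) - (\<Sum>j\<in>J. d j * (a j * (\<integral>\<omega>. X \<omega> (s j) \<partial>P)))\<bar>
     \<le> C * real (card J) * (\<integral>\<omega>. (sup_norm (X \<omega>))\<^sup>2 \<partial>P) * A\<^sup>2"
proof -
  note mom = second_moment_bound[OF sq s]
  have [simp]: "integrable P (\<lambda>\<omega>. \<Prod>j\<in>J. f j (c j + a j * X \<omega> (s j)))"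
    by (rule integrable_const_bound[where B = 1])
       (use smooth_test_prod_bounds[where J = J and f = f] f in \<open>auto intro!: test_prod_measurable s\<close>)
  have i2: "integrable P (\<lambda>\<omega>. \<Sum>j\<in>J. d j * (a j * X \<omega> (s j)))" using mom by (intro Bochner_Integration.integrable_sum) auto
  have i3: "integrable P (\<lambda>\<omega>. C * (\<Sum>j\<in>J. (a j * X \<omega> (s j))\<^sup>2))"
    using mom by (intro Bochner_Integration.integrable_sum integrable_mult_right) (auto simp: power_mult_distrib)
  have "test_mean f J s c a - (\<Prod>j\<in>J. f j (c j)) - (\<Sum>j\<in>J. d j * (a j * (\<integral>\<omega>. X \<omega> (s j) \<partial>P))) =
     (\<integral>\<omega>. (\<Prod>j\<in>J. f j (c j + a j * X \<omega> (s j))) - (\<Prod>j\<in>J. f j (c j)) - (\<Sum>j\<in>J. d j * (a j * X \<omega> (s j))) \<partial>P)"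
    unfolding test_mean_def using mom i2
    by (simp add: Bochner_Integration.integral_diff Bochner_Integration.integral_sum prob_space)
  also have "\<bar>\<dots>\<bar> \<le> (\<integral>\<omega>. C * (\<Sum>j\<in>J. (a j * X \<omega> (s j))\<^sup>2) \<partial>P)"
    by (rule integral_abs_le_integral) (use i2 i3 d[of "\<lambda>j. a j * X _ (s j)"] in auto)
  also have "\<dots> = C * (\<Sum>j\<in>J. (a j)\<^sup>2 * (\<integral>\<omega>. (X \<omega> (s j))\<^sup>2 \<partial>P))"
    using mom by (simp add: Bochner_Integration.integral_sum power_mult_distrib)
  also have "\<dots> \<le> C * (\<Sum>j\<in>J. A\<^sup>2 * (\<integral>\<omega>. (sup_norm (X \<omega>))\<^sup>2 \<partial>P))"
  proof (intro mult_left_mono sum_mono mult_mono C mom)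
    show "(a j)\<^sup>2 \<le> A\<^sup>2" if "j \<in> J" for j using a[OF that] by (metis abs_ge_zero power2_abs power_mono)
  qed auto
  finally show ?thesis by (simp add: algebra_simps)
qed

context two_solutions begin

text \<open>A bound in the style of the Zolotarev metric of order two. It is claimed for all
  positions, shifts and scales at once, because one application of the fixed-point equation changes
  all three; \<open>n\<close> counts the applications.\<close>

lemma test_mean_contraction:
  assumes J: "finite J" and f: "\<And>j. j \<in> J \<Longrightarrow> smooth_test (f j)"
  shows "\<exists>C\<ge>0. \<forall>n s c a A. (\<forall>j\<in>J. s j \<in> {0..1}) \<longrightarrow> (\<forall>j\<in>J. \<bar>a j\<bar> \<le> A) \<longrightarrow> A \<ge> 0 \<longrightarrow>
    \<bar>X.test_mean f J s c a - Y.test_mean f J s c a\<bar> \<le> C * fp_ratio ^ n * A\<^sup>2"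
proof -
  obtain C0 where C0: "C0 \<ge> 0" and tay: "\<And>y. \<exists>d. \<forall>h.
    \<bar>(\<Prod>j\<in>J. f j (y j + h j)) - (\<Prod>j\<in>J. f j (y j)) - (\<Sum>j\<in>J. d j * h j)\<bar> \<le> C0 * (\<Sum>j\<in>J. (h j)\<^sup>2)"
    using prod_smooth_test_taylor[OF J f] by meson
  define C where "C = C0 * real (card J) * (\<integral>\<omega>. (sup_norm (X \<omega>))\<^sup>2 \<partial>P) + C0 * real (card J) * (\<integral>\<omega>. (sup_norm (Y \<omega>))\<^sup>2 \<partial>Q)"
  have C: "C \<ge> 0" unfolding C_def using C0 by (intro add_nonneg_nonneg mult_nonneg_nonneg integral_nonneg_AE) auto
  define R where "R K \<longleftrightarrow> (\<forall>s c a A. (\<forall>j\<in>J. s j \<in> {0..1}) \<longrightarrow> (\<forall>j\<in>J. \<bar>a j\<bar> \<le> A) \<longrightarrow> A \<ge> 0 \<longrightarrow>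
    \<bar>X.test_mean f J s c a - Y.test_mean f J s c a\<bar> \<le> K * A\<^sup>2)" for K :: real
  have base: "\<bar>X.test_mean f J s c a - Y.test_mean f J s c a\<bar> \<le> C * A\<^sup>2"
    if s: "\<And>j. j \<in> J \<Longrightarrow> s j \<in> {0..1}" and a: "\<And>j. j \<in> J \<Longrightarrow> \<bar>a j\<bar> \<le> A" and A: "A \<ge> 0" for s c a A
  proof -
    obtain d where d: "\<And>h. \<bar>(\<Prod>j\<in>J. f j (c j + h j)) - (\<Prod>j\<in>J. f j (c j)) - (\<Sum>j\<in>J. d j * h j)\<bar> \<le> C0 * (\<Sum>j\<in>J. (h j)\<^sup>2)"
      using tay by blast
    have "(\<Sum>j\<in>J. d j * (a j * (\<integral>\<omega>. X \<omega> (s j) \<partial>P))) = (\<Sum>j\<in>J. d j * (a j * (\<integral>\<omega>. Y \<omega> (s j) \<partial>Q)))"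
      using mean_eq[OF s] by (intro sum.cong) auto
    with X.test_mean_expansion[where f = f and s = s and a = a and c = c and d = d, OF sqX J f s C0 d a A]
      Y.test_mean_expansion[where f = f and s = s and a = a and c = c and d = d, OF sqY J f s C0 d a A]
    show ?thesis unfolding C_def distrib_right by linarith
  qed
  have step: "R (K * fp_ratio)" if RK: "R K" and K: "K \<ge> 0" for K
    unfolding R_def
  proof (intro allI impI)
    fix s c a :: "real \<Rightarrow> real" and A :: real
    assume "\<forall>j\<in>J. s j \<in> {0..1}" "\<forall>j\<in>J. \<bar>a j\<bar> \<le> A" and A: "A \<ge> 0"
    then have s: "\<And>j. j \<in> J \<Longrightarrow> s j \<in> {0..1}" and a: "\<And>j. j \<in> J \<Longrightarrow> \<bar>a j\<bar> \<le> A" by blast+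
    have IH: "\<bar>X.test_mean f J s c a - Y.test_mean f J s c a\<bar> \<le> K * A\<^sup>2"
      if "\<And>j. j \<in> J \<Longrightarrow> s j \<in> {0..1}" "\<And>j. j \<in> J \<Longrightarrow> \<bar>a j\<bar> \<le> A" "A \<ge> 0" for s c a A
      using RK that unfolding R_def by blast
    define H where "H x = (\<Prod>j\<in>J. f j (c j + a j * x (s j)))" for x :: "real \<Rightarrow> real"
    have Hm: "H \<in> borel_measurable (\<Pi>\<^sub>M s\<in>{0..1}. borel)" unfolding H_def
      by (rule smooth_test_prod_measurable[OF f])
         (use s in \<open>auto intro!: borel_measurable_add borel_measurable_times measurable_component_singleton\<close>)
    have Hr: "H (restrict x {0..1}) = H x" for x
      unfolding H_def using s by (intro prod.cong) auto
    have Hb: "\<bar>H x\<bar> \<le> 1" for x unfolding H_def by (rule smooth_test_prod_bounds[OF f])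
    have intX: "integrable P (\<lambda>\<omega>. H (restrict (X \<omega>) {0..1}))"
      by (rule X.integrable_const_bound[where B = 1])
         (auto simp: Hb intro: measurable_compose[OF real_process_restrict_measurable[OF X.proc] Hm])
    have intY: "integrable Q (\<lambda>\<omega>. H (restrict (Y \<omega>) {0..1}))"
      by (rule Y.integrable_const_bound[where B = 1])
         (auto simp: Hb intro: measurable_compose[OF real_process_restrict_measurable[OF Y.proc] Hm])
    define gX where "gX z = (\<integral>p. H (glue (X (fst p)) (X (snd p)) (fst z) (snd z)) \<partial>(P \<Otimes>\<^sub>M P))" for z
    define gY where "gY z = (\<integral>p. H (glue (Y (fst p)) (Y (snd p)) (fst z) (snd z)) \<partial>(Q \<Otimes>\<^sub>M Q))" for z
    have X_eq: "X.test_mean f J s c a = (\<integral>z. gX z \<partial>uv_law)" and gXi: "integrable uv_law gX"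
      using X.FP_integral(1,2)[OF FPX Hm intX] unfolding Hr gX_def[abs_def] by (simp_all add: X.test_mean_def H_def)
    have Y_eq: "Y.test_mean f J s c a = (\<integral>z. gY z \<partial>uv_law)" and gYi: "integrable uv_law gY"
      using Y.FP_integral(1,2)[OF FPY Hm intY] unfolding Hr gY_def[abs_def] by (simp_all add: Y.test_mean_def H_def)
    have bound: "\<bar>gX z - gY z\<bar> \<le> K * A\<^sup>2 * (((1 - (snd z - fst z)) powr lam_beta)\<^sup>2 + ((snd z - fst z) powr lam_beta)\<^sup>2)"
      if z: "z \<in> space uv_law" for z
    proof -
      define \<alpha> where "\<alpha> = (1 - (snd z - fst z)) powr lam_beta"
      define b where "b j = inner_wt (fst z) (snd z) (s j)" for j
      define s0 where "s0 j = outer_pos (fst z) (snd z) (s j)" for j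
      define s1 where "s1 j = inner_pos (fst z) (snd z) (s j)" for j
      have s0: "s0 j \<in> {0..1}" if "j \<in> J" for j
        unfolding s0_def using z s[OF that] by (intro outer_pos_in) (auto simp: mem_Times_iff)
      have s1: "s1 j \<in> {0..1}" for j unfolding s1_def by (rule inner_pos_in)
      have \<alpha>: "\<alpha> \<ge> 0" by (simp add: \<alpha>_def)
      have b: "0 \<le> b j" "b j \<le> (snd z - fst z) powr lam_beta" for j by (auto simp: b_def inner_wt_def)
      have aA: "\<bar>a j * \<alpha>\<bar> \<le> A * \<alpha>" "\<bar>a j * b j\<bar> \<le> A * (snd z - fst z) powr lam_beta" if "j \<in> J" for j
        using a[OF that] \<alpha> b[of j] A by (auto simp: abs_mult intro!: mult_mono)
      have Hg: "H (glue x y (fst z) (snd z)) = (\<Prod>j\<in>J. f j (c j + a j * (\<alpha> * x (s0 j) + b j * y (s1 j))))" for x y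
        by (simp add: H_def glue_eq \<alpha>_def b_def s0_def s1_def)
      have ev: "c j + a j * (\<alpha> * x + b j * y) = (c j + a j * b j * y) + (a j * \<alpha>) * x"
        "c j + a j * (\<alpha> * x + b j * y) = (c j + a j * \<alpha> * x) + (a j * b j) * y" for x y j
        by (simp_all add: algebra_simps)
      interpret PP: pair_prob_space P P ..
      interpret QQ: pair_prob_space Q Q ..
      interpret QP: pair_prob_space Q P ..
      \<comment> \<open>\<open>?F x y\<close> is the test with outer path \<open>x\<close> and inner
        path \<open>y\<close>. Three versions are compared: both paths from \<open>P\<close>, both
        from \<open>Q\<close>, and the hybrid with outer path from \<open>Q\<close> and inner path
        from \<open>P\<close>.\<close>
      let ?F = "\<lambda>x y. \<Prod>j\<in>J. f j (c j + a j * (\<alpha> * x (s0 j) + b j * y (s1 j)))"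
      have Fb: "\<bar>?F x y\<bar> \<le> 1" for x y by (rule smooth_test_prod_bounds[OF f])
      have Fm: "(\<lambda>p. ?F (X (fst p)) (X (snd p))) \<in> borel_measurable (P \<Otimes>\<^sub>M P)"
          "(\<lambda>p. ?F (Y (fst p)) (Y (snd p))) \<in> borel_measurable (Q \<Otimes>\<^sub>M Q)"
          "(\<lambda>p. ?F (Y (fst p)) (X (snd p))) \<in> borel_measurable (Q \<Otimes>\<^sub>M P)"
        by (rule smooth_test_prod_measurable[OF f], assumption,
            intro borel_measurable_add borel_measurable_times borel_measurable_const
              measurable_compose[OF measurable_fst X.eval_measurable[OF s0]] measurable_compose[OF measurable_snd X.eval_measurable[OF s1]]
              measurable_compose[OF measurable_fst Y.eval_measurable[OF s0]] measurable_compose[OF measurable_snd Y.eval_measurable[OF s1]];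
            assumption)+
      have Fi: "integrable (P \<Otimes>\<^sub>M P) (\<lambda>p. ?F (X (fst p)) (X (snd p)))"
          "integrable (Q \<Otimes>\<^sub>M Q) (\<lambda>p. ?F (Y (fst p)) (Y (snd p)))"
          "integrable (Q \<Otimes>\<^sub>M P) (\<lambda>p. ?F (Y (fst p)) (X (snd p)))"
        by (rule PP.integrable_const_bound[where B = 1] QQ.integrable_const_bound[where B = 1] QP.integrable_const_bound[where B = 1];
            use Fb Fm in simp)+
      \<comment> \<open>With the inner path frozen, \<open>gX z\<close> and the hybrid differ only
        in the law of the outer path, which carries the scale \<open>A * \<alpha>\<close>.\<close>
      have 1: "gX z = (\<integral>\<omega>. X.test_mean f J s0 (\<lambda>j. c j + a j * b j * X \<omega> (s1 j)) (\<lambda>j. a j * \<alpha>) \<partial>P)"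
        unfolding gX_def Hg X.test_mean_def
        using PP.integral_snd[where f = "\<lambda>x y. ?F (X x) (X y)"] Fi(1) by (simp add: split_beta' ev(1))
      have 2: "(\<integral>p. ?F (Y (fst p)) (X (snd p)) \<partial>(Q \<Otimes>\<^sub>M P)) = (\<integral>\<omega>. Y.test_mean f J s0 (\<lambda>j. c j + a j * b j * X \<omega> (s1 j)) (\<lambda>j. a j * \<alpha>) \<partial>P)"
        unfolding Y.test_mean_def
        using QP.integral_snd[where f = "\<lambda>x y. ?F (Y x) (X y)"] Fi(3) by (simp add: split_beta' ev(1))
      \<comment> \<open>With the outer path frozen, the hybrid and \<open>gY z\<close> differ only
        in the law of the inner path, whose scale carries the factor
        \<open>(snd z - fst z) powr lam_beta\<close>.\<close>
      have 3: "(\<integral>p. ?F (Y (fst p)) (X (snd p)) \<partial>(Q \<Otimes>\<^sub>M P)) = (\<integral>\<eta>. X.test_mean f J s1 (\<lambda>j. c j + a j * \<alpha> * Y \<eta> (s0 j)) (\<lambda>j. a j * b j) \<partial>Q)"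
        unfolding X.test_mean_def
        using QP.integral_fst[where f = "\<lambda>x y. ?F (Y x) (X y)"] Fi(3) by (simp add: split_beta' ev(2))
      have 4: "gY z = (\<integral>\<eta>. Y.test_mean f J s1 (\<lambda>j. c j + a j * \<alpha> * Y \<eta> (s0 j)) (\<lambda>j. a j * b j) \<partial>Q)"
        unfolding gY_def Hg Y.test_mean_def
        using QQ.integral_fst[where f = "\<lambda>x y. ?F (Y x) (Y y)"] Fi(2) by (simp add: split_beta' ev(2))
      have i1: "integrable P (\<lambda>\<omega>. X.test_mean f J s0 (\<lambda>j. c j + a j * b j * X \<omega> (s1 j)) (\<lambda>j. a j * \<alpha>))"
        using PP.integrable_snd[where f = "\<lambda>x y. ?F (X x) (X y)"] Fi(1) by (simp add: X.test_mean_def split_beta' ev(1))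
      have i2: "integrable P (\<lambda>\<omega>. Y.test_mean f J s0 (\<lambda>j. c j + a j * b j * X \<omega> (s1 j)) (\<lambda>j. a j * \<alpha>))"
        using QP.integrable_snd[where f = "\<lambda>x y. ?F (Y x) (X y)"] Fi(3) by (simp add: Y.test_mean_def split_beta' ev(1))
      have i3: "integrable Q (\<lambda>\<eta>. X.test_mean f J s1 (\<lambda>j. c j + a j * \<alpha> * Y \<eta> (s0 j)) (\<lambda>j. a j * b j))"
        using QP.integrable_fst[where f = "\<lambda>x y. ?F (Y x) (X y)"] Fi(3) by (simp add: X.test_mean_def split_beta' ev(2))
      have i4: "integrable Q (\<lambda>\<eta>. Y.test_mean f J s1 (\<lambda>j. c j + a j * \<alpha> * Y \<eta> (s0 j)) (\<lambda>j. a j * b j))"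
        using QQ.integrable_fst[where f = "\<lambda>x y. ?F (Y x) (Y y)"] Fi(2) by (simp add: Y.test_mean_def split_beta' ev(2))
      have "\<bar>gX z - (\<integral>p. ?F (Y (fst p)) (X (snd p)) \<partial>(Q \<Otimes>\<^sub>M P))\<bar> \<le> (\<integral>\<omega>. K * (A * \<alpha>)\<^sup>2 \<partial>P)"
        unfolding 1 2 Bochner_Integration.integral_diff[OF i1 i2, symmetric]
        by (rule integral_abs_le_integral)
           (use i1 i2 A \<alpha> in \<open>auto intro!: IH s0 aA Bochner_Integration.integrable_diff\<close>)
      moreover have "\<bar>(\<integral>p. ?F (Y (fst p)) (X (snd p)) \<partial>(Q \<Otimes>\<^sub>M P)) - gY z\<bar> \<le> (\<integral>\<eta>. K * (A * (snd z - fst z) powr lam_beta)\<^sup>2 \<partial>Q)"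
        unfolding 3 4 Bochner_Integration.integral_diff[OF i3 i4, symmetric]
        by (rule integral_abs_le_integral)
           (use i3 i4 A in \<open>auto intro!: IH s1 aA Bochner_Integration.integrable_diff\<close>)
      ultimately have "\<bar>gX z - gY z\<bar> \<le> K * (A * \<alpha>)\<^sup>2 + K * (A * (snd z - fst z) powr lam_beta)\<^sup>2"
        by (simp add: X.prob_space Y.prob_space)
      also have "\<dots> = K * A\<^sup>2 * (\<alpha>\<^sup>2 + ((snd z - fst z) powr lam_beta)\<^sup>2)"
        by (simp add: power_mult_distrib algebra_simps)
      finally show ?thesis by (simp add: \<alpha>_def)
    qed
    let ?r = "\<lambda>z. ((1 - (snd z - fst z)) powr lam_beta)\<^sup>2 + ((snd z - fst z) powr lam_beta)\<^sup>2"
    have rm: "?r \<in> borel_measurable uv_law" by measurable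
    have ri: "integrable uv_law ?r" "(\<integral>z. ?r z \<partial>uv_law) = fp_ratio"
    proof -
      show "integrable uv_law ?r"
        by (rule integrableI_nonneg) (use rm fp_ratio_integral in auto)
      show "(\<integral>z. ?r z \<partial>uv_law) = fp_ratio"
        using integral_eq_nn_integral[OF rm] fp_ratio_integral fp_ratio(1) by simp
    qed
    have "\<bar>(\<integral>z. gX z \<partial>uv_law) - (\<integral>z. gY z \<partial>uv_law)\<bar> = \<bar>(\<integral>z. gX z - gY z \<partial>uv_law)\<bar>"
      using gXi gYi by simp
    also have "\<dots> \<le> (\<integral>z. K * A\<^sup>2 * ?r z \<partial>uv_law)"
      by (rule integral_abs_le_integral) (use gXi gYi ri bound in auto)
    also have "\<dots> = K * fp_ratio * A\<^sup>2" using ri by simp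
    finally show "\<bar>X.test_mean f J s c a - Y.test_mean f J s c a\<bar> \<le> K * fp_ratio * A\<^sup>2" by (simp add: X_eq Y_eq)
  qed
  have "R (C * fp_ratio ^ n)" for n
  proof (induction n)
    case 0
    show ?case unfolding R_def using base by simp
  next
    case (Suc n)
    have "R (C * fp_ratio ^ n * fp_ratio)"
      by (rule step[OF Suc.IH]) (use C fp_ratio(1) in simp)
    then show ?case by (simp add: mult_ac)
  qed
  then show ?thesis using C unfolding R_def by (intro exI[of _ C]) auto
qed

theorem path_law_unique: "path_law P X = path_law Q Y"
proof (rule path_law_eqI[OF X.prob_space_axioms Y.prob_space_axioms X.proc Y.proc])
  fix J :: "real set" and f :: "real \<Rightarrow> real \<Rightarrow> real"
  assume J: "finite J" "J \<subseteq> {0..1}" and f: "\<And>j. j \<in> J \<Longrightarrow> smooth_test (f j)"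
  have "\<exists>C\<ge>0. \<forall>n s c a A. (\<forall>j\<in>J. s j \<in> {0..1}) \<longrightarrow> (\<forall>j\<in>J. \<bar>a j\<bar> \<le> A) \<longrightarrow> A \<ge> 0 \<longrightarrow>
    \<bar>X.test_mean f J s c a - Y.test_mean f J s c a\<bar> \<le> C * fp_ratio ^ n * A\<^sup>2"
    by (rule test_mean_contraction[OF J(1)]) (rule f)
  then obtain C where C: "\<forall>n s c a A. (\<forall>j\<in>J. s j \<in> {0..1}) \<longrightarrow> (\<forall>j\<in>J. \<bar>a j\<bar> \<le> A) \<longrightarrow> A \<ge> 0 \<longrightarrow>
    \<bar>X.test_mean f J s c a - Y.test_mean f J s c a\<bar> \<le> C * fp_ratio ^ n * A\<^sup>2"
    by (elim exE conjE)
  have le: "\<bar>X.test_mean f J id (\<lambda>_. 0) (\<lambda>_. 1) - Y.test_mean f J id (\<lambda>_. 0) (\<lambda>_. 1)\<bar> \<le> C * fp_ratio ^ n" for n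
    using C[rule_format, of id "\<lambda>_. 1" 1 "\<lambda>_. 0" n] J(2) by (simp add: subset_iff)
  have "(\<lambda>n. C * fp_ratio ^ n) \<longlonglongrightarrow> C * 0"
    using fp_ratio by (intro tendsto_intros LIMSEQ_power_zero) auto
  then have "\<bar>X.test_mean f J id (\<lambda>_. 0) (\<lambda>_. 1) - Y.test_mean f J id (\<lambda>_. 0) (\<lambda>_. 1)\<bar> \<le> C * 0"
    by (rule LIMSEQ_le_const) (use le in blast)
  then show "(\<integral>\<omega>. (\<Prod>j\<in>J. f j (X \<omega> j)) \<partial>P) = (\<integral>\<omega>. (\<Prod>j\<in>J. f j (Y \<omega> j)) \<partial>Q)"
    by (simp add: X.test_mean_def Y.test_mean_def)
qed

end

subsection \<open>The fixed-point equation for the mean\<close>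

definition mean_kernel :: "(real \<Rightarrow> ennreal) \<Rightarrow> real \<Rightarrow> real \<times> real \<Rightarrow> ennreal" where
  "mean_kernel f s z = ennreal ((1 - (snd z - fst z)) powr lam_beta) * f (outer_pos (fst z) (snd z) s)
      + ennreal (inner_wt (fst z) (snd z) s) * f (inner_pos (fst z) (snd z) s)"

text \<open>Taken in \<open>ennreal\<close>, so that mass preservation and positivity can be stated
  for all measurable functions without carrying integrability along.\<close>

definition mean_op :: "(real \<Rightarrow> ennreal) \<Rightarrow> real \<Rightarrow> ennreal" where
  "mean_op f s = (\<integral>\<^sup>+z. mean_kernel f s z \<partial>uv_law)"

lemma outer_pos_measurable3 [measurable (raw)]:
  assumes [measurable]: "f \<in> borel_measurable M" "g \<in> borel_measurable M" "h \<in> borel_measurable M"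
  shows "(\<lambda>x. outer_pos (f x) (g x) (h x)) \<in> borel_measurable M"
  unfolding outer_pos_def by measurable

lemma inner_pos_measurable3 [measurable (raw)]:
  assumes [measurable]: "f \<in> borel_measurable M" "g \<in> borel_measurable M" "h \<in> borel_measurable M"
  shows "(\<lambda>x. inner_pos (f x) (g x) (h x)) \<in> borel_measurable M"
  unfolding inner_pos_def by measurable

lemma inner_wt_measurable3 [measurable (raw)]:
  assumes [measurable]: "f \<in> borel_measurable M" "g \<in> borel_measurable M" "h \<in> borel_measurable M"
  shows "(\<lambda>x. inner_wt (f x) (g x) (h x)) \<in> borel_measurable M"
  unfolding inner_wt_def by measurable

lemma mean_kernel_measurable [measurable (raw)]:
  assumes [measurable]: "f \<in> borel_measurable borel" "s \<in> borel_measurable M" "u \<in> borel_measurable M" "v \<in> borel_measurable M"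
  shows "(\<lambda>x. mean_kernel f (s x) (u x, v x)) \<in> borel_measurable M"
  unfolding mean_kernel_def by simp

lemma mean_kernel_measurable_z [measurable]:
  assumes [measurable]: "f \<in> borel_measurable borel"
  shows "mean_kernel f s \<in> borel_measurable (borel \<Otimes>\<^sub>M borel)"
  using mean_kernel_measurable[of f "\<lambda>_. s" "borel \<Otimes>\<^sub>M borel" fst snd] by simp

lemma mean_op_eq:
  assumes [measurable]: "f \<in> borel_measurable borel"
  shows "mean_op f s = (\<integral>\<^sup>+l. \<integral>\<^sup>+w. mean_kernel f s (w * (1 - l), w * (1 - l) + l) * ennreal (2 * (1 - l)) * indicator {0..1} w * indicator {0..<1} l \<partial>lborel \<partial>lborel)"
  unfolding mean_op_def by (rule nn_integral_uv_law) measurable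

lemma mean_op_measurable [measurable (raw)]:
  assumes [measurable]: "f \<in> borel_measurable borel" "s \<in> borel_measurable M"
  shows "(\<lambda>x. mean_op f (s x)) \<in> borel_measurable M"
  unfolding mean_op_eq[OF assms(1)] by measurable

text \<open>The image of the uniform law under the collapse: the two rescaled pieces outside the arc
  join at \<open>w\<close> to form \<open>{0..<1}\<close>, and the arc itself becomes an atom of
  mass \<open>l\<close> at \<open>w\<close>.\<close>

lemma nn_integral_outer_pos:
  assumes [measurable]: "f \<in> borel_measurable borel" and l: "0 < l" "l < 1" and w: "0 \<le> w" "w \<le> 1"
  shows "(\<integral>\<^sup>+s. f (outer_pos (w * (1 - l)) (w * (1 - l) + l) s) * indicator {0..<1} s \<partial>lborel) =
    ennreal (1 - l) * (\<integral>\<^sup>+y. f y * indicator {0..<1} y \<partial>lborel) + ennreal l * f w"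
proof -
  define a where "a = 1 - l"
  have a: "a > 0" "l = 1 - a" using l by (auto simp: a_def)
  let ?u = "w * a" and ?v = "w * a + l"
  have uv: "0 \<le> ?u" "?u < ?v" "?v \<le> 1" "1 - (?v - ?u) = a"
    using a w l mult_right_mono[OF w(2), of a] by auto
  have "(\<integral>\<^sup>+s. f (outer_pos ?u ?v s) * indicator {0..<1} s \<partial>lborel) =
    (\<integral>\<^sup>+s. f (s / a) * indicator {0..<?u} s + f w * indicator {?u..<?v} s + f ((s - l) / a) * indicator {?v..<1} s \<partial>lborel)"
    using uv a(1) l by (intro nn_integral_cong) (auto simp: outer_pos_def split: split_indicator)
  also have "\<dots> = (\<integral>\<^sup>+s. f (s / a) * indicator {0..<?u} s \<partial>lborel) + (\<integral>\<^sup>+s. f w * indicator {?u..<?v} s \<partial>lborel)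
     + (\<integral>\<^sup>+s. f ((s - l) / a) * indicator {?v..<1} s \<partial>lborel)"
    by (subst nn_integral_add, simp, simp)+ simp
  also have "(\<integral>\<^sup>+s. f w * indicator {?u..<?v} s \<partial>lborel) = ennreal l * f w"
    using uv by (subst nn_integral_cmult) (auto simp: mult.commute)
  also have "(\<integral>\<^sup>+s. f (s / a) * indicator {0..<?u} s \<partial>lborel) = ennreal a * (\<integral>\<^sup>+y. f y * indicator {0..<w} y \<partial>lborel)"
  proof -
    have "(\<integral>\<^sup>+s. f (s / a) * indicator {0..<?u} s \<partial>lborel) = ennreal a * (\<integral>\<^sup>+y. f ((a * y) / a) * indicator {0..<?u} (a * y) \<partial>lborel)"
      using a by (subst nn_integral_real_affine[where c = a and t = 0]) auto
    also have "(\<lambda>y. f ((a * y) / a) * indicator {0..<?u} (a * y)) = (\<lambda>y. f y * indicator {0..<w} y)"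
      using a by (auto simp: fun_eq_iff zero_le_mult_iff mult.commute split: split_indicator)
    finally show ?thesis .
  qed
  also have "(\<integral>\<^sup>+s. f ((s - l) / a) * indicator {?v..<1} s \<partial>lborel) = ennreal a * (\<integral>\<^sup>+y. f y * indicator {w..<1} y \<partial>lborel)"
  proof -
    have "(\<integral>\<^sup>+s. f ((s - l) / a) * indicator {?v..<1} s \<partial>lborel) = ennreal a * (\<integral>\<^sup>+y. f ((l + a * y - l) / a) * indicator {?v..<1} (l + a * y) \<partial>lborel)"
      using a by (subst nn_integral_real_affine[where c = a and t = l]) auto
    also have "(\<lambda>y. f ((l + a * y - l) / a) * indicator {?v..<1} (l + a * y)) = (\<lambda>y. f y * indicator {w..<1} y)"
    proof
      fix y
      have "?v \<le> l + a * y \<longleftrightarrow> w \<le> y" "l + a * y < 1 \<longleftrightarrow> y < 1" using a by (auto simp: mult.commute)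
      then show "f ((l + a * y - l) / a) * indicator {?v..<1} (l + a * y) = f y * indicator {w..<1} y"
        using a by (auto simp: indicator_def)
    qed
    finally show ?thesis .
  qed
  also have "ennreal a * (\<integral>\<^sup>+y. f y * indicator {0..<w} y \<partial>lborel) + ennreal l * f w + ennreal a * (\<integral>\<^sup>+y. f y * indicator {w..<1} y \<partial>lborel)
     = ennreal a * (\<integral>\<^sup>+y. f y * indicator {0..<w} y + f y * indicator {w..<1} y \<partial>lborel) + ennreal l * f w"
    by (subst nn_integral_add) (auto simp: distrib_left add_ac)
  also have "(\<integral>\<^sup>+y. f y * indicator {0..<w} y + f y * indicator {w..<1} y \<partial>lborel) = (\<integral>\<^sup>+y. f y * indicator {0..<1} y \<partial>lborel)"
    using w by (intro nn_integral_cong) (auto split: split_indicator)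
  finally show ?thesis by (simp add: a_def)
qed

lemma nn_integral_inner_pos:
  assumes [measurable]: "f \<in> borel_measurable borel" and l: "0 < l" "l < 1" and w: "0 \<le> w" "w \<le> 1"
  shows "(\<integral>\<^sup>+s. ennreal (inner_wt (w * (1 - l)) (w * (1 - l) + l) s) * f (inner_pos (w * (1 - l)) (w * (1 - l) + l) s) * indicator {0..<1} s \<partial>lborel) =
    ennreal (l powr lam_beta * l) * (\<integral>\<^sup>+y. f y * indicator {0..<1} y \<partial>lborel)"
proof -
  define u where "u = w * (1 - l)"
  have u: "0 \<le> u" "u + l \<le> 1"
    using w l mult_nonneg_nonneg[of "1 - w" "1 - l"] mult_nonneg_nonneg[of w "1 - l"] by (simp_all add: u_def algebra_simps)
  have "(\<integral>\<^sup>+s. ennreal (inner_wt u (u + l) s) * f (inner_pos u (u + l) s) * indicator {0..<1} s \<partial>lborel) =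
    (\<integral>\<^sup>+s. ennreal (l powr lam_beta) * (f ((s - u) / l) * indicator {u..<u + l} s) \<partial>lborel)"
    using u by (intro nn_integral_cong) (auto simp: inner_wt_def inner_pos_def split: split_indicator)
  also have "\<dots> = ennreal (l powr lam_beta) * (\<integral>\<^sup>+s. f ((s - u) / l) * indicator {u..<u + l} s \<partial>lborel)"
    by (subst nn_integral_cmult) auto
  also have "(\<integral>\<^sup>+s. f ((s - u) / l) * indicator {u..<u + l} s \<partial>lborel) = ennreal l * (\<integral>\<^sup>+y. f ((u + l * y - u) / l) * indicator {u..<u + l} (u + l * y) \<partial>lborel)"
    using l by (subst nn_integral_real_affine[where c = l and t = u]) auto
  also have "(\<lambda>y. f ((u + l * y - u) / l) * indicator {u..<u + l} (u + l * y)) = (\<lambda>y. f y * indicator {0..<1} y)"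
    using l by (auto simp: fun_eq_iff zero_le_mult_iff split: split_indicator)
  finally show ?thesis using l by (simp add: u_def ennreal_mult mult.assoc)
qed

text \<open>Averaging the atom \<open>f w\<close> over the uniform \<open>w\<close> returns the
  total mass, so only the scalar \<open>r l\<close> survives. Its mean
  \<open>(2 * lam_beta + 8) / ((lam_beta + 2) * (lam_beta + 3))\<close> equals 1 by
  \<open>lam_beta_root\<close>.\<close>

lemma nn_integral_mean_op:
  assumes [measurable]: "f \<in> borel_measurable borel"
  shows "(\<integral>\<^sup>+s. mean_op f s * indicator {0..<1} s \<partial>lborel) = (\<integral>\<^sup>+s. f s * indicator {0..<1} s \<partial>lborel)" (is "_ = ?I")
proof -
  define r where "r l = (1 - l) powr lam_beta + l powr lam_beta * l" for l
  have [measurable]: "r \<in> borel_measurable borel" unfolding r_def by measurable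
  have r0: "r l \<ge> 0" if "0 \<le> l" for l using that by (simp add: r_def)
  have ri: "((\<lambda>l. r l * (2 * (1 - l))) has_integral 1) {0..1}"
  proof -
    have b: "lam_beta > 0" by (rule lam_beta_pos)
    have 1: "((\<lambda>x. 2 * x powr (lam_beta + 1)) has_integral 2 * (1 / (lam_beta + 1 + 1))) {0..1::real}"
      using b by (intro has_integral_mult_right powr_has_integral_01) auto
    have "((\<lambda>x. 2 * x powr (lam_beta + 1) - 2 * x powr (lam_beta + 2)) has_integral 2 * (1 / (lam_beta + 1 + 1)) - 2 * (1 / (lam_beta + 2 + 1))) {0..1::real}"
      using b by (intro has_integral_diff has_integral_mult_right powr_has_integral_01) auto
    from has_integral_add[OF has_integral_reflect_01[OF 1] this]
    have "((\<lambda>x. 2 * (1 - x) powr (lam_beta + 1) + (2 * x powr (lam_beta + 1) - 2 * x powr (lam_beta + 2))) has_integral 1) {0..1::real}"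
    proof (rule has_integral_eq_rhs)
      show "1 = 2 * (1 / (lam_beta + 1 + 1)) + (2 * (1 / (lam_beta + 1 + 1)) - 2 * (1 / (lam_beta + 2 + 1)))"
      proof -
        have "2 * (1 / (lam_beta + 1 + 1)) + (2 * (1 / (lam_beta + 1 + 1)) - 2 * (1 / (lam_beta + 2 + 1))) = (2 * lam_beta + 8) / ((lam_beta + 2) * (lam_beta + 3))"
          using b by (simp add: divide_simps) (simp add: algebra_simps)
        moreover have "(lam_beta + 2) * (lam_beta + 3) = 2 * lam_beta + 8"
          using lam_beta_root by (simp add: algebra_simps power2_eq_square)
        ultimately show ?thesis using b by simp
      qed
    qed
    then show ?thesis
    proof (rule has_integral_eq[rotated])
      fix x :: real assume x: "x \<in> {0..1}"
      have "x powr (lam_beta + 2) = x powr lam_beta * x * x"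
        using x by (simp add: powr_add mult.assoc flip: power2_eq_square)
      then show "2 * (1 - x) powr (lam_beta + 1) + (2 * x powr (lam_beta + 1) - 2 * x powr (lam_beta + 2)) = r x * (2 * (1 - x))"
        using x by (simp add: r_def powr_add algebra_simps power2_eq_square)
    qed
  qed
  have "(\<integral>\<^sup>+s. mean_op f s * indicator {0..<1} s \<partial>lborel) =
    (\<integral>\<^sup>+s. \<integral>\<^sup>+l. \<integral>\<^sup>+w. mean_kernel f s (w * (1 - l), w * (1 - l) + l) * ennreal (2 * (1 - l)) * indicator {0..1} w * indicator {0..<1} l * indicator {0..<1} s \<partial>lborel \<partial>lborel \<partial>lborel)"
    unfolding mean_op_eq[OF assms] by (simp add: nn_integral_multc)
  also have "\<dots> = (\<integral>\<^sup>+l. \<integral>\<^sup>+s. \<integral>\<^sup>+w. mean_kernel f s (w * (1 - l), w * (1 - l) + l) * ennreal (2 * (1 - l)) * indicator {0..1} w * indicator {0..<1} l * indicator {0..<1} s \<partial>lborel \<partial>lborel \<partial>lborel)"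
    by (rule lborel_pair.Fubini') measurable
  also have "\<dots> = (\<integral>\<^sup>+l. \<integral>\<^sup>+w. \<integral>\<^sup>+s. mean_kernel f s (w * (1 - l), w * (1 - l) + l) * ennreal (2 * (1 - l)) * indicator {0..1} w * indicator {0..<1} l * indicator {0..<1} s \<partial>lborel \<partial>lborel \<partial>lborel)"
    by (intro nn_integral_cong lborel_pair.Fubini') measurable
  also have "\<dots> = (\<integral>\<^sup>+l. ennreal (r l * (2 * (1 - l))) * indicator {0..1} l * ?I \<partial>lborel)"
  proof (rule nn_integral_cong_AE, rule eventually_mono[OF eventually_conj[OF AE_lborel_singleton[of 0] AE_lborel_singleton[of 1]]])
    fix l :: real assume l01: "l \<noteq> 0 \<and> l \<noteq> 1"
    show "(\<integral>\<^sup>+w. \<integral>\<^sup>+s. mean_kernel f s (w * (1 - l), w * (1 - l) + l) * ennreal (2 * (1 - l)) * indicator {0..1} w * indicator {0..<1} l * indicator {0..<1} s \<partial>lborel \<partial>lborel)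
       = ennreal (r l * (2 * (1 - l))) * indicator {0..1} l * ?I"
    proof (cases "0 < l \<and> l < 1")
      case True
      then have l: "0 < l" "l < 1" by auto
      let ?D = "ennreal (2 * (1 - l))"
      let ?A = "ennreal ((1 - l) powr lam_beta)"
      have "(\<integral>\<^sup>+w. \<integral>\<^sup>+s. mean_kernel f s (w * (1 - l), w * (1 - l) + l) * ?D * indicator {0..1} w * indicator {0..<1} l * indicator {0..<1} s \<partial>lborel \<partial>lborel)
        = (\<integral>\<^sup>+w. ?D * ((?A * (ennreal (1 - l) * ?I + ennreal l * f w) + ennreal (l powr lam_beta * l) * ?I) * indicator {0..1} w) \<partial>lborel)"
      proof (rule nn_integral_cong)
        fix w :: real
        show "(\<integral>\<^sup>+s. mean_kernel f s (w * (1 - l), w * (1 - l) + l) * ?D * indicator {0..1} w * indicator {0..<1} l * indicator {0..<1} s \<partial>lborel)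
          = ?D * ((?A * (ennreal (1 - l) * ?I + ennreal l * f w) + ennreal (l powr lam_beta * l) * ?I) * indicator {0..1} w)"
        proof (cases "0 \<le> w \<and> w \<le> 1")
          case True
          have "(\<integral>\<^sup>+s. mean_kernel f s (w * (1 - l), w * (1 - l) + l) * ?D * indicator {0..1} w * indicator {0..<1} l * indicator {0..<1} s \<partial>lborel) =
            (\<integral>\<^sup>+s. ?D * (?A * (f (outer_pos (w * (1 - l)) (w * (1 - l) + l) s) * indicator {0..<1} s)
               + (ennreal (inner_wt (w * (1 - l)) (w * (1 - l) + l) s) * f (inner_pos (w * (1 - l)) (w * (1 - l) + l) s) * indicator {0..<1} s)) \<partial>lborel)"
            using True l by (intro nn_integral_cong) (auto simp: mean_kernel_def mult.commute split: split_indicator)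
          also have "\<dots> = ?D * (?A * (\<integral>\<^sup>+s. f (outer_pos (w * (1 - l)) (w * (1 - l) + l) s) * indicator {0..<1} s \<partial>lborel)
             + (\<integral>\<^sup>+s. ennreal (inner_wt (w * (1 - l)) (w * (1 - l) + l) s) * f (inner_pos (w * (1 - l)) (w * (1 - l) + l) s) * indicator {0..<1} s \<partial>lborel))"
            by (subst nn_integral_cmult, simp, subst nn_integral_add, simp, simp, subst nn_integral_cmult, simp_all)
          also have "\<dots> = ?D * (?A * (ennreal (1 - l) * ?I + ennreal l * f w) + ennreal (l powr lam_beta * l) * ?I)"
            using True by (simp only: nn_integral_outer_pos[OF assms l] nn_integral_inner_pos[OF assms l])
          finally show ?thesis using True by simp
        qed auto
      qed
      also have "\<dots> = ?D * (\<integral>\<^sup>+w. (?A * ennreal (1 - l) * ?I + ennreal (l powr lam_beta * l) * ?I) * indicator {0..1} w + ?A * ennreal l * (f w * indicator {0..1} w) \<partial>lborel)"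
        by (subst nn_integral_cmult, simp) (intro arg_cong2[where f = "(*)"] refl nn_integral_cong, simp add: algebra_simps)
      also have "\<dots> = ?D * ((?A * ennreal (1 - l) * ?I + ennreal (l powr lam_beta * l) * ?I) + ?A * ennreal l * (\<integral>\<^sup>+w. f w * indicator {0..1} w \<partial>lborel))"
        by (subst nn_integral_add, simp, simp, subst nn_integral_cmult, simp, subst nn_integral_cmult, simp_all)
      also have "(\<integral>\<^sup>+w. f w * indicator {0..1} w \<partial>lborel) = ?I"
        by (rule nn_integral_cong_AE, rule eventually_mono[OF AE_lborel_singleton[of 1]]) (auto split: split_indicator)
      also have "?D * ((?A * ennreal (1 - l) * ?I + ennreal (l powr lam_beta * l) * ?I) + ?A * ennreal l * ?I)
         = ?D * (?A * (ennreal (1 - l) + ennreal l) + ennreal (l powr lam_beta * l)) * ?I"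
        by (simp add: algebra_simps)
      also have "ennreal (1 - l) + ennreal l = 1" using l by (simp add: ennreal_plus[symmetric] del: ennreal_plus)
      also have "?D * (?A * 1 + ennreal (l powr lam_beta * l)) = ennreal (r l * (2 * (1 - l)))"
        using l by (simp add: r_def ennreal_plus[symmetric] ennreal_mult[symmetric] mult.commute del: ennreal_plus)
      finally show ?thesis using l by simp
    next
      case False
      then show ?thesis using l01 by (auto simp: indicator_def)
    qed
  qed
  also have "\<dots> = (\<integral>\<^sup>+l. ennreal (r l * (2 * (1 - l))) * indicator {0..1} l \<partial>lborel) * ?I"
    by (rule nn_integral_multc) simp
  also have "(\<integral>\<^sup>+l. ennreal (r l * (2 * (1 - l))) * indicator {0..1} l \<partial>lborel) = ennreal 1"
    by (rule nn_integral_Icc_01[OF _ ri]) (auto intro!: mult_nonneg_nonneg r0)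
  finally show ?thesis by simp
qed

text \<open>Arcs longer than both \<open>s\<close> and \<open>1 - s\<close> contain \<open>s\<close>
  wherever they lie, so \<open>s\<close> is collapsed to \<open>w\<close>, and \<open>w\<close> hits
  the interval where \<open>f\<close> is positive with positive probability.\<close>

lemma mean_op_pos:
  assumes [measurable]: "f \<in> borel_measurable borel" and w: "0 \<le> w1" "w1 < w2" "w2 \<le> 1"
    and f: "\<And>w. w1 < w \<Longrightarrow> w < w2 \<Longrightarrow> f w > 0" and s: "0 < s" "s < 1"
  shows "mean_op f s > 0"
proof (rule ccontr)
  assume "\<not> mean_op f s > 0"
  then have "mean_op f s = 0" by simp
  then have "(\<integral>\<^sup>+l. \<integral>\<^sup>+w. mean_kernel f s (w * (1 - l), w * (1 - l) + l) * ennreal (2 * (1 - l)) * indicator {0..1} w * indicator {0..<1} l \<partial>lborel \<partial>lborel) = 0"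
    unfolding mean_op_eq[OF assms(1)] .
  then have "AE l in lborel. (\<integral>\<^sup>+w. mean_kernel f s (w * (1 - l), w * (1 - l) + l) * ennreal (2 * (1 - l)) * indicator {0..1} w * indicator {0..<1} l \<partial>lborel) = 0"
    by (subst (asm) nn_integral_0_iff_AE) simp_all
  then obtain N where N: "N \<in> null_sets lborel"
    "{l. (\<integral>\<^sup>+w. mean_kernel f s (w * (1 - l), w * (1 - l) + l) * ennreal (2 * (1 - l)) * indicator {0..1} w * indicator {0..<1} l \<partial>lborel) \<noteq> 0} \<subseteq> N"
    by (auto elim!: AE_E simp: null_sets_def)
  define l0 where "l0 = max s (1 - s)"
  have l0: "l0 < 1" "l0 > 0" using s by (auto simp: l0_def)
  have "\<not> {l0<..<1} \<subseteq> N"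
  proof
    assume "{l0<..<1} \<subseteq> N"
    then have "emeasure lborel {l0<..<1} \<le> emeasure lborel N" using N(1) by (intro emeasure_mono) auto
    then show False using N(1) l0 by (auto simp: null_sets_def)
  qed
  then obtain l where "l \<in> {l0<..<1}" and lN: "l \<notin> N" by blast
  then have l: "l0 < l" "l < 1" by auto
  then have "(\<integral>\<^sup>+w. mean_kernel f s (w * (1 - l), w * (1 - l) + l) * ennreal (2 * (1 - l)) * indicator {0..1} w * indicator {0..<1} l \<partial>lborel) = 0"
    using N(2) lN by blast
  then have "AE w in lborel. mean_kernel f s (w * (1 - l), w * (1 - l) + l) * ennreal (2 * (1 - l)) * indicator {0..1} w * indicator {0..<1} l = 0"
    by (subst (asm) nn_integral_0_iff_AE) simp_all
  then obtain N2 where N2: "N2 \<in> null_sets lborel"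
    "{w. mean_kernel f s (w * (1 - l), w * (1 - l) + l) * ennreal (2 * (1 - l)) * indicator {0..1} w * indicator {0..<1} l \<noteq> 0} \<subseteq> N2"
    by (auto elim!: AE_E simp: null_sets_def)
  have "\<not> {w1<..<w2} \<subseteq> N2"
  proof
    assume "{w1<..<w2} \<subseteq> N2"
    then have "emeasure lborel {w1<..<w2} \<le> emeasure lborel N2" using N2(1) by (intro emeasure_mono) auto
    then show False using N2(1) w by (auto simp: null_sets_def)
  qed
  then obtain x where "x \<in> {w1<..<w2}" and xN: "x \<notin> N2" by blast
  then have x: "w1 < x" "x < w2" by auto
  have z: "mean_kernel f s (x * (1 - l), x * (1 - l) + l) * ennreal (2 * (1 - l)) * indicator {0..1} x * indicator {0..<1} l = 0"
    using N2(2) xN by blast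
  have x01: "0 < x" "x < 1" using x w by auto
  have l01: "0 < l" "l < 1" using l l0 by auto
  have l1: "s < l" "1 - s < l" using l by (auto simp: l0_def)
  have u: "x * (1 - l) \<le> s"
    using mult_nonneg_nonneg[of "1 - x" "1 - l"] x01 l01 l1 by (simp add: algebra_simps)
  have v: "s < x * (1 - l) + l"
  proof -
    have "0 \<le> x * (1 - l)" using x01 l01 by simp
    with l1 show ?thesis by linarith
  qed
  have "outer_pos (x * (1 - l)) (x * (1 - l) + l) s = x"
    using u v l01 by (simp add: outer_pos_def)
  then have "mean_kernel f s (x * (1 - l), x * (1 - l) + l) > 0"
    unfolding mean_kernel_def using f[OF x(1,2)] l01 by (simp add: ennreal_zero_less_mult_iff add_pos_nonneg)
  with z x01 l01 show False by (auto simp: ennreal_zero_less_mult_iff)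
qed

text \<open>The derivative may be unbounded at the ends, as happens for powers with exponent below
  1; only the primitive has to be continuous up to the ends.\<close>

lemma nn_integral_FTC_Ioo:
  fixes F f :: "real \<Rightarrow> real"
  assumes b: "0 \<le> b" and F: "continuous_on {0..b} F"
    and F': "\<And>x. 0 < x \<Longrightarrow> x < b \<Longrightarrow> (F has_real_derivative f x) (at x)"
    and f: "\<And>x. 0 < x \<Longrightarrow> x < b \<Longrightarrow> f x \<ge> 0" and [measurable]: "f \<in> borel_measurable borel"
  shows "(\<integral>\<^sup>+x. ennreal (f x) * indicator {0<..<b} x \<partial>lborel) = ennreal (F b - F 0)"
proof -
  have "(f has_integral (F b - F 0)) {0..b}"
    by (rule fundamental_theorem_of_calculus_interior[OF b F])
       (use F' in \<open>auto simp: has_real_derivative_iff_has_vector_derivative[symmetric]\<close>)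
  then have "(f has_integral (F b - F 0)) {0<..<b}" by (simp add: has_integral_Icc_iff_Ioo)
  then have "((\<lambda>x. if x \<in> {0<..<b} then f x else 0) has_integral (F b - F 0)) UNIV"
    by (simp only: has_integral_restrict_UNIV)
  then have "((\<lambda>x. f x * indicator {0<..<b} x) has_integral (F b - F 0)) UNIV"
    by (rule has_integral_eq[rotated]) auto
  then have "(\<integral>\<^sup>+x. ennreal (f x * indicator {0<..<b} x) \<partial>lborel) = ennreal (F b - F 0)"
    by (intro nn_integral_has_integral_lborel) (use f in \<open>auto split: split_indicator\<close>)
  then show ?thesis
    by (simp add: indicator_def of_bool_def if_distrib[of "\<lambda>x. _ * x"] if_distrib[of ennreal] cong: if_cong)
qed

section \<open>The explicit fixed point of the mean operator\<close>

text \<open>\<open>x * y / (x + y)\<close> is the resistance of two resistors in parallel. By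
  \<open>powr_mult_bump\<close>, \<open>par x y\<close> is the profile \<open>bump\<close>
  transported to an interval of length \<open>x + y\<close>, scaled by that length to the power
  \<open>lam_beta\<close> and read off at distances \<open>x\<close> and \<open>y\<close> from the
  ends.\<close>

definition par :: "real \<Rightarrow> real \<Rightarrow> real" where
  "par x y = (x * y / (x + y)) powr lam_beta"

text \<open>The mixed second derivative of \<open>par_prim\<close>, brought into the form of a
  multiple of \<open>par\<close>.\<close>

definition par_density :: "real \<Rightarrow> real \<Rightarrow> real" where
  "par_density x y = par x y * (2 * lam_beta * (x + y)\<^sup>2 / (x * y) + (2 - lam_beta) * (1 - lam_beta))"

text \<open>Chosen to reduce to \<open>bump a\<close> when \<open>a + b = 1\<close>; the power of
  \<open>x + y\<close> makes it homogeneous of degree \<open>lam_beta + 2\<close>, like the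
  integrals in \<open>par_identity\<close>.\<close>

definition par_prim :: "real \<Rightarrow> real \<Rightarrow> real" where
  "par_prim x y = (x * y) powr lam_beta * (x + y) powr (2 - lam_beta)"

definition par_prim_x :: "real \<Rightarrow> real \<Rightarrow> real" where
  "par_prim_x x y = (x * y) powr lam_beta * (lam_beta / x * (x + y) powr (2 - lam_beta) + (2 - lam_beta) * (x + y) powr (1 - lam_beta))"

lemma par_eq: "x > 0 \<Longrightarrow> y > 0 \<Longrightarrow> par x y = (x * y) powr lam_beta * (x + y) powr (- lam_beta)"
  by (simp add: par_def powr_divide powr_minus_divide)

lemma par_commute: "par x y = par y x" by (simp add: par_def mult.commute add.commute)

lemma par_nonneg: "par x y \<ge> 0" by (simp add: par_def)

lemma par_measurable [measurable]: "(\<lambda>z. par (fst z) (snd z)) \<in> borel_measurable (borel \<Otimes>\<^sub>M borel)"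
  unfolding par_def by measurable

lemma par_measurable2 [measurable (raw)]:
  assumes [measurable]: "f \<in> borel_measurable M" "g \<in> borel_measurable M"
  shows "(\<lambda>z. par (f z) (g z)) \<in> borel_measurable M"
  unfolding par_def by measurable

lemma par_density_nonneg: "x > 0 \<Longrightarrow> y > 0 \<Longrightarrow> par_density x y \<ge> 0"
  unfolding par_density_def using lam_beta_pos lam_beta_less_1
  by (intro mult_nonneg_nonneg par_nonneg add_nonneg_nonneg divide_nonneg_nonneg) auto

lemma par_density_measurable [measurable (raw)]:
  assumes [measurable]: "f \<in> borel_measurable M" "g \<in> borel_measurable M"
  shows "(\<lambda>z. par_density (f z) (g z)) \<in> borel_measurable M"
  unfolding par_density_def by measurable

lemma par_prim_x_measurable [measurable (raw)]:
  assumes [measurable]: "f \<in> borel_measurable M" "g \<in> borel_measurable M"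
  shows "(\<lambda>z. par_prim_x (f z) (g z)) \<in> borel_measurable M"
  unfolding par_prim_x_def by measurable

lemma par_prim_has_derivative:
  assumes "x > 0" "y > 0"
  shows "((\<lambda>x. par_prim x y) has_real_derivative par_prim_x x y) (at x)"
proof -
  have xy: "x * y > 0" "x + y > 0" using assms by auto
  have 1: "((\<lambda>x. (x * y) powr lam_beta) has_real_derivative lam_beta * (x * y) powr (lam_beta - 1) * y) (at x)"
    by (rule DERIV_fun_powr[where r = lam_beta, THEN DERIV_cong]) (use xy in \<open>auto intro!: derivative_eq_intros\<close>)
  have 2: "((\<lambda>x. (x + y) powr (2 - lam_beta)) has_real_derivative (2 - lam_beta) * (x + y) powr (2 - lam_beta - 1)) (at x)"
    by (rule DERIV_fun_powr[where r = "2 - lam_beta", THEN DERIV_cong]) (use xy in \<open>auto intro!: derivative_eq_intros\<close>)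
  have e1: "(x * y) powr (lam_beta - 1) * y = (x * y) powr lam_beta / x"
    using assms xy by (simp add: powr_diff)
  have e2: "2 - lam_beta - 1 = 1 - lam_beta" by simp
  show ?thesis unfolding par_prim_def par_prim_x_def
    by (rule DERIV_mult[OF 1 2, THEN DERIV_cong]) (use e1 e2 in \<open>simp add: algebra_simps\<close>)
qed

lemma par_prim_x_has_derivative:
  assumes "x > 0" "y > 0"
  shows "((\<lambda>y. par_prim_x x y) has_real_derivative par_density x y) (at y)"
proof -
  have xy: "x * y > 0" "x + y > 0" using assms by auto
  let ?b = lam_beta
  define S where "S = x + y"
  define Z where "Z = (x * y) powr ?b"
  define R where "R = S powr (- ?b)"
  have S: "S > 0" using xy by (simp add: S_def)
  have p: "S powr (2 - ?b) = R * S\<^sup>2" "S powr (1 - ?b) = R * S"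
    using S unfolding R_def
    by (simp_all add: powr_diff powr_minus_divide powr_numeral)
  have 1: "((\<lambda>y. (x * y) powr ?b) has_real_derivative ?b * Z / y) (at y)"
  proof (rule DERIV_fun_powr[where r = ?b, THEN DERIV_cong])
    show "((*) x has_real_derivative x) (at y)" by (auto intro!: derivative_eq_intros)
    show "0 < x * y" by fact
    show "?b * (x * y) powr (?b - real 1) * x = ?b * Z / y" using assms xy by (simp add: powr_diff Z_def)
  qed
  have 2: "((\<lambda>y. (x + y) powr (2 - ?b)) has_real_derivative (2 - ?b) * (R * S)) (at y)"
  proof (rule DERIV_fun_powr[where r = "2 - ?b", THEN DERIV_cong])
    show "((+) x has_real_derivative 1) (at y)" by (auto intro!: derivative_eq_intros)
    show "0 < x + y" by fact
    have "2 - ?b - 1 = 1 - ?b" by simp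
    then show "(2 - ?b) * (x + y) powr (2 - ?b - real 1) * 1 = (2 - ?b) * (R * S)"
      using p by (simp add: S_def)
  qed
  have 3: "((\<lambda>y. (x + y) powr (1 - ?b)) has_real_derivative (1 - ?b) * R) (at y)"
  proof (rule DERIV_fun_powr[where r = "1 - ?b", THEN DERIV_cong])
    show "((+) x has_real_derivative 1) (at y)" by (auto intro!: derivative_eq_intros)
    show "0 < x + y" by fact
    have "1 - ?b - 1 = - ?b" by simp
    then show "(1 - ?b) * (x + y) powr (1 - ?b - real 1) * 1 = (1 - ?b) * R"
      by (simp add: R_def S_def)
  qed
  have "((\<lambda>y. par_prim_x x y) has_real_derivative
      ?b * Z / y * (?b / x * (x + y) powr (2 - ?b) + (2 - ?b) * (x + y) powr (1 - ?b))
      + (?b / x * ((2 - ?b) * (R * S)) + (2 - ?b) * ((1 - ?b) * R)) * (x * y) powr ?b) (at y)"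
    unfolding par_prim_x_def
    by (intro DERIV_mult DERIV_add DERIV_cmult 1 2 3)
  moreover have "?b * Z / y * (?b / x * (x + y) powr (2 - ?b) + (2 - ?b) * (x + y) powr (1 - ?b))
      + (?b / x * ((2 - ?b) * (R * S)) + (2 - ?b) * ((1 - ?b) * R)) * (x * y) powr ?b = par_density x y"
  proof -
    have "par_density x y = Z * R * (2 * ?b * S\<^sup>2 / (x * y) + (2 - ?b) * (1 - ?b))"
      unfolding par_density_def par_eq[OF assms] by (simp add: Z_def R_def S_def)
    moreover have "?b * Z / y * (?b / x * (R * S\<^sup>2) + (2 - ?b) * (R * S)) + (?b / x * ((2 - ?b) * (R * S)) + (2 - ?b) * ((1 - ?b) * R)) * Z
       = Z * R * (?b\<^sup>2 * S\<^sup>2 / (x * y) + ?b * (2 - ?b) * S * (1 / y + 1 / x) + (2 - ?b) * (1 - ?b))"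
      using assms by (simp add: field_simps power2_eq_square)
    moreover have "1 / y + 1 / x = S / (x * y)" using assms by (simp add: S_def field_simps)
    moreover have "?b\<^sup>2 * S\<^sup>2 / (x * y) + ?b * (2 - ?b) * S * (S / (x * y)) = 2 * ?b * S\<^sup>2 / (x * y)"
      using assms by (simp add: field_simps power2_eq_square)
    ultimately show ?thesis using p by (simp only: S_def[symmetric] Z_def[symmetric])
  qed
  ultimately show ?thesis by simp
qed

lemma par_has_derivative:
  assumes "x > 0" "y > 0"
  shows "((\<lambda>x. par x y) has_real_derivative par x y * (lam_beta * y / (x * (x + y)))) (at x)"
proof -
  have xy: "x * y / (x + y) > 0" "x + y > 0" using assms by auto
  show ?thesis unfolding par_def
  proof (rule DERIV_fun_powr[where r = lam_beta, THEN DERIV_cong])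
    show "((\<lambda>x. x * y / (x + y)) has_real_derivative y\<^sup>2 / (x + y)\<^sup>2) (at x)"
      using xy by (auto intro!: derivative_eq_intros simp: power2_eq_square field_simps)
    show "0 < x * y / (x + y)" by fact
    show "lam_beta * (x * y / (x + y)) powr (lam_beta - real 1) * (y\<^sup>2 / (x + y)\<^sup>2) = (x * y / (x + y)) powr lam_beta * (lam_beta * y / (x * (x + y)))"
    proof -
      have "(y\<^sup>2 / (x + y)\<^sup>2) / (x * y / (x + y)) = y / (x * (x + y))"
        using assms by (simp add: power2_eq_square divide_simps)
      moreover have "lam_beta * q powr (lam_beta - real 1) * r = lam_beta * q powr lam_beta * (r / q)" if "q > 0" for q r :: real
        using that by (simp add: powr_diff)
      from this[OF xy(1)] have "lam_beta * (x * y / (x + y)) powr (lam_beta - real 1) * (y\<^sup>2 / (x + y)\<^sup>2) =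
          lam_beta * (x * y / (x + y)) powr lam_beta * ((y\<^sup>2 / (x + y)\<^sup>2) / (x * y / (x + y)))" .
      ultimately show ?thesis by simp
    qed
  qed
qed

text \<open>The fundamental theorem applied in each variable in turn; the primitives vanish on the
  axes.\<close>

lemma nn_integral_par_density:
  assumes a: "a > 0" and b: "b > 0"
  shows "(\<integral>\<^sup>+x. \<integral>\<^sup>+y. ennreal (par_density x y) * indicator {0<..<a} x * indicator {0<..<b} y \<partial>lborel \<partial>lborel) = ennreal (par_prim a b)"
proof -
  have "(\<integral>\<^sup>+x. \<integral>\<^sup>+y. ennreal (par_density x y) * indicator {0<..<a} x * indicator {0<..<b} y \<partial>lborel \<partial>lborel)
      = (\<integral>\<^sup>+x. ennreal (par_prim_x x b) * indicator {0<..<a} x \<partial>lborel)"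
  proof (rule nn_integral_cong)
    fix x :: real
    show "(\<integral>\<^sup>+y. ennreal (par_density x y) * indicator {0<..<a} x * indicator {0<..<b} y \<partial>lborel) = ennreal (par_prim_x x b) * indicator {0<..<a} x"
    proof (cases "x \<in> {0<..<a}")
      case True
      have "(\<integral>\<^sup>+y. ennreal (par_density x y) * indicator {0<..<b} y \<partial>lborel) = ennreal (par_prim_x x b - par_prim_x x 0)"
      proof (rule nn_integral_FTC_Ioo)
        show "continuous_on {0..b} (par_prim_x x)"
          unfolding par_prim_x_def using True lam_beta_pos lam_beta_less_1
          by (intro continuous_intros continuous_on_powr') auto
      qed (use True b par_prim_x_has_derivative par_density_nonneg in auto)
      then show ?thesis using True by (simp add: par_prim_x_def)
    qed auto
  qed
  also have "\<dots> = ennreal (par_prim a b - par_prim 0 b)"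
  proof (rule nn_integral_FTC_Ioo)
    show "continuous_on {0..a} (\<lambda>x. par_prim x b)"
      unfolding par_prim_def using b lam_beta_pos lam_beta_less_1
      by (intro continuous_intros continuous_on_powr') auto
    show "par_prim_x x b \<ge> 0" if "0 < x" for x unfolding par_prim_x_def using that b lam_beta_pos lam_beta_less_1
      by (intro mult_nonneg_nonneg add_nonneg_nonneg divide_nonneg_nonneg) auto
  qed (use a b par_prim_has_derivative in auto)
  finally show ?thesis by (simp add: par_prim_def)
qed

text \<open>The one-dimensional terms of \<open>par_identity\<close> are rewritten as integrals over
  \<open>x\<close>, so that all its terms become double integrals over one rectangle.\<close>

lemma nn_integral_par_edge:
  assumes a: "a > 0" and t: "t > 0"
  shows "ennreal (t * par a t) = (\<integral>\<^sup>+x. ennreal (par x t * (lam_beta * t\<^sup>2 / (x * (x + t)))) * indicator {0<..<a} x \<partial>lborel)"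
proof -
  have "(\<integral>\<^sup>+x. ennreal (par x t * (lam_beta * t\<^sup>2 / (x * (x + t)))) * indicator {0<..<a} x \<partial>lborel) = ennreal (t * par a t - t * par 0 t)"
  proof (rule nn_integral_FTC_Ioo)
    show "continuous_on {0..a} (\<lambda>x. t * par x t)"
      unfolding par_def using t lam_beta_pos
      by (intro continuous_intros continuous_on_powr') (auto simp: add_nonneg_eq_0_iff)
    show "((\<lambda>x. t * par x t) has_real_derivative par x t * (lam_beta * t\<^sup>2 / (x * (x + t)))) (at x)" if "0 < x" for x
      by (rule DERIV_cmult[OF par_has_derivative[OF that t], THEN DERIV_cong]) (simp add: power2_eq_square)
    show "par x t * (lam_beta * t\<^sup>2 / (x * (x + t))) \<ge> 0" if "0 < x" for x
      using that t lam_beta_pos by (intro mult_nonneg_nonneg divide_nonneg_nonneg par_nonneg) auto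
  qed (use a in auto)
  then show ?thesis by (simp add: par_def)
qed

text \<open>Both sides are integrals of their mixed second derivatives; these agree because
  \<open>lam_beta\<close> is a root of \<open>\<beta>\<^sup>2 + 3 \<beta> - 2\<close>.\<close>

lemma par_identity:
  assumes a: "a > 0" and b: "b > 0"
  shows "2 * (\<integral>\<^sup>+t. ennreal (t * par a t) * indicator {0<..<b} t \<partial>lborel)
       + 2 * (\<integral>\<^sup>+t. ennreal (t * par b t) * indicator {0<..<a} t \<partial>lborel)
       + 4 * (\<integral>\<^sup>+x. \<integral>\<^sup>+y. ennreal (par x y) * indicator {0<..<a} x * indicator {0<..<b} y \<partial>lborel \<partial>lborel)
      = ennreal (par_prim a b)"
proof -
  let ?I = "\<lambda>x y. indicator {0<..<a} x * indicator {0<..<b} y :: ennreal"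
  let ?e = "\<lambda>x t. par x t * (lam_beta * t\<^sup>2 / (x * (x + t)))"
  have 1: "(\<integral>\<^sup>+t. ennreal (t * par a t) * indicator {0<..<b} t \<partial>lborel) = (\<integral>\<^sup>+x. \<integral>\<^sup>+y. ennreal (?e x y) * ?I x y \<partial>lborel \<partial>lborel)"
  proof -
    have "(\<integral>\<^sup>+t. ennreal (t * par a t) * indicator {0<..<b} t \<partial>lborel) = (\<integral>\<^sup>+y. \<integral>\<^sup>+x. ennreal (?e x y) * ?I x y \<partial>lborel \<partial>lborel)"
    proof (rule nn_integral_cong)
      fix t :: real
      show "ennreal (t * par a t) * indicator {0<..<b} t = (\<integral>\<^sup>+x. ennreal (?e x t) * ?I x t \<partial>lborel)"
        using nn_integral_par_edge[OF a, of t] by (cases "t \<in> {0<..<b}") auto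
    qed
    also have "\<dots> = (\<integral>\<^sup>+x. \<integral>\<^sup>+y. ennreal (?e x y) * ?I x y \<partial>lborel \<partial>lborel)"
      by (rule lborel_pair.Fubini') measurable
    finally show ?thesis .
  qed
  have 2: "(\<integral>\<^sup>+t. ennreal (t * par b t) * indicator {0<..<a} t \<partial>lborel) = (\<integral>\<^sup>+x. \<integral>\<^sup>+y. ennreal (?e y x) * ?I x y \<partial>lborel \<partial>lborel)"
  proof (rule nn_integral_cong)
    fix t :: real
    show "ennreal (t * par b t) * indicator {0<..<a} t = (\<integral>\<^sup>+y. ennreal (?e y t) * ?I t y \<partial>lborel)"
      using nn_integral_par_edge[OF b, of t] by (cases "t \<in> {0<..<a}") auto
  qed
  have "2 * (\<integral>\<^sup>+t. ennreal (t * par a t) * indicator {0<..<b} t \<partial>lborel)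
       + 2 * (\<integral>\<^sup>+t. ennreal (t * par b t) * indicator {0<..<a} t \<partial>lborel)
       + 4 * (\<integral>\<^sup>+x. \<integral>\<^sup>+y. ennreal (par x y) * indicator {0<..<a} x * indicator {0<..<b} y \<partial>lborel \<partial>lborel) =
     (\<integral>\<^sup>+x. \<integral>\<^sup>+y. 2 * (ennreal (?e x y) * ?I x y) + 2 * (ennreal (?e y x) * ?I x y) + 4 * (ennreal (par x y) * ?I x y) \<partial>lborel \<partial>lborel)"
    unfolding 1 2 by (simp add: nn_integral_add nn_integral_cmult mult.assoc)
  also have "\<dots> = (\<integral>\<^sup>+x. \<integral>\<^sup>+y. ennreal (par_density x y) * indicator {0<..<a} x * indicator {0<..<b} y \<partial>lborel \<partial>lborel)"
  proof (intro nn_integral_cong)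
    fix x y :: real
    show "2 * (ennreal (?e x y) * ?I x y) + 2 * (ennreal (?e y x) * ?I x y) + 4 * (ennreal (par x y) * ?I x y)
      = ennreal (par_density x y) * indicator {0<..<a} x * indicator {0<..<b} y"
    proof (cases "x \<in> {0<..<a} \<and> y \<in> {0<..<b}")
      case True
      then have xy: "x > 0" "y > 0" by auto
      \<comment> \<open>The coefficient left over once the terms in
        \<open>(x + y)\<^sup>2 / (x * y)\<close> are collected; this equality is the quadratic for
        \<open>lam_beta\<close>.\<close>
      have c: "4 - 6 * lam_beta = (2 - lam_beta) * (1 - lam_beta)"
        using lam_beta_root by (simp add: algebra_simps power2_eq_square)
      have e: "ennreal (2 * p + 2 * q + 4 * r) = 2 * ennreal p + 2 * ennreal q + 4 * ennreal r"
        if "p \<ge> 0" "q \<ge> 0" "r \<ge> 0" for p q r using that by (simp add: ennreal_mult)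
      have nn: "?e x y \<ge> 0" "?e y x \<ge> 0"
        using xy lam_beta_pos by (auto intro!: mult_nonneg_nonneg divide_nonneg_nonneg par_nonneg)
      have "2 * ?e x y + 2 * ?e y x + 4 * par x y = par x y * (2 * lam_beta * ((y\<^sup>2 / (x * (x + y))) + (x\<^sup>2 / (y * (x + y)))) + 4)"
        unfolding par_commute[of y x] by (simp add: algebra_simps)
      also have "y\<^sup>2 / (x * (x + y)) + x\<^sup>2 / (y * (x + y)) = (x\<^sup>2 - x * y + y\<^sup>2) / (x * y)"
        using xy by (simp add: divide_simps) (simp add: algebra_simps power2_eq_square power3_eq_cube)
      also have "2 * lam_beta * ((x\<^sup>2 - x * y + y\<^sup>2) / (x * y)) + 4 = 2 * lam_beta * (x + y)\<^sup>2 / (x * y) + (4 - 6 * lam_beta)"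
        using xy by (simp add: divide_simps) (simp add: algebra_simps power2_eq_square)
      finally have "2 * ?e x y + 2 * ?e y x + 4 * par x y = par_density x y" unfolding c par_density_def .
      then have "ennreal (par_density x y) = 2 * ennreal (?e x y) + 2 * ennreal (?e y x) + 4 * ennreal (par x y)"
        using e[OF nn par_nonneg[of x y]] by simp
      then show ?thesis using True by simp
    qed auto
  qed
  also have "\<dots> = ennreal (par_prim a b)" by (rule nn_integral_par_density[OF a b])
  finally show ?thesis .
qed

definition bump :: "real \<Rightarrow> real" where "bump y = (y * (1 - y)) powr lam_beta"

lemma bump_measurable [measurable]: "bump \<in> borel_measurable borel"
  unfolding bump_def by measurable

lemma powr_mult_bump:
  assumes "0 < c" "0 \<le> x" "0 \<le> y" "x + y = c"
  shows "c powr lam_beta * bump (x / c) = par x y"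
proof -
  have "1 - x / c = y / c" using assms by (simp add: field_simps)
  then have "c powr lam_beta * bump (x / c) = (c * (x / c * (y / c))) powr lam_beta"
    unfolding bump_def using assms by (subst powr_mult) auto
  also have "c * (x / c * (y / c)) = x * y / (x + y)" using assms by simp
  finally show ?thesis by (simp add: par_def)
qed

lemma par_zero [simp]: "par 0 y = 0" "par x 0 = 0"
  by (simp_all add: par_def)

lemma AE_lborel_neq2: "AE x in lborel. x \<noteq> (a::real) \<and> x \<noteq> b"
  using AE_lborel_singleton[of a] AE_lborel_singleton[of b] by eventually_elim auto

lemma nn_integral_shift_reflect:
  assumes [measurable]: "g \<in> borel_measurable borel"
  shows "(\<integral>\<^sup>+x. g (c - x) \<partial>lborel) = (\<integral>\<^sup>+x. g x \<partial>(lborel :: real measure))"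
  using nn_integral_real_affine[of g "-1" c] by simp

lemma nn_integral_shift:
  assumes [measurable]: "g \<in> borel_measurable borel"
  shows "(\<integral>\<^sup>+x. g (c + x) \<partial>lborel) = (\<integral>\<^sup>+x. g x \<partial>(lborel :: real measure))"
  using nn_integral_real_affine[of g "1" c] by simp

text \<open>Conditioning on where the chord lies. A chord on one side of \<open>s\<close>
  contributes a one-dimensional integral, since only the free length \<open>t\<close> matters; a
  straddling chord contributes an outer and an inner part, which become the same double integral
  after a change of variables. The sum is the left side of \<open>par_identity\<close> at
  \<open>a = s\<close> and \<open>b = 1 - s\<close>.\<close>

lemma mean_op_bump:
  assumes s: "0 < s" "s < 1"
  shows "mean_op (\<lambda>y. ennreal (bump y)) s = ennreal (bump s)"
proof -
  let ?D = "{(u, v). 0 \<le> u \<and> u \<le> v \<and> v \<le> (1::real)}"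
  \<comment> \<open>\<open>k1\<close> is the contribution of chords to the right of
    \<open>s\<close>, \<open>k3\<close> of those to the left; \<open>k2\<close> and
    \<open>k4\<close> are the outer and the inner contribution of a straddling chord.\<close>
  define k1 where "k1 z = ennreal (par s (1 - s - (snd z - fst z))) * indicator {s<..} (fst z)" for z :: "real \<times> real"
  define k2 where "k2 z = ennreal (par (fst z) (1 - snd z)) * indicator {..s} (fst z) * indicator {s<..} (snd z)" for z :: "real \<times> real"
  define k3 where "k3 z = ennreal (par (1 - s) (s - (snd z - fst z))) * indicator {..s} (snd z)" for z :: "real \<times> real"
  define k4 where "k4 z = ennreal (par (s - fst z) (snd z - s)) * indicator {..s} (fst z) * indicator {s<..} (snd z)" for z :: "real \<times> real"
  have [measurable]: "k1 \<in> borel_measurable (borel \<Otimes>\<^sub>M borel)" "k2 \<in> borel_measurable (borel \<Otimes>\<^sub>M borel)"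
    "k3 \<in> borel_measurable (borel \<Otimes>\<^sub>M borel)" "k4 \<in> borel_measurable (borel \<Otimes>\<^sub>M borel)"
    unfolding k1_def k2_def k3_def k4_def by measurable
  have mk: "k1 \<in> borel_measurable uv_law" "k2 \<in> borel_measurable uv_law" "k3 \<in> borel_measurable uv_law" "k4 \<in> borel_measurable uv_law"
    by (auto intro!: measurable_uv_lawI)
  have "mean_op (\<lambda>y. ennreal (bump y)) s = (\<integral>\<^sup>+z. k1 z + k2 z + k3 z + k4 z \<partial>uv_law)"
    unfolding mean_op_def
  proof (rule nn_integral_cong_AE, rule eventually_mono[OF AE_uv_law])
    fix z :: "real \<times> real"
    define u v where "u = fst z" and "v = snd z"
    assume "0 \<le> fst z \<and> fst z < snd z \<and> snd z \<le> 1 \<and> snd z - fst z < 1"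
    then have uv: "0 \<le> u" "u < v" "v \<le> 1" "v - u < 1" by (auto simp: u_def v_def)
    define c where "c = 1 - (v - u)"
    have c: "c > 0" using uv by (simp add: c_def)
    have "mean_kernel (\<lambda>y. ennreal (bump y)) s z =
      ennreal (c powr lam_beta * bump (outer_pos u v s)) + ennreal (inner_wt u v s * bump (inner_pos u v s))"
      unfolding mean_kernel_def by (simp add: u_def v_def c_def ennreal_mult' bump_def inner_wt_def)
    also have "\<dots> = k1 z + k2 z + k3 z + k4 z"
    proof -
      consider "s < u" | "u \<le> s" "s < v" | "v \<le> s" by linarith
      then show ?thesis
      proof cases
        case 1
        have "c powr lam_beta * bump (s / c) = par s (1 - s - (v - u))"
          by (rule powr_mult_bump) (use 1 s uv c in \<open>auto simp: c_def\<close>)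
        then show ?thesis using 1 uv
          by (simp add: outer_pos_def inner_wt_def k1_def k2_def k3_def k4_def u_def[symmetric] v_def[symmetric] c_def[symmetric])
      next
        case 2
        have "c powr lam_beta * bump (u / c) = par u (1 - v)"
          by (rule powr_mult_bump) (use 2 s uv c in \<open>auto simp: c_def\<close>)
        moreover have "(v - u) powr lam_beta * bump ((s - u) / (v - u)) = par (s - u) (v - s)"
          by (rule powr_mult_bump) (use 2 s uv c in \<open>auto simp: c_def\<close>)
        ultimately show ?thesis using 2 uv
          by (simp add: outer_pos_def inner_wt_def inner_pos_def k1_def k2_def k3_def k4_def u_def[symmetric] v_def[symmetric] c_def[symmetric])
      next
        case 3
        have "c powr lam_beta * bump ((s - (v - u)) / c) = par (s - (v - u)) (1 - s)"
          by (rule powr_mult_bump) (use 3 s uv c in \<open>auto simp: c_def\<close>)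
        then show ?thesis using 3 uv
          by (simp add: outer_pos_def inner_wt_def k1_def k2_def k3_def k4_def par_commute[of "1 - s"] u_def[symmetric] v_def[symmetric] c_def[symmetric])
      qed
    qed
    finally show "mean_kernel (\<lambda>y. ennreal (bump y)) s z = k1 z + k2 z + k3 z + k4 z" .
  qed
  also have "\<dots> = (\<integral>\<^sup>+z. k1 z \<partial>uv_law) + (\<integral>\<^sup>+z. k2 z \<partial>uv_law) + (\<integral>\<^sup>+z. k3 z \<partial>uv_law) + (\<integral>\<^sup>+z. k4 z \<partial>uv_law)"
    using mk by (simp add: nn_integral_add)
  also have "(\<integral>\<^sup>+z. k1 z \<partial>uv_law) = 2 * (\<integral>\<^sup>+t. ennreal (t * par s t) * indicator {0<..<1 - s} t \<partial>lborel)"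
  proof -
    have "(\<integral>\<^sup>+z. k1 z \<partial>uv_law) = (\<integral>\<^sup>+l. \<integral>\<^sup>+u. k1 (u, u + l) * 2 * indicator ?D (u, u + l) \<partial>lborel \<partial>lborel)"
      by (rule nn_integral_uv_law_lu) measurable
    \<comment> \<open>For given \<open>l\<close> the admissible \<open>u\<close> form an interval of
      length \<open>1 - s - l\<close>; this is the factor \<open>t\<close>.\<close>
    also have "\<dots> = (\<integral>\<^sup>+l. (\<lambda>t. 2 * (ennreal (t * par s t) * indicator {0<..<1 - s} t)) (1 - s - l) \<partial>lborel)"
    proof (rule nn_integral_cong_AE, rule eventually_mono[OF AE_lborel_singleton[of 0]])
      fix l :: real assume l0: "l \<noteq> 0"
      have lcomm: "1 - l - s = 1 - s - l" by simp
      have "(\<integral>\<^sup>+u. k1 (u, u + l) * 2 * indicator ?D (u, u + l) \<partial>lborel) =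
        (\<integral>\<^sup>+u. ennreal (par s (1 - s - l)) * 2 * indicator {0..} l * indicator {s<..1 - l} u \<partial>lborel)"
        using s by (intro nn_integral_cong) (auto simp: k1_def split: split_indicator)
      also have "\<dots> = ennreal (par s (1 - s - l)) * 2 * indicator {0..} l * emeasure lborel {s<..1 - l}"
        by (subst nn_integral_cmult) auto
      also have "\<dots> = 2 * (ennreal ((1 - s - l) * par s (1 - s - l)) * indicator {0<..<1 - s} (1 - s - l))"
        using l0 par_nonneg[of s "1 - s - l"] lcomm
        by (cases "0 < 1 - s - l") (auto simp: indicator_def ennreal_mult mult_ac lcomm)
      finally show "(\<integral>\<^sup>+u. k1 (u, u + l) * 2 * indicator ?D (u, u + l) \<partial>lborel) =
        (\<lambda>t. 2 * (ennreal (t * par s t) * indicator {0<..<1 - s} t)) (1 - s - l)" by simp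
    qed
    also have "\<dots> = (\<integral>\<^sup>+t. 2 * (ennreal (t * par s t) * indicator {0<..<1 - s} t) \<partial>lborel)"
      by (rule nn_integral_shift_reflect) measurable
    finally show ?thesis by (simp add: nn_integral_cmult)
  qed
  also have "(\<integral>\<^sup>+z. k3 z \<partial>uv_law) = 2 * (\<integral>\<^sup>+t. ennreal (t * par (1 - s) t) * indicator {0<..<s} t \<partial>lborel)"
  proof -
    have "(\<integral>\<^sup>+z. k3 z \<partial>uv_law) = (\<integral>\<^sup>+l. \<integral>\<^sup>+u. k3 (u, u + l) * 2 * indicator ?D (u, u + l) \<partial>lborel \<partial>lborel)"
      by (rule nn_integral_uv_law_lu) measurable
    also have "\<dots> = (\<integral>\<^sup>+l. (\<lambda>t. 2 * (ennreal (t * par (1 - s) t) * indicator {0<..<s} t)) (s - l) \<partial>lborel)"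
    proof (rule nn_integral_cong_AE, rule eventually_mono[OF AE_lborel_singleton[of 0]])
      fix l :: real assume l0: "l \<noteq> 0"
      have "(\<integral>\<^sup>+u. k3 (u, u + l) * 2 * indicator ?D (u, u + l) \<partial>lborel) =
        (\<integral>\<^sup>+u. ennreal (par (1 - s) (s - l)) * 2 * indicator {0..} l * indicator {0..s - l} u \<partial>lborel)"
        using s by (intro nn_integral_cong) (auto simp: k3_def split: split_indicator)
      also have "\<dots> = ennreal (par (1 - s) (s - l)) * 2 * indicator {0..} l * emeasure lborel {0..s - l}"
        by (subst nn_integral_cmult) auto
      also have "\<dots> = 2 * (ennreal ((s - l) * par (1 - s) (s - l)) * indicator {0<..<s} (s - l))"
        using l0 par_nonneg[of "1 - s" "s - l"]
        by (cases "0 < s - l") (auto simp: indicator_def ennreal_mult mult_ac emeasure_lborel_Icc_eq)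
      finally show "(\<integral>\<^sup>+u. k3 (u, u + l) * 2 * indicator ?D (u, u + l) \<partial>lborel) =
        (\<lambda>t. 2 * (ennreal (t * par (1 - s) t) * indicator {0<..<s} t)) (s - l)" by simp
    qed
    also have "\<dots> = (\<integral>\<^sup>+t. 2 * (ennreal (t * par (1 - s) t) * indicator {0<..<s} t) \<partial>lborel)"
      by (rule nn_integral_shift_reflect) measurable
    finally show ?thesis by (simp add: nn_integral_cmult)
  qed
  also have "(\<integral>\<^sup>+z. k2 z \<partial>uv_law) = 2 * (\<integral>\<^sup>+x. \<integral>\<^sup>+y. ennreal (par x y) * indicator {0<..<s} x * indicator {0<..<1 - s} y \<partial>lborel \<partial>lborel)"
  proof -
    have "(\<integral>\<^sup>+z. k2 z \<partial>uv_law) = (\<integral>\<^sup>+u. \<integral>\<^sup>+v. k2 (u, v) * 2 * indicator ?D (u, v) \<partial>lborel \<partial>lborel)"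
      by (rule nn_integral_uv_law_uv) measurable
    also have "\<dots> = (\<integral>\<^sup>+x. \<integral>\<^sup>+y. 2 * (ennreal (par x y) * indicator {0<..<s} x * indicator {0<..<1 - s} y) \<partial>lborel \<partial>lborel)"
    proof (rule nn_integral_cong_AE, rule eventually_mono[OF AE_lborel_singleton[of s]])
      fix u :: real assume u: "u \<noteq> s"
      have "(\<integral>\<^sup>+v. k2 (u, v) * 2 * indicator ?D (u, v) \<partial>lborel) =
        (\<integral>\<^sup>+v. (\<lambda>y. 2 * (ennreal (par u y) * indicator {0<..<s} u * indicator {0<..<1 - s} y)) (1 - v) \<partial>lborel)"
        using s u by (intro nn_integral_cong) (auto simp: k2_def mult_ac le_less split: split_indicator)
      also have "\<dots> = (\<integral>\<^sup>+y. 2 * (ennreal (par u y) * indicator {0<..<s} u * indicator {0<..<1 - s} y) \<partial>lborel)"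
        by (rule nn_integral_shift_reflect) measurable
      finally show "(\<integral>\<^sup>+v. k2 (u, v) * 2 * indicator ?D (u, v) \<partial>lborel) = (\<integral>\<^sup>+y. 2 * (ennreal (par u y) * indicator {0<..<s} u * indicator {0<..<1 - s} y) \<partial>lborel)" .
    qed
    finally show ?thesis by (simp add: nn_integral_cmult)
  qed
  also have "(\<integral>\<^sup>+z. k4 z \<partial>uv_law) = 2 * (\<integral>\<^sup>+x. \<integral>\<^sup>+y. ennreal (par x y) * indicator {0<..<s} x * indicator {0<..<1 - s} y \<partial>lborel \<partial>lborel)"
  proof -
    have "(\<integral>\<^sup>+z. k4 z \<partial>uv_law) = (\<integral>\<^sup>+u. \<integral>\<^sup>+v. k4 (u, v) * 2 * indicator ?D (u, v) \<partial>lborel \<partial>lborel)"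
      by (rule nn_integral_uv_law_uv) measurable
    also have "\<dots> = (\<integral>\<^sup>+u. (\<lambda>x. \<integral>\<^sup>+y. 2 * (ennreal (par x y) * indicator {0<..<s} x * indicator {0<..<1 - s} y) \<partial>lborel) (s - u) \<partial>lborel)"
    proof (rule nn_integral_cong_AE, rule eventually_mono[OF AE_lborel_neq2[of s 0]])
      fix u :: real assume u: "u \<noteq> s \<and> u \<noteq> 0"
      have "(\<integral>\<^sup>+v. k4 (u, v) * 2 * indicator ?D (u, v) \<partial>lborel) = (\<integral>\<^sup>+y. k4 (u, s + y) * 2 * indicator ?D (u, s + y) \<partial>lborel)"
        by (rule nn_integral_shift[symmetric]) measurable
      also have "\<dots> = (\<integral>\<^sup>+y. 2 * (ennreal (par (s - u) y) * indicator {0<..<s} (s - u) * indicator {0<..<1 - s} y) \<partial>lborel)"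
      proof (rule nn_integral_cong_AE, rule eventually_mono[OF AE_lborel_singleton[of "1 - s"]])
        fix y assume "y \<noteq> 1 - s"
        then show "k4 (u, s + y) * 2 * indicator ?D (u, s + y) = 2 * (ennreal (par (s - u) y) * indicator {0<..<s} (s - u) * indicator {0<..<1 - s} y)"
          using s u by (auto simp: k4_def mult_ac split: split_indicator)
      qed
      finally show "(\<integral>\<^sup>+v. k4 (u, v) * 2 * indicator ?D (u, v) \<partial>lborel) = (\<lambda>x. \<integral>\<^sup>+y. 2 * (ennreal (par x y) * indicator {0<..<s} x * indicator {0<..<1 - s} y) \<partial>lborel) (s - u)" by simp
    qed
    also have "\<dots> = (\<integral>\<^sup>+x. \<integral>\<^sup>+y. 2 * (ennreal (par x y) * indicator {0<..<s} x * indicator {0<..<1 - s} y) \<partial>lborel \<partial>lborel)"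
      by (rule nn_integral_shift_reflect) measurable
    finally show ?thesis by (simp add: nn_integral_cmult)
  qed
  finally have "mean_op (\<lambda>y. ennreal (bump y)) s =
      2 * (\<integral>\<^sup>+t. ennreal (t * par s t) * indicator {0<..<1 - s} t \<partial>lborel)
    + 2 * (\<integral>\<^sup>+t. ennreal (t * par (1 - s) t) * indicator {0<..<s} t \<partial>lborel)
    + 4 * (\<integral>\<^sup>+x. \<integral>\<^sup>+y. ennreal (par x y) * indicator {0<..<s} x * indicator {0<..<1 - s} y \<partial>lborel \<partial>lborel)"
  proof -
    have e: "a + b + c + b = a + c + 4 * d" if "b = 2 * d" for a b c d :: ennreal
      unfolding that by (simp add: algebra_simps flip: distrib_right mult_2)
    show "x = a + 2 * d + c + 2 * d \<Longrightarrow> x = a + c + 4 * d" for x a c d :: ennreal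
      using e[OF refl, of a d c] by simp
  qed
  also have "\<dots> = ennreal (par_prim s (1 - s))"
    by (rule par_identity) (use s in auto)
  also have "par_prim s (1 - s) = bump s" by (simp add: par_prim_def bump_def)
  finally show ?thesis .
qed

text \<open>No integrability is required: otherwise the Bochner integral is 0 by convention.\<close>

lemma ennreal_integral_le_nn_integral:
  fixes f :: "'a \<Rightarrow> real"
  shows "ennreal (\<integral>x. f x \<partial>M) \<le> (\<integral>\<^sup>+x. ennreal (f x) \<partial>M)"
proof (cases "integrable M f")
  case True
  have "(\<integral>x. f x \<partial>M) \<le> enn2real (\<integral>\<^sup>+x. ennreal (f x) \<partial>M)"
    unfolding real_lebesgue_integral_def[OF True] by simp
  also have "ennreal (enn2real (\<integral>\<^sup>+x. ennreal (f x) \<partial>M)) = (\<integral>\<^sup>+x. ennreal (f x) \<partial>M)"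
    using True by (auto simp: real_integrable_def less_top)
  finally show ?thesis by (simp add: ennreal_leI)
qed (simp add: not_integrable_integral_eq)

section \<open>Fixed points of the mean equation with mass zero\<close>

text \<open>Required on the open interval only; in \<open>mean_fp_zero\<close> the end points are
  reached by continuity.\<close>

definition mean_fp :: "(real \<Rightarrow> real) \<Rightarrow> bool" where
  "mean_fp m \<longleftrightarrow> (\<forall>s\<in>{0<..<1}. m s = (\<integral>z. (1 - (snd z - fst z)) powr lam_beta * m (outer_pos (fst z) (snd z) s)
      + inner_wt (fst z) (snd z) s * m (inner_pos (fst z) (snd z) s) \<partial>uv_law))"

lemma mean_fp_clamp:
  assumes "mean_fp m" shows "mean_fp (\<lambda>y. m (clamp01 y))"
  unfolding mean_fp_def
proof
  fix s :: real assume s: "s \<in> {0<..<1}"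
  have "m (clamp01 s) = m s" using s by (subst clamp01_id) auto
  also have "\<dots> = (\<integral>z. (1 - (snd z - fst z)) powr lam_beta * m (outer_pos (fst z) (snd z) s)
      + inner_wt (fst z) (snd z) s * m (inner_pos (fst z) (snd z) s) \<partial>uv_law)"
    using assms s unfolding mean_fp_def by blast
  also have "\<dots> = (\<integral>z. (1 - (snd z - fst z)) powr lam_beta * m (clamp01 (outer_pos (fst z) (snd z) s))
      + inner_wt (fst z) (snd z) s * m (clamp01 (inner_pos (fst z) (snd z) s)) \<partial>uv_law)"
  proof (rule Bochner_Integration.integral_cong[OF refl])
    fix z assume "z \<in> space uv_law"
    then have "outer_pos (fst z) (snd z) s \<in> {0..1}" using s by (intro outer_pos_in) auto
    then show "(1 - (snd z - fst z)) powr lam_beta * m (outer_pos (fst z) (snd z) s)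
      + inner_wt (fst z) (snd z) s * m (inner_pos (fst z) (snd z) s) = (1 - (snd z - fst z)) powr lam_beta * m (clamp01 (outer_pos (fst z) (snd z) s))
      + inner_wt (fst z) (snd z) s * m (clamp01 (inner_pos (fst z) (snd z) s))"
      by (simp only: clamp01_id[OF inner_pos_in] clamp01_id)
  qed
  finally show "m (clamp01 s) = \<dots>" .
qed

lemma mean_fp_minus:
  assumes "mean_fp m" shows "mean_fp (\<lambda>y. - m y)"
  unfolding mean_fp_def
proof
  fix s :: real assume s: "s \<in> {0<..<1}"
  let ?k = "\<lambda>z. (1 - (snd z - fst z)) powr lam_beta * m (outer_pos (fst z) (snd z) s) + inner_wt (fst z) (snd z) s * m (inner_pos (fst z) (snd z) s)"
  have "m s = (\<integral>z. ?k z \<partial>uv_law)" using assms s unfolding mean_fp_def by blast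
  then have "- m s = (\<integral>z. - ?k z \<partial>uv_law)" by (simp only: Bochner_Integration.integral_minus)
  also have "\<dots> = (\<integral>z. (1 - (snd z - fst z)) powr lam_beta * - m (outer_pos (fst z) (snd z) s) + inner_wt (fst z) (snd z) s * - m (inner_pos (fst z) (snd z) s) \<partial>uv_law)"
    by (rule Bochner_Integration.integral_cong[OF refl]) (simp only: mult_minus_right minus_add_distrib)
  finally show "- m s = \<dots>" .
qed

text \<open>\<open>ennreal\<close> cuts off negative values, so the function on the right is the
  positive part of \<open>m\<close>, and the positive part of an integral is at most the integral of
  the positive part.\<close>

lemma mean_op_positive_part_ge:
  assumes fp: "mean_fp m" and s: "s \<in> {0<..<1}"
  shows "ennreal (m s) \<le> mean_op (\<lambda>y. ennreal (m y)) s"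
proof -
  have eq: "m s = (\<integral>z. (1 - (snd z - fst z)) powr lam_beta * m (outer_pos (fst z) (snd z) s)
      + inner_wt (fst z) (snd z) s * m (inner_pos (fst z) (snd z) s) \<partial>uv_law)"
    using fp s unfolding mean_fp_def by blast
  have "ennreal (m s) \<le> (\<integral>\<^sup>+z. ennreal ((1 - (snd z - fst z)) powr lam_beta * m (outer_pos (fst z) (snd z) s)
      + inner_wt (fst z) (snd z) s * m (inner_pos (fst z) (snd z) s)) \<partial>uv_law)"
    by (subst eq) (rule ennreal_integral_le_nn_integral)
  also have "\<dots> \<le> mean_op (\<lambda>y. ennreal (m y)) s"
    unfolding mean_op_def mean_kernel_def
  proof (rule nn_integral_mono)
    fix z
    have e: "ennreal (a * x + b * y) \<le> ennreal a * ennreal x + ennreal b * ennreal y" if "a \<ge> 0" "b \<ge> 0" for a b x y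
    proof -
      have "ennreal (a * x + b * y) \<le> ennreal (a * max 0 x + b * max 0 y)"
        using that by (intro ennreal_leI add_mono mult_left_mono) auto
      also have "\<dots> = ennreal a * ennreal x + ennreal b * ennreal y"
        using that by (simp add: ennreal_mult)
      finally show ?thesis .
    qed
    show "ennreal ((1 - (snd z - fst z)) powr lam_beta * m (outer_pos (fst z) (snd z) s)
      + inner_wt (fst z) (snd z) s * m (inner_pos (fst z) (snd z) s)) \<le>
      ennreal ((1 - (snd z - fst z)) powr lam_beta) * ennreal (m (outer_pos (fst z) (snd z) s))
      + ennreal (inner_wt (fst z) (snd z) s) * ennreal (m (inner_pos (fst z) (snd z) s))"
      by (rule e) (auto simp: inner_wt_def)
  qed
  finally show ?thesis .
qed

text \<open>The positive part lies below its image under \<open>mean_op\<close> and has the same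
  finite mass, so the two agree almost everywhere; and the image is positive on the whole open
  interval as soon as \<open>m\<close> is positive at one point.\<close>

lemma mean_fp_AE_pos:
  assumes fp: "mean_fp m" and cont: "continuous_on UNIV m" and bd: "\<And>y. m y \<le> B"
    and y0: "y0 \<in> {0..1}" "m y0 > 0"
  shows "AE s in lborel. s \<in> {0<..<1} \<longrightarrow> m s > 0"
proof -
  have [measurable]: "m \<in> borel_measurable borel" using cont by (rule borel_measurable_continuous_onI)
  define p where "p = (\<lambda>y. ennreal (m y))"
  have [measurable]: "p \<in> borel_measurable borel" unfolding p_def by measurable
  have "isCont m y0" using cont by (simp add: continuous_on_eq_continuous_at)
  then have "\<forall>\<^sub>F y in at y0. m y > 0" using y0(2) by (intro order_tendstoD(1)[of m "m y0"]) (auto simp: isCont_def)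
  then obtain d where d: "d > 0" "\<And>y. y \<noteq> y0 \<Longrightarrow> dist y y0 < d \<Longrightarrow> m y > 0" unfolding eventually_at by auto
  have near: "m y > 0" if "\<bar>y - y0\<bar> < d" for y
    using d(2)[of y] that y0(2) by (cases "y = y0") (auto simp: dist_real_def)
  define w1 where "w1 = max 0 (y0 - d)"
  define w2 where "w2 = min 1 (y0 + d)"
  have w: "0 \<le> w1" "w1 < w2" "w2 \<le> 1" using y0 d by (auto simp: w1_def w2_def)
  have pos: "mean_op p s > 0" if "0 < s" "s < 1" for s
    by (rule mean_op_pos[OF _ w]) (use that near in \<open>auto simp: p_def w1_def w2_def\<close>)
  have fin: "(\<integral>\<^sup>+s. p s * indicator {0..<1} s \<partial>lborel) < \<infinity>"
  proof -
    have "(\<integral>\<^sup>+s. p s * indicator {0..<1} s \<partial>lborel) \<le> (\<integral>\<^sup>+s. ennreal B * indicator {0..<1::real} s \<partial>lborel)"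
      by (rule nn_integral_mono) (auto simp: p_def bd intro!: ennreal_leI split: split_indicator)
    also have "\<dots> < \<infinity>" by (subst nn_integral_cmult_indicator) (auto simp: ennreal_mult_less_top)
    finally show ?thesis .
  qed
  have le: "p s * indicator {0..<1} s \<le> mean_op p s * indicator {0..<1} s" if "s \<noteq> 0" for s
    using mean_op_positive_part_ge[OF fp, of s] that by (auto simp: p_def split: split_indicator)
  have "(\<integral>\<^sup>+s. mean_op p s * indicator {0..<1} s - p s * indicator {0..<1} s \<partial>lborel) =
    (\<integral>\<^sup>+s. mean_op p s * indicator {0..<1} s \<partial>lborel) - (\<integral>\<^sup>+s. p s * indicator {0..<1} s \<partial>lborel)"
    by (rule nn_integral_diff) (use fin le in \<open>auto intro: eventually_mono[OF AE_lborel_singleton[of 0]]\<close>)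
  also have "\<dots> = 0"
    using fin by (simp add: nn_integral_mean_op)
  finally have "AE s in lborel. mean_op p s * indicator {0..<1} s - p s * indicator {0..<1} s = 0"
    by (subst (asm) nn_integral_0_iff_AE) simp_all
  then show ?thesis
  proof eventually_elim
    case (elim s)
    show ?case
    proof
      assume s: "s \<in> {0<..<1}"
      have "p s \<noteq> 0"
      proof
        assume "p s = 0"
        then have "mean_op p s = 0" using elim s by auto
        then show False using pos[of s] s by auto
      qed
      then show "m s > 0" by (auto simp: p_def ennreal_eq_0_iff not_le)
    qed
  qed
qed

text \<open>The operator preserves integrals of non-negative functions and improves positivity, so a
  fixed point has constant sign: if both parts were non-zero, both would be positive almost everywhere.\<close>

theorem mean_fp_zero:
  assumes fp: "mean_fp m" and cont: "continuous_on {0..1} m" and int: "(m has_integral 0) {0..1}" and s: "s \<in> {0..1}"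
  shows "m s = 0"
proof -
  define n where "n y = m (clamp01 y)" for y
  have clc: "continuous_on UNIV clamp01" unfolding clamp01_def by (intro continuous_intros)
  have nc: "continuous_on UNIV n" unfolding n_def
    by (rule continuous_on_compose2[OF cont clc]) auto
  have nfp: "mean_fp n" unfolding n_def by (rule mean_fp_clamp[OF fp])
  have "\<exists>B. \<forall>y\<in>{0..1}. \<bar>m y\<bar> \<le> B"
    using compact_imp_bounded[OF compact_continuous_image[OF cont compact_Icc]] unfolding bounded_iff by auto
  then obtain B where B: "\<And>y. y \<in> {0..1} \<Longrightarrow> \<bar>m y\<bar> \<le> B" by blast
  have nB: "\<bar>n y\<bar> \<le> B" for y unfolding n_def by (rule B) simp
  have nm: "n y = m y" if "y \<in> {0..1}" for y using that by (simp add: n_def clamp01_id)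
  have "\<not> ((\<exists>y\<in>{0..1}. n y > 0) \<and> (\<exists>y\<in>{0..1}. n y < 0))"
  proof
    assume "(\<exists>y\<in>{0..1}. n y > 0) \<and> (\<exists>y\<in>{0..1}. n y < 0)"
    then obtain y0 y1 where y: "y0 \<in> {0..1}" "n y0 > 0" "y1 \<in> {0..1}" "n y1 < 0" by blast
    have "AE s in lborel. s \<in> {0<..<1} \<longrightarrow> n s > 0"
      by (rule mean_fp_AE_pos[OF nfp nc _ y(1,2), of B]) (use nB in \<open>auto simp: abs_le_iff\<close>)
    moreover have "AE s in lborel. s \<in> {0<..<1} \<longrightarrow> - n s > 0"
      by (rule mean_fp_AE_pos[OF mean_fp_minus[OF nfp] _ _ y(3), of B])
         (use nB y nc in \<open>auto simp: abs_le_iff intro!: continuous_intros intro: order_trans\<close>)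
    ultimately have "AE s in lborel. s \<notin> {0<..<1::real}" by eventually_elim auto
    then have "emeasure lborel {0<..<1::real} = 0"
      by (subst (asm) AE_iff_measurable[where N = "{0<..<1}"]) auto
    then show False by simp
  qed
  then consider "\<And>y. y \<in> {0..1} \<Longrightarrow> 0 \<le> m y" | "\<And>y. y \<in> {0..1} \<Longrightarrow> 0 \<le> - m y"
    using nm by (metis linorder_not_le neg_0_le_iff_le)
  then show ?thesis
  proof cases
    case 1
    then show ?thesis
      using has_integral_0_cbox_imp_0[of 0 1 m s] cont int s by auto
  next
    case 2
    have "((\<lambda>y. - m y) has_integral 0) {0..1}" using has_integral_neg[OF int] by simp
    then have "- m s = 0"
      using has_integral_0_cbox_imp_0[of 0 1 "\<lambda>y. - m y" s] cont s 2 by (auto intro!: continuous_intros)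
    then show ?thesis by simp
  qed
qed

section \<open>Crossing chords as a combinatorial relation on pairs\<close>

text \<open>With half-open arcs every point is either inside or outside, in accordance with
  \<open>glue\<close>, and no degenerate positions need separate treatment. For generic points the
  relation agrees with geometric intersection (\<open>chord_disjoint_iff\<close>).\<close>

definition crosses :: "real \<times> real \<Rightarrow> real \<times> real \<Rightarrow> bool" where
  "crosses p q \<longleftrightarrow> (fst p \<le> fst q \<and> fst q < snd p) \<noteq> (fst p \<le> snd q \<and> snd q < snd p)"

definition sort_pair :: "real \<times> real \<Rightarrow> real \<times> real" where
  "sort_pair q = (min (fst q) (snd q), max (fst q) (snd q))"

definition add_chord :: "(real \<times> real) list \<Rightarrow> real \<times> real \<Rightarrow> (real \<times> real) list" where
  "add_chord K q = (if \<exists>p\<in>set K. crosses p q then K else K @ [sort_pair q])"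

text \<open>A list in order of insertion rather than a set: induction from the right follows the
  process, and filtering one side of a chord commutes with it. \<open>lamination_eq_kept\<close>
  makes the link to the set.\<close>

definition kept :: "(real \<times> real) list \<Rightarrow> (real \<times> real) list" where
  "kept xs = foldl add_chord [] xs"

definition straddles :: "real \<Rightarrow> real \<times> real \<Rightarrow> bool" where
  "straddles s p \<longleftrightarrow> fst p \<le> s \<and> s < snd p"

definition count_over :: "(real \<times> real) list \<Rightarrow> real \<Rightarrow> nat" where
  "count_over xs s = length (filter (straddles s) (kept xs))"

lemma kept_Nil [simp]: "kept [] = []"
  by (simp add: kept_def)

lemma kept_snoc [simp]: "kept (xs @ [q]) = add_chord (kept xs) q"
  by (simp add: kept_def)

lemma kept_singleton: "kept [q] = [sort_pair q]"
  by (simp add: kept_def add_chord_def)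

lemma kept_subset: "set (kept xs) \<subseteq> sort_pair ` set xs"
  by (induction xs rule: rev_induct) (auto simp: add_chord_def)

text \<open>Needed because \<open>uv_law\<close> describes the ordered first pair, while the input
  delivers it in either order.\<close>

lemma kept_Cons_sort_pair: "kept (sort_pair q # xs) = kept (q # xs)"
proof (induction xs rule: rev_induct)
  case Nil
  then show ?case by (simp add: kept_singleton sort_pair_def)
next
  case (snoc x xs)
  then show ?case using kept_snoc[of "sort_pair q # xs" x] kept_snoc[of "q # xs" x] by simp
qed

lemma count_over_sort_pair: "count_over (sort_pair q # xs) s = count_over (q # xs) s"
  by (simp add: count_over_def kept_Cons_sort_pair)

lemma count_over_le: "count_over xs s \<le> length xs"
proof -
  have "length (kept xs) \<le> length xs"
    by (induction xs rule: rev_induct) (auto simp: add_chord_def)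
  then show ?thesis unfolding count_over_def using length_filter_le order_trans by blast
qed

definition inner_pair :: "real \<Rightarrow> real \<Rightarrow> real \<times> real \<Rightarrow> bool" where
  "inner_pair u v q \<longleftrightarrow> (u \<le> fst q \<and> fst q < v) \<and> (u \<le> snd q \<and> snd q < v)"

definition outer_pair :: "real \<Rightarrow> real \<Rightarrow> real \<times> real \<Rightarrow> bool" where
  "outer_pair u v q \<longleftrightarrow> \<not> (u \<le> fst q \<and> fst q < v) \<and> \<not> (u \<le> snd q \<and> snd q < v)"

definition inner_map :: "real \<Rightarrow> real \<Rightarrow> real \<times> real \<Rightarrow> real \<times> real" where
  "inner_map u v q = (inner_pos u v (fst q), inner_pos u v (snd q))"

definition outer_map :: "real \<Rightarrow> real \<Rightarrow> real \<times> real \<Rightarrow> real \<times> real" where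
  "outer_map u v q = (outer_pos u v (fst q), outer_pos u v (snd q))"

context
  fixes u v :: real
  assumes uv: "u < v" "v - u < 1"
begin

text \<open>Off the collapsed arc the map is strictly increasing. \<open>crosses\<close>,
  \<open>sort_pair\<close> and \<open>straddles\<close> are built from order comparisons alone,
  which is why the rescalings carry them over.\<close>

lemma outer_pos_less_iff:
  assumes "\<not> (u \<le> x \<and> x < v)" "\<not> (u \<le> y \<and> y < v)"
  shows "outer_pos u v x < outer_pos u v y \<longleftrightarrow> x < y"
proof -
  have c: "1 - (v - u) > 0" using uv by simp
  have x: "outer_pos u v x = (if x < u then x else x - (v - u)) / (1 - (v - u))"
    and y: "outer_pos u v y = (if y < u then y else y - (v - u)) / (1 - (v - u))"
    using assms uv by (auto simp: outer_pos_def)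
  show ?thesis unfolding x y divide_less_cancel using assms c uv by auto
qed

lemma outer_pos_le_iff:
  assumes "\<not> (u \<le> x \<and> x < v)" "\<not> (u \<le> y \<and> y < v)"
  shows "outer_pos u v x \<le> outer_pos u v y \<longleftrightarrow> x \<le> y"
  using outer_pos_less_iff[OF assms(2,1)] by (simp add: not_less[symmetric])

lemma inner_pos_less_iff:
  assumes "u \<le> x \<and> x < v" "u \<le> y \<and> y < v"
  shows "inner_pos u v x < inner_pos u v y \<longleftrightarrow> x < y"
proof -
  have x: "inner_pos u v x = (x - u) / (v - u)" and y: "inner_pos u v y = (y - u) / (v - u)"
    using assms by (auto simp: inner_pos_def)
  show ?thesis unfolding x y divide_less_cancel using uv by auto
qed

lemma inner_pos_le_iff:
  assumes "u \<le> x \<and> x < v" "u \<le> y \<and> y < v"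
  shows "inner_pos u v x \<le> inner_pos u v y \<longleftrightarrow> x \<le> y"
  using inner_pos_less_iff[OF assms(2,1)] by (simp add: not_less[symmetric])

lemma crosses_outer_map:
  "outer_pair u v p \<Longrightarrow> outer_pair u v q \<Longrightarrow> crosses (outer_map u v p) (outer_map u v q) \<longleftrightarrow> crosses p q"
  unfolding crosses_def outer_map_def outer_pair_def
  by (elim conjE) (simp only: fst_conv snd_conv outer_pos_less_iff outer_pos_le_iff simp_thms)

lemma crosses_inner_map:
  "inner_pair u v p \<Longrightarrow> inner_pair u v q \<Longrightarrow> crosses (inner_map u v p) (inner_map u v q) \<longleftrightarrow> crosses p q"
  unfolding crosses_def inner_map_def inner_pair_def
  by (elim conjE) (simp only: fst_conv snd_conv inner_pos_less_iff inner_pos_le_iff simp_thms)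

lemma sort_pair_outer_map:
  "outer_pair u v q \<Longrightarrow> sort_pair (outer_map u v q) = outer_map u v (sort_pair q)"
  unfolding sort_pair_def outer_map_def outer_pair_def by (simp add: min_def max_def outer_pos_le_iff)

lemma sort_pair_inner_map:
  "inner_pair u v q \<Longrightarrow> sort_pair (inner_map u v q) = inner_map u v (sort_pair q)"
  unfolding sort_pair_def inner_map_def inner_pair_def by (simp add: min_def max_def inner_pos_le_iff)

lemma pair_sort_pair [simp]:
  "outer_pair u v (sort_pair q) \<longleftrightarrow> outer_pair u v q" "inner_pair u v (sort_pair q) \<longleftrightarrow> inner_pair u v q"
  by (auto simp: outer_pair_def inner_pair_def sort_pair_def min_def max_def)

lemma not_crosses_outer_inner: "outer_pair u v p \<Longrightarrow> inner_pair u v q \<Longrightarrow> \<not> crosses p q"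
  unfolding outer_pair_def inner_pair_def crosses_def by linarith

lemma not_crosses_inner_outer: "inner_pair u v p \<Longrightarrow> outer_pair u v q \<Longrightarrow> \<not> crosses p q"
  unfolding outer_pair_def inner_pair_def crosses_def by linarith

lemma not_inner_outer: "inner_pair u v q \<Longrightarrow> \<not> outer_pair u v q"
  by (auto simp: outer_pair_def inner_pair_def)

lemma crosses_first: "crosses (u, v) q \<longleftrightarrow> \<not> outer_pair u v q \<and> \<not> inner_pair u v q"
  by (auto simp: outer_pair_def inner_pair_def crosses_def)

text \<open>Chords on different sides of the first one never cross, so acceptance of a pair depends
  only on the earlier pairs on its own side; each side reproduces the process run on its own
  rescaled pairs.\<close>

lemma kept_decomposition:
  "\<exists>R. kept ((u, v) # xs) = (u, v) # R \<and> (\<forall>p\<in>set R. outer_pair u v p \<or> inner_pair u v p) \<and>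
    map (outer_map u v) (filter (outer_pair u v) R) = kept (map (outer_map u v) (filter (outer_pair u v) xs)) \<and>
    map (inner_map u v) (filter (inner_pair u v) R) = kept (map (inner_map u v) (filter (inner_pair u v) xs)) \<and>
    set R \<subseteq> sort_pair ` set xs"
proof (induction xs rule: rev_induct)
  case Nil
  then show ?case using uv by (simp add: kept_singleton sort_pair_def)
next
  case (snoc q xs)
  then obtain R where R: "kept ((u, v) # xs) = (u, v) # R" "\<forall>p\<in>set R. outer_pair u v p \<or> inner_pair u v p"
    and o: "map (outer_map u v) (filter (outer_pair u v) R) = kept (map (outer_map u v) (filter (outer_pair u v) xs))"
    and i: "map (inner_map u v) (filter (inner_pair u v) R) = kept (map (inner_map u v) (filter (inner_pair u v) xs))"
    and sub: "set R \<subseteq> sort_pair ` set xs"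
    by blast
  have k: "kept ((u, v) # xs @ [q]) = add_chord ((u, v) # R) q"
    using kept_snoc[of "(u, v) # xs" q] R(1) by simp
  consider "\<not> outer_pair u v q" "\<not> inner_pair u v q" | "outer_pair u v q" | "inner_pair u v q" by blast
  then show ?case
  proof cases
    case 1
    then have "crosses (u, v) q" by (simp add: crosses_first)
    then have "kept ((u, v) # xs @ [q]) = (u, v) # R" unfolding k by (simp add: add_chord_def)
    then show ?thesis using 1 R(2) o i sub by (intro exI[of _ R]) auto
  next
    case 2
    then have ni: "\<not> inner_pair u v q" using not_inner_outer by blast
    have nc: "\<not> crosses (u, v) q" using 2 by (simp add: crosses_first)
    have eq: "(\<exists>p\<in>set R. crosses p q) \<longleftrightarrow> (\<exists>p\<in>set (kept (map (outer_map u v) (filter (outer_pair u v) xs))). crosses p (outer_map u v q))"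
    proof -
      have "(\<exists>p\<in>set R. crosses p q) \<longleftrightarrow> (\<exists>p\<in>set (filter (outer_pair u v) R). crosses p q)"
        using R(2) not_crosses_inner_outer[OF _ 2] unfolding set_filter by blast
      also have "\<dots> \<longleftrightarrow> (\<exists>p\<in>set (filter (outer_pair u v) R). crosses (outer_map u v p) (outer_map u v q))"
        using crosses_outer_map[OF _ 2] by (intro bex_cong) auto
      finally show ?thesis unfolding o[symmetric] by simp
    qed
    show ?thesis
    proof (cases "\<exists>p\<in>set R. crosses p q")
      case True
      then have "kept ((u, v) # xs @ [q]) = (u, v) # R" unfolding k by (auto simp: add_chord_def)
      moreover have "kept (map (outer_map u v) (filter (outer_pair u v) (xs @ [q]))) = kept (map (outer_map u v) (filter (outer_pair u v) xs))"
        using 2 True eq by (simp add: add_chord_def)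
      ultimately show ?thesis using ni R(2) o i sub by (intro exI[of _ R]) auto
    next
      case False
      then have "kept ((u, v) # xs @ [q]) = (u, v) # (R @ [sort_pair q])" unfolding k using nc by (auto simp: add_chord_def)
      moreover have "kept (map (outer_map u v) (filter (outer_pair u v) (xs @ [q]))) =
          kept (map (outer_map u v) (filter (outer_pair u v) xs)) @ [outer_map u v (sort_pair q)]"
        using 2 False eq by (simp add: add_chord_def sort_pair_outer_map)
      ultimately show ?thesis using 2 ni R(2) o i sub by (intro exI[of _ "R @ [sort_pair q]"]) auto
    qed
  next
    case 3
    then have no: "\<not> outer_pair u v q" using not_inner_outer by blast
    have nc: "\<not> crosses (u, v) q" using 3 by (simp add: crosses_first)
    have eq: "(\<exists>p\<in>set R. crosses p q) \<longleftrightarrow> (\<exists>p\<in>set (kept (map (inner_map u v) (filter (inner_pair u v) xs))). crosses p (inner_map u v q))"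
    proof -
      have "(\<exists>p\<in>set R. crosses p q) \<longleftrightarrow> (\<exists>p\<in>set (filter (inner_pair u v) R). crosses p q)"
        using R(2) not_crosses_outer_inner[OF _ 3] unfolding set_filter by blast
      also have "\<dots> \<longleftrightarrow> (\<exists>p\<in>set (filter (inner_pair u v) R). crosses (inner_map u v p) (inner_map u v q))"
        using crosses_inner_map[OF _ 3] by (intro bex_cong) auto
      finally show ?thesis unfolding i[symmetric] by simp
    qed
    show ?thesis
    proof (cases "\<exists>p\<in>set R. crosses p q")
      case True
      then have "kept ((u, v) # xs @ [q]) = (u, v) # R" unfolding k by (auto simp: add_chord_def)
      moreover have "kept (map (inner_map u v) (filter (inner_pair u v) (xs @ [q]))) = kept (map (inner_map u v) (filter (inner_pair u v) xs))"
        using 3 True eq by (simp add: add_chord_def)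
      ultimately show ?thesis using no R(2) o i sub by (intro exI[of _ R]) auto
    next
      case False
      then have "kept ((u, v) # xs @ [q]) = (u, v) # (R @ [sort_pair q])" unfolding k using nc by (auto simp: add_chord_def)
      moreover have "kept (map (inner_map u v) (filter (inner_pair u v) (xs @ [q]))) =
          kept (map (inner_map u v) (filter (inner_pair u v) xs)) @ [inner_map u v (sort_pair q)]"
        using 3 False eq by (simp add: add_chord_def sort_pair_inner_map)
      ultimately show ?thesis using 3 no R(2) o i sub by (intro exI[of _ "R @ [sort_pair q]"]) auto
    qed
  qed
qed

text \<open>A point \<open>s\<close> inside the arc is sent to \<open>u / (1 - (v - u))\<close>,
  which is also the image of \<open>v\<close>; this is why end points equal to \<open>v\<close> are
  excluded.\<close>

lemma straddles_outer:
  assumes p: "outer_pair u v p" and v: "fst p \<noteq> v" "snd p \<noteq> v"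
  shows "straddles s p \<longleftrightarrow> straddles (outer_pos u v s) (outer_map u v p)"
proof (cases "u \<le> s \<and> s < v")
  case False
  with p show ?thesis unfolding straddles_def outer_map_def outer_pair_def
    by (elim conjE) (simp only: fst_conv snd_conv outer_pos_less_iff outer_pos_le_iff simp_thms)
next
  case True
  have c: "1 - (v - u) > 0" using uv by simp
  have s: "outer_pos u v s = u / (1 - (v - u))" using True by (auto simp: outer_pos_def)
  have pos: "outer_pos u v x \<le> u / (1 - (v - u)) \<longleftrightarrow> x < u" "u / (1 - (v - u)) < outer_pos u v x \<longleftrightarrow> x > v"
    if "\<not> (u \<le> x \<and> x < v)" "x \<noteq> v" for x
  proof -
    have x: "outer_pos u v x = (if x < u then x else x - (v - u)) / (1 - (v - u))"
      using that uv by (auto simp: outer_pos_def)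
    show "outer_pos u v x \<le> u / (1 - (v - u)) \<longleftrightarrow> x < u" "u / (1 - (v - u)) < outer_pos u v x \<longleftrightarrow> x > v"
      unfolding x divide_less_cancel divide_le_cancel using that c uv by auto
  qed
  show ?thesis using p v True pos[of "fst p"] pos[of "snd p"]
    unfolding straddles_def outer_map_def outer_pair_def s by auto
qed

lemma straddles_inner:
  assumes p: "inner_pair u v p"
  shows "straddles s p \<longleftrightarrow> (u \<le> s \<and> s < v) \<and> straddles (inner_pos u v s) (inner_map u v p)"
proof (cases "u \<le> s \<and> s < v")
  case True
  with p show ?thesis unfolding straddles_def inner_map_def inner_pair_def
    by (elim conjE) (simp only: fst_conv snd_conv inner_pos_less_iff inner_pos_le_iff simp_thms)
next
  case False
  then show ?thesis using p unfolding straddles_def inner_pair_def by auto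
qed

text \<open>The two recursive counts belong to the two sides; the summand 1 is the first chord
  itself.\<close>

lemma count_over_decomposition:
  assumes "\<And>q. q \<in> set xs \<Longrightarrow> fst q \<noteq> v \<and> snd q \<noteq> v"
  shows "count_over ((u, v) # xs) s =
    count_over (map (outer_map u v) (filter (outer_pair u v) xs)) (outer_pos u v s) +
    (if u \<le> s \<and> s < v then 1 + count_over (map (inner_map u v) (filter (inner_pair u v) xs)) (inner_pos u v s) else 0)"
proof -
  obtain R where R: "kept ((u, v) # xs) = (u, v) # R" "\<forall>p\<in>set R. outer_pair u v p \<or> inner_pair u v p"
    and o: "map (outer_map u v) (filter (outer_pair u v) R) = kept (map (outer_map u v) (filter (outer_pair u v) xs))"
    and i: "map (inner_map u v) (filter (inner_pair u v) R) = kept (map (inner_map u v) (filter (inner_pair u v) xs))"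
    and sub: "set R \<subseteq> sort_pair ` set xs"
    using kept_decomposition[of xs] by blast
  have Rv: "fst p \<noteq> v \<and> snd p \<noteq> v" if pR: "p \<in> set R" for p
  proof -
    obtain q where "q \<in> set xs" "p = sort_pair q" using sub pR by blast
    then show ?thesis using assms[of q] by (auto simp: sort_pair_def min_def max_def)
  qed
  have split: "length (filter Q R) = length (filter Q (filter (outer_pair u v) R)) + length (filter Q (filter (inner_pair u v) R))" for Q
    using R(2) not_inner_outer by (induction R) auto
  have 1: "length (filter (straddles s) (filter (outer_pair u v) R)) =
      count_over (map (outer_map u v) (filter (outer_pair u v) xs)) (outer_pos u v s)"
  proof -
    have "filter (straddles s) (filter (outer_pair u v) R) =
       filter (straddles (outer_pos u v s) \<circ> outer_map u v) (filter (outer_pair u v) R)"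
      by (rule filter_cong[OF refl]) (use Rv straddles_outer in auto)
    then show ?thesis unfolding count_over_def o[symmetric] by (simp add: filter_map)
  qed
  have 2: "length (filter (straddles s) (filter (inner_pair u v) R)) =
      (if u \<le> s \<and> s < v then count_over (map (inner_map u v) (filter (inner_pair u v) xs)) (inner_pos u v s) else 0)"
  proof -
    have "filter (straddles s) (filter (inner_pair u v) R) =
       filter (straddles (inner_pos u v s) \<circ> inner_map u v) (filter (inner_pair u v) R)" if "u \<le> s \<and> s < v"
      by (rule filter_cong[OF refl]) (use straddles_inner that in auto)
    moreover have "filter (straddles s) (filter (inner_pair u v) R) = []" if "\<not> (u \<le> s \<and> s < v)"
      unfolding filter_empty_conv using straddles_inner that by auto
    ultimately show ?thesis unfolding count_over_def i[symmetric] filter_map length_map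
      by (cases "u \<le> s \<and> s < v") (simp_all only: simp_thms if_True if_False list.size not_False_eq_True)
  qed
  show ?thesis unfolding count_over_def[of "(u, v) # xs"] R(1)
    using split[of "straddles s"] 1 2 by (simp add: straddles_def[of s "(u, v)"])
qed

end

subsection \<open>Chords of the circle\<close>

lemma cos_less_far:
  assumes "0 \<le> d" "d < \<theta>" "\<theta> < 2 * pi - d" shows "cos \<theta> < cos d"
proof (cases "\<theta> \<le> pi")
  case True
  then show ?thesis using assms by (intro cos_monotone_0_pi) auto
next
  case False
  have "cos \<theta> = cos (2 * pi - \<theta>)" by (simp add: cos_diff)
  also have "\<dots> < cos d" using assms False by (intro cos_monotone_0_pi) auto
  finally show ?thesis .
qed

lemma cos_greater_near:
  assumes "\<bar>\<theta>\<bar> < d" "d \<le> pi" shows "cos d < cos \<theta>"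
  using cos_monotone_0_pi[of "\<bar>\<theta>\<bar>" d] assms by simp

context
  fixes a b :: real
  assumes ab: "0 < a" "a < b" "b < 1"
begin

text \<open>The signed distance of \<open>z\<close> from the line through the end points: rotating
  back by the angle \<open>pi * (a + b)\<close> makes that line vertical, and the sign is positive
  on the side of the arc from \<open>a\<close> to \<open>b\<close>.\<close>

definition chord_level :: "complex \<Rightarrow> real" where
  "chord_level z = Re (z * cnj (cis (pi * (a + b)))) - cos (pi * (b - a)) / (2 * pi)"

lemma circle_pt_cis: "circle_pt s = cis (2 * pi * s) / (2 * pi)"
  by (simp add: circle_pt_def cis_conv_exp mult_ac)

lemma circle_pt_rotated: "circle_pt s * cnj (cis (pi * (a + b))) = cis (2 * pi * s - pi * (a + b)) / (2 * pi)"
proof -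
  have "cis (2 * pi * s) * cis (- (pi * (a + b))) = cis (2 * pi * s - pi * (a + b))"
    by (simp add: cis_mult)
  then show ?thesis by (simp add: circle_pt_cis cis_cnj)
qed

lemma chord_level_circle_pt: "chord_level (circle_pt s) = (cos (2 * pi * s - pi * (a + b)) - cos (pi * (b - a))) / (2 * pi)"
  unfolding chord_level_def circle_pt_rotated by (simp add: diff_divide_distrib)

lemma chord_level_inside:
  assumes "a < s" "s < b" shows "chord_level (circle_pt s) > 0"
proof -
  have "cos (pi * (b - a)) < cos (2 * pi * s - pi * (a + b))"
  proof (rule cos_greater_near)
    have "2 * pi * s - pi * (a + b) = pi * (2 * s - (a + b))" by (simp add: algebra_simps)
    then have "\<bar>2 * pi * s - pi * (a + b)\<bar> = pi * \<bar>2 * s - (a + b)\<bar>" by (simp add: abs_mult)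
    also have "\<dots> < pi * (b - a)" using assms by (intro mult_strict_left_mono) auto
    finally show "\<bar>2 * pi * s - pi * (a + b)\<bar> < pi * (b - a)" .
    show "pi * (b - a) \<le> pi" using ab by simp
  qed
  then show ?thesis by (simp add: chord_level_circle_pt)
qed

lemma chord_level_outside:
  assumes "0 < s" "s < 1" "s < a \<or> b < s" shows "chord_level (circle_pt s) < 0"
proof -
  define t where "t = \<bar>2 * s - (a + b)\<bar>"
  have t: "b - a < t" "t < 2 - (b - a)" using assms ab by (auto simp: t_def)
  have "2 * pi * s - pi * (a + b) = pi * (2 * s - (a + b))" by (simp add: algebra_simps)
  then have "\<bar>2 * pi * s - pi * (a + b)\<bar> = pi * t" by (simp add: abs_mult t_def)
  then have "cos (2 * pi * s - pi * (a + b)) = cos (pi * t)" by (metis cos_abs_real)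
  also have "\<dots> < cos (pi * (b - a))"
  proof (rule cos_less_far)
    show "0 \<le> pi * (b - a)" using ab by simp
    show "pi * (b - a) < pi * t" using t by simp
    have "pi * t < pi * (2 - (b - a))" using t by (intro mult_strict_left_mono) auto
    then show "pi * t < 2 * pi - pi * (b - a)" by (simp add: algebra_simps)
  qed
  finally show ?thesis by (simp add: chord_level_circle_pt divide_neg_pos)
qed

lemma chord_level_affine: "chord_level ((1 - t) *\<^sub>R x + t *\<^sub>R y) = (1 - t) * chord_level x + t * chord_level y"
  by (simp add: chord_level_def algebra_simps diff_divide_distrib)

lemma chord_level_on_chord: "z \<in> chord a b \<Longrightarrow> chord_level z = 0"
proof -
  have "chord_level (circle_pt a) = 0" "chord_level (circle_pt b) = 0"
  proof -
    have "2 * pi * a - pi * (a + b) = - (pi * (b - a))" "2 * pi * b - pi * (a + b) = pi * (b - a)"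
      by (simp_all add: algebra_simps)
    then show "chord_level (circle_pt a) = 0" "chord_level (circle_pt b) = 0"
      by (simp_all only: chord_level_circle_pt cos_minus) simp_all
  qed
  then show "z \<in> chord a b \<Longrightarrow> chord_level z = 0"
    by (auto simp: chord_def closed_segment_def chord_level_affine)
qed

text \<open>Inside the closed disc the line through the end points contains nothing but the chord:
  the imaginary part of the rotated point is bounded by half the length of the chord, and
  \<open>t\<close> is its affine coordinate.\<close>

lemma on_chordI:
  assumes z: "chord_level z = 0" and n: "norm z \<le> 1 / (2 * pi)"
  shows "z \<in> chord a b"
proof -
  define r where "r = 1 / (2 * pi)"
  define d where "d = pi * (b - a)"
  define w where "w = cis (pi * (a + b))"
  define z' where "z' = z * cnj w"
  have r: "r > 0" by (simp add: r_def)
  have "pi * (b - a) < pi * 1" using ab by (intro mult_strict_left_mono) auto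
  then have sd: "sin d > 0" unfolding d_def using ab by (intro sin_gt_zero) auto
  have ww: "cnj w * w = 1" "w * cnj w = 1" by (simp_all add: w_def cis_cnj cis_mult)
  have zz: "z = z' * w" using ww by (simp add: z'_def mult.assoc)
  have re: "Re z' = r * cos d" using z unfolding chord_level_def z'_def w_def r_def d_def by simp
  have "norm z' = norm z" by (simp add: z'_def norm_mult w_def)
  then have "(norm z')\<^sup>2 \<le> r\<^sup>2" using n by (simp add: r_def power_mono del: power_divide power_one_over)
  then have "(r * cos d)\<^sup>2 + (Im z')\<^sup>2 \<le> r\<^sup>2" by (simp add: cmod_power2 re)
  then have "(Im z')\<^sup>2 \<le> r\<^sup>2 * (1 - (cos d)\<^sup>2)" by (simp add: power_mult_distrib algebra_simps)
  then have "(Im z')\<^sup>2 \<le> (r * sin d)\<^sup>2" by (simp add: power_mult_distrib sin_squared_eq)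
  then have im: "\<bar>Im z'\<bar> \<le> r * sin d" using r sd by (simp add: abs_le_square_iff[symmetric] abs_mult)
  define t where "t = (Im z' / (r * sin d) + 1) / 2"
  have rs: "r * sin d > 0" using r sd by simp
  have imt: "Im z' / (r * sin d) \<le> 1" "- 1 \<le> Im z' / (r * sin d)"
    using im rs by (auto simp: divide_le_eq le_divide_eq abs_le_iff)
  then have t: "0 \<le> t" "t \<le> 1" by (auto simp: t_def)
  have "2 * t - 1 = Im z' / (r * sin d)" by (simp add: t_def field_simps)
  then have "Im z' = (2 * t - 1) * (r * sin d)" using rs r sd by simp
  then have z't: "z' = (1 - t) *\<^sub>R (r *\<^sub>R cis (- d)) + t *\<^sub>R (r *\<^sub>R cis d)"
    using re by (simp add: complex_eq_iff algebra_simps)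
  have A: "circle_pt a = (r *\<^sub>R cis (- d)) * w" and B: "circle_pt b = (r *\<^sub>R cis d) * w"
  proof -
    have c: "cis (- d) * w = cis (2 * pi * a)" "cis d * w = cis (2 * pi * b)"
      unfolding w_def d_def cis_mult by (simp_all add: algebra_simps)
    show "circle_pt a = (r *\<^sub>R cis (- d)) * w" "circle_pt b = (r *\<^sub>R cis d) * w"
      unfolding mult_scaleR_left c circle_pt_cis r_def by (simp_all add: scaleR_conv_of_real)
  qed
  have "z = (1 - t) *\<^sub>R circle_pt a + t *\<^sub>R circle_pt b"
    unfolding zz z't A B by (simp add: algebra_simps)
  with t show ?thesis unfolding chord_def closed_segment_def by blast
qed

text \<open>\<open>chord_level\<close> is affine, so it keeps its sign along a chord whose end
  points lie on one side. If they lie on opposite sides it vanishes somewhere on the chord, and by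
  convexity that point is in the disc, hence on the other chord.\<close>

lemma chord_disjoint_iff:
  assumes c: "0 < c" "c < 1" "c \<noteq> a" "c \<noteq> b" and d: "0 < d" "d < 1" "d \<noteq> a" "d \<noteq> b"
  shows "chord c d \<inter> chord a b = {} \<longleftrightarrow> \<not> crosses (a, b) (c, d)"
proof -
  have sgn: "(chord_level (circle_pt s) > 0 \<longleftrightarrow> a \<le> s \<and> s < b) \<and> chord_level (circle_pt s) \<noteq> 0"
    if "0 < s" "s < 1" "s \<noteq> a" "s \<noteq> b" for s
    using chord_level_inside[of s] chord_level_outside[of s] that by (cases "a < s \<and> s < b") (auto simp: not_less)
  note lc = sgn[OF c] and ld = sgn[OF d]
  let ?x = "chord_level (circle_pt c)" and ?y = "chord_level (circle_pt d)"
  have cr: "crosses (a, b) (c, d) \<longleftrightarrow> (0 < ?x) \<noteq> (0 < ?y)" using lc ld by (simp add: crosses_def)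
  have nz: "?x \<noteq> 0" "?y \<noteq> 0" using lc ld by blast+
  show ?thesis
  proof (cases "crosses (a, b) (c, d)")
    case True
    then have opp: "(?x > 0 \<and> ?y < 0) \<or> (?x < 0 \<and> ?y > 0)"
      using cr nz by (smt (verit))
    \<comment> \<open>The zero of the affine function with value \<open>?x\<close> at 0 and
      \<open>?y\<close> at 1.\<close>
    define t where "t = ?x / (?x - ?y)"
    have t: "0 \<le> t" "t \<le> 1" using opp by (auto simp: t_def divide_simps)
    define z where "z = (1 - t) *\<^sub>R circle_pt c + t *\<^sub>R circle_pt d"
    have "?x - ?y \<noteq> 0" using opp by auto
    then have z0: "chord_level z = 0"
      unfolding z_def chord_level_affine t_def by (simp add: field_simps)
    have nrm: "norm (circle_pt s) = 1 / (2 * pi)" for s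
      by (simp add: circle_pt_cis norm_divide)
    have "norm z \<le> (1 - t) * norm (circle_pt c) + t * norm (circle_pt d)"
      unfolding z_def using t by (intro norm_triangle_le) simp
    also have "\<dots> = 1 / (2 * pi)" unfolding nrm distrib_right[symmetric] by simp
    finally have zab: "z \<in> chord a b" by (intro on_chordI z0)
    have zc: "z \<in> chord c d" unfolding chord_def in_segment z_def using t by (intro exI[of _ t]) simp
    from IntI[OF zc zab] have "chord c d \<inter> chord a b \<noteq> {}" by auto
    with True show ?thesis by (simp only: simp_thms)
  next
    case False
    then have same: "(?x > 0 \<and> ?y > 0) \<or> (?x < 0 \<and> ?y < 0)"
      using cr nz by (smt (verit))
    have "chord_level z \<noteq> 0" if zc: "z \<in> chord c d" for z
    proof -
      obtain t where t: "0 \<le> t" "t \<le> 1" "z = (1 - t) *\<^sub>R circle_pt c + t *\<^sub>R circle_pt d"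
        using zc unfolding chord_def in_segment by (elim exE conjE)
      have "chord_level z = (1 - t) * ?x + t * ?y" unfolding t(3) by (rule chord_level_affine)
      moreover have "(1 - t) * ?x + t * ?y \<noteq> 0"
      proof -
        have "(1 - t) * min ?x ?y + t * min ?x ?y \<le> (1 - t) * ?x + t * ?y"
          using t by (intro add_mono mult_left_mono) auto
        moreover have "(1 - t) * ?x + t * ?y \<le> (1 - t) * max ?x ?y + t * max ?x ?y"
          using t by (intro add_mono mult_left_mono) auto
        moreover have "0 < min ?x ?y \<or> max ?x ?y < 0" using same by (simp only: min_less_iff_conj max_less_iff_conj)
        moreover have "(1 - t) * m + t * m = m" for m :: real by (simp add: algebra_simps)
        ultimately show ?thesis by (smt (verit))
      qed
      ultimately show ?thesis by simp
    qed
    then have "chord c d \<inter> chord a b = {}" using chord_level_on_chord by (metis IntD1 IntD2 equals0I)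
    then show ?thesis using False by simp
  qed
qed

end

text \<open>Distinctness is proved along with the equality because \<open>chord_count\<close> takes
  the cardinality of a set and \<open>count_over\<close> the length of a list. Position
  \<open>i\<close> of the list holds the pair with index \<open>Suc i\<close>.\<close>

lemma lamination_eq_kept:
  assumes r: "\<And>i. 1 \<le> i \<Longrightarrow> 0 < u i \<and> u i < 1 \<and> 0 < v i \<and> v i < 1 \<and> u i \<noteq> v i"
    and d: "\<And>i j. 1 \<le> i \<Longrightarrow> i < j \<Longrightarrow> u i \<noteq> u j \<and> u i \<noteq> v j \<and> v i \<noteq> u j \<and> v i \<noteq> v j"
  shows "lamination u v n = set (kept (map (\<lambda>i. (u (Suc i), v (Suc i))) [0..<n])) \<and>
     distinct (kept (map (\<lambda>i. (u (Suc i), v (Suc i))) [0..<n]))"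
proof (induction n)
  case (Suc n)
  let ?xs = "map (\<lambda>i. (u (Suc i), v (Suc i))) [0..<n]"
  let ?q = "(u (Suc n), v (Suc n))"
  have mem: "\<exists>i\<ge>1. i \<le> n \<and> p = sort_pair (u i, v i)" if p: "p \<in> set (kept ?xs)" for p
  proof -
    have "p \<in> sort_pair ` set ?xs" using kept_subset[of ?xs] p by blast
    then obtain i where "i < n" "p = sort_pair (u (Suc i), v (Suc i))" by auto
    then show ?thesis by (intro exI[of _ "Suc i"]) auto
  qed
  have iff: "chord (u (Suc n)) (v (Suc n)) \<inter> chord (fst p) (snd p) = {} \<longleftrightarrow> \<not> crosses p ?q" if p: "p \<in> set (kept ?xs)" for p
  proof -
    obtain i where i: "i \<ge> 1" "i \<le> n" "p = sort_pair (u i, v i)" using mem[OF p] by blast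
    have "0 < fst p" "fst p < snd p" "snd p < 1" "u (Suc n) \<noteq> fst p" "u (Suc n) \<noteq> snd p" "v (Suc n) \<noteq> fst p" "v (Suc n) \<noteq> snd p"
      using r[OF i(1)] d[OF i(1), of "Suc n"] i by (auto simp: sort_pair_def min_def max_def)
    with chord_disjoint_iff[of "fst p" "snd p" "u (Suc n)" "v (Suc n)"] r[of "Suc n"] show ?thesis by simp
  qed
  have new: "sort_pair ?q \<notin> set (kept ?xs)"
  proof
    assume "sort_pair ?q \<in> set (kept ?xs)"
    then obtain i where i: "i \<ge> 1" "i \<le> n" "sort_pair ?q = sort_pair (u i, v i)" using mem by blast
    then show False using d[OF i(1), of "Suc n"] by (auto simp: sort_pair_def min_def max_def split: if_splits)
  qed
  have cond: "(\<forall>(a, b)\<in>lamination u v n. chord (u (Suc n)) (v (Suc n)) \<inter> chord a b = {}) \<longleftrightarrow> \<not> (\<exists>p\<in>set (kept ?xs). crosses p ?q)"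
    using Suc iff by (auto simp: split_beta)
  have k: "kept (map (\<lambda>i. (u (Suc i), v (Suc i))) [0..<Suc n]) = add_chord (kept ?xs) ?q" by simp
  show ?case unfolding k lamination.simps(2) cond using Suc new
    by (auto simp: add_chord_def sort_pair_def)
qed simp

lemma chord_count_eq_count_over:
  assumes r: "\<And>i. 1 \<le> i \<Longrightarrow> 0 < u i \<and> u i < 1 \<and> 0 < v i \<and> v i < 1 \<and> u i \<noteq> v i"
    and d: "\<And>i j. 1 \<le> i \<Longrightarrow> i < j \<Longrightarrow> u i \<noteq> u j \<and> u i \<noteq> v j \<and> v i \<noteq> u j \<and> v i \<noteq> v j"
  shows "chord_count u v n s = count_over (map (\<lambda>i. (u (Suc i), v (Suc i))) [0..<n]) s"
proof -
  let ?K = "kept (map (\<lambda>i. (u (Suc i), v (Suc i))) [0..<n])"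
  have lam: "lamination u v n = set ?K" "distinct ?K" using lamination_eq_kept[of u v n] r d by blast+
  have in01: "0 < fst p \<and> snd p < 1" if p: "p \<in> set ?K" for p
  proof -
    have "p \<in> sort_pair ` set (map (\<lambda>i. (u (Suc i), v (Suc i))) [0..<n])" using kept_subset p by blast
    then obtain i where "p = sort_pair (u (Suc i), v (Suc i))" by auto
    then show ?thesis using r[of "Suc i"] by (auto simp: sort_pair_def)
  qed
  have "{(a, b) \<in> lamination u v n. 0 < a \<and> a \<le> s \<and> s < b \<and> b < 1} = set (filter (straddles s) ?K)"
    unfolding lam(1) using in01 by (auto simp: straddles_def)
  then show ?thesis unfolding chord_count_def count_over_def
    using distinct_card[OF distinct_filter[OF lam(2)]] by simp
qed

subsection \<open>Splitting a sequence into two types\<close>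

text \<open>Continuing the finitely many selected entries by a fresh stream \<open>ys\<close>
  produces a full stream, whose joint law with the counts can be stated exactly;
  \<open>select_num\<close> tells how much of it stems from \<open>x\<close>.\<close>

definition select_fill :: "('a \<Rightarrow> bool) \<Rightarrow> ('a \<Rightarrow> 'a) \<Rightarrow> nat \<Rightarrow> 'a stream \<Rightarrow> 'a stream \<Rightarrow> 'a stream" where
  "select_fill A e n x ys = map e (filter A (stake n x)) @- ys"

definition select_num :: "('a \<Rightarrow> bool) \<Rightarrow> nat \<Rightarrow> 'a stream \<Rightarrow> nat" where
  "select_num A n x = length (filter A (stake n x))"

lemma select_fill_0 [simp]: "select_fill A e 0 x ys = ys"
  by (simp add: select_fill_def)

lemma select_fill_Suc:
  "select_fill A e (Suc n) x ys = (if A (shd x) then e (shd x) ## select_fill A e n (stl x) ys else select_fill A e n (stl x) ys)"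
  by (simp add: select_fill_def)

lemma select_num_0 [simp]: "select_num A 0 x = 0"
  by (simp add: select_num_def)

lemma select_num_Suc:
  "select_num A (Suc n) x = (if A (shd x) then Suc (select_num A n (stl x)) else select_num A n (stl x))"
  by (simp add: select_num_def)

lemma stake_select_fill: "stake (select_num A n x) (select_fill A e n x ys) = map e (filter A (stake n x))"
  by (simp add: select_fill_def select_num_def stake_shift)

lemma select_fill_measurable [measurable (raw)]:
  assumes [measurable]: "Measurable.pred M A" "e \<in> measurable M M" and f: "f \<in> measurable N (stream_space M)"
    and [measurable]: "g \<in> measurable N (stream_space M)"
  shows "(\<lambda>x. select_fill A e n (f x) (g x)) \<in> measurable N (stream_space M)"
  using f
proof (induction n arbitrary: f)
  case (Suc n)
  note [measurable] = Suc.prems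
  have [measurable]: "(\<lambda>x. select_fill A e n (stl (f x)) (g x)) \<in> measurable N (stream_space M)"
    by (rule Suc.IH) measurable
  show ?case unfolding select_fill_Suc by measurable
qed simp

lemma select_num_measurable [measurable (raw)]:
  assumes [measurable]: "Measurable.pred M A" and f: "f \<in> measurable N (stream_space M)"
  shows "(\<lambda>x. select_num A n (f x)) \<in> measurable N (count_space UNIV)"
  using f
proof (induction n arbitrary: f)
  case (Suc n)
  note [measurable] = Suc.prems
  have [measurable]: "(\<lambda>x. select_num A n (stl (f x))) \<in> measurable N (count_space UNIV)"
    by (rule Suc.IH) measurable
  show ?case unfolding select_num_Suc by measurable
qed simp

text \<open>Thinning with rescaling in abstract form: conditioned on either type, the rescaled entry
  has the original law.\<close>

locale two_types = prob_space M for M :: "'a measure" +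
  fixes A0 A1 :: "'a \<Rightarrow> bool" and e0 e1 :: "'a \<Rightarrow> 'a" and p0 p1 :: ennreal
  assumes meas [measurable]: "Measurable.pred M A0" "Measurable.pred M A1" "e0 \<in> measurable M M" "e1 \<in> measurable M M"
    and disj: "\<And>q. A0 q \<Longrightarrow> \<not> A1 q"
    and type0: "\<And>G. G \<in> borel_measurable M \<Longrightarrow> (\<integral>\<^sup>+q. (if A0 q then G (e0 q) else 0) \<partial>M) = p0 * (\<integral>\<^sup>+q. G q \<partial>M)"
    and type1: "\<And>G. G \<in> borel_measurable M \<Longrightarrow> (\<integral>\<^sup>+q. (if A1 q then G (e1 q) else 0) \<partial>M) = p1 * (\<integral>\<^sup>+q. G q \<partial>M)"
begin

abbreviation "S \<equiv> stream_space M"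

lemma nn_integral_types:
  assumes [measurable]: "h0 \<in> borel_measurable M" "h1 \<in> borel_measurable M"
  shows "(\<integral>\<^sup>+q. (if A0 q then h0 (e0 q) else if A1 q then h1 (e1 q) else h2) \<partial>M) =
    p0 * (\<integral>\<^sup>+q. h0 q \<partial>M) + p1 * (\<integral>\<^sup>+q. h1 q \<partial>M) + (\<integral>\<^sup>+q. (if A0 q \<or> A1 q then 0 else h2) \<partial>M)"
proof -
  have "(\<integral>\<^sup>+q. (if A0 q then h0 (e0 q) else if A1 q then h1 (e1 q) else h2) \<partial>M) =
    (\<integral>\<^sup>+q. (if A0 q then h0 (e0 q) else 0) + (if A1 q then h1 (e1 q) else 0) + (if A0 q \<or> A1 q then 0 else h2) \<partial>M)"
    using disj by (intro nn_integral_cong) auto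
  also have "\<dots> = (\<integral>\<^sup>+q. (if A0 q then h0 (e0 q) else 0) \<partial>M) + (\<integral>\<^sup>+q. (if A1 q then h1 (e1 q) else 0) \<partial>M)
      + (\<integral>\<^sup>+q. (if A0 q \<or> A1 q then 0 else h2) \<partial>M)"
    by (simp add: nn_integral_add)
  finally show ?thesis by (simp add: type0 type1)
qed

lemma indexed_measurable:
  fixes G :: "nat \<Rightarrow> nat \<Rightarrow> 'a stream \<Rightarrow> 'a stream \<Rightarrow> ennreal"
  assumes G: "\<And>k0 k1. (\<lambda>p. G k0 k1 (fst p) (snd p)) \<in> borel_measurable (S \<Otimes>\<^sub>M S)"
    and [measurable]: "a \<in> measurable N (count_space UNIV)" "b \<in> measurable N (count_space UNIV)"
    and [measurable]: "f \<in> measurable N S" "g \<in> measurable N S"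
  shows "(\<lambda>x. G (a x) (b x) (f x) (g x)) \<in> borel_measurable N"
proof -
  have "(\<lambda>x. G k0 k1 (f x) (g x)) \<in> borel_measurable N" for k0 k1
    using measurable_compose[OF _ G, of "\<lambda>x. (f x, g x)" N k0 k1] by simp
  then have "(\<lambda>x. G k0 (b x) (f x) (g x)) \<in> borel_measurable N" for k0
    by (rule measurable_compose_countable) simp
  then show ?thesis by (rule measurable_compose_countable) simp
qed

text \<open>The pair of counts and the two filled streams are independent, and both streams have law
  \<open>S\<close>. The induction removes the first entry of \<open>x\<close>; its contribution is
  absorbed into \<open>G\<close> by raising an index and prefixing the entry to one of the
  streams.\<close>

theorem nn_integral_select_fill:
  fixes G :: "nat \<Rightarrow> nat \<Rightarrow> 'a stream \<Rightarrow> 'a stream \<Rightarrow> ennreal"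
  assumes "\<And>k0 k1. (\<lambda>p. G k0 k1 (fst p) (snd p)) \<in> borel_measurable (S \<Otimes>\<^sub>M S)"
  shows "(\<integral>\<^sup>+x. \<integral>\<^sup>+ys. \<integral>\<^sup>+zs. G (select_num A0 n x) (select_num A1 n x) (select_fill A0 e0 n x ys) (select_fill A1 e1 n x zs) \<partial>S \<partial>S \<partial>S)
     = (\<integral>\<^sup>+x. \<integral>\<^sup>+ys. \<integral>\<^sup>+zs. G (select_num A0 n x) (select_num A1 n x) ys zs \<partial>S \<partial>S \<partial>S)"
  using assms
proof (induction n arbitrary: G)
  case (Suc n)
  interpret S: prob_space S by (rule prob_space_stream_space)
  interpret MS: pair_sigma_finite M S ..
  note GM [measurable (raw)] = indexed_measurable[OF Suc.prems]
  let ?a = "select_num A0 n" and ?b = "select_num A1 n"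
  let ?f = "select_fill A0 e0 n" and ?g = "select_fill A1 e1 n"
  \<comment> \<open>\<open>h0\<close>, \<open>h1\<close> and \<open>h2\<close> are the values after
    a first entry of the first type, of the second type and of neither; \<open>g0\<close>,
    \<open>g1\<close> and \<open>g2\<close> are their counterparts with independent streams.\<close>
  define h0 where "h0 y = (\<integral>\<^sup>+x. \<integral>\<^sup>+ys. \<integral>\<^sup>+zs. G (Suc (?a x)) (?b x) (y ## ?f x ys) (?g x zs) \<partial>S \<partial>S \<partial>S)" for y
  define h1 where "h1 y = (\<integral>\<^sup>+x. \<integral>\<^sup>+ys. \<integral>\<^sup>+zs. G (?a x) (Suc (?b x)) (?f x ys) (y ## ?g x zs) \<partial>S \<partial>S \<partial>S)" for y
  define h2 where "h2 = (\<integral>\<^sup>+x. \<integral>\<^sup>+ys. \<integral>\<^sup>+zs. G (?a x) (?b x) (?f x ys) (?g x zs) \<partial>S \<partial>S \<partial>S)"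
  define g0 where "g0 = (\<integral>\<^sup>+x. \<integral>\<^sup>+ys. \<integral>\<^sup>+zs. G (Suc (?a x)) (?b x) ys zs \<partial>S \<partial>S \<partial>S)"
  define g1 where "g1 = (\<integral>\<^sup>+x. \<integral>\<^sup>+ys. \<integral>\<^sup>+zs. G (?a x) (Suc (?b x)) ys zs \<partial>S \<partial>S \<partial>S)"
  define g2 where "g2 = (\<integral>\<^sup>+x. \<integral>\<^sup>+ys. \<integral>\<^sup>+zs. G (?a x) (?b x) ys zs \<partial>S \<partial>S \<partial>S)"
  have hm [measurable]: "h0 \<in> borel_measurable M" "h1 \<in> borel_measurable M"
    unfolding h0_def h1_def by measurable
  have h2: "h2 = g2" unfolding h2_def g2_def by (rule Suc.IH) (rule Suc.prems)
  have h0: "h0 y = (\<integral>\<^sup>+x. \<integral>\<^sup>+ys. \<integral>\<^sup>+zs. G (Suc (?a x)) (?b x) (y ## ys) zs \<partial>S \<partial>S \<partial>S)" if [measurable]: "y \<in> space M" for y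
    unfolding h0_def by (rule Suc.IH[of "\<lambda>k0 k1 ys zs. G (Suc k0) k1 (y ## ys) zs"]) measurable
  have h1: "h1 y = (\<integral>\<^sup>+x. \<integral>\<^sup>+ys. \<integral>\<^sup>+zs. G (?a x) (Suc (?b x)) ys (y ## zs) \<partial>S \<partial>S \<partial>S)" if [measurable]: "y \<in> space M" for y
    unfolding h1_def by (rule Suc.IH[of "\<lambda>k0 k1 ys zs. G k0 (Suc k1) ys (y ## zs)"]) measurable
  have i0: "(\<integral>\<^sup>+y. h0 y \<partial>M) = g0"
  proof -
    have "(\<integral>\<^sup>+y. h0 y \<partial>M) = (\<integral>\<^sup>+y. \<integral>\<^sup>+x. \<integral>\<^sup>+ys. \<integral>\<^sup>+zs. G (Suc (?a x)) (?b x) (y ## ys) zs \<partial>S \<partial>S \<partial>S \<partial>M)"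
      by (rule nn_integral_cong) (rule h0)
    also have "\<dots> = (\<integral>\<^sup>+x. \<integral>\<^sup>+y. \<integral>\<^sup>+ys. \<integral>\<^sup>+zs. G (Suc (?a x)) (?b x) (y ## ys) zs \<partial>S \<partial>S \<partial>M \<partial>S)"
      by (rule MS.Fubini'[symmetric]) measurable
    also have "\<dots> = g0" unfolding g0_def
      by (rule nn_integral_cong, rule nn_integral_stream_space[symmetric]) measurable
    finally show ?thesis .
  qed
  have i1: "(\<integral>\<^sup>+y. h1 y \<partial>M) = g1"
  proof -
    have "(\<integral>\<^sup>+y. h1 y \<partial>M) = (\<integral>\<^sup>+y. \<integral>\<^sup>+x. \<integral>\<^sup>+ys. \<integral>\<^sup>+zs. G (?a x) (Suc (?b x)) ys (y ## zs) \<partial>S \<partial>S \<partial>S \<partial>M)"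
      by (rule nn_integral_cong) (rule h1)
    also have "\<dots> = (\<integral>\<^sup>+x. \<integral>\<^sup>+y. \<integral>\<^sup>+ys. \<integral>\<^sup>+zs. G (?a x) (Suc (?b x)) ys (y ## zs) \<partial>S \<partial>S \<partial>M \<partial>S)"
      by (rule MS.Fubini'[symmetric]) measurable
    also have "\<dots> = (\<integral>\<^sup>+x. \<integral>\<^sup>+ys. \<integral>\<^sup>+y. \<integral>\<^sup>+zs. G (?a x) (Suc (?b x)) ys (y ## zs) \<partial>S \<partial>M \<partial>S \<partial>S)"
      by (rule nn_integral_cong, rule MS.Fubini'[symmetric]) measurable
    also have "\<dots> = g1" unfolding g1_def
      by (rule nn_integral_cong, rule nn_integral_cong, rule nn_integral_stream_space[symmetric]) measurable
    finally show ?thesis .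
  qed
  have "(\<integral>\<^sup>+x. \<integral>\<^sup>+ys. \<integral>\<^sup>+zs. G (select_num A0 (Suc n) x) (select_num A1 (Suc n) x) (select_fill A0 e0 (Suc n) x ys) (select_fill A1 e1 (Suc n) x zs) \<partial>S \<partial>S \<partial>S)
    = (\<integral>\<^sup>+q. \<integral>\<^sup>+x. \<integral>\<^sup>+ys. \<integral>\<^sup>+zs. G (select_num A0 (Suc n) (q ## x)) (select_num A1 (Suc n) (q ## x)) (select_fill A0 e0 (Suc n) (q ## x) ys) (select_fill A1 e1 (Suc n) (q ## x) zs) \<partial>S \<partial>S \<partial>S \<partial>M)"
    by (rule nn_integral_stream_space) measurable
  also have "\<dots> = (\<integral>\<^sup>+q. (if A0 q then h0 (e0 q) else if A1 q then h1 (e1 q) else h2) \<partial>M)"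
    using disj by (intro nn_integral_cong) (auto simp: select_fill_Suc select_num_Suc h0_def h1_def h2_def)
  also have "\<dots> = p0 * g0 + p1 * g1 + (\<integral>\<^sup>+q. (if A0 q \<or> A1 q then 0 else g2) \<partial>M)"
    unfolding nn_integral_types[OF hm] i0 i1 h2 ..
  also have "\<dots> = (\<integral>\<^sup>+q. (if A0 q then (\<lambda>_. g0) (e0 q) else if A1 q then (\<lambda>_. g1) (e1 q) else g2) \<partial>M)"
    by (subst nn_integral_types) (simp_all add: emeasure_space_1)
  also have "\<dots> = (\<integral>\<^sup>+q. \<integral>\<^sup>+x. \<integral>\<^sup>+ys. \<integral>\<^sup>+zs. G (select_num A0 (Suc n) (q ## x)) (select_num A1 (Suc n) (q ## x)) ys zs \<partial>S \<partial>S \<partial>S \<partial>M)"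
    using disj by (intro nn_integral_cong) (auto simp: select_num_Suc g0_def g1_def g2_def)
  also have "\<dots> = (\<integral>\<^sup>+x. \<integral>\<^sup>+ys. \<integral>\<^sup>+zs. G (select_num A0 (Suc n) x) (select_num A1 (Suc n) x) ys zs \<partial>S \<partial>S \<partial>S)"
    by (rule nn_integral_stream_space[symmetric]) measurable
  finally show ?case .
qed simp

text \<open>The recursion of the binomial distribution, obtained by conditioning on the first entry;
  it yields both the second moment and the exact weights by induction.\<close>

lemma nn_integral_select_num_Suc:
  "(\<integral>\<^sup>+x. \<phi> (select_num A0 (Suc n) x) \<partial>S) =
     p0 * (\<integral>\<^sup>+x. \<phi> (Suc (select_num A0 n x)) \<partial>S) + emeasure M {q \<in> space M. \<not> A0 q} * (\<integral>\<^sup>+x. \<phi> (select_num A0 n x) \<partial>S)"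
proof -
  have [measurable]: "\<phi> \<in> borel_measurable (count_space UNIV)" by simp
  have pm [measurable (raw)]: "(\<lambda>x. \<phi> (f x)) \<in> borel_measurable N" if "f \<in> measurable N (count_space UNIV)" for f N
    by (rule measurable_compose[OF that]) simp
  define a b where "a = (\<integral>\<^sup>+x. \<phi> (Suc (select_num A0 n x)) \<partial>S)" and "b = (\<integral>\<^sup>+x. \<phi> (select_num A0 n x) \<partial>S)"
  have "(\<integral>\<^sup>+x. \<phi> (select_num A0 (Suc n) x) \<partial>S) = (\<integral>\<^sup>+q. \<integral>\<^sup>+x. \<phi> (select_num A0 (Suc n) (q ## x)) \<partial>S \<partial>M)"
    by (rule nn_integral_stream_space) measurable
  also have "\<dots> = (\<integral>\<^sup>+q. (if A0 q then (\<lambda>_. a) (e0 q) else 0) + b * indicator {q \<in> space M. \<not> A0 q} q \<partial>M)"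
    by (intro nn_integral_cong) (auto simp: select_num_Suc a_def b_def)
  also have "\<dots> = p0 * a + emeasure M {q \<in> space M. \<not> A0 q} * b"
    using type0[of "\<lambda>_. a"]
    by (subst nn_integral_add) (simp_all add: emeasure_space_1 nn_integral_cmult_indicator mult.commute)
  finally show ?thesis by (simp add: a_def b_def)
qed

lemma p0_eq: "p0 = emeasure M {q \<in> space M. A0 q}"
proof -
  have "p0 = (\<integral>\<^sup>+q. (if A0 q then (\<lambda>_. 1) (e0 q) else 0) \<partial>M)" by (subst type0) (simp_all add: emeasure_space_1)
  also have "\<dots> = (\<integral>\<^sup>+q. indicator {q \<in> space M. A0 q} q \<partial>M)" by (intro nn_integral_cong) auto
  finally show ?thesis by simp
qed

lemma two_types_swap: "two_types M A1 A0 e1 e0 p1 p0"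
  by unfold_locales (use meas disj type0 type1 in auto)

end

section \<open>Uniform pairs and their splitting by a chord\<close>

definition unif :: "real measure" where "unif = uniform_measure lborel {0..1}"

definition unif2 :: "(real \<times> real) measure" where "unif2 = unif \<Otimes>\<^sub>M unif"

lemma sets_unif [measurable_cong, simp]: "sets unif = sets borel"
  by (simp add: unif_def)

lemma space_unif [simp]: "space unif = UNIV"
  by (simp add: unif_def)

lemma prob_space_unif: "prob_space unif"
  unfolding unif_def by (rule prob_space_uniform_measure) auto

lemma sets_unif2 [measurable_cong]: "sets unif2 = sets (borel \<Otimes>\<^sub>M borel)"
  unfolding unif2_def by (rule sets_pair_measure_cong) simp_all

lemma space_unif2 [simp]: "space unif2 = UNIV"
  by (simp add: unif2_def space_pair_measure)

lemma prob_space_unif2: "prob_space unif2"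
proof -
  interpret prob_space unif by (rule prob_space_unif)
  interpret pair_prob_space unif unif ..
  show ?thesis unfolding unif2_def by unfold_locales
qed

interpretation unif2: prob_space unif2 by (rule prob_space_unif2)

lemma nn_integral_unif:
  assumes [measurable]: "f \<in> borel_measurable borel"
  shows "(\<integral>\<^sup>+x. f x \<partial>unif) = (\<integral>\<^sup>+x. f x * indicator {0..<1} x \<partial>lborel)"
proof -
  have "(\<integral>\<^sup>+x. f x \<partial>unif) = (\<integral>\<^sup>+x. f x * indicator {0..1} x \<partial>lborel)"
    unfolding unif_def by (subst nn_integral_uniform_measure) (auto simp: divide_ennreal_def)
  also have "\<dots> = (\<integral>\<^sup>+x. f x * indicator {0..<1} x \<partial>lborel)"
    by (rule nn_integral_cong_AE, rule eventually_mono[OF AE_lborel_singleton[of 1]]) (auto split: split_indicator)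
  finally show ?thesis .
qed

lemma nn_integral_unif2:
  assumes [measurable]: "f \<in> borel_measurable (borel \<Otimes>\<^sub>M borel)"
  shows "(\<integral>\<^sup>+q. f q \<partial>unif2) = (\<integral>\<^sup>+x. \<integral>\<^sup>+y. f (x, y) \<partial>unif \<partial>unif)"
proof -
  interpret prob_space unif by (rule prob_space_unif)
  have "f \<in> borel_measurable (unif \<Otimes>\<^sub>M unif)" by measurable
  from nn_integral_fst[OF this] show ?thesis unfolding unif2_def by simp
qed

lemma AE_unif_neq: "AE x in unif. x \<noteq> a"
  unfolding unif_def by (rule AE_uniform_measureI) (auto intro: eventually_mono[OF AE_lborel_singleton[of a]])

lemma AE_unif_01: "AE x in unif. 0 < x \<and> x < 1"
  unfolding unif_def by (rule AE_uniform_measureI) (auto intro: eventually_mono[OF AE_lborel_neq2[of 0 1]])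

lemma nn_integral_unif_outer:
  assumes [measurable]: "g \<in> borel_measurable borel" and uv: "0 \<le> u" "u < v" "v \<le> 1" "v - u < 1"
  shows "(\<integral>\<^sup>+x. (if \<not> (u \<le> x \<and> x < v) then g (outer_pos u v x) else 0) \<partial>unif) = ennreal (1 - (v - u)) * (\<integral>\<^sup>+x. g x \<partial>unif)"
proof -
  define l where "l = v - u"
  define w where "w = u / (1 - l)"
  have l: "0 < l" "l < 1" using uv by (auto simp: l_def)
  have u: "w * (1 - l) = u" and v: "u + l = v" using l by (auto simp: w_def l_def)
  have w: "0 \<le> w" "w \<le> 1" using uv l by (auto simp: w_def l_def divide_le_eq)
  \<comment> \<open>Setting the value at \<open>w\<close> to 0 removes exactly the contribution of
    the arc, which \<open>outer_pos\<close> maps to \<open>w\<close>; apart from the null point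
    \<open>v\<close>, no point outside the arc is mapped there.\<close>
  define g' where "g' = (\<lambda>y. if y = w then 0 else g y)"
  have [measurable]: "g' \<in> borel_measurable borel" unfolding g'_def by measurable
  have "(\<integral>\<^sup>+x. (if \<not> (u \<le> x \<and> x < v) then g (outer_pos u v x) else 0) \<partial>unif) = (\<integral>\<^sup>+x. g' (outer_pos u v x) \<partial>unif)"
  proof (rule nn_integral_cong_AE, rule eventually_mono[OF AE_unif_neq[of v]])
    fix x assume x: "x \<noteq> v"
    show "(if \<not> (u \<le> x \<and> x < v) then g (outer_pos u v x) else 0) = g' (outer_pos u v x)"
    proof (cases "u \<le> x \<and> x < v")
      case True
      then have "outer_pos u v x = w" by (auto simp: outer_pos_def w_def l_def)
      then show ?thesis using True by (simp add: g'_def)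
    next
      case False
      then have "outer_pos u v x = (if x < u then x else x - (v - u)) / (1 - l)" using uv by (auto simp: outer_pos_def l_def)
      then have "outer_pos u v x \<noteq> w" using False x l by (auto simp: w_def)
      then show ?thesis using False by (auto simp: g'_def)
    qed
  qed
  also have "\<dots> = ennreal (1 - l) * (\<integral>\<^sup>+y. g' y * indicator {0..<1} y \<partial>lborel) + ennreal l * g' w"
    using nn_integral_outer_pos[of g' l w] l w by (subst nn_integral_unif) (simp_all add: u v)
  also have "\<dots> = ennreal (1 - l) * (\<integral>\<^sup>+y. g y * indicator {0..<1} y \<partial>lborel)"
  proof -
    have "(\<integral>\<^sup>+y. g' y * indicator {0..<1} y \<partial>lborel) = (\<integral>\<^sup>+y. g y * indicator {0..<1} y \<partial>lborel)"
      by (rule nn_integral_cong_AE, rule eventually_mono[OF AE_lborel_singleton[of w]]) (auto simp: g'_def)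
    then show ?thesis by (simp add: g'_def)
  qed
  finally show ?thesis by (simp add: nn_integral_unif l_def)
qed

lemma nn_integral_unif_inner:
  assumes [measurable]: "g \<in> borel_measurable borel" and uv: "0 \<le> u" "u < v" "v \<le> 1"
  shows "(\<integral>\<^sup>+x. (if u \<le> x \<and> x < v then g (inner_pos u v x) else 0) \<partial>unif) = ennreal (v - u) * (\<integral>\<^sup>+x. g x \<partial>unif)"
proof -
  define l where "l = v - u"
  have l: "0 < l" and v: "v = u + l" using uv by (auto simp: l_def)
  have "(\<integral>\<^sup>+x. (if u \<le> x \<and> x < v then g (inner_pos u v x) else 0) \<partial>unif) = (\<integral>\<^sup>+s. g ((s - u) / l) * indicator {u..<u + l} s \<partial>lborel)"
    using uv by (subst nn_integral_unif) (auto intro!: nn_integral_cong simp: inner_pos_def l_def split: split_indicator)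
  also have "\<dots> = ennreal l * (\<integral>\<^sup>+y. g ((u + l * y - u) / l) * indicator {u..<u + l} (u + l * y) \<partial>lborel)"
    using l by (subst nn_integral_real_affine[where c = l and t = u]) auto
  also have "(\<lambda>y. g ((u + l * y - u) / l) * indicator {u..<u + l} (u + l * y)) = (\<lambda>y. g y * indicator {0..<1} y)"
    using l by (auto simp: fun_eq_iff zero_le_mult_iff split: split_indicator)
  finally show ?thesis by (simp add: nn_integral_unif l_def)
qed

lemma outer_pair_pred [measurable]: "Measurable.pred unif2 (outer_pair u v)"
  unfolding outer_pair_def[abs_def] by measurable

lemma inner_pair_pred [measurable]: "Measurable.pred unif2 (inner_pair u v)"
  unfolding inner_pair_def[abs_def] by measurable

lemma outer_map_measurable [measurable]: "outer_map u v \<in> measurable unif2 unif2"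
proof -
  have "outer_map u v \<in> measurable unif2 (borel \<Otimes>\<^sub>M borel)" unfolding outer_map_def[abs_def] by measurable
  then show ?thesis by (simp add: measurable_cong_sets[OF refl sets_unif2])
qed

lemma inner_map_measurable [measurable]: "inner_map u v \<in> measurable unif2 unif2"
proof -
  have "inner_map u v \<in> measurable unif2 (borel \<Otimes>\<^sub>M borel)" unfolding inner_map_def[abs_def] by measurable
  then show ?thesis by (simp add: measurable_cong_sets[OF refl sets_unif2])
qed

text \<open>The two end points of a pair are independent and each contributes one factor, which
  gives the squares.\<close>

lemma two_types_unif2:
  assumes uv: "0 \<le> u" "u < v" "v \<le> 1" "v - u < 1"
  shows "two_types unif2 (outer_pair u v) (inner_pair u v) (outer_map u v) (inner_map u v)
     (ennreal ((1 - (v - u))\<^sup>2)) (ennreal ((v - u)\<^sup>2))"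
proof unfold_locales
  show "outer_pair u v q \<Longrightarrow> \<not> inner_pair u v q" for q by (auto simp: outer_pair_def inner_pair_def)
next
  fix G :: "real \<times> real \<Rightarrow> ennreal" assume "G \<in> borel_measurable unif2"
  then have [measurable]: "G \<in> borel_measurable (borel \<Otimes>\<^sub>M borel)" by (simp add: measurable_cong_sets[OF sets_unif2 refl])
  have [measurable]: "(\<lambda>q. if outer_pair u v q then G (outer_map u v q) else 0) \<in> borel_measurable (borel \<Otimes>\<^sub>M borel)"
    unfolding outer_pair_def outer_map_def by measurable
  interpret prob_space unif by (rule prob_space_unif)
  have "(\<integral>\<^sup>+q. (if outer_pair u v q then G (outer_map u v q) else 0) \<partial>unif2) =
    (\<integral>\<^sup>+x. (if \<not> (u \<le> x \<and> x < v) then (\<lambda>x'. \<integral>\<^sup>+y. (if \<not> (u \<le> y \<and> y < v) then G (x', outer_pos u v y) else 0) \<partial>unif) (outer_pos u v x) else 0) \<partial>unif)"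
    by (subst nn_integral_unif2, simp, rule nn_integral_cong) (auto simp: outer_pair_def outer_map_def intro!: nn_integral_cong)
  also have "\<dots> = (\<integral>\<^sup>+x. (if \<not> (u \<le> x \<and> x < v) then (\<lambda>x'. ennreal (1 - (v - u)) * (\<integral>\<^sup>+y. G (x', y) \<partial>unif)) (outer_pos u v x) else 0) \<partial>unif)"
    using uv by (subst nn_integral_unif_outer) simp_all
  also have "\<dots> = ennreal (1 - (v - u)) * (\<integral>\<^sup>+x. ennreal (1 - (v - u)) * (\<integral>\<^sup>+y. G (x, y) \<partial>unif) \<partial>unif)"
    by (rule nn_integral_unif_outer[OF _ uv]) measurable
  also have "\<dots> = ennreal ((1 - (v - u))\<^sup>2) * (\<integral>\<^sup>+q. G q \<partial>unif2)"
    using uv by (subst nn_integral_cmult, simp) (simp add: nn_integral_unif2 power2_eq_square ennreal_mult mult.assoc)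
  finally show "(\<integral>\<^sup>+q. (if outer_pair u v q then G (outer_map u v q) else 0) \<partial>unif2) = ennreal ((1 - (v - u))\<^sup>2) * (\<integral>\<^sup>+q. G q \<partial>unif2)" .
next
  fix G :: "real \<times> real \<Rightarrow> ennreal" assume "G \<in> borel_measurable unif2"
  then have [measurable]: "G \<in> borel_measurable (borel \<Otimes>\<^sub>M borel)" by (simp add: measurable_cong_sets[OF sets_unif2 refl])
  have [measurable]: "(\<lambda>q. if inner_pair u v q then G (inner_map u v q) else 0) \<in> borel_measurable (borel \<Otimes>\<^sub>M borel)"
    unfolding inner_pair_def inner_map_def by measurable
  interpret prob_space unif by (rule prob_space_unif)
  have "(\<integral>\<^sup>+q. (if inner_pair u v q then G (inner_map u v q) else 0) \<partial>unif2) =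
    (\<integral>\<^sup>+x. (if u \<le> x \<and> x < v then (\<lambda>x'. \<integral>\<^sup>+y. (if u \<le> y \<and> y < v then G (x', inner_pos u v y) else 0) \<partial>unif) (inner_pos u v x) else 0) \<partial>unif)"
    by (subst nn_integral_unif2, simp, rule nn_integral_cong) (auto simp: inner_pair_def inner_map_def intro!: nn_integral_cong)
  also have "\<dots> = (\<integral>\<^sup>+x. (if u \<le> x \<and> x < v then (\<lambda>x'. ennreal (v - u) * (\<integral>\<^sup>+y. G (x', y) \<partial>unif)) (inner_pos u v x) else 0) \<partial>unif)"
    using uv by (subst nn_integral_unif_inner) simp_all
  also have "\<dots> = ennreal (v - u) * (\<integral>\<^sup>+x. ennreal (v - u) * (\<integral>\<^sup>+y. G (x, y) \<partial>unif) \<partial>unif)"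
    by (rule nn_integral_unif_inner[OF _ uv(1-3)]) measurable
  also have "\<dots> = ennreal ((v - u)\<^sup>2) * (\<integral>\<^sup>+q. G q \<partial>unif2)"
    using uv by (subst nn_integral_cmult, simp) (simp add: nn_integral_unif2 power2_eq_square ennreal_mult mult.assoc)
  finally show "(\<integral>\<^sup>+q. (if inner_pair u v q then G (inner_map u v q) else 0) \<partial>unif2) = ennreal ((v - u)\<^sup>2) * (\<integral>\<^sup>+q. G q \<partial>unif2)" .
qed measurable

text \<open>Sorting folds two triangles onto one, the source of the factor 2 in
  \<open>uv_law\<close>; the diagonal is null.\<close>

lemma nn_integral_sort_pair:
  assumes [measurable]: "F \<in> borel_measurable (borel \<Otimes>\<^sub>M borel)"
  shows "(\<integral>\<^sup>+q. F (sort_pair q) \<partial>unif2) = (\<integral>\<^sup>+z. F z \<partial>uv_law)"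
proof -
  let ?I = "\<lambda>x y. indicator {0..<1::real} x * indicator {0..<1::real} y :: ennreal"
  let ?L = "\<lambda>x y. F (x, y) * indicator {..y} x * ?I x y"
  have spm [measurable]: "(\<lambda>q. F (sort_pair q)) \<in> borel_measurable (borel \<Otimes>\<^sub>M borel)" unfolding sort_pair_def by measurable
  have Lm: "(\<lambda>z. ?L (fst z) (snd z)) \<in> borel_measurable (borel \<Otimes>\<^sub>M borel)"
  proof -
    have "(\<lambda>z. F (fst z, snd z) * (if fst z \<le> snd z then 1 else 0) * ?I (fst z) (snd z)) \<in> borel_measurable (borel \<Otimes>\<^sub>M borel)"
      by measurable
    then show ?thesis by (rule measurable_cong[THEN iffD1, rotated]) (auto split: split_indicator)
  qed
  have [measurable (raw)]: "(\<lambda>x. ?L (f x) (g x)) \<in> borel_measurable N" if "f \<in> borel_measurable N" "g \<in> borel_measurable N" for f g N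
  proof -
    have "(\<lambda>x. (f x, g x)) \<in> measurable N (borel \<Otimes>\<^sub>M borel)" using that by simp
    from measurable_compose[OF this Lm] show ?thesis by simp
  qed
  have "(\<integral>\<^sup>+q. F (sort_pair q) \<partial>unif2) = (\<integral>\<^sup>+x. \<integral>\<^sup>+y. F (sort_pair (x, y)) * ?I x y \<partial>lborel \<partial>lborel)"
  proof -
    interpret u: prob_space unif by (rule prob_space_unif)
    have [measurable]: "(\<lambda>x. \<integral>\<^sup>+y. F (sort_pair (x, y)) \<partial>unif) \<in> borel_measurable borel"
      unfolding sort_pair_def by measurable
    have "(\<integral>\<^sup>+q. F (sort_pair q) \<partial>unif2) = (\<integral>\<^sup>+x. (\<integral>\<^sup>+y. F (sort_pair (x, y)) \<partial>unif) * indicator {0..<1} x \<partial>lborel)"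
      by (simp add: nn_integral_unif2 nn_integral_unif[of "\<lambda>x. \<integral>\<^sup>+y. F (sort_pair (x, y)) \<partial>unif"])
    also have "\<dots> = (\<integral>\<^sup>+x. \<integral>\<^sup>+y. F (sort_pair (x, y)) * ?I x y \<partial>lborel \<partial>lborel)"
    proof (rule nn_integral_cong)
      fix x :: real
      have [measurable]: "(\<lambda>y. F (sort_pair (x, y))) \<in> borel_measurable borel"
        by (rule measurable_compose[OF _ spm]) simp
      have "(\<integral>\<^sup>+y. F (sort_pair (x, y)) \<partial>unif) * indicator {0..<1} x = (\<integral>\<^sup>+y. F (sort_pair (x, y)) * indicator {0..<1} y * indicator {0..<1} x \<partial>lborel)"
        by (subst nn_integral_unif, measurable) (rule nn_integral_multc[symmetric], measurable)
      then show "(\<integral>\<^sup>+y. F (sort_pair (x, y)) \<partial>unif) * indicator {0..<1} x = (\<integral>\<^sup>+y. F (sort_pair (x, y)) * ?I x y \<partial>lborel)"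
        by (simp add: mult_ac)
    qed
    finally show ?thesis .
  qed
  also have "\<dots> = (\<integral>\<^sup>+x. \<integral>\<^sup>+y. ?L x y + ?L y x \<partial>lborel \<partial>lborel)"
  proof (rule nn_integral_cong, rule nn_integral_cong_AE)
    fix x :: real
    show "AE y in lborel. F (sort_pair (x, y)) * ?I x y = ?L x y + ?L y x"
      by (rule eventually_mono[OF AE_lborel_singleton[of x]]) (auto simp: sort_pair_def min_def max_def split: split_indicator)
  qed
  also have "\<dots> = (\<integral>\<^sup>+x. \<integral>\<^sup>+y. ?L x y \<partial>lborel \<partial>lborel) + (\<integral>\<^sup>+x. \<integral>\<^sup>+y. ?L y x \<partial>lborel \<partial>lborel)"
    by (subst nn_integral_add[symmetric], measurable) (intro nn_integral_cong nn_integral_add; measurable)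
  also have "(\<integral>\<^sup>+x. \<integral>\<^sup>+y. ?L y x \<partial>lborel \<partial>lborel) = (\<integral>\<^sup>+x. \<integral>\<^sup>+y. ?L x y \<partial>lborel \<partial>lborel)"
    by (rule lborel_pair.Fubini') measurable
  also have "(\<integral>\<^sup>+x. \<integral>\<^sup>+y. ?L x y \<partial>lborel \<partial>lborel) + (\<integral>\<^sup>+x. \<integral>\<^sup>+y. ?L x y \<partial>lborel \<partial>lborel) = (\<integral>\<^sup>+x. \<integral>\<^sup>+y. ?L x y * 2 \<partial>lborel \<partial>lborel)"
  proof -
    have "(\<integral>\<^sup>+x. \<integral>\<^sup>+y. ?L x y * 2 \<partial>lborel \<partial>lborel) = (\<integral>\<^sup>+x. (\<integral>\<^sup>+y. ?L x y \<partial>lborel) * 2 \<partial>lborel)"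
      by (intro nn_integral_cong nn_integral_multc) measurable
    also have "\<dots> = (\<integral>\<^sup>+x. \<integral>\<^sup>+y. ?L x y \<partial>lborel \<partial>lborel) * 2"
      by (rule nn_integral_multc) measurable
    finally show ?thesis by (simp only: mult_2_right)
  qed
  also have "\<dots> = (\<integral>\<^sup>+u. \<integral>\<^sup>+v. F (u, v) * 2 * indicator {(u, v). 0 \<le> u \<and> u \<le> v \<and> v \<le> 1} (u, v) \<partial>lborel \<partial>lborel)"
  proof (rule nn_integral_cong, rule nn_integral_cong_AE)
    fix x :: real
    show "AE y in lborel. ?L x y * 2 = F (x, y) * 2 * indicator {(u, v). 0 \<le> u \<and> u \<le> v \<and> v \<le> 1} (x, y)"
      by (rule eventually_mono[OF AE_lborel_singleton[of 1]]) (auto split: split_indicator)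
  qed
  finally show ?thesis by (simp add: nn_integral_uv_law_uv)
qed

section \<open>The stream of uniform pairs\<close>

abbreviation "SU \<equiv> stream_space unif2"

interpretation SU: prob_space SU by (rule unif2.prob_space_stream_space)

text \<open>Measurability is obtained for the predicate, by recursion on \<open>n\<close>, so that
  the list \<open>kept\<close> never has to be treated as a random variable itself.\<close>

lemma crosses_kept_pred:
  "(\<lambda>p. \<exists>c\<in>set (kept (stake n (fst p))). crosses c (snd p)) \<in> measurable (SU \<Otimes>\<^sub>M unif2) (count_space UNIV)"
proof (induction n)
  case (Suc n)
  note Suc [measurable]
  have sn: "stake (Suc n) x = stake n x @ [x !! n]" for x :: "(real \<times> real) stream" by (rule stake_Suc)
  have eq: "(\<exists>c\<in>set (kept (stake (Suc n) x)). crosses c q) \<longleftrightarrow> (\<exists>c\<in>set (kept (stake n x)). crosses c q) \<or>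
      (\<not> (\<exists>c\<in>set (kept (stake n x)). crosses c (x !! n)) \<and> crosses (sort_pair (x !! n)) q)" for x q
    unfolding sn kept_snoc add_chord_def by auto
  have [measurable]: "(\<lambda>p. \<exists>c\<in>set (kept (stake n (fst p))). crosses c (fst p !! n)) \<in> measurable (SU \<Otimes>\<^sub>M unif2) (count_space UNIV)"
    using measurable_compose[OF _ Suc, of "\<lambda>p. (fst p, fst p !! n)" "SU \<Otimes>\<^sub>M unif2"] by simp
  have [measurable]: "(\<lambda>p. crosses (sort_pair (fst p !! n)) (snd p)) \<in> measurable (SU \<Otimes>\<^sub>M unif2) (count_space UNIV)"
    unfolding crosses_def sort_pair_def by measurable
  show ?case unfolding eq by measurable
qed simp

lemma count_over_measurable2:
  "(\<lambda>p. count_over (stake n (fst p)) (snd p)) \<in> measurable (SU \<Otimes>\<^sub>M borel) (count_space UNIV)"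
proof (induction n)
  case 0
  then show ?case by (simp add: count_over_def)
next
  case (Suc n)
  note Suc [measurable]
  have sn: "stake (Suc n) x = stake n x @ [x !! n]" for x :: "(real \<times> real) stream" by (rule stake_Suc)
  have eq: "count_over (stake (Suc n) x) s = count_over (stake n x) s +
      (if \<not> (\<exists>c\<in>set (kept (stake n x)). crosses c (x !! n)) \<and> straddles s (sort_pair (x !! n)) then 1 else 0)" for x s
    unfolding sn count_over_def kept_snoc add_chord_def by auto
  have [measurable]: "(\<lambda>p. \<exists>c\<in>set (kept (stake n (fst p))). crosses c (fst p !! n)) \<in> measurable (SU \<Otimes>\<^sub>M (borel :: real measure)) (count_space UNIV)"
    using measurable_compose[OF _ crosses_kept_pred[of n], of "\<lambda>p. (fst p, fst p !! n)" "SU \<Otimes>\<^sub>M borel"] by simp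
  have [measurable]: "(\<lambda>p. straddles (snd p) (sort_pair (fst p !! n))) \<in> measurable (SU \<Otimes>\<^sub>M borel) (count_space UNIV)"
    unfolding straddles_def sort_pair_def by measurable
  show ?case unfolding eq by measurable
qed

lemma count_over_measurable [measurable (raw)]:
  assumes [measurable]: "f \<in> measurable N SU" "g \<in> borel_measurable N"
  shows "(\<lambda>x. count_over (stake n (f x)) (g x)) \<in> measurable N (count_space UNIV)"
  using measurable_compose[OF _ count_over_measurable2, of "\<lambda>x. (f x, g x)" N n] by simp

lemma AE_stream_avoid: "AE x in SU. \<forall>i. fst (x !! i) \<noteq> v \<and> snd (x !! i) \<noteq> v"
proof -
  interpret u: prob_space unif by (rule prob_space_unif)
  interpret pair_sigma_finite unif unif ..
  have "AE q in unif2. fst q \<noteq> v \<and> snd q \<noteq> v"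
    unfolding unif2_def
  proof (rule AE_pair_measure)
    show "AE x in unif. AE y in unif. fst (x, y) \<noteq> v \<and> snd (x, y) \<noteq> v"
      by (rule eventually_mono[OF AE_unif_neq[of v]]) (simp add: AE_unif_neq)
  qed measurable
  moreover have "Measurable.pred unif2 (\<lambda>q. fst q \<noteq> v \<and> snd q \<noteq> v)" by measurable
  ultimately have "AE x in SU. stream_all (\<lambda>q. fst q \<noteq> v \<and> snd q \<noteq> v) x" by (rule unif2.AE_stream_all[rotated])
  then show ?thesis unfolding stream_all_def .
qed

text \<open>Fubini between head and tail settles the pairs that contain the first entry, and
  shifting the stream settles the others by induction on the smaller index.\<close>

lemma AE_stream_pairs:
  assumes [measurable]: "Measurable.pred (unif2 \<Otimes>\<^sub>M unif2) (\<lambda>p. R (fst p) (snd p))"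
    and R: "\<And>q. AE q' in unif2. R q q'"
  shows "AE x in SU. \<forall>i j. i < j \<longrightarrow> R (x !! i) (x !! j)"
proof -
  have [measurable (raw)]: "Measurable.pred N (\<lambda>x. R (f x) (g x))" if "f \<in> measurable N unif2" "g \<in> measurable N unif2" for f g N
    using measurable_compose[OF _ assms(1), of "\<lambda>x. (f x, g x)" N] that by simp
  have [measurable]: "Measurable.pred SU (\<lambda>x. R (x !! a) (x !! b))" for a b
    using measurable_compose[OF _ assms(1), of "\<lambda>x. (x !! a, x !! b)" SU] by simp
  have m1: "Measurable.pred SU (\<lambda>x. \<forall>j. R (x !! i) (x !! Suc (i + j)))" for i by measurable
  have "AE x in SU. \<forall>j. R (x !! i) (x !! Suc (i + j))" for i
  proof (induction i)
    case 0
    have "AE q in unif2. AE x in SU. \<forall>j. R q (x !! j)"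
    proof (rule AE_I2)
      fix q
      have "AE x in SU. stream_all (R q) x" by (rule unif2.AE_stream_all[OF _ R]) measurable
      then show "AE x in SU. \<forall>j. R q (x !! j)" unfolding stream_all_def .
    qed
    then show ?case by (subst unif2.AE_stream_space[OF m1]) simp
  next
    case (Suc i)
    have "AE q in unif2. AE x in SU. \<forall>j. R ((q ## x) !! Suc i) ((q ## x) !! Suc (Suc i + j))" using Suc by simp
    then show ?case by (subst unif2.AE_stream_space[OF m1])
  qed
  then have "AE x in SU. \<forall>i j. R (x !! i) (x !! Suc (i + j))" by (simp add: AE_all_countable)
  then show ?thesis
  proof eventually_elim
    case (elim x)
    show ?case
    proof (intro allI impI)
      fix i j :: nat assume "i < j"
      then obtain k where "j = Suc (i + k)" using less_imp_Suc_add by auto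
      then show "R (x !! i) (x !! j)" using elim by simp
    qed
  qed
qed

lemma AE_stream_generic:
  "AE x in SU. (\<forall>i. 0 < fst (x !! i) \<and> fst (x !! i) < 1 \<and> 0 < snd (x !! i) \<and> snd (x !! i) < 1 \<and> fst (x !! i) \<noteq> snd (x !! i)) \<and>
    (\<forall>i j. i < j \<longrightarrow> fst (x !! i) \<noteq> fst (x !! j) \<and> fst (x !! i) \<noteq> snd (x !! j) \<and> snd (x !! i) \<noteq> fst (x !! j) \<and> snd (x !! i) \<noteq> snd (x !! j))"
proof -
  interpret u: prob_space unif by (rule prob_space_unif)
  interpret pair_sigma_finite unif unif ..
  have "AE q in unif2. 0 < fst q \<and> fst q < 1 \<and> 0 < snd q \<and> snd q < 1 \<and> fst q \<noteq> snd q"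
    unfolding unif2_def
  proof (rule AE_pair_measure)
    show "AE x in unif. AE y in unif. 0 < fst (x, y) \<and> fst (x, y) < 1 \<and> 0 < snd (x, y) \<and> snd (x, y) < 1 \<and> fst (x, y) \<noteq> snd (x, y)"
    proof (rule eventually_mono[OF AE_unif_01])
      fix x assume x: "0 < x \<and> x < (1::real)"
      show "AE y in unif. 0 < fst (x, y) \<and> fst (x, y) < 1 \<and> 0 < snd (x, y) \<and> snd (x, y) < 1 \<and> fst (x, y) \<noteq> snd (x, y)"
        using AE_unif_01 AE_unif_neq[of x] by eventually_elim (use x in auto)
    qed
  qed measurable
  then have 1: "AE x in SU. stream_all (\<lambda>q. 0 < fst q \<and> fst q < 1 \<and> 0 < snd q \<and> snd q < 1 \<and> fst q \<noteq> snd q) x"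
    by (rule unif2.AE_stream_all[rotated]) measurable
  have 2: "AE x in SU. \<forall>i j. i < j \<longrightarrow> fst (x !! i) \<noteq> fst (x !! j) \<and> fst (x !! i) \<noteq> snd (x !! j) \<and> snd (x !! i) \<noteq> fst (x !! j) \<and> snd (x !! i) \<noteq> snd (x !! j)"
  proof (rule AE_stream_pairs)
    fix q :: "real \<times> real"
    have "AE q' in unif2. (fst q' \<noteq> fst q \<and> fst q' \<noteq> snd q) \<and> (snd q' \<noteq> fst q \<and> snd q' \<noteq> snd q)"
      unfolding unif2_def
    proof (rule AE_pair_measure)
      show "AE x in unif. AE y in unif. (fst (x, y) \<noteq> fst q \<and> fst (x, y) \<noteq> snd q) \<and> (snd (x, y) \<noteq> fst q \<and> snd (x, y) \<noteq> snd q)"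
        using AE_unif_neq[of "fst q"] AE_unif_neq[of "snd q"]
      proof eventually_elim
        case (elim x)
        show ?case using AE_unif_neq[of "fst q"] AE_unif_neq[of "snd q"] by eventually_elim (use elim in auto)
      qed
    qed measurable
    then show "AE q' in unif2. fst q \<noteq> fst q' \<and> fst q \<noteq> snd q' \<and> snd q \<noteq> fst q' \<and> snd q \<noteq> snd q'"
      by eventually_elim auto
  qed measurable
  show ?thesis using 1 2 by eventually_elim (auto simp: stream_all_def)
qed

section \<open>The input sequences as a stream of uniform pairs\<close>

context lamination_input begin

definition input_stream :: "'a \<Rightarrow> (real \<times> real) stream" where
  "input_stream \<omega> = to_stream (\<lambda>i. (U (Suc i) \<omega>, V (Suc i) \<omega>))"

lemma input_pair_measurable: "(\<lambda>\<omega>. (U (Suc i) \<omega>, V (Suc i) \<omega>)) \<in> measurable P (borel \<Otimes>\<^sub>M borel)"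
  using indep_pairs unfolding indep_vars_def by auto

lemma distr_input_pair: "distr P (borel \<Otimes>\<^sub>M borel) (\<lambda>\<omega>. (U (Suc i) \<omega>, V (Suc i) \<omega>)) = unif2"
proof -
  have "indep_var borel (U (Suc i)) borel (V (Suc i))" by (rule indep_within_pair) simp
  then have "distr P borel (U (Suc i)) \<Otimes>\<^sub>M distr P borel (V (Suc i)) = distr P (borel \<Otimes>\<^sub>M borel) (\<lambda>\<omega>. (U (Suc i) \<omega>, V (Suc i) \<omega>))"
    by (subst (asm) indep_var_distribution_eq) blast
  then show ?thesis using uniform_U[of "Suc i"] uniform_V[of "Suc i"] by (simp add: unif2_def unif_def)
qed

lemma input_stream_measurable [measurable]: "input_stream \<in> measurable P SU"
proof (rule measurable_stream_space2)
  fix n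
  have "(\<lambda>\<omega>. input_stream \<omega> !! n) = (\<lambda>\<omega>. (U (Suc n) \<omega>, V (Suc n) \<omega>))"
    by (simp add: input_stream_def to_stream_def)
  then show "(\<lambda>\<omega>. input_stream \<omega> !! n) \<in> measurable P unif2"
    using input_pair_measurable[of n] by (simp add: measurable_cong_sets[OF refl sets_unif2])
qed

text \<open>Independence identifies the joint law with a product measure over the indices from 1 on;
  reindexing by \<open>Suc\<close> and passing to streams turns it into
  \<open>stream_space\<close>.\<close>

lemma distr_input_stream: "distr P SU input_stream = SU"
proof -
  let ?Z = "\<lambda>\<omega>. \<lambda>i\<in>UNIV. (U (Suc i) \<omega>, V (Suc i) \<omega>)"
  let ?B = "\<Pi>\<^sub>M i\<in>(UNIV::nat set). (borel \<Otimes>\<^sub>M borel :: (real \<times> real) measure)"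
  have B: "sets ?B = sets (\<Pi>\<^sub>M i\<in>(UNIV::nat set). unif2)"
    by (rule sets_PiM_cong) (simp_all add: sets_unif2)
  have Z: "distr P ?B ?Z = (\<Pi>\<^sub>M i\<in>UNIV. unif2)"
  proof -
    let ?K = "\<Pi>\<^sub>M i\<in>{1::nat..}. (borel \<Otimes>\<^sub>M borel :: (real \<times> real) measure)"
    let ?Y = "\<lambda>\<omega>. \<lambda>i\<in>{1..}. (U i \<omega>, V i \<omega>)"
    let ?r = "\<lambda>\<omega>. \<lambda>n\<in>UNIV. \<omega> (Suc n)"
    have pm: "(\<lambda>\<omega>. (U i \<omega>, V i \<omega>)) \<in> measurable P (borel \<Otimes>\<^sub>M borel)" if "i \<in> {1..}" for i
      using input_pair_measurable[of "i - 1"] that by simp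
    have K: "sets ?K = sets (\<Pi>\<^sub>M i\<in>{1::nat..}. unif2)"
      by (rule sets_PiM_cong) (simp_all add: sets_unif2)
    have Ym: "?Y \<in> measurable P ?K" by (rule measurable_restrict) (rule pm)
    have "distr P ?K ?Y = (\<Pi>\<^sub>M i\<in>{1..}. distr P (borel \<Otimes>\<^sub>M borel) (\<lambda>\<omega>. (U i \<omega>, V i \<omega>)))"
      using indep_pairs by (subst (asm) indep_vars_iff_distr_eq_PiM') (use pm in auto)
    also have "\<dots> = (\<Pi>\<^sub>M i\<in>{1..}. unif2)"
    proof (rule PiM_cong[OF refl])
      fix i :: nat assume "i \<in> {1..}"
      then show "distr P (borel \<Otimes>\<^sub>M borel) (\<lambda>\<omega>. (U i \<omega>, V i \<omega>)) = unif2"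
        using distr_input_pair[of "i - 1"] by simp
    qed
    finally have DY: "distr P ?K ?Y = (\<Pi>\<^sub>M i\<in>{1..}. unif2)" .
    have rm: "?r \<in> measurable ?K ?B"
      by (rule measurable_restrict) (rule measurable_component_singleton, simp)
    have "distr P ?B ?Z = distr P ?B (?r \<circ> ?Y)" by (rule distr_cong) (auto simp: fun_eq_iff)
    also have "\<dots> = distr (distr P ?K ?Y) ?B ?r" by (rule distr_distr[OF rm Ym, symmetric])
    also have "\<dots> = distr (\<Pi>\<^sub>M i\<in>{1..}. unif2) (\<Pi>\<^sub>M i\<in>UNIV. unif2) ?r"
      unfolding DY by (rule distr_cong) (simp_all add: B)
    also have "\<dots> = (\<Pi>\<^sub>M i\<in>UNIV. unif2)"
      by (rule distr_PiM_reindex) (auto simp: prob_space_unif2)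
    finally show ?thesis .
  qed
  have Zm: "?Z \<in> measurable P ?B"
    by (rule measurable_restrict) (rule input_pair_measurable)
  have ts: "to_stream \<in> measurable ?B SU"
    using measurable_to_stream[of unif2] by (simp add: measurable_cong_sets[OF B refl])
  have "SU = distr (\<Pi>\<^sub>M i\<in>UNIV. unif2) SU to_stream" by (rule stream_space_eq_distr)
  also have "\<dots> = distr (distr P ?B ?Z) SU to_stream" unfolding Z ..
  also have "\<dots> = distr P SU (to_stream \<circ> ?Z)" by (rule distr_distr[OF ts Zm])
  also have "to_stream \<circ> ?Z = input_stream" by (simp add: input_stream_def fun_eq_iff restrict_def)
  finally show ?thesis ..
qed

lemma nn_integral_input_stream:
  "f \<in> borel_measurable SU \<Longrightarrow> (\<integral>\<^sup>+\<omega>. f (input_stream \<omega>) \<partial>P) = (\<integral>\<^sup>+x. f x \<partial>SU)"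
  by (subst distr_input_stream[symmetric], subst nn_integral_distr) simp_all

lemma AE_chord_count: "AE \<omega> in P. \<forall>n s. chord_count (\<lambda>i. U i \<omega>) (\<lambda>i. V i \<omega>) n s = count_over (stake n (input_stream \<omega>)) s"
proof -
  have "AE x in distr P SU input_stream. (\<forall>i. 0 < fst (x !! i) \<and> fst (x !! i) < 1 \<and> 0 < snd (x !! i) \<and> snd (x !! i) < 1 \<and> fst (x !! i) \<noteq> snd (x !! i)) \<and>
    (\<forall>i j. i < j \<longrightarrow> fst (x !! i) \<noteq> fst (x !! j) \<and> fst (x !! i) \<noteq> snd (x !! j) \<and> snd (x !! i) \<noteq> fst (x !! j) \<and> snd (x !! i) \<noteq> snd (x !! j))"
    unfolding distr_input_stream by (rule AE_stream_generic)
  from AE_distrD[OF input_stream_measurable this] show ?thesis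
  proof eventually_elim
    case (elim \<omega>)
    have nth: "input_stream \<omega> !! i = (U (Suc i) \<omega>, V (Suc i) \<omega>)" for i by (simp add: input_stream_def to_stream_def)
    have st: "stake n (input_stream \<omega>) = map (\<lambda>i. (U (Suc i) \<omega>, V (Suc i) \<omega>)) [0..<n]" for n
      by (rule nth_equalityI) (simp_all add: nth)
    have pos: "0 < U i \<omega> \<and> U i \<omega> < 1 \<and> 0 < V i \<omega> \<and> V i \<omega> < 1 \<and> U i \<omega> \<noteq> V i \<omega>" if "1 \<le> i" for i
      using elim[THEN conjunct1, rule_format, of "i - 1"] that by (simp add: nth)
    have dis: "U i \<omega> \<noteq> U j \<omega> \<and> U i \<omega> \<noteq> V j \<omega> \<and> V i \<omega> \<noteq> U j \<omega> \<and> V i \<omega> \<noteq> V j \<omega>" if "1 \<le> i" "i < j" for i j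
      using elim[THEN conjunct2, rule_format, of "i - 1" "j - 1"] that by (simp add: nth)
    show ?case unfolding st using chord_count_eq_count_over[of "\<lambda>i. U i \<omega>" "\<lambda>i. V i \<omega>"] pos dis by blast
  qed
qed

end

subsection \<open>Binomial sums for the mean number of chords\<close>

text \<open>The general term of Gauss's series \<open>2F1(-a, -a; c; 1)\<close>.\<close>

definition gauss_term :: "real \<Rightarrow> real \<Rightarrow> nat \<Rightarrow> real" where
  "gauss_term a c k = (pochhammer (- a) k)\<^sup>2 / (pochhammer c k * fact k)"

lemma gauss_term_0 [simp]: "gauss_term a c 0 = 1"
  by (simp add: gauss_term_def)

text \<open>The saving of one factor against \<open>fact (Suc k)\<close> is what makes the terms of
  the series of order 1/k^2.\<close>

lemma abs_pochhammer_neg_le: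
  fixes a :: real
  assumes a: "0 \<le> a" "a \<le> 1"
  shows "\<bar>pochhammer (- a) (Suc k)\<bar> \<le> a * fact k"
proof (induction k)
  case (Suc k)
  have "\<bar>pochhammer (- a) (Suc (Suc k))\<bar> = \<bar>pochhammer (- a) (Suc k)\<bar> * \<bar>- a + real (Suc k)\<bar>"
    by (subst pochhammer_Suc) (simp only: abs_mult)
  also have "\<dots> \<le> (a * fact k) * real (Suc k)"
    using Suc a by (intro mult_mono) auto
  finally show ?case by (simp add: mult_ac)
qed (use a in simp)

lemma pochhammer_pos_ge1: "c \<ge> (1::real) \<Longrightarrow> pochhammer c k > 0"
  by (rule pochhammer_pos) simp

lemma gauss_term_nonneg: "c \<ge> 1 \<Longrightarrow> gauss_term a c k \<ge> 0"
  unfolding gauss_term_def using pochhammer_pos_ge1[of c k] by (intro divide_nonneg_pos) auto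

lemma pochhammer_ge_mult_fact:
  assumes "c \<ge> (1::real)" shows "pochhammer c (Suc k) \<ge> c * fact (Suc k)"
proof -
  have "pochhammer c (Suc k) = c * pochhammer (c + 1) k" by (rule pochhammer_rec)
  moreover have "fact (Suc k) \<le> pochhammer (c + 1) k"
  proof (induction k)
    case (Suc k)
    have "fact (Suc k) * real (Suc (Suc k)) \<le> pochhammer (c + 1) k * (c + 1 + real k)"
      using Suc assms by (intro mult_mono) (auto intro: order_trans[of 0 "fact (Suc k)"])
    then show ?case by (simp add: pochhammer_Suc mult_ac)
  qed simp
  ultimately show ?thesis using assms by (simp add: mult_left_mono del: fact_Suc)
qed

lemma gauss_term_le:
  assumes a: "0 \<le> a" "a \<le> 1" and c: "c \<ge> 1"
  shows "gauss_term a c (Suc k) \<le> (1 / c) * (1 / (real (Suc k))\<^sup>2)"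
proof -
  have "(pochhammer (- a) (Suc k))\<^sup>2 \<le> (fact k)\<^sup>2"
  proof (rule power2_le_iff_abs_le[THEN iffD2])
    have "a * fact k \<le> 1 * fact k" using a by (intro mult_right_mono) auto
    then have "a * fact k \<le> fact k" by (simp only: mult_1)
    from order_trans[OF abs_pochhammer_neg_le[OF a] this]
    show "\<bar>pochhammer (- a) (Suc k)\<bar> \<le> fact k" .
  qed simp
  moreover have "pochhammer c (Suc k) * fact (Suc k) \<ge> (c * fact (Suc k)) * fact (Suc k)"
    using pochhammer_ge_mult_fact[OF c] by (intro mult_right_mono) auto
  ultimately have "gauss_term a c (Suc k) \<le> (fact k)\<^sup>2 / ((c * fact (Suc k)) * fact (Suc k))"
    unfolding gauss_term_def using c by (intro frac_le) auto
  also have "\<dots> = (1 / c) * (1 / (real (Suc k))\<^sup>2)"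
  proof -
    have e: "F\<^sup>2 / ((c * (S * F)) * (S * F)) = (1 / c) * (1 / S\<^sup>2)" if "F \<noteq> 0" for F S :: real
      using that by (simp add: power2_eq_square)
    show ?thesis using e[of "fact k" "real (Suc k)"] by (simp only: fact_Suc of_nat_mult of_nat_fact fact_nonzero not_False_eq_True simp_thms)
  qed
  finally show ?thesis .
qed

lemma inverse_squares_Suc_summable: "summable (\<lambda>k. 1 / (real (Suc k))\<^sup>2)"
  using inverse_power_summable[of 2, where 'a = real] summable_Suc_iff[of "\<lambda>k. 1 / (real k)\<^sup>2"]
  by (simp add: inverse_eq_divide)

lemma gauss_term_summable:
  assumes a: "0 \<le> a" "a \<le> 1" and c: "c \<ge> 1"
  shows "summable (gauss_term a c)"
proof -
  have "summable (\<lambda>k. gauss_term a c (Suc k))"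
  proof (rule summable_comparison_test'[OF summable_mult[OF inverse_squares_Suc_summable, of "1 / c"]])
    show "norm (gauss_term a c (Suc n)) \<le> 1 / c * (1 / (real (Suc n))\<^sup>2)" if "n \<ge> 0" for n
      using gauss_term_le[OF a c, of n] gauss_term_nonneg[OF c, of a "Suc n"] by simp
  qed
  then show ?thesis by (simp only: summable_Suc_iff)
qed

lemma gauss_term_Suc:
  assumes "c \<ge> 1"
  shows "gauss_term a c (Suc k) = gauss_term a c k * (real k - a)\<^sup>2 / ((c + real k) * real (Suc k))"
  unfolding gauss_term_def using pochhammer_pos_ge1[OF assms, of k] assms
  by (simp add: pochhammer_Suc power_mult_distrib)

lemma gauss_term_shift:
  assumes "c \<ge> 1"
  shows "gauss_term a (c + 1) k = gauss_term a c k * c / (c + real k)"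
proof -
  have "c * pochhammer (c + 1) k = pochhammer c k * (c + real k)"
    using pochhammer_rec[of c k] pochhammer_Suc[of c k] by simp
  moreover have "pochhammer c k > 0" "pochhammer (c + 1) k > 0" "c + real k > 0"
    using assms pochhammer_pos_ge1[of c k] pochhammer_pos_ge1[of "c + 1" k] by auto
  ultimately show ?thesis unfolding gauss_term_def using assms
    by (simp add: divide_simps mult_ac)
qed

text \<open>A contiguous relation proved by telescoping: the difference of the two sides, summed
  over \<open>k < N\<close>, is the single boundary term
  \<open>- c * real N * gauss_term a c N\<close>, which tends to 0.\<close>

lemma gauss_contiguous:
  assumes a: "0 \<le> a" "a \<le> 1" and c: "c \<ge> 1"
  shows "c * (c + 2 * a) * (\<Sum>k. gauss_term a c k) = (c + a)\<^sup>2 * (\<Sum>k. gauss_term a (c + 1) k)"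
proof -
  have c1: "c + 1 \<ge> 1" using c by simp
  have part: "(\<Sum>k<N. c * (c + 2 * a) * gauss_term a c k - (c + a)\<^sup>2 * gauss_term a (c + 1) k) = - c * real N * gauss_term a c N" for N
  proof (induction N)
    case (Suc N)
    define t where "t = gauss_term a c N"
    have p: "c + real N > 0" using c by simp
    have 1: "gauss_term a (c + 1) N = t * c / (c + real N)" using gauss_term_shift[OF c] by (simp add: t_def)
    have 2: "real (Suc N) * gauss_term a c (Suc N) = t * (real N - a)\<^sup>2 / (c + real N)"
      using gauss_term_Suc[OF c, of a N] p by (simp add: t_def)
    have "- c * real (Suc N) * gauss_term a c (Suc N) = - c * (t * (real N - a)\<^sup>2 / (c + real N))"
      using 2 by (simp add: mult.assoc)
    also have "\<dots> = - c * real N * t + (c * (c + 2 * a) * t - (c + a)\<^sup>2 * (t * c / (c + real N)))"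
      using p by (simp add: divide_simps) (simp add: algebra_simps power2_eq_square)
    finally show ?case using Suc 1 by (simp add: t_def)
  qed simp
  have lim0: "(\<lambda>N. - c * real N * gauss_term a c N) \<longlonglongrightarrow> 0"
  proof (rule LIMSEQ_imp_Suc, rule Lim_null_comparison)
    show "\<forall>\<^sub>F n in sequentially. norm (- c * real (Suc n) * gauss_term a c (Suc n)) \<le> 1 / real (Suc n)"
    proof (intro always_eventually allI)
      fix n
      have "norm (- c * real (Suc n) * gauss_term a c (Suc n)) = c * real (Suc n) * gauss_term a c (Suc n)"
        using c gauss_term_nonneg[OF c, of a "Suc n"] by (simp add: abs_mult)
      also have "\<dots> \<le> c * real (Suc n) * ((1 / c) * (1 / (real (Suc n))\<^sup>2))"
        using c gauss_term_le[OF a c, of n] by (intro mult_left_mono) auto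
      also have "\<dots> = 1 / real (Suc n)"
      proof -
        have e: "c * S * ((1 / c) * (1 / S\<^sup>2)) = 1 / S" if "S \<noteq> 0" for S :: real
          using that c by (simp add: power2_eq_square)
        show ?thesis by (rule e) simp
      qed
      finally show "norm (- c * real (Suc n) * gauss_term a c (Suc n)) \<le> 1 / real (Suc n)" .
    qed
    show "(\<lambda>n. 1 / real (Suc n)) \<longlonglongrightarrow> 0" using LIMSEQ_inverse_real_of_nat by (simp add: inverse_eq_divide)
  qed
  have "(\<lambda>k. c * (c + 2 * a) * gauss_term a c k - (c + a)\<^sup>2 * gauss_term a (c + 1) k) sums
     (c * (c + 2 * a) * (\<Sum>k. gauss_term a c k) - (c + a)\<^sup>2 * (\<Sum>k. gauss_term a (c + 1) k))"
    by (intro sums_diff sums_mult summable_sums gauss_term_summable a c c1)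
  moreover have "(\<lambda>k. c * (c + 2 * a) * gauss_term a c k - (c + a)\<^sup>2 * gauss_term a (c + 1) k) sums 0"
    unfolding sums_def part by (rule lim0)
  ultimately show ?thesis using sums_unique2 by fastforce
qed

text \<open>All terms except the one with \<open>k = 0\<close> are bounded by a fixed summable
  sequence times \<open>1 / (c + real N)\<close>.\<close>

lemma gauss_sum_tendsto_1:
  assumes a: "0 \<le> a" "a \<le> 1" and c: "c \<ge> 1"
  shows "(\<lambda>N. \<Sum>k. gauss_term a (c + real N) k) \<longlonglongrightarrow> 1"
proof -
  define Z where "Z = (\<Sum>k. 1 / (real (Suc k))\<^sup>2)"
  have cN: "c + real N \<ge> 1" for N using c by simp
  have eq: "(\<Sum>k. gauss_term a (c + real N) k) = 1 + (\<Sum>k. gauss_term a (c + real N) (Suc k))" for N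
    using suminf_split_head[OF gauss_term_summable[OF a cN[of N]]] by simp
  have "(\<lambda>N. \<Sum>k. gauss_term a (c + real N) (Suc k)) \<longlonglongrightarrow> 0"
  proof (rule tendsto_sandwich)
    have s: "summable (\<lambda>k. gauss_term a (c + real N) (Suc k))" for N
      using gauss_term_summable[OF a cN[of N]] by (simp only: summable_Suc_iff)
    show "\<forall>\<^sub>F N in sequentially. 0 \<le> (\<Sum>k. gauss_term a (c + real N) (Suc k))"
      by (intro always_eventually allI suminf_nonneg s gauss_term_nonneg cN)
    have "(\<Sum>k. gauss_term a (c + real N) (Suc k)) \<le> (1 / (c + real N)) * Z" for N
      unfolding Z_def suminf_mult[OF inverse_squares_Suc_summable, symmetric]
      by (intro suminf_le s summable_mult inverse_squares_Suc_summable gauss_term_le a cN)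
    then show "\<forall>\<^sub>F N in sequentially. (\<Sum>k. gauss_term a (c + real N) (Suc k)) \<le> (1 / (c + real N)) * Z"
      by (intro always_eventually) blast
    show "(\<lambda>N. (1 / (c + real N)) * Z) \<longlonglongrightarrow> 0" by real_asymp
  qed auto
  from tendsto_add[OF tendsto_const[of 1] this] show ?thesis by (simp add: eq)
qed

lemma Gamma_ratio_tendsto:
  assumes a: "0 \<le> a" and c: "c \<ge> (1::real)"
  shows "(\<lambda>N. (pochhammer (c + a) N)\<^sup>2 / (pochhammer c N * pochhammer (c + 2 * a) N)) \<longlonglongrightarrow> Gamma c * Gamma (c + 2 * a) / (Gamma (c + a))\<^sup>2"
proof -
  have p: "pochhammer c N > 0" "pochhammer (c + a) N > 0" "pochhammer (c + 2 * a) N > 0" for N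
    using a c by (auto intro!: pochhammer_pos)
  have "Gamma (c + a) > 0" by (rule Gamma_real_pos) (use a c in simp)
  then have G: "Gamma (c + a) \<noteq> 0" by simp
  have "(\<lambda>N. Gamma_series c N * Gamma_series (c + 2 * a) N / (Gamma_series (c + a) N)\<^sup>2) \<longlonglongrightarrow> Gamma c * Gamma (c + 2 * a) / (Gamma (c + a))\<^sup>2"
    using G by (intro tendsto_intros Gamma_series_LIMSEQ) auto
  moreover have "Gamma_series c N * Gamma_series (c + 2 * a) N / (Gamma_series (c + a) N)\<^sup>2
      = (pochhammer (c + a) (Suc N))\<^sup>2 / (pochhammer c (Suc N) * pochhammer (c + 2 * a) (Suc N))" for N
  proof -
    define L where "L = ln (real N)"
    have e: "exp (c * L) * exp ((c + 2 * a) * L) = (exp ((c + a) * L))\<^sup>2"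
      by (simp add: exp_add[symmetric] power2_eq_square algebra_simps)
    have "Gamma_series c N * Gamma_series (c + 2 * a) N = (fact N)\<^sup>2 * (exp ((c + a) * L))\<^sup>2 / (pochhammer c (Suc N) * pochhammer (c + 2 * a) (Suc N))"
      unfolding Gamma_series_def e[symmetric] by (simp add: L_def power2_eq_square)
    moreover have "(Gamma_series (c + a) N)\<^sup>2 = (fact N)\<^sup>2 * (exp ((c + a) * L))\<^sup>2 / (pochhammer (c + a) (Suc N))\<^sup>2"
      unfolding Gamma_series_def by (simp add: L_def power_mult_distrib power_divide)
    moreover have "(fact N)\<^sup>2 * (exp ((c + a) * L))\<^sup>2 \<noteq> 0" by simp
    moreover have "(K / D) / (K / E) = E / D" if "K \<noteq> 0" for K D E :: real using that by simp
    ultimately show ?thesis by (simp only:)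
  qed
  ultimately have "(\<lambda>N. (pochhammer (c + a) (Suc N))\<^sup>2 / (pochhammer c (Suc N) * pochhammer (c + 2 * a) (Suc N))) \<longlonglongrightarrow> Gamma c * Gamma (c + 2 * a) / (Gamma (c + a))\<^sup>2"
    by simp
  then show ?thesis by (rule LIMSEQ_imp_Suc)
qed

text \<open>A case of Gauss's summation theorem. Iterating the contiguous relation moves
  \<open>c\<close> to \<open>c + real N\<close>, where the series tends to 1, and the accumulated
  factors tend to the quotient of Gamma values.\<close>

theorem gauss_sum:
  assumes a: "0 \<le> a" "a \<le> 1" and c: "c \<ge> 1"
  shows "(\<Sum>k. gauss_term a c k) = Gamma c * Gamma (c + 2 * a) / (Gamma (c + a))\<^sup>2"
proof -
  have it: "(\<Sum>k. gauss_term a c k) = (pochhammer (c + a) N)\<^sup>2 / (pochhammer c N * pochhammer (c + 2 * a) N) * (\<Sum>k. gauss_term a (c + real N) k)" for N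
  proof (induction N)
    case (Suc N)
    have cN: "c + real N \<ge> 1" using c by simp
    have "(\<Sum>k. gauss_term a (c + real N) k) = (c + a + real N)\<^sup>2 / ((c + real N) * (c + 2 * a + real N)) * (\<Sum>k. gauss_term a (c + real (Suc N)) k)"
    proof -
      have div: "F = B / A * F'" if "A * F = B * F'" "A \<noteq> 0" for A B F F' :: real using that by (simp add: field_simps)
      have "(c + real N) * (c + real N + 2 * a) \<noteq> 0" using a c by simp
      from div[OF gauss_contiguous[OF a cN] this] show ?thesis by (simp add: ac_simps)
    qed
    then show ?case by (subst Suc) (simp add: pochhammer_Suc power_mult_distrib mult_ac)
  qed simp
  have "(\<lambda>N. (pochhammer (c + a) N)\<^sup>2 / (pochhammer c N * pochhammer (c + 2 * a) N) * (\<Sum>k. gauss_term a (c + real N) k))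
     \<longlonglongrightarrow> Gamma c * Gamma (c + 2 * a) / (Gamma (c + a))\<^sup>2 * 1"
    by (intro tendsto_mult Gamma_ratio_tendsto gauss_sum_tendsto_1 a c)
  then have "(\<lambda>N::nat. (\<Sum>k. gauss_term a c k)) \<longlonglongrightarrow> Gamma c * Gamma (c + 2 * a) / (Gamma (c + a))\<^sup>2 * 1"
    unfolding it[symmetric] .
  then show ?thesis by (simp add: LIMSEQ_const_iff)
qed

text \<open>Coefficients, in the basis \<open>n choose k\<close>, of the solution of the recursion
  for the mean. The two Pochhammer parameters come from the factorisation of
  \<open>2 * k^2 + 3 * k - 1\<close> as
  \<open>2 * (k - lam_beta / 2) * (k + (lam_beta + 3) / 2)\<close>, see
  \<open>binom_coeff_rec\<close>.\<close>

definition binom_coeff :: "nat \<Rightarrow> real" where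
  "binom_coeff k = (- 1) ^ k * pochhammer (- (lam_beta / 2)) k * pochhammer ((lam_beta + 3) / 2) k / (pochhammer (3 / 2) k * fact k)"

text \<open>One more than the mean number of chords over a uniform point
  (\<open>mean_area_eq_mean_count\<close>); the added 1 absorbs the first chord and makes the
  recursion homogeneous. In hypergeometric notation this is
  \<open>3F2(-n, - lam_beta / 2, (lam_beta + 3) / 2; 3 / 2, 1; 1)\<close>.\<close>

definition mean_count :: "nat \<Rightarrow> real" where
  "mean_count n = (\<Sum>k\<le>n. real (n choose k) * binom_coeff k)"

text \<open>The coefficients of the power series of
  \<open>(1 - x) powr (- 1 - lam_beta / 2)\<close>.\<close>

definition growth :: "nat \<Rightarrow> real" where
  "growth m = pochhammer (1 + lam_beta / 2) m / fact m"

text \<open>The factor on the left is the mean of \<open>(1 - l) ^ (2 * k) + l ^ (2 * k + 1)\<close>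
  under the density \<open>2 * (1 - l)\<close>, that is, the effect of the first chord on
  \<open>n choose k\<close>; the right side is the effect of raising \<open>n\<close> by one, see
  \<open>mean_count_Suc\<close>.\<close>

lemma binom_coeff_rec:
  "(1 / (real k + 1) + 1 / ((real k + 1) * (2 * real k + 3))) * binom_coeff k = binom_coeff k + binom_coeff (Suc k)"
proof -
  have q: "lam_beta\<^sup>2 + 3 * lam_beta = 2" unfolding lam_beta_def by (simp add: power2_eq_square field_simps)
  define t where "t = binom_coeff k"
  have "pochhammer (3 / 2 :: real) k > 0" by (rule pochhammer_pos) simp
  then have "binom_coeff (Suc k) = - t * ((real k - lam_beta / 2) * (real k + (lam_beta + 3) / 2)) / ((3 / 2 + real k) * (real k + 1))"
    unfolding binom_coeff_def t_def by (simp add: pochhammer_Suc) (simp add: field_simps)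
  also have "(real k - lam_beta / 2) * (real k + (lam_beta + 3) / 2) = (2 * (real k)\<^sup>2 + 3 * real k - 1) / 2"
    using q by (simp add: field_simps power2_eq_square)
  finally have s: "binom_coeff (Suc k) = - t * ((2 * (real k)\<^sup>2 + 3 * real k - 1) / 2) / ((3 / 2 + real k) * (real k + 1))" .
  have nz: "2 * real k + 3 \<noteq> 0" "real k + 1 \<noteq> 0" by linarith+
  have "(2 * (real k)\<^sup>2 + 3 * real k - 1) / 2 / ((3 / 2 + real k) * (real k + 1)) = (2 * (real k)\<^sup>2 + 3 * real k - 1) / ((2 * real k + 3) * (real k + 1))"
    by (simp add: divide_simps) (simp add: algebra_simps)
  then have s': "binom_coeff (Suc k) = - t * ((2 * (real k)\<^sup>2 + 3 * real k - 1) / ((2 * real k + 3) * (real k + 1)))"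
    using s by (metis times_divide_eq_right)
  have r: "1 / (real k + 1) + 1 / ((real k + 1) * (2 * real k + 3)) = 1 - (2 * (real k)\<^sup>2 + 3 * real k - 1) / ((2 * real k + 3) * (real k + 1))"
    using nz by (simp add: divide_simps) (simp add: algebra_simps power2_eq_square)
  have "(1 - w) * t = t + - t * w" for w by (simp add: algebra_simps)
  then show ?thesis unfolding r s' t_def[symmetric] .
qed

lemma mean_count_Suc: "mean_count (Suc n) = (\<Sum>k\<le>n. real (n choose k) * (binom_coeff k + binom_coeff (Suc k)))"
proof -
  have "mean_count (Suc n) = binom_coeff 0 + (\<Sum>k\<le>n. real (Suc n choose Suc k) * binom_coeff (Suc k))"
    unfolding mean_count_def by (subst sum.atMost_Suc_shift) simp
  also have "\<dots> = (\<Sum>k\<le>n. real (n choose k) * binom_coeff (Suc k)) + (binom_coeff 0 + (\<Sum>k\<le>n. real (n choose Suc k) * binom_coeff (Suc k)))"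
    by (simp add: sum.distrib distrib_right)
  also have "binom_coeff 0 + (\<Sum>k\<le>n. real (n choose Suc k) * binom_coeff (Suc k)) = (\<Sum>k\<le>Suc n. real (n choose k) * binom_coeff k)"
    by (subst sum.atMost_Suc_shift) simp
  also have "\<dots> = (\<Sum>k\<le>n. real (n choose k) * binom_coeff k)" by simp
  finally show ?thesis by (simp add: sum.distrib distrib_left)
qed

lemma pochhammer_convolution:
  "pochhammer (x + y) m / fact m = (\<Sum>i\<le>m. (pochhammer x i / fact i) * (pochhammer y (m - i) / fact (m - i)) :: real)"
proof -
  have "pochhammer (x + y) m / fact m = (\<Sum>i\<le>m. real (m choose i) * pochhammer x i * pochhammer y (m - i)) / fact m"
    by (subst pochhammer_binomial_sum) simp
  also have "\<dots> = (\<Sum>i\<le>m. (pochhammer x i / fact i) * (pochhammer y (m - i) / fact (m - i)))"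
    unfolding sum_divide_distrib by (intro sum.cong refl) (simp add: binomial_fact field_simps)
  finally show ?thesis .
qed

text \<open>A terminating series evaluated by the Chu-Vandermonde identity; the Pochhammer factor
  gets squared because \<open>3 / 2 - (lam_beta + 3) / 2 = - (lam_beta / 2)\<close>.\<close>

lemma gauss_term_binom_coeff:
  "gauss_term (lam_beta / 2) (3 / 2) j = (\<Sum>k\<le>j. binom_coeff k * (pochhammer (- (lam_beta / 2) + real k) (j - k) / fact (j - k)))"
proof -
  define a where "a = - (lam_beta / 2)"
  define b where "b = (lam_beta + 3) / 2"
  have "(\<Sum>k\<le>j. binom_coeff k * (pochhammer (a + real k) (j - k) / fact (j - k))) =
    (\<Sum>k\<le>j. pochhammer a j / fact j * ((pochhammer b k * pochhammer (- real j) k) / (fact k * pochhammer (3 / 2) k)))"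
  proof (rule sum.cong[OF refl])
    fix k assume "k \<in> {..j}"
    then have k: "k \<le> j" by simp
    have 1: "pochhammer a j = pochhammer a k * pochhammer (a + real k) (j - k)"
      using pochhammer_product[OF k, of a] by simp
    have 2: "pochhammer (- real j) k = (- 1) ^ k * (fact j / fact (j - k))"
    proof -
      have "pochhammer (- real j) k = (- 1) ^ k * (fact k * real (j choose k))"
        using binomial_fact'[OF k] gbinomial_pochhammer[of "real j" k] binomial_gbinomial[of j k, where 'a = real]
        by (simp add: field_simps power_mult_distrib flip: power_add)
      also have "fact k * real (j choose k) = fact j / fact (j - k)"
        using k by (simp add: binomial_fact)
      finally show ?thesis .
    qed
    have p: "pochhammer (3 / 2 :: real) k > 0" by (rule pochhammer_pos) simp
    show "binom_coeff k * (pochhammer (a + real k) (j - k) / fact (j - k)) =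
       pochhammer a j / fact j * ((pochhammer b k * pochhammer (- real j) k) / (fact k * pochhammer (3 / 2) k))"
      unfolding 1 2 binom_coeff_def a_def[symmetric] b_def[symmetric] using p by (simp add: field_simps)
  qed
  also have "\<dots> = pochhammer a j / fact j * (\<Sum>k\<in>{0..j}. (pochhammer b k * pochhammer (- real j) k) / (of_nat (fact k) * pochhammer (3 / 2) k))"
    by (simp add: sum_distrib_left atMost_atLeast0)
  also have "(\<Sum>k\<in>{0..j}. (pochhammer b k * pochhammer (- real j) k) / (of_nat (fact k) * pochhammer (3 / 2) k)) = pochhammer (3 / 2 - b) j / pochhammer (3 / 2) j"
  proof (rule Vandermonde_pochhammer, rule ballI)
    fix i show "(3 / 2 :: real) \<noteq> - real i" by linarith
  qed
  also have "3 / 2 - b = a" by (simp add: a_def b_def field_simps)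
  finally show ?thesis by (simp add: gauss_term_def a_def power2_eq_square mult_ac)
qed

text \<open>Pfaff's transformation read off coefficient by coefficient: the generating function of
  \<open>mean_count\<close> is \<open>(1 - x) powr (- 1 - lam_beta / 2)\<close> times
  \<open>2F1(- lam_beta / 2, - lam_beta / 2; 3 / 2; x)\<close>. An alternating sum becomes one with
  non-negative terms, from which the growth can be read.\<close>

lemma mean_count_convolution:
  "mean_count n = (\<Sum>j\<le>n. gauss_term (lam_beta / 2) (3 / 2) j * growth (n - j))"
proof -
  define a where "a = - (lam_beta / 2)"
  define y where "y = 1 + lam_beta / 2"
  have "(\<Sum>j\<le>n. gauss_term (lam_beta / 2) (3 / 2) j * growth (n - j)) =
    (\<Sum>j\<le>n. \<Sum>k\<le>j. binom_coeff k * (pochhammer (a + real k) (j - k) / fact (j - k)) * (pochhammer y (n - j) / fact (n - j)))"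
    unfolding gauss_term_binom_coeff growth_def a_def y_def by (simp only: sum_distrib_right)
  also have "\<dots> = (\<Sum>k\<le>n. \<Sum>j\<in>{k..n}. binom_coeff k * (pochhammer (a + real k) (j - k) / fact (j - k)) * (pochhammer y (n - j) / fact (n - j)))"
    by (subst sum.triangle_reindex_eq[symmetric] | rule sum.swap_restrict[THEN trans])?
       (simp add: sum.Sigma, rule sum.reindex_bij_witness[of _ "\<lambda>(a, b). (b, a)" "\<lambda>(a, b). (b, a)"], auto)
  also have "\<dots> = (\<Sum>k\<le>n. real (n choose k) * binom_coeff k)"
  proof (rule sum.cong[OF refl])
    fix k assume "k \<in> {..n}"
    then have k: "k \<le> n" by simp
    have "(\<Sum>j\<in>{k..n}. binom_coeff k * (pochhammer (a + real k) (j - k) / fact (j - k)) * (pochhammer y (n - j) / fact (n - j)))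
      = (\<Sum>i\<le>n - k. binom_coeff k * ((pochhammer (a + real k) i / fact i) * (pochhammer y (n - k - i) / fact (n - k - i))))"
      by (rule sum.reindex_bij_witness[of _ "\<lambda>i. i + k" "\<lambda>j. j - k"]) (use k in auto)
    also have "\<dots> = binom_coeff k * (pochhammer (a + real k + y) (n - k) / fact (n - k))"
      unfolding sum_distrib_left[symmetric] pochhammer_convolution ..
    also have "a + real k + y = real k + 1" by (simp add: a_def y_def)
    also have "pochhammer (real k + 1) (n - k) / fact (n - k) = real (n choose k)"
    proof -
      have "fact n = pochhammer 1 k * pochhammer (1 + real k) (n - k)"
        using pochhammer_product[OF k, of "1::real"] by (simp add: pochhammer_fact)
      then show ?thesis using k by (simp add: binomial_fact pochhammer_fact[symmetric] add.commute field_simps)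
    qed
    finally show "(\<Sum>j\<in>{k..n}. binom_coeff k * (pochhammer (a + real k) (j - k) / fact (j - k)) * (pochhammer y (n - j) / fact (n - j))) = real (n choose k) * binom_coeff k"
      by simp
  qed
  finally show ?thesis by (simp add: mean_count_def)
qed

lemma growth_pos: "growth n > 0"
  unfolding growth_def using lam_beta_pos lam_beta_less_1 by (intro divide_pos_pos pochhammer_pos) auto

lemma growth_Suc: "growth (Suc n) = growth n * ((1 + lam_beta / 2 + real n) / (real n + 1))"
  unfolding growth_def by (simp add: pochhammer_Suc field_simps)

lemma growth_mono: "m \<le> n \<Longrightarrow> growth m \<le> growth n"
proof (rule lift_Suc_mono_le[of growth])
  fix n
  have "growth n * 1 \<le> growth n * ((1 + lam_beta / 2 + real n) / (real n + 1))"
    using growth_pos[of n] lam_beta_pos lam_beta_less_1 by (intro mult_left_mono) (auto simp: field_simps)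
  then show "growth n \<le> growth (Suc n)" by (simp add: growth_Suc)
qed

lemma growth_asymp: "(\<lambda>n. growth n / real n powr (lam_beta / 2)) \<longlonglongrightarrow> 1 / Gamma (1 + lam_beta / 2)"
proof -
  define al where "al = lam_beta / 2"
  have al: "al > 0" using lam_beta_pos lam_beta_less_1 by (simp add: al_def)
  have "al \<notin> \<int>\<^sub>\<le>\<^sub>0" using al by (auto dest: nonpos_Ints_nonpos)
  then have G: "Gamma (1 + al) = al * Gamma al"
    using Gamma_plus1[of al] by (simp add: add.commute)
  have nz: "Gamma al \<noteq> 0" using Gamma_real_pos[OF al] by simp
  have "(\<lambda>n. inverse (al * Gamma_series al n)) \<longlonglongrightarrow> inverse (al * Gamma al)"
    using al nz by (intro tendsto_intros Gamma_series_LIMSEQ) auto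
  then have "(\<lambda>n. inverse (al * Gamma_series al n)) \<longlonglongrightarrow> 1 / Gamma (1 + al)"
    by (simp add: G inverse_eq_divide)
  moreover have "\<forall>\<^sub>F n in sequentially. inverse (al * Gamma_series al n) = growth n / real n powr al"
    using eventually_gt_at_top[of 0]
  proof eventually_elim
    case (elim n)
    have "pochhammer al (n + 1) = al * pochhammer (1 + al) n"
      using pochhammer_rec[of al n] by (simp add: add.commute)
    then show ?case using elim al
      by (simp add: Gamma_series_def growth_def al_def[symmetric] powr_def field_simps)
  qed
  ultimately show ?thesis unfolding al_def[symmetric] by (rule Lim_transform_eventually)
qed

lemma growth_ratio: "(\<lambda>n. growth (n - k) / growth n) \<longlonglongrightarrow> 1"
proof -
  have step: "(\<lambda>n. growth n / growth (n + k)) \<longlonglongrightarrow> 1"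
  proof (induction k)
    case 0 show ?case using growth_pos by (simp add: less_imp_neq[symmetric])
  next
    case (Suc k)
    have "(\<lambda>n. (real (n + k) + 1) / (1 + lam_beta / 2 + real (n + k))) \<longlonglongrightarrow> 1" by real_asymp
    from tendsto_mult[OF Suc this]
    have "(\<lambda>n. growth n / growth (n + k) * ((real (n + k) + 1) / (1 + lam_beta / 2 + real (n + k)))) \<longlonglongrightarrow> 1" by simp
    moreover have "growth n / growth (n + k) * ((real (n + k) + 1) / (1 + lam_beta / 2 + real (n + k))) = growth n / growth (n + Suc k)" for n
      using growth_pos[of "n + k"] lam_beta_pos lam_beta_less_1 by (simp add: growth_Suc)
    ultimately show ?case by simp
  qed
  have "(\<lambda>n. growth (n + k - k) / growth (n + k)) \<longlonglongrightarrow> 1" using step by simp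
  then show ?thesis by (rule LIMSEQ_offset)
qed

text \<open>Tannery's theorem: the ratios \<open>growth (n - k) / growth n\<close> tend to 1 and
  never exceed 1, so the summable Gauss terms dominate.\<close>

lemma mean_count_growth: "(\<lambda>n. mean_count n / growth n) \<longlonglongrightarrow> (\<Sum>k. gauss_term (lam_beta / 2) (3 / 2) k)"
proof -
  let ?t = "gauss_term (lam_beta / 2) (3 / 2)"
  let ?f = "\<lambda>k n. if k \<le> n then ?t k * (growth (n - k) / growth n) else 0"
  have t0: "?t k \<ge> 0" for k by (rule gauss_term_nonneg) simp
  have sm: "summable ?t" by (rule gauss_term_summable) (use lam_beta_pos lam_beta_less_1 in auto)
  have "((\<lambda>n. suminf (\<lambda>k. ?f k n)) \<longlongrightarrow> suminf ?t) sequentially"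
  proof (rule tannerys_theorem[THEN conjunct2, THEN conjunct2])
    show "((\<lambda>n. ?f k n) \<longlongrightarrow> ?t k) sequentially" for k
    proof (rule Lim_transform_eventually)
      show "(\<lambda>n. ?t k * (growth (n - k) / growth n)) \<longlonglongrightarrow> ?t k"
        using tendsto_mult[OF tendsto_const[of "?t k"] growth_ratio[of k]] by simp
      show "\<forall>\<^sub>F n in sequentially. ?t k * (growth (n - k) / growth n) = ?f k n"
        using eventually_ge_at_top[of k] by eventually_elim simp
    qed
    show "\<forall>\<^sub>F (k, n) in at_top \<times>\<^sub>F sequentially. norm (?f k n) \<le> ?t k"
    proof (intro always_eventually allI, clarify)
      fix k n
      have "growth (n - k) / growth n \<le> 1" using growth_mono[of "n - k" n] growth_pos[of n] by simp
      then have "?t k * (growth (n - k) / growth n) \<le> ?t k * 1" by (intro mult_left_mono t0)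
      moreover have "0 \<le> growth (n - k) / growth n" using growth_pos[of n] growth_pos[of "n - k"] by simp
      ultimately show "norm (?f k n) \<le> ?t k" using t0[of k] by (auto simp: abs_mult abs_of_pos[OF growth_pos])
    qed
    show "summable ?t" by (rule sm)
  qed simp
  moreover have "suminf (\<lambda>k. ?f k n) = mean_count n / growth n" for n
  proof -
    have "suminf (\<lambda>k. ?f k n) = (\<Sum>k\<le>n. ?f k n)" by (rule suminf_finite) auto
    also have "\<dots> = mean_count n / growth n" unfolding mean_count_convolution sum_divide_distrib by (intro sum.cong) auto
    finally show ?thesis .
  qed
  ultimately show ?thesis by simp
qed

theorem mean_count_asymp: "(\<lambda>n. mean_count n / real n powr (lam_beta / 2)) \<longlonglongrightarrow> lam_c"
proof -
  have "(\<lambda>n. (mean_count n / growth n) * (growth n / real n powr (lam_beta / 2))) \<longlonglongrightarrow>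
    (\<Sum>k. gauss_term (lam_beta / 2) (3 / 2) k) * (1 / Gamma (1 + lam_beta / 2))"
    by (intro tendsto_mult mean_count_growth growth_asymp)
  moreover have "(mean_count n / growth n) * (growth n / real n powr (lam_beta / 2)) = mean_count n / real n powr (lam_beta / 2)" for n
    using growth_pos[of n] by simp
  moreover have "(\<Sum>k. gauss_term (lam_beta / 2) (3 / 2) k) * (1 / Gamma (1 + lam_beta / 2)) = lam_c"
  proof -
    have "(1 / 2 :: real) \<notin> \<int>\<^sub>\<le>\<^sub>0" by (auto dest: nonpos_Ints_nonpos)
    \<comment> \<open>The source of the factor \<open>sqrt pi / 2\<close> in
      \<open>lam_c\<close>.\<close>
    then have g: "Gamma (3 / 2 :: real) = sqrt pi / 2"
      using Gamma_plus1[of "1 / 2 :: real"] Gamma_one_half_real by simp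
    have "(\<Sum>k. gauss_term (lam_beta / 2) (3 / 2) k) = Gamma (3 / 2) * Gamma (3 / 2 + 2 * (lam_beta / 2)) / (Gamma (3 / 2 + lam_beta / 2))\<^sup>2"
      by (rule gauss_sum) (use lam_beta_pos lam_beta_less_1 in auto)
    moreover have e1: "2 * lam_gamma - 1 / 2 = 3 / 2 + 2 * (lam_beta / 2)" and e2: "lam_gamma + 1 / 2 = 3 / 2 + lam_beta / 2"
      and e3: "lam_gamma = 1 + lam_beta / 2"
      by (simp_all add: lam_gamma_def)
    ultimately show ?thesis unfolding lam_c_def e1 e2 unfolding e3 g by (simp add: field_simps)
  qed
  ultimately show ?thesis by (simp only:)
qed

subsection \<open>The limit process\<close>

lemma cadlag_grid_bound:
  assumes f: "cadlag f" and le: "\<And>k n. \<bar>f (clamp01 (real_of_int k / real (Suc n)))\<bar> \<le> c" and s: "s \<in> {0..1}"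
  shows "\<bar>f s\<bar> \<le> c"
proof -
  have "(\<lambda>n. \<bar>f (clamp01 (real_of_int (\<lfloor>real (Suc n) * clamp01 s\<rfloor> + 1) / real (Suc n)))\<bar>) \<longlonglongrightarrow> \<bar>f (clamp01 s)\<bar>"
    by (rule tendsto_rabs[OF cadlag_grid_tendsto[OF f]])
  then have "\<bar>f (clamp01 s)\<bar> \<le> c" by (rule LIMSEQ_le_const2) (use le in blast)
  then show ?thesis using s by (simp only: clamp01_id)
qed

lemma sup_norm_le:
  assumes "\<And>s. s \<in> {0..1} \<Longrightarrow> \<bar>f s\<bar> \<le> c" shows "sup_norm f \<le> c"
  unfolding sup_norm_def by (rule cSUP_least) (use assms in auto)

lemma sup_norm_nonneg: "cadlag f \<Longrightarrow> 0 \<le> sup_norm f"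
  using abs_le_sup_norm[of f 0] abs_ge_zero[of "f 0"] by force

text \<open>Right-continuity reduces the supremum to a countable grid.\<close>

lemma (in cadlag_proc) sup_norm_measurable: "(\<lambda>\<omega>. sup_norm (X \<omega>)) \<in> borel_measurable P"
proof (rule borel_measurableI_le)
  fix c
  have "{\<omega> \<in> space P. sup_norm (X \<omega>) \<le> c} = {\<omega> \<in> space P. \<forall>k n. \<bar>X \<omega> (clamp01 (real_of_int k / real (Suc n)))\<bar> \<le> c}"
  proof (intro Collect_cong conj_cong refl iffI allI)
    fix \<omega> and k :: int and n assume w: "\<omega> \<in> space P" and le: "sup_norm (X \<omega>) \<le> c"
    show "\<bar>X \<omega> (clamp01 (real_of_int k / real (Suc n)))\<bar> \<le> c"
      by (rule order_trans[OF abs_le_sup_norm[OF paths[OF w] clamp01_in(1)] le])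
  next
    fix \<omega> assume w: "\<omega> \<in> space P" and le: "\<forall>(k::int) n. \<bar>X \<omega> (clamp01 (real_of_int k / real (Suc n)))\<bar> \<le> c"
    show "sup_norm (X \<omega>) \<le> c"
    proof (rule sup_norm_le)
      fix s :: real assume "s \<in> {0..1}"
      with cadlag_grid_bound[OF paths[OF w] le[rule_format]] show "\<bar>X \<omega> s\<bar> \<le> c" .
    qed
  qed
  moreover have "{\<omega> \<in> space P. \<forall>k n. \<bar>X \<omega> (clamp01 (real_of_int k / real (Suc n)))\<bar> \<le> c} \<in> sets P"
    by measurable
  ultimately show "{\<omega> \<in> space P. sup_norm (X \<omega>) \<le> c} \<in> sets P" by simp
qed

lemma (in cadlag_proc) glue_measurable_comp:
  assumes s: "s \<in> {0..1}" and [measurable]: "f \<in> measurable N P" "g \<in> measurable N P" "h \<in> measurable N uv_law"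
  shows "(\<lambda>x. glue (X (f x)) (X (g x)) (fst (h x)) (snd (h x)) s) \<in> borel_measurable N"
  using measurable_compose[OF _ glue_measurable[OF s], of "\<lambda>x. (f x, g x, h x)" N] by (simp add: split_beta')

lemma continuous_imp_cadlag:
  assumes c: "continuous_on {0..1} f" shows "cadlag f"
proof -
  have r: "(f \<longlongrightarrow> f s) (at_right s)" if "s \<in> {0..<1}" for s
    using continuous_on_Icc_at_rightD[of s 1 f] continuous_on_subset[OF c, of "{s..1}"] that by auto
  have l: "(f \<longlongrightarrow> f s) (at_left s)" if "s \<in> {0<..1}" for s
    using continuous_on_Icc_at_leftD[of 0 s f] continuous_on_subset[OF c, of "{0..s}"] that by auto
  show ?thesis unfolding cadlag_def continuous_within
  proof (intro conjI ballI)
    show "\<exists>l. (f \<longlongrightarrow> l) (at_left s)" if "s \<in> {0<..1}" for s using l[OF that] by blast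
  qed (use r l in auto)
qed

lemma (in prob_space) nn_integral_bounded_convergence:
  fixes u :: "nat \<Rightarrow> 'a \<Rightarrow> ennreal"
  assumes "\<And>n. u n \<in> borel_measurable M" "v \<in> borel_measurable M"
    and "\<And>n x. u n x \<le> 1" and "AE x in M. (\<lambda>n. u n x) \<longlonglongrightarrow> v x"
  shows "(\<lambda>n. \<integral>\<^sup>+x. u n x \<partial>M) \<longlonglongrightarrow> (\<integral>\<^sup>+x. v x \<partial>M)"
  by (rule nn_integral_dominated_convergence[where w = "\<lambda>_. 1"]) (use assms in \<open>auto simp: emeasure_space_1\<close>)

text \<open>Variance plus squared bias. The centre \<open>a\<close> has to be free in the induction,
  since a first entry of type \<open>A0\<close> shifts it to \<open>a - 1\<close>.\<close>

lemma (in two_types) select_num_second_moment: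
  assumes p: "p0 = ennreal p" "0 \<le> p" "p \<le> 1"
  shows "(\<integral>\<^sup>+x. ennreal ((real (select_num A0 n x) - a)\<^sup>2) \<partial>S) = ennreal (real n * (p * (1 - p)) + (real n * p - a)\<^sup>2)"
proof (induction n arbitrary: a)
  case 0
  interpret S: prob_space S by (rule prob_space_stream_space)
  show ?case by (simp add: S.emeasure_space_1)
next
  case (Suc n)
  have q: "emeasure M {q \<in> space M. \<not> A0 q} = ennreal (1 - p)"
  proof -
    have "emeasure M {q \<in> space M. \<not> A0 q} = ennreal (1 - prob {q \<in> space M. A0 q})"
      by (simp add: emeasure_eq_measure prob_neg)
    also have "prob {q \<in> space M. A0 q} = p"
      using p0_eq p by (simp add: emeasure_eq_measure)
    finally show ?thesis .
  qed
  have "(\<integral>\<^sup>+x. ennreal ((real (select_num A0 (Suc n) x) - a)\<^sup>2) \<partial>S) =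
    ennreal p * (\<integral>\<^sup>+x. ennreal ((real (select_num A0 n x) - (a - 1))\<^sup>2) \<partial>S) + ennreal (1 - p) * (\<integral>\<^sup>+x. ennreal ((real (select_num A0 n x) - a)\<^sup>2) \<partial>S)"
    using nn_integral_select_num_Suc[of "\<lambda>k. ennreal ((real k - a)\<^sup>2)" n] unfolding p(1) q by (simp add: algebra_simps)
  also have "\<dots> = ennreal p * ennreal (real n * (p * (1 - p)) + (real n * p - (a - 1))\<^sup>2) + ennreal (1 - p) * ennreal (real n * (p * (1 - p)) + (real n * p - a)\<^sup>2)"
    by (simp only: Suc)
  also have "\<dots> = ennreal (p * (real n * (p * (1 - p)) + (real n * p - (a - 1))\<^sup>2) + (1 - p) * (real n * (p * (1 - p)) + (real n * p - a)\<^sup>2))"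
    using p by (subst (1 2) ennreal_mult[symmetric]) (auto simp: ennreal_plus[symmetric] simp del: ennreal_plus intro!: add_nonneg_nonneg mult_nonneg_nonneg)
  also have "p * (real n * (p * (1 - p)) + (real n * p - (a - 1))\<^sup>2) + (1 - p) * (real n * (p * (1 - p)) + (real n * p - a)\<^sup>2)
    = real (Suc n) * (p * (1 - p)) + (real (Suc n) * p - a)\<^sup>2"
    by (simp add: power2_eq_square algebra_simps)
  finally show ?case .
qed

text \<open>At the times \<open>(Suc j)\<^sup>2\<close> the second moments of the deviations are
  bounded by a summable sequence, which gives almost sure convergence without higher
  moments.\<close>

lemma (in two_types) select_num_frequency:
  assumes p: "p0 = ennreal p" "0 \<le> p" "p \<le> 1"
  shows "AE x in S. (\<lambda>j. real (select_num A0 ((Suc j)\<^sup>2) x) / real ((Suc j)\<^sup>2)) \<longlonglongrightarrow> p"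
proof -
  define r where "r j = (Suc j)\<^sup>2" for j
  define h where "h j x = (real (select_num A0 (r j) x) - real (r j) * p)\<^sup>2 / (real (r j))\<^sup>2" for j x
  have r0: "real (r j) > 0" for j by (simp add: r_def)
  have [measurable]: "h j \<in> borel_measurable S" for j unfolding h_def by measurable
  have int: "(\<integral>\<^sup>+x. ennreal (h j x) \<partial>S) \<le> ennreal (1 / real (r j))" for j
  proof -
    have "(\<integral>\<^sup>+x. ennreal (h j x) \<partial>S) = (\<integral>\<^sup>+x. ennreal ((real (select_num A0 (r j) x) - real (r j) * p)\<^sup>2) * ennreal (1 / (real (r j))\<^sup>2) \<partial>S)"
      unfolding h_def by (intro nn_integral_cong) (simp add: ennreal_mult[symmetric])
    also have "\<dots> = ennreal (real (r j) * (p * (1 - p))) * ennreal (1 / (real (r j))\<^sup>2)"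
      by (subst nn_integral_multc, measurable) (simp add: select_num_second_moment[OF p])
    also have "\<dots> = ennreal (real (r j) * (p * (1 - p)) * (1 / (real (r j))\<^sup>2))"
      using p by (intro ennreal_mult[symmetric]) auto
    also have "\<dots> \<le> ennreal (1 / real (r j))"
    proof (rule ennreal_leI)
      have "p * (1 - p) \<le> 1" using p by (intro mult_le_one) auto
      then have "p * (1 - p) / real (r j) \<le> 1 / real (r j)" using r0[of j] by (intro divide_right_mono) auto
      then show "real (r j) * (p * (1 - p)) * (1 / (real (r j))\<^sup>2) \<le> 1 / real (r j)"
        using r0[of j] by (simp add: power2_eq_square)
    qed
    finally show ?thesis .
  qed
  have sm: "summable (\<lambda>j. 1 / real (r j))"
    using inverse_power_summable[of 2, where 'a = real] summable_Suc_iff[of "\<lambda>k. 1 / (real k)\<^sup>2"]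
    by (simp add: inverse_eq_divide r_def)
  have "(\<integral>\<^sup>+x. (\<Sum>j. ennreal (h j x)) \<partial>S) = (\<Sum>j. \<integral>\<^sup>+x. ennreal (h j x) \<partial>S)"
    by (rule nn_integral_suminf) measurable
  also have "\<dots> \<le> (\<Sum>j. ennreal (1 / real (r j)))" by (intro suminf_le int summableI)
  also have "\<dots> = ennreal (\<Sum>j. 1 / real (r j))"
    by (rule suminf_ennreal2) (use sm in \<open>auto intro: order_less_imp_le\<close>)
  also have "\<dots> < \<top>" by simp
  finally have "(\<integral>\<^sup>+x. (\<Sum>j. ennreal (h j x)) \<partial>S) \<noteq> \<infinity>" by simp
  then have "AE x in S. (\<Sum>j. ennreal (h j x)) \<noteq> \<infinity>"
    by (intro nn_integral_PInf_AE) measurable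
  then show ?thesis
  proof eventually_elim
    case (elim x)
    have "summable (\<lambda>j. h j x)"
      by (rule summable_suminf_not_top) (use elim in \<open>auto simp: h_def\<close>)
    then have "(\<lambda>j. h j x) \<longlonglongrightarrow> 0" by (rule summable_LIMSEQ_zero)
    then have "(\<lambda>j. sqrt (h j x)) \<longlonglongrightarrow> sqrt 0" by (rule tendsto_real_sqrt)
    moreover have "sqrt (h j x) = \<bar>real (select_num A0 (r j) x) / real (r j) - p\<bar>" for j
    proof -
      have "real (select_num A0 (r j) x) / real (r j) - p = (real (select_num A0 (r j) x) - real (r j) * p) / real (r j)"
        using r0[of j] by (simp add: field_simps)
      then show ?thesis using r0[of j] by (simp add: h_def real_sqrt_divide abs_divide)
    qed
    ultimately have "(\<lambda>j. \<bar>real (select_num A0 (r j) x) / real (r j) - p\<bar>) \<longlonglongrightarrow> 0" by simp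
    then have "(\<lambda>j. real (select_num A0 (r j) x) / real (r j) - p) \<longlonglongrightarrow> 0" by (rule tendsto_rabs_zero_cancel)
    then show ?case unfolding r_def by (simp only: LIM_zero_iff)
  qed
qed

text \<open>A sequence sampled at the number \<open>K j\<close> of surviving pairs but rescaled by
  the total time. \<open>Suc (r j)\<close> counts the first chord together with the
  \<open>r j\<close> pairs after it.\<close>

lemma rescaled_limit:
  assumes y: "(\<lambda>n. real n powr (- b) * y n) \<longlonglongrightarrow> m" and b: "b > 0"
    and r: "filterlim r at_top sequentially" and K: "(\<lambda>j. real (K j) / real (r j)) \<longlonglongrightarrow> p" and p: "p > 0"
  shows "(\<lambda>j. real (Suc (r j)) powr (- b) * y (K j)) \<longlonglongrightarrow> p powr b * m"
proof -
  have rr: "filterlim (\<lambda>j. real (r j)) at_top sequentially"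
    by (rule filterlim_compose[OF filterlim_real_sequentially r])
  have "filterlim (\<lambda>j. real (r j) * (real (K j) / real (r j))) at_top sequentially"
    by (rule filterlim_at_top_mult_tendsto_pos[OF K p rr])
  moreover have "\<forall>\<^sub>F j in sequentially. real (r j) * (real (K j) / real (r j)) = real (K j)"
    using r[unfolded filterlim_at_top, rule_format, of 1] by eventually_elim auto
  ultimately have Kr: "filterlim (\<lambda>j. real (K j)) at_top sequentially"
    by (rule filterlim_cong[OF refl refl, THEN iffD1, rotated])
  then have Kn: "filterlim K at_top sequentially" by (simp add: filterlim_real_sequentially filterlim_sequentially_iff_filterlim_real)
  have 1: "(\<lambda>j. real (K j) powr (- b) * y (K j)) \<longlonglongrightarrow> m"
    by (rule filterlim_compose[OF y Kn])
  have "(\<lambda>j. real (r j) / real (Suc (r j))) \<longlonglongrightarrow> 1"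
  proof -
    have "((\<lambda>x::real. x / (1 + x)) \<longlongrightarrow> 1) at_top" by real_asymp
    from filterlim_compose[OF this rr] show ?thesis by (simp add: add.commute)
  qed
  from tendsto_mult[OF K this] have "(\<lambda>j. (real (K j) / real (r j)) * (real (r j) / real (Suc (r j)))) \<longlonglongrightarrow> p" by simp
  then have 2: "(\<lambda>j. ((real (K j) / real (r j)) * (real (r j) / real (Suc (r j)))) powr b) \<longlonglongrightarrow> p powr b"
    using p b by (intro tendsto_powr tendsto_const) auto
  from tendsto_mult[OF 2 1] show ?thesis
  proof (rule Lim_transform_eventually)
    show "\<forall>\<^sub>F j in sequentially. ((real (K j) / real (r j)) * (real (r j) / real (Suc (r j)))) powr b * (real (K j) powr (- b) * y (K j)) = real (Suc (r j)) powr (- b) * y (K j)"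
      using r[unfolded filterlim_at_top, rule_format, of 1] Kr[unfolded filterlim_at_top, rule_format, of 1]
    proof eventually_elim
      case (elim j)
      then have e: "(real (K j) / real (r j)) * (real (r j) / real (Suc (r j))) = real (K j) / real (Suc (r j))" by simp
      have "real (K j) powr b * real (K j) powr (- b) = 1" using elim by (simp add: powr_minus field_simps)
      then show ?case unfolding e using elim by (simp add: powr_divide powr_minus_divide)
    qed
  qed
qed

locale lamination_limit = lamination_input P U V for P :: "'a measure" and U V +
  fixes M :: "'a \<Rightarrow> real \<Rightarrow> real"
  assumes limit: "is_lamination_limit P U V M"
begin

text \<open>Built from \<open>count_over\<close> of the input stream, which is measurable; it agrees
  almost surely with the process in \<open>is_lamination_limit\<close>.\<close>

definition rescaled :: "nat \<Rightarrow> 'a \<Rightarrow> real \<Rightarrow> real" where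
  "rescaled n \<omega> s = real n powr (- (lam_beta / 2)) * real (count_over (stake n (input_stream \<omega>)) s)"

definition gap :: "nat \<Rightarrow> 'a \<Rightarrow> real" where
  "gap n \<omega> = sup_norm (\<lambda>s. real n powr (- lam_beta / 2) * real (chord_count (\<lambda>i. U i \<omega>) (\<lambda>i. V i \<omega>) n s) - M \<omega> s)"

lemma M_process: "real_process P M" and M_continuous: "\<And>\<omega>. \<omega> \<in> space P \<Longrightarrow> continuous_on {0..1} (M \<omega>)"
  and M_moments: "\<And>m. m \<ge> 1 \<Longrightarrow> (\<lambda>n. \<integral>\<^sup>+\<omega>. ennreal (gap n \<omega> ^ m) \<partial>P) \<longlonglongrightarrow> 0"
  using limit unfolding is_lamination_limit_def Let_def gap_def by blast+

sublocale M: cadlag_proc P M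
  by unfold_locales (use M_process M_continuous continuous_imp_cadlag in auto)

lemma AE_rescaled_tendsto: "AE \<omega> in P. \<forall>s\<in>{0..1}. (\<lambda>n. rescaled n \<omega> s) \<longlonglongrightarrow> M \<omega> s"
proof -
  have "AE \<omega> in P. uniform_limit {0..1} (\<lambda>n s. real n powr (- lam_beta / 2) * real (chord_count (\<lambda>i. U i \<omega>) (\<lambda>i. V i \<omega>) n s)) (M \<omega>) sequentially"
    using limit unfolding is_lamination_limit_def Let_def by blast
  then show ?thesis using AE_chord_count
  proof eventually_elim
    case (elim \<omega>)
    show ?case
    proof
      fix s :: real assume "s \<in> {0..1}"
      from tendsto_uniform_limitI[OF elim(1) this] elim(2) show "(\<lambda>n. rescaled n \<omega> s) \<longlonglongrightarrow> M \<omega> s"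
        by (simp add: rescaled_def)
    qed
  qed
qed

lemma AE_gap: "AE \<omega> in P. \<forall>n. \<forall>s\<in>{0..1}. \<bar>rescaled n \<omega> s - M \<omega> s\<bar> \<le> gap n \<omega>"
  using AE_chord_count AE_space
proof eventually_elim
  case (elim \<omega>)
  show ?case
  proof (intro allI ballI)
    fix n and s :: real assume s: "s \<in> {0..1}"
    let ?f = "\<lambda>s. real n powr (- lam_beta / 2) * real (chord_count (\<lambda>i. U i \<omega>) (\<lambda>i. V i \<omega>) n s) - M \<omega> s"
    have eq: "?f s = rescaled n \<omega> s - M \<omega> s" for s using elim(1) by (simp add: rescaled_def)
    obtain B where B: "\<And>s. s \<in> {0..1} \<Longrightarrow> \<bar>M \<omega> s\<bar> \<le> B" using cadlag_bounded[OF M.paths[OF elim(2)]] by blast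
    have "\<bar>?f s\<bar> \<le> real n powr (- (lam_beta / 2)) * real n + B" if "s \<in> {0..1}" for s
    proof -
      have "real (count_over (stake n (input_stream \<omega>)) s) \<le> real n" using count_over_le[of "stake n (input_stream \<omega>)" s] by simp
      then have "\<bar>rescaled n \<omega> s\<bar> \<le> real n powr (- (lam_beta / 2)) * real n"
        unfolding rescaled_def by (simp add: abs_mult mult_left_mono)
      then show ?thesis unfolding eq using B[OF that] by linarith
    qed
    then have "bdd_above ((\<lambda>s. \<bar>?f s\<bar>) ` {0..1})" by (rule bdd_aboveI2)
    then have "\<bar>?f s\<bar> \<le> sup_norm ?f" unfolding sup_norm_def by (rule cSUP_upper[OF s])
    then show "\<bar>rescaled n \<omega> s - M \<omega> s\<bar> \<le> gap n \<omega>" unfolding eq gap_def by (simp add: eq)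
  qed
qed

text \<open>A single \<open>n\<close> for which \<open>gap n\<close> has finite second moment
  suffices, since at most \<open>n\<close> chords are present at time \<open>n\<close>.\<close>

lemma M_sup_norm_square_integrable: "integrable P (\<lambda>\<omega>. (sup_norm (M \<omega>))\<^sup>2)"
proof -
  note [measurable] = M.sup_norm_measurable
  have "\<forall>\<^sub>F n in sequentially. (\<integral>\<^sup>+\<omega>. ennreal (gap n \<omega> ^ 2) \<partial>P) < 1"
    using M_moments[of 2] by (intro order_tendstoD(2)) auto
  then obtain n where n: "(\<integral>\<^sup>+\<omega>. ennreal (gap n \<omega> ^ 2) \<partial>P) < 1" by (auto simp: eventually_sequentially)
  define B where "B = real n powr (- (lam_beta / 2)) * real n"
  \<comment> \<open>Measurability is available for the norm of the limit but has not been shown for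
    \<open>gap n\<close>; the estimate is therefore phrased through \<open>h\<close>, which
    \<open>gap n\<close> dominates.\<close>
  define h where "h \<omega> = max 0 (sup_norm (M \<omega>) - B)" for \<omega>
  have [measurable]: "h \<in> borel_measurable P" unfolding h_def by measurable
  have "AE \<omega> in P. ennreal ((h \<omega>)\<^sup>2) \<le> ennreal (gap n \<omega> ^ 2)"
    using AE_gap AE_space
  proof eventually_elim
    case (elim \<omega>)
    have "\<bar>M \<omega> s\<bar> \<le> gap n \<omega> + B" if s: "s \<in> {0..1}" for s
    proof -
      have "real (count_over (stake n (input_stream \<omega>)) s) \<le> real n" using count_over_le[of "stake n (input_stream \<omega>)" s] by simp
      then have "\<bar>rescaled n \<omega> s\<bar> \<le> B" unfolding rescaled_def B_def by (simp add: abs_mult mult_left_mono)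
      then show ?thesis using elim(1)[rule_format, OF s, of n] by linarith
    qed
    then have "sup_norm (M \<omega>) \<le> gap n \<omega> + B" by (rule sup_norm_le)
    moreover have "0 \<le> gap n \<omega>" using elim(1)[rule_format, of 0 n] by (force intro: order_trans[OF abs_ge_zero])
    ultimately have "h \<omega> \<le> gap n \<omega>" "0 \<le> h \<omega>" by (auto simp: h_def)
    then show ?case by (intro ennreal_leI power_mono)
  qed
  then have "(\<integral>\<^sup>+\<omega>. ennreal ((h \<omega>)\<^sup>2) \<partial>P) \<le> (\<integral>\<^sup>+\<omega>. ennreal (gap n \<omega> ^ 2) \<partial>P)" by (rule nn_integral_mono_AE)
  then have "(\<integral>\<^sup>+\<omega>. ennreal ((h \<omega>)\<^sup>2) \<partial>P) < \<infinity>" using n by (auto intro: le_less_trans less_trans)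
  then have "integrable P (\<lambda>\<omega>. (h \<omega>)\<^sup>2)" by (intro integrableI_nonneg) auto
  then have "integrable P (\<lambda>\<omega>. 2 * (h \<omega>)\<^sup>2 + 2 * B\<^sup>2)" by simp
  then show ?thesis
  proof (rule Bochner_Integration.integrable_bound)
    show "AE \<omega> in P. norm ((sup_norm (M \<omega>))\<^sup>2) \<le> norm (2 * (h \<omega>)\<^sup>2 + 2 * B\<^sup>2)"
      using AE_space
    proof eventually_elim
      case (elim \<omega>)
      have B0: "B \<ge> 0" by (simp add: B_def)
      have "0 \<le> sup_norm (M \<omega>)" "sup_norm (M \<omega>) \<le> h \<omega> + B"
        using sup_norm_nonneg[OF M.paths[OF elim]] by (auto simp: h_def)
      then have "(sup_norm (M \<omega>))\<^sup>2 \<le> (h \<omega> + B)\<^sup>2" by (intro power_mono)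
      also have "\<dots> \<le> 2 * (h \<omega>)\<^sup>2 + 2 * B\<^sup>2" using zero_le_power2[of "h \<omega> - B"] by (simp add: power2_sum power2_diff)
      finally show ?case by simp
    qed
  qed measurable
qed

end

section \<open>Splitting the counts at finite time and passing to the limit\<close>

text \<open>The finite-time analogue of \<open>glue\<close>, with the two sides read from separate
  streams.\<close>

definition count_glue :: "nat \<Rightarrow> nat \<Rightarrow> (real \<times> real) stream \<Rightarrow> (real \<times> real) stream \<Rightarrow> real \<Rightarrow> real \<Rightarrow> real \<Rightarrow> real" where
  "count_glue k0 k1 ys zs u v s = real (count_over (stake k0 ys) (outer_pos u v s)) +
     (if u \<le> s \<and> s < v then 1 + real (count_over (stake k1 zs) (inner_pos u v s)) else 0)"

lemma count_glue_measurable [measurable (raw)]: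
  assumes [measurable]: "a \<in> measurable N (count_space UNIV)" "b \<in> measurable N (count_space UNIV)"
    "f \<in> measurable N SU" "g \<in> measurable N SU" "s \<in> borel_measurable N"
  shows "(\<lambda>x. count_glue (a x) (b x) (f x) (g x) u v (s x)) \<in> borel_measurable N"
proof -
  have 1: "(\<lambda>x. count_over (stake (a x) (f x)) (outer_pos u v (s x))) \<in> measurable N (count_space UNIV)"
    by (rule measurable_compose_countable[where f = "\<lambda>k x. count_over (stake k (f x)) (outer_pos u v (s x))" and g = a]) measurable
  have 2: "(\<lambda>x. count_over (stake (b x) (g x)) (inner_pos u v (s x))) \<in> measurable N (count_space UNIV)"
    by (rule measurable_compose_countable[where f = "\<lambda>k x. count_over (stake k (g x)) (inner_pos u v (s x))" and g = b]) measurable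
  note [measurable] = 1 2
  show ?thesis unfolding count_glue_def by measurable
qed

text \<open>\<open>\<Phi>\<close> acts on the whole count function, so that the lemma serves both
  the finite-dimensional tests in \<open>M_test_product_eq\<close> and the integral over
  \<open>s\<close> in \<open>nn_integral_first_chord\<close>.\<close>

lemma nn_integral_count_split:
  fixes \<Phi> :: "(real \<Rightarrow> real) \<Rightarrow> ennreal"
  assumes uv: "0 \<le> u" "u < v" "v \<le> 1" "v - u < 1"
    and m: "\<And>k0 k1. (\<lambda>p. \<Phi> (count_glue k0 k1 (fst p) (snd p) u v)) \<in> borel_measurable (SU \<Otimes>\<^sub>M SU)"
  shows "(\<integral>\<^sup>+x. \<Phi> (\<lambda>s. real (count_over ((u, v) # stake n x) s)) \<partial>SU) =
    (\<integral>\<^sup>+x. \<integral>\<^sup>+ys. \<integral>\<^sup>+zs. \<Phi> (count_glue (select_num (outer_pair u v) n x) (select_num (inner_pair u v) n x) ys zs u v) \<partial>SU \<partial>SU \<partial>SU)"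
proof -
  interpret two_types unif2 "outer_pair u v" "inner_pair u v" "outer_map u v" "inner_map u v" "ennreal ((1 - (v - u))\<^sup>2)" "ennreal ((v - u)\<^sup>2)"
    by (rule two_types_unif2[OF uv])
  let ?a = "select_num (outer_pair u v) n" and ?b = "select_num (inner_pair u v) n"
  let ?f = "select_fill (outer_pair u v) (outer_map u v) n" and ?g = "select_fill (inner_pair u v) (inner_map u v) n"
  have "(\<integral>\<^sup>+x. \<Phi> (\<lambda>s. real (count_over ((u, v) # stake n x) s)) \<partial>SU) =
    (\<integral>\<^sup>+x. \<integral>\<^sup>+ys. \<integral>\<^sup>+zs. \<Phi> (count_glue (?a x) (?b x) (?f x ys) (?g x zs) u v) \<partial>SU \<partial>SU \<partial>SU)"
  proof (rule nn_integral_cong_AE, rule eventually_mono[OF AE_stream_avoid[of v]])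
    fix x :: "(real \<times> real) stream" assume av: "\<forall>i. fst (x !! i) \<noteq> v \<and> snd (x !! i) \<noteq> v"
    have av': "fst q \<noteq> v \<and> snd q \<noteq> v" if "q \<in> set (stake n x)" for q
      using that av by (auto simp: in_set_conv_nth)
    \<comment> \<open>The entries filled in from \<open>ys\<close> and \<open>zs\<close> lie beyond
      the first \<open>?a x\<close> and \<open>?b x\<close> entries and are never read, so
      integrating over them changes nothing.\<close>
    have "(\<lambda>s. real (count_over ((u, v) # stake n x) s)) = count_glue (?a x) (?b x) (?f x ys) (?g x zs) u v" for ys zs
      using count_over_decomposition[OF uv(2,4) av'] by (auto simp: count_glue_def stake_select_fill fun_eq_iff)
    then show "\<Phi> (\<lambda>s. real (count_over ((u, v) # stake n x) s)) = (\<integral>\<^sup>+ys. \<integral>\<^sup>+zs. \<Phi> (count_glue (?a x) (?b x) (?f x ys) (?g x zs) u v) \<partial>SU \<partial>SU)"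
      by (simp add: SU.emeasure_space_1)
  qed
  also have "\<dots> = (\<integral>\<^sup>+x. \<integral>\<^sup>+ys. \<integral>\<^sup>+zs. \<Phi> (count_glue (?a x) (?b x) ys zs u v) \<partial>SU \<partial>SU \<partial>SU)"
    by (rule nn_integral_select_fill[of "\<lambda>k0 k1 ys zs. \<Phi> (count_glue k0 k1 ys zs u v)"]) (rule m)
  finally show ?thesis .
qed

text \<open>The first pair can be sorted because \<open>count_over\<close> does not see its order;
  after sorting its law is \<open>uv_law\<close>.\<close>

lemma nn_integral_count_first:
  fixes \<Phi> :: "(real \<Rightarrow> real) \<Rightarrow> ennreal"
  assumes m: "(\<lambda>x. \<Phi> (\<lambda>s. real (count_over (stake (Suc n) x) s))) \<in> borel_measurable SU"
  shows "(\<integral>\<^sup>+x. \<Phi> (\<lambda>s. real (count_over (stake (Suc n) x) s)) \<partial>SU) =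
      (\<integral>\<^sup>+z. \<integral>\<^sup>+x. \<Phi> (\<lambda>s. real (count_over (z # stake n x) s)) \<partial>SU \<partial>uv_law)"
    and "(\<lambda>z. \<integral>\<^sup>+x. \<Phi> (\<lambda>s. real (count_over (z # stake n x) s)) \<partial>SU) \<in> borel_measurable (borel \<Otimes>\<^sub>M borel)"
proof -
  define F where "F = (\<lambda>q. \<integral>\<^sup>+x. \<Phi> (\<lambda>s. real (count_over (q # stake n x) s)) \<partial>SU)"
  have "(\<lambda>p. \<Phi> (\<lambda>s. real (count_over (stake (Suc n) (fst p ## snd p)) s))) \<in> borel_measurable (unif2 \<Otimes>\<^sub>M SU)"
    by (rule measurable_compose[OF _ m]) measurable
  then have m2: "(\<lambda>p. \<Phi> (\<lambda>s. real (count_over (fst p # stake n (snd p)) s))) \<in> borel_measurable (unif2 \<Otimes>\<^sub>M SU)" by simp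
  have "F \<in> borel_measurable unif2"
    unfolding F_def by (rule SU.borel_measurable_nn_integral) (use m2 in \<open>simp add: split_beta'\<close>)
  then show Fm: "(\<lambda>z. \<integral>\<^sup>+x. \<Phi> (\<lambda>s. real (count_over (z # stake n x) s)) \<partial>SU) \<in> borel_measurable (borel \<Otimes>\<^sub>M borel)"
    by (simp add: F_def measurable_cong_sets[OF sets_unif2 refl])
  have "(\<integral>\<^sup>+x. \<Phi> (\<lambda>s. real (count_over (stake (Suc n) x) s)) \<partial>SU) = (\<integral>\<^sup>+q. F q \<partial>unif2)"
    unfolding F_def by (subst unif2.nn_integral_stream_space[OF m]) simp
  also have "\<dots> = (\<integral>\<^sup>+q. F (sort_pair q) \<partial>unif2)"
    unfolding F_def by (simp add: count_over_sort_pair)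
  also have "\<dots> = (\<integral>\<^sup>+z. F z \<partial>uv_law)" using Fm by (intro nn_integral_sort_pair) (simp add: F_def)
  finally show "(\<integral>\<^sup>+x. \<Phi> (\<lambda>s. real (count_over (stake (Suc n) x) s)) \<partial>SU) =
      (\<integral>\<^sup>+z. \<integral>\<^sup>+x. \<Phi> (\<lambda>s. real (count_over (z # stake n x) s)) \<partial>SU \<partial>uv_law)" unfolding F_def .
qed

lemma AE_select_frequencies:
  assumes uv: "0 \<le> u" "u < v" "v \<le> 1" "v - u < 1"
  shows "AE x in SU. (\<lambda>j. real (select_num (outer_pair u v) ((Suc j)\<^sup>2) x) / real ((Suc j)\<^sup>2)) \<longlonglongrightarrow> (1 - (v - u))\<^sup>2 \<and>
     (\<lambda>j. real (select_num (inner_pair u v) ((Suc j)\<^sup>2) x) / real ((Suc j)\<^sup>2)) \<longlonglongrightarrow> (v - u)\<^sup>2"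
proof -
  interpret two_types unif2 "outer_pair u v" "inner_pair u v" "outer_map u v" "inner_map u v" "ennreal ((1 - (v - u))\<^sup>2)" "ennreal ((v - u)\<^sup>2)"
    by (rule two_types_unif2[OF uv])
  interpret sw: two_types unif2 "inner_pair u v" "outer_pair u v" "inner_map u v" "outer_map u v" "ennreal ((v - u)\<^sup>2)" "ennreal ((1 - (v - u))\<^sup>2)"
    by (rule two_types_swap)
  have "AE x in SU. (\<lambda>j. real (select_num (outer_pair u v) ((Suc j)\<^sup>2) x) / real ((Suc j)\<^sup>2)) \<longlonglongrightarrow> (1 - (v - u))\<^sup>2"
    by (rule select_num_frequency[OF refl]) (use uv in \<open>auto simp: power_le_one\<close>)
  moreover have "AE x in SU. (\<lambda>j. real (select_num (inner_pair u v) ((Suc j)\<^sup>2) x) / real ((Suc j)\<^sup>2)) \<longlonglongrightarrow> (v - u)\<^sup>2"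
    by (rule sw.select_num_frequency[OF refl]) (use uv in \<open>auto simp: power_le_one\<close>)
  ultimately show ?thesis by eventually_elim simp
qed

context lamination_limit begin

text \<open>The two sides run for numbers of steps with asymptotic frequencies
  \<open>(1 - (v - u))\<^sup>2\<close> and \<open>(v - u)\<^sup>2\<close>; the summand 1 for the
  first chord disappears in the scaling.\<close>

lemma count_glue_tendsto:
  assumes uv: "0 \<le> u" "u < v" "v \<le> 1" "v - u < 1" and s: "s \<in> {0..1}"
    and w0: "\<forall>s\<in>{0..1}. (\<lambda>n. rescaled n \<omega>0 s) \<longlonglongrightarrow> M \<omega>0 s" and w1: "\<forall>s\<in>{0..1}. (\<lambda>n. rescaled n \<omega>1 s) \<longlonglongrightarrow> M \<omega>1 s"
    and r: "filterlim r at_top sequentially"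
    and K0: "(\<lambda>j. real (K0 j) / real (r j)) \<longlonglongrightarrow> (1 - (v - u))\<^sup>2" and K1: "(\<lambda>j. real (K1 j) / real (r j)) \<longlonglongrightarrow> (v - u)\<^sup>2"
  shows "(\<lambda>j. real (Suc (r j)) powr (- (lam_beta / 2)) * count_glue (K0 j) (K1 j) (input_stream \<omega>0) (input_stream \<omega>1) u v s)
     \<longlonglongrightarrow> glue (M \<omega>0) (M \<omega>1) u v s"
proof -
  have b: "lam_beta / 2 > 0" using lam_beta_pos by simp
  \<comment> \<open>A squared length to the power \<open>lam_beta / 2\<close> gives the weight in
    \<open>glue\<close>.\<close>
  have sq: "(x\<^sup>2) powr (lam_beta / 2) = x powr lam_beta" if "x > 0" for x :: real
    using that by (simp add: powr_powr flip: powr_numeral)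
  have op: "outer_pos u v s \<in> {0..1}" using uv s by (intro outer_pos_in) auto
  have 1: "(\<lambda>j. real (Suc (r j)) powr (- (lam_beta / 2)) * real (count_over (stake (K0 j) (input_stream \<omega>0)) (outer_pos u v s)))
      \<longlonglongrightarrow> (1 - (v - u)) powr lam_beta * M \<omega>0 (outer_pos u v s)"
    using rescaled_limit[OF w0[rule_format, OF op, unfolded rescaled_def] b r K0] uv by (simp add: sq)
  have 2: "(\<lambda>j. real (Suc (r j)) powr (- (lam_beta / 2)) * real (count_over (stake (K1 j) (input_stream \<omega>1)) (inner_pos u v s)))
      \<longlonglongrightarrow> (v - u) powr lam_beta * M \<omega>1 (inner_pos u v s)"
    using rescaled_limit[OF w1[rule_format, OF inner_pos_in, unfolded rescaled_def] b r K1] uv by (simp add: sq)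
  have "((\<lambda>x::real. (x + 1) powr (- (lam_beta / 2))) \<longlongrightarrow> 0) at_top" using b by real_asymp
  from filterlim_compose[OF this filterlim_compose[OF filterlim_real_sequentially r]]
  have 3: "(\<lambda>j. real (Suc (r j)) powr (- (lam_beta / 2))) \<longlonglongrightarrow> 0" by (simp add: add.commute)
  show ?thesis
  proof (cases "u \<le> s \<and> s < v")
    case True
    have "(\<lambda>j. real (Suc (r j)) powr (- (lam_beta / 2)) * real (count_over (stake (K0 j) (input_stream \<omega>0)) (outer_pos u v s)) +
        (real (Suc (r j)) powr (- (lam_beta / 2)) + real (Suc (r j)) powr (- (lam_beta / 2)) * real (count_over (stake (K1 j) (input_stream \<omega>1)) (inner_pos u v s))))
       \<longlonglongrightarrow> (1 - (v - u)) powr lam_beta * M \<omega>0 (outer_pos u v s) + (0 + (v - u) powr lam_beta * M \<omega>1 (inner_pos u v s))"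
      by (intro tendsto_add 1 2 3)
    then show ?thesis using True by (simp add: count_glue_def glue_eq inner_wt_def distrib_left)
  next
    case False
    then have "inner_wt u v s = 0" by (auto simp: inner_wt_def)
    then show ?thesis using False 1 by (auto simp: count_glue_def glue_eq)
  qed
qed

text \<open>The finite-time identity passes to the limit by bounded convergence, once for each
  integral, along the times \<open>Suc (r j)\<close>. Restricting to these times loses nothing, as
  the left side converges along all times.\<close>

lemma M_test_product_eq:
  assumes J: "finite J" "J \<subseteq> {0..1}" and f: "\<And>j. j \<in> J \<Longrightarrow> smooth_test (f j)"
  shows "(\<integral>\<^sup>+\<omega>. ennreal (\<Prod>j\<in>J. f j (M \<omega> j)) \<partial>P) =
    (\<integral>\<^sup>+z. \<integral>\<^sup>+\<omega>0. \<integral>\<^sup>+\<omega>1. ennreal (\<Prod>j\<in>J. f j (glue (M \<omega>0) (M \<omega>1) (fst z) (snd z) j)) \<partial>P \<partial>P \<partial>uv_law)"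
proof -
  define \<Phi> where "\<Phi> n g = ennreal (\<Prod>j\<in>J. f j (real (Suc n) powr (- (lam_beta / 2)) * g j))" for n and g :: "real \<Rightarrow> real"
  define r where "r j = (Suc j)\<^sup>2" for j :: nat
  have r: "filterlim r at_top sequentially" unfolding r_def
    by (rule filterlim_at_top_mono[OF filterlim_ident]) (auto simp: power2_eq_square)
  have p1: "ennreal (\<Prod>j\<in>J. f j (y j)) \<le> 1" for y
    using smooth_test_prod_bounds(2)[of J f y, OF f] by (simp add: ennreal_le_1)
  have \<Phi>1: "\<Phi> n g \<le> 1" for n g unfolding \<Phi>_def by (rule p1)
  let ?R = "\<lambda>n z. \<integral>\<^sup>+x. \<Phi> n (\<lambda>s. real (count_over (z # stake n x) s)) \<partial>SU"
  have \<Phi>m: "(\<lambda>x. \<Phi> n (\<lambda>s. real (count_over (stake (Suc n) x) s))) \<in> borel_measurable SU" for n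
    unfolding \<Phi>_def by (rule measurable_compose[OF smooth_test_prod_measurable[OF f]]) measurable
  have lhs: "(\<integral>\<^sup>+\<omega>. ennreal (\<Prod>j\<in>J. f j (rescaled (Suc n) \<omega> j)) \<partial>P) = (\<integral>\<^sup>+z. ?R n z \<partial>uv_law)" for n
  proof -
    have "(\<integral>\<^sup>+\<omega>. ennreal (\<Prod>j\<in>J. f j (rescaled (Suc n) \<omega> j)) \<partial>P) = (\<integral>\<^sup>+\<omega>. (\<lambda>x. \<Phi> n (\<lambda>s. real (count_over (stake (Suc n) x) s))) (input_stream \<omega>) \<partial>P)"
      unfolding \<Phi>_def rescaled_def ..
    also have "\<dots> = (\<integral>\<^sup>+x. \<Phi> n (\<lambda>s. real (count_over (stake (Suc n) x) s)) \<partial>SU)"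
      by (rule nn_integral_input_stream[OF \<Phi>m])
    also have "\<dots> = (\<integral>\<^sup>+z. ?R n z \<partial>uv_law)" by (rule nn_integral_count_first[OF \<Phi>m])
    finally show ?thesis .
  qed
  have Rm: "?R n \<in> borel_measurable uv_law" for n
    by (rule measurable_uv_lawI) (rule nn_integral_count_first(2)[OF \<Phi>m])
  let ?L = "\<lambda>z \<omega>0 \<omega>1. ennreal (\<Prod>j\<in>J. f j (glue (M \<omega>0) (M \<omega>1) (fst z) (snd z) j))"
  have Lm [measurable (raw)]: "(\<lambda>x. ?L (h x) (a x) (b x)) \<in> borel_measurable N"
    if "h \<in> measurable N uv_law" "a \<in> measurable N P" "b \<in> measurable N P" for h a b and N :: "'n measure"
    by (rule measurable_compose[OF smooth_test_prod_measurable[OF f M.glue_measurable_comp[OF _ that(2,3,1)]]]) (use J in auto)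
  have limz: "(\<lambda>j. ?R (r j) z) \<longlonglongrightarrow> (\<integral>\<^sup>+\<omega>0. \<integral>\<^sup>+\<omega>1. ?L z \<omega>0 \<omega>1 \<partial>P \<partial>P)"
    if z: "0 \<le> fst z \<and> fst z < snd z \<and> snd z \<le> 1 \<and> snd z - fst z < 1" for z
  proof -
    define u v where "u = fst z" and "v = snd z"
    have uv: "0 \<le> u" "u < v" "v \<le> 1" "v - u < 1" and zz: "z = (u, v)" using z by (auto simp: u_def v_def)
    have zs: "z \<in> space uv_law" using uv by (auto simp: zz)
    define T where "T n x \<omega>0 \<omega>1 = \<Phi> n (count_glue (select_num (outer_pair u v) n x) (select_num (inner_pair u v) n x) (input_stream \<omega>0) (input_stream \<omega>1) u v)" for n x \<omega>0 \<omega>1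
    have Tm [measurable (raw)]: "(\<lambda>y. T n (c y) (a y) (b y)) \<in> borel_measurable N"
      if [measurable]: "c \<in> measurable N SU" "a \<in> measurable N P" "b \<in> measurable N P" for n c a b and N :: "'m measure"
      unfolding T_def \<Phi>_def by (rule measurable_compose[OF smooth_test_prod_measurable[OF f]]) measurable
    \<comment> \<open>The independent streams are realised as input streams of independent sample
      points; this is where the two copies of \<open>M\<close> come from.\<close>
    have Req: "?R n z = (\<integral>\<^sup>+x. \<integral>\<^sup>+\<omega>0. \<integral>\<^sup>+\<omega>1. T n x \<omega>0 \<omega>1 \<partial>P \<partial>P \<partial>SU)" for n
    proof -
      have gm: "(\<lambda>p. \<Phi> n (count_glue k0 k1 (fst p) (snd p) u v)) \<in> borel_measurable (SU \<Otimes>\<^sub>M SU)" for k0 k1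
        unfolding \<Phi>_def by (rule measurable_compose[OF smooth_test_prod_measurable[OF f]]) measurable
      have g1: "(\<lambda>zs. \<Phi> n (count_glue k0 k1 y zs u v)) \<in> borel_measurable SU" if "y \<in> space SU" for k0 k1 y
        using measurable_compose[OF measurable_Pair1'[OF that] gm[of k0 k1]] by simp
      have g2: "(\<lambda>y. \<integral>\<^sup>+zs. \<Phi> n (count_glue k0 k1 y zs u v) \<partial>SU) \<in> borel_measurable SU" for k0 k1
        by (rule SU.borel_measurable_nn_integral) (use gm[of k0 k1] in \<open>simp add: split_beta'\<close>)
      have "(\<integral>\<^sup>+ys. \<integral>\<^sup>+zs. \<Phi> n (count_glue k0 k1 ys zs u v) \<partial>SU \<partial>SU) =
          (\<integral>\<^sup>+\<omega>0. \<integral>\<^sup>+\<omega>1. \<Phi> n (count_glue k0 k1 (input_stream \<omega>0) (input_stream \<omega>1) u v) \<partial>P \<partial>P)" for k0 k1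
        unfolding nn_integral_input_stream[OF g2, symmetric]
        by (intro nn_integral_cong nn_integral_input_stream[symmetric] g1 measurable_space[OF input_stream_measurable])
      then show ?thesis unfolding zz nn_integral_count_split[OF uv gm] T_def by simp
    qed
    have T1: "T n x \<omega>0 \<omega>1 \<le> 1" for n x \<omega>0 \<omega>1 unfolding T_def by (rule \<Phi>1)
    have T2: "(\<integral>\<^sup>+\<omega>1. T n x \<omega>0 \<omega>1 \<partial>P) \<le> 1" for n x \<omega>0
      using nn_integral_mono[of P "T n x \<omega>0" "\<lambda>_. 1"] T1 by (simp add: emeasure_space_1)
    have T3: "(\<integral>\<^sup>+\<omega>0. \<integral>\<^sup>+\<omega>1. T n x \<omega>0 \<omega>1 \<partial>P \<partial>P) \<le> 1" for n x
      using nn_integral_mono[of P "\<lambda>\<omega>0. \<integral>\<^sup>+\<omega>1. T n x \<omega>0 \<omega>1 \<partial>P" "\<lambda>_. 1"] T2 by (simp add: emeasure_space_1)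
    have pt: "(\<lambda>j. T (r j) x \<omega>0 \<omega>1) \<longlonglongrightarrow> ?L z \<omega>0 \<omega>1"
      if x: "(\<lambda>j. real (select_num (outer_pair u v) ((Suc j)\<^sup>2) x) / real ((Suc j)\<^sup>2)) \<longlonglongrightarrow> (1 - (v - u))\<^sup>2 \<and>
     (\<lambda>j. real (select_num (inner_pair u v) ((Suc j)\<^sup>2) x) / real ((Suc j)\<^sup>2)) \<longlonglongrightarrow> (v - u)\<^sup>2"
        and w0: "\<forall>s\<in>{0..1}. (\<lambda>n. rescaled n \<omega>0 s) \<longlonglongrightarrow> M \<omega>0 s" and w1: "\<forall>s\<in>{0..1}. (\<lambda>n. rescaled n \<omega>1 s) \<longlonglongrightarrow> M \<omega>1 s"
      for x \<omega>0 \<omega>1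
      unfolding T_def \<Phi>_def zz fst_conv snd_conv
    proof (intro tendsto_ennrealI tendsto_prod)
      fix s assume s: "s \<in> J"
      then have s01: "s \<in> {0..1}" using J by auto
      have fc: "isCont (f s) y" for y
        using smooth_test_continuous[OF f[OF s]] by (simp add: continuous_on_eq_continuous_at)
      show "(\<lambda>j. f s (real (Suc (r j)) powr (- (lam_beta / 2)) * count_glue (select_num (outer_pair u v) (r j) x) (select_num (inner_pair u v) (r j) x) (input_stream \<omega>0) (input_stream \<omega>1) u v s)) \<longlonglongrightarrow> f s (glue (M \<omega>0) (M \<omega>1) u v s)"
        by (rule isCont_tendsto_compose[OF fc count_glue_tendsto[OF uv s01 w0 w1 r]]) (use x in \<open>simp_all add: r_def\<close>)
    qed
    have l1: "(\<lambda>j. \<integral>\<^sup>+\<omega>1. T (r j) x \<omega>0 \<omega>1 \<partial>P) \<longlonglongrightarrow> (\<integral>\<^sup>+\<omega>1. ?L z \<omega>0 \<omega>1 \<partial>P)"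
      if x: "(\<lambda>j. real (select_num (outer_pair u v) ((Suc j)\<^sup>2) x) / real ((Suc j)\<^sup>2)) \<longlonglongrightarrow> (1 - (v - u))\<^sup>2 \<and>
     (\<lambda>j. real (select_num (inner_pair u v) ((Suc j)\<^sup>2) x) / real ((Suc j)\<^sup>2)) \<longlonglongrightarrow> (v - u)\<^sup>2"
        and w0: "\<forall>s\<in>{0..1}. (\<lambda>n. rescaled n \<omega>0 s) \<longlonglongrightarrow> M \<omega>0 s" and m0: "x \<in> space SU" "\<omega>0 \<in> space P" for x \<omega>0
    proof (rule nn_integral_bounded_convergence)
      show "AE \<omega>1 in P. (\<lambda>j. T (r j) x \<omega>0 \<omega>1) \<longlonglongrightarrow> ?L z \<omega>0 \<omega>1"
        using AE_rescaled_tendsto by eventually_elim (rule pt[OF x w0])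
    qed (use T1 m0 zs in \<open>auto intro!: Tm Lm\<close>)
    have l2: "(\<lambda>j. \<integral>\<^sup>+\<omega>0. \<integral>\<^sup>+\<omega>1. T (r j) x \<omega>0 \<omega>1 \<partial>P \<partial>P) \<longlonglongrightarrow> (\<integral>\<^sup>+\<omega>0. \<integral>\<^sup>+\<omega>1. ?L z \<omega>0 \<omega>1 \<partial>P \<partial>P)"
      if x: "(\<lambda>j. real (select_num (outer_pair u v) ((Suc j)\<^sup>2) x) / real ((Suc j)\<^sup>2)) \<longlonglongrightarrow> (1 - (v - u))\<^sup>2 \<and>
     (\<lambda>j. real (select_num (inner_pair u v) ((Suc j)\<^sup>2) x) / real ((Suc j)\<^sup>2)) \<longlonglongrightarrow> (v - u)\<^sup>2" and m0: "x \<in> space SU" for x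
    proof (rule nn_integral_bounded_convergence)
      show "AE \<omega>0 in P. (\<lambda>j. \<integral>\<^sup>+\<omega>1. T (r j) x \<omega>0 \<omega>1 \<partial>P) \<longlonglongrightarrow> (\<integral>\<^sup>+\<omega>1. ?L z \<omega>0 \<omega>1 \<partial>P)"
        using AE_rescaled_tendsto AE_space by eventually_elim (rule l1[OF x _ m0])
      show "(\<lambda>\<omega>0. \<integral>\<^sup>+\<omega>1. T (r j) x \<omega>0 \<omega>1 \<partial>P) \<in> borel_measurable P" for j
        using m0 by measurable
      show "(\<lambda>\<omega>0. \<integral>\<^sup>+\<omega>1. ?L z \<omega>0 \<omega>1 \<partial>P) \<in> borel_measurable P"
        using zs by measurable
    qed (rule T2)
    have "(\<lambda>j. \<integral>\<^sup>+x. \<integral>\<^sup>+\<omega>0. \<integral>\<^sup>+\<omega>1. T (r j) x \<omega>0 \<omega>1 \<partial>P \<partial>P \<partial>SU) \<longlonglongrightarrow> (\<integral>\<^sup>+x. \<integral>\<^sup>+\<omega>0. \<integral>\<^sup>+\<omega>1. ?L z \<omega>0 \<omega>1 \<partial>P \<partial>P \<partial>SU)"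
    proof (rule SU.nn_integral_bounded_convergence)
      show "AE x in SU. (\<lambda>j. \<integral>\<^sup>+\<omega>0. \<integral>\<^sup>+\<omega>1. T (r j) x \<omega>0 \<omega>1 \<partial>P \<partial>P) \<longlonglongrightarrow> (\<integral>\<^sup>+\<omega>0. \<integral>\<^sup>+\<omega>1. ?L z \<omega>0 \<omega>1 \<partial>P \<partial>P)"
        using AE_select_frequencies[OF uv] AE_space by eventually_elim (rule l2)
      show "(\<lambda>x. \<integral>\<^sup>+\<omega>0. \<integral>\<^sup>+\<omega>1. T (r j) x \<omega>0 \<omega>1 \<partial>P \<partial>P) \<in> borel_measurable SU" for j by measurable
    qed (auto intro: T3)
    then show ?thesis unfolding Req by (simp add: SU.emeasure_space_1)
  qed
  interpret uv: prob_space uv_law by (rule prob_space_uv_law)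
  have "(\<lambda>j. \<integral>\<^sup>+z. ?R (r j) z \<partial>uv_law) \<longlonglongrightarrow> (\<integral>\<^sup>+z. \<integral>\<^sup>+\<omega>0. \<integral>\<^sup>+\<omega>1. ?L z \<omega>0 \<omega>1 \<partial>P \<partial>P \<partial>uv_law)"
  proof (rule uv.nn_integral_bounded_convergence)
    show "AE z in uv_law. (\<lambda>j. ?R (r j) z) \<longlonglongrightarrow> (\<integral>\<^sup>+\<omega>0. \<integral>\<^sup>+\<omega>1. ?L z \<omega>0 \<omega>1 \<partial>P \<partial>P)"
      using AE_uv_law by eventually_elim (rule limz)
    show "(\<lambda>z. \<integral>\<^sup>+\<omega>0. \<integral>\<^sup>+\<omega>1. ?L z \<omega>0 \<omega>1 \<partial>P \<partial>P) \<in> borel_measurable uv_law" by measurable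
    show "?R (r j) z \<le> 1" for j z
      using nn_integral_mono[of SU "\<lambda>x. \<Phi> (r j) (\<lambda>s. real (count_over (z # stake (r j) x) s))" "\<lambda>_. 1"] \<Phi>1 by (simp add: SU.emeasure_space_1)
  qed (rule Rm)
  moreover have "(\<lambda>j. \<integral>\<^sup>+z. ?R (r j) z \<partial>uv_law) \<longlonglongrightarrow> (\<integral>\<^sup>+\<omega>. ennreal (\<Prod>j\<in>J. f j (M \<omega> j)) \<partial>P)"
    unfolding lhs[symmetric]
  proof (rule nn_integral_bounded_convergence)
    show "AE \<omega> in P. (\<lambda>j. ennreal (\<Prod>i\<in>J. f i (rescaled (Suc (r j)) \<omega> i))) \<longlonglongrightarrow> ennreal (\<Prod>j\<in>J. f j (M \<omega> j))"
      using AE_rescaled_tendsto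
    proof eventually_elim
      case (elim \<omega>)
      show ?case
      proof (intro tendsto_ennrealI tendsto_prod)
        fix s assume s: "s \<in> J"
        have fc: "isCont (f s) y" for y
          using smooth_test_continuous[OF f[OF s]] by (simp add: continuous_on_eq_continuous_at)
        have "filterlim (\<lambda>j. Suc (r j)) at_top sequentially" by (rule filterlim_compose[OF filterlim_Suc r])
        from filterlim_compose[OF elim[rule_format, of s] this] s J
        show "(\<lambda>j. f s (rescaled (Suc (r j)) \<omega> s)) \<longlonglongrightarrow> f s (M \<omega> s)"
          by (intro isCont_tendsto_compose[OF fc]) auto
      qed
    qed
    show "(\<lambda>\<omega>. ennreal (\<Prod>i\<in>J. f i (rescaled (Suc (r j)) \<omega> i))) \<in> borel_measurable P" for j
      unfolding rescaled_def by (rule measurable_compose[OF smooth_test_prod_measurable[OF f]]) measurable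
    show "(\<lambda>\<omega>. ennreal (\<Prod>j\<in>J. f j (M \<omega> j))) \<in> borel_measurable P"
      by (rule measurable_compose[OF smooth_test_prod_measurable[OF f M.eval_measurable]]) (use J in auto)
  qed (rule p1)
  ultimately show ?thesis by (rule LIMSEQ_unique[rotated])
qed

theorem M_solves_FP: "solves_FP P M"
  unfolding solves_FP_def
proof (rule path_law_eqI)
  interpret uv: prob_space uv_law by (rule prob_space_uv_law)
  interpret PN: pair_prob_space P uv_law ..
  interpret PPN: pair_prob_space P "P \<Otimes>\<^sub>M uv_law" ..
  interpret PP: pair_prob_space P P ..
  let ?G = "\<lambda>(\<omega>0, \<omega>1, u, v). glue (M \<omega>0) (M \<omega>1) u v"
  show "prob_space P" by (rule prob_space_axioms)
  show pP: "prob_space (P \<Otimes>\<^sub>M P \<Otimes>\<^sub>M uv_law)" by (rule PPN.P.prob_space_axioms)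
  show "real_process P M" by (rule M_process)
  show "real_process (P \<Otimes>\<^sub>M P \<Otimes>\<^sub>M uv_law) ?G"
    unfolding real_process_def using M.glue_measurable by (simp add: split_beta')
  fix J :: "real set" and f :: "real \<Rightarrow> real \<Rightarrow> real"
  assume J: "finite J" "J \<subseteq> {0..1}" and f: "\<And>j. j \<in> J \<Longrightarrow> smooth_test (f j)"
  have m1: "(\<lambda>\<omega>. \<Prod>j\<in>J. f j (M \<omega> j)) \<in> borel_measurable P"
    by (rule smooth_test_prod_measurable[OF f M.eval_measurable]) (use J in auto)
  have m2: "(\<lambda>x. \<Prod>j\<in>J. f j (?G x j)) \<in> borel_measurable (P \<Otimes>\<^sub>M P \<Otimes>\<^sub>M uv_law)"
    by (rule smooth_test_prod_measurable[OF f]) (use J M.glue_measurable in \<open>auto simp: split_beta'\<close>)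
  note rot = distr_rotate_pair_measure[OF sigma_finite_measure_axioms sigma_finite_measure_axioms uv.sigma_finite_measure_axioms]
  have m3: "(\<lambda>y. ennreal (\<Prod>j\<in>J. f j (glue (M (fst (snd y))) (M (snd (snd y))) (fst (fst y)) (snd (fst y)) j))) \<in> borel_measurable (uv_law \<Otimes>\<^sub>M (P \<Otimes>\<^sub>M P))"
    by (rule measurable_compose[OF smooth_test_prod_measurable[OF f M.glue_measurable_comp]]) (use J in auto)
  have m4: "(\<lambda>p. ennreal (\<Prod>j\<in>J. f j (glue (M (fst p)) (M (snd p)) (fst z) (snd z) j))) \<in> borel_measurable (P \<Otimes>\<^sub>M P)" if "z \<in> space uv_law" for z
    by (rule measurable_compose[OF smooth_test_prod_measurable[OF f M.glue_measurable_comp[where h = "\<lambda>_. z"]]]) (use J that in auto)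
  have "(\<integral>\<^sup>+x. ennreal (\<Prod>j\<in>J. f j (?G x j)) \<partial>(P \<Otimes>\<^sub>M P \<Otimes>\<^sub>M uv_law)) =
      (\<integral>\<^sup>+y. ennreal (\<Prod>j\<in>J. f j (glue (M (fst (snd y))) (M (snd (snd y))) (fst (fst y)) (snd (fst y)) j)) \<partial>(uv_law \<Otimes>\<^sub>M (P \<Otimes>\<^sub>M P)))"
    by (subst rot[symmetric], subst nn_integral_distr) (use m2 in \<open>auto simp: split_beta'\<close>)
  also have "\<dots> = (\<integral>\<^sup>+z. \<integral>\<^sup>+p. ennreal (\<Prod>j\<in>J. f j (glue (M (fst p)) (M (snd p)) (fst z) (snd z) j)) \<partial>(P \<Otimes>\<^sub>M P) \<partial>uv_law)"
    by (subst PP.P.nn_integral_fst[OF m3, symmetric]) simp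
  also have "\<dots> = (\<integral>\<^sup>+z. \<integral>\<^sup>+\<omega>0. \<integral>\<^sup>+\<omega>1. ennreal (\<Prod>j\<in>J. f j (glue (M \<omega>0) (M \<omega>1) (fst z) (snd z) j)) \<partial>P \<partial>P \<partial>uv_law)"
    by (rule nn_integral_cong) (subst nn_integral_fst[OF m4, symmetric], simp_all)
  also have "\<dots> = (\<integral>\<^sup>+\<omega>. ennreal (\<Prod>j\<in>J. f j (M \<omega> j)) \<partial>P)"
    by (rule M_test_product_eq[OF J f, symmetric])
  finally have eq: "(\<integral>\<^sup>+\<omega>. ennreal (\<Prod>j\<in>J. f j (M \<omega> j)) \<partial>P) = (\<integral>\<^sup>+x. ennreal (\<Prod>j\<in>J. f j (?G x j)) \<partial>(P \<Otimes>\<^sub>M P \<Otimes>\<^sub>M uv_law))" ..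
  have nn: "0 \<le> (\<Prod>j\<in>J. f j (y j))" for y by (rule smooth_test_prod_bounds(1)[OF f])
  show "(\<integral>\<omega>. (\<Prod>j\<in>J. f j (M \<omega> j)) \<partial>P) = (\<integral>x. (\<Prod>j\<in>J. f j (?G x j)) \<partial>(P \<Otimes>\<^sub>M P \<Otimes>\<^sub>M uv_law))"
    using eq m1 m2 nn by (simp add: integral_eq_nn_integral)
qed

end

subsection \<open>The mean number of chords\<close>

definition cross_mean :: "nat \<Rightarrow> real \<Rightarrow> ennreal" where
  "cross_mean n w = (\<integral>\<^sup>+x. ennreal (real (count_over (stake n x) w)) \<partial>SU)"

text \<open>Averaging over a uniform point instead of fixing one gives a recursion that closes
  (\<open>mean_area_Suc\<close>).\<close>

definition mean_area :: "nat \<Rightarrow> ennreal" where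
  "mean_area n = (\<integral>\<^sup>+w. cross_mean n w \<partial>unif)"

lemma cross_mean_measurable [measurable]: "cross_mean n \<in> borel_measurable borel"
  unfolding cross_mean_def by measurable

lemma measurable_unif: "borel_measurable unif = borel_measurable borel"
  by (rule measurable_cong_sets) (auto simp: unif_def)

interpretation unif: prob_space unif by (rule prob_space_unif)

lemma emeasure_unif_UNIV: "emeasure unif UNIV = 1"
  using unif.emeasure_space_1 by (simp add: unif_def)

lemma area_measurable [measurable (raw)]:
  assumes [measurable]: "f \<in> measurable N SU"
  shows "(\<lambda>x. \<integral>\<^sup>+s. ennreal (real (count_over (stake n (f x)) s)) \<partial>unif) \<in> borel_measurable N"
proof (rule unif.borel_measurable_nn_integral)
  have [measurable]: "snd \<in> borel_measurable (N \<Otimes>\<^sub>M unif)"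
    using measurable_snd[of N unif] by (simp add: measurable_cong_sets[of _ _ unif borel] unif_def)
  show "(\<lambda>(x, s). ennreal (real (count_over (stake n (f x)) s))) \<in> borel_measurable (N \<Otimes>\<^sub>M unif)"
    by measurable
qed

lemma mean_area_eq: "mean_area n = (\<integral>\<^sup>+x. \<integral>\<^sup>+s. ennreal (real (count_over (stake n x) s)) \<partial>unif \<partial>SU)"
proof -
  interpret pair_sigma_finite SU unif ..
  have [measurable]: "snd \<in> borel_measurable (SU \<Otimes>\<^sub>M unif)"
    using measurable_snd[of SU unif] by (simp add: measurable_cong_sets[of _ _ unif borel] unif_def)
  show ?thesis unfolding mean_area_def cross_mean_def
    by (rule Fubini') measurable
qed

lemma nn_integral_count_glue_unif:
  assumes l: "0 < l" "l < 1" and w: "0 \<le> w" "w \<le> 1"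
  shows "(\<integral>\<^sup>+s. ennreal (count_glue k0 k1 ys zs (w * (1 - l)) (w * (1 - l) + l) s) \<partial>unif) =
    ennreal (1 - l) * (\<integral>\<^sup>+s. ennreal (real (count_over (stake k0 ys) s)) \<partial>unif) + ennreal l * ennreal (real (count_over (stake k0 ys) w))
    + ennreal l * (1 + (\<integral>\<^sup>+s. ennreal (real (count_over (stake k1 zs) s)) \<partial>unif))"
proof -
  let ?u = "w * (1 - l)" and ?v = "w * (1 - l) + l"
  have uv: "0 \<le> ?u" "?u < ?v" "?v \<le> 1"
    using l mult_nonneg_nonneg[of w "1 - l"] mult_nonneg_nonneg[of "1 - w" "1 - l"] w by (simp_all add: algebra_simps)
  have cm [measurable (raw)]: "(\<lambda>x. ennreal (real (count_over (stake k ys) (f x)))) \<in> borel_measurable N" if [measurable]: "f \<in> borel_measurable N"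
    for k ys f and N :: "real measure"
    by (rule measurable_compose[OF that]) (use count_over_measurable[of "\<lambda>_. ys" borel "\<lambda>x. x" k] in \<open>simp add: space_stream_space\<close>)
  have cmr: "(\<lambda>s. real (count_over (stake k ys) (f s))) \<in> borel_measurable borel" if [measurable]: "f \<in> borel_measurable borel" for k ys and f :: "real \<Rightarrow> real"
    by (rule measurable_compose[OF that]) (use count_over_measurable[of "\<lambda>_. ys" borel "\<lambda>x. x" k] in \<open>simp add: space_stream_space\<close>)
  have om: "outer_pos ?u ?v \<in> borel_measurable borel" by measurable
  have "(\<integral>\<^sup>+s. ennreal (count_glue k0 k1 ys zs ?u ?v s) \<partial>unif) =
     (\<integral>\<^sup>+s. ennreal (real (count_over (stake k0 ys) (outer_pos ?u ?v s)))
        + (if ?u \<le> s \<and> s < ?v then 1 + ennreal (real (count_over (stake k1 zs) (inner_pos ?u ?v s))) else 0) \<partial>unif)"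
    by (intro nn_integral_cong) (auto simp: count_glue_def simp flip: ennreal_1)
  also have "\<dots> = (\<integral>\<^sup>+s. ennreal (real (count_over (stake k0 ys) (outer_pos ?u ?v s))) \<partial>unif)
        + (\<integral>\<^sup>+s. (if ?u \<le> s \<and> s < ?v then 1 + ennreal (real (count_over (stake k1 zs) (inner_pos ?u ?v s))) else 0) \<partial>unif)"
    by (rule nn_integral_add) (auto simp only: measurable_unif, measurable)
  also have "(\<integral>\<^sup>+s. (if ?u \<le> s \<and> s < ?v then 1 + ennreal (real (count_over (stake k1 zs) (inner_pos ?u ?v s))) else 0) \<partial>unif)
      = ennreal (?v - ?u) * (\<integral>\<^sup>+s. 1 + ennreal (real (count_over (stake k1 zs) s)) \<partial>unif)"
    by (rule nn_integral_unif_inner) (use uv in \<open>auto intro!: borel_measurable_add cm\<close>)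
  also have "(\<integral>\<^sup>+s. 1 + ennreal (real (count_over (stake k1 zs) s)) \<partial>unif) = 1 + (\<integral>\<^sup>+s. ennreal (real (count_over (stake k1 zs) s)) \<partial>unif)"
    by (subst nn_integral_add) (use cm[of "\<lambda>x. x" borel k1 zs] in \<open>simp_all add: measurable_unif emeasure_unif_UNIV\<close>)
  also have "(\<integral>\<^sup>+s. ennreal (real (count_over (stake k0 ys) (outer_pos ?u ?v s))) \<partial>unif) =
     ennreal (1 - l) * (\<integral>\<^sup>+s. ennreal (real (count_over (stake k0 ys) s)) \<partial>unif) + ennreal l * ennreal (real (count_over (stake k0 ys) w))"
    by (subst (1 2) nn_integral_unif) (auto intro!: cmr om nn_integral_outer_pos l w)
  finally show ?thesis by (simp add: add.assoc)
qed

text \<open>Success and failure weight are separate arguments over a semiring, so that one recursion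
  serves \<open>real\<close> as well as \<open>ennreal\<close>, where subtraction is badly
  behaved.\<close>

definition binomial_weight :: "'a::comm_semiring_1 \<Rightarrow> 'a \<Rightarrow> nat \<Rightarrow> nat \<Rightarrow> 'a" where
  "binomial_weight p r n k = of_nat (n choose k) * p ^ k * r ^ (n - k)"

lemma sum_binomial_weight_Suc:
  "(\<Sum>k\<le>Suc n. binomial_weight p r (Suc n) k * f k) =
    p * (\<Sum>k\<le>n. binomial_weight p r n k * f (Suc k)) + r * (\<Sum>k\<le>n. binomial_weight p r n k * f k)"
proof -
  have a: "binomial_weight p r (Suc n) (Suc k) = p * binomial_weight p r n k + r * binomial_weight p r n (Suc k)" if "k \<le> n" for k
  proof (cases "k = n")
    case True then show ?thesis by (simp add: binomial_weight_def binomial_eq_0)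
  next
    case False
    then have "n - k = Suc (n - Suc k)" using that by simp
    then show ?thesis by (simp add: binomial_weight_def algebra_simps)
  qed
  have "(\<Sum>k\<le>Suc n. binomial_weight p r (Suc n) k * f k) = binomial_weight p r (Suc n) 0 * f 0 + (\<Sum>k\<le>n. binomial_weight p r (Suc n) (Suc k) * f (Suc k))"
    by (rule sum.atMost_Suc_shift)
  also have "\<dots> = r * (binomial_weight p r n 0 * f 0) + (\<Sum>k\<le>n. (p * binomial_weight p r n k + r * binomial_weight p r n (Suc k)) * f (Suc k))"
    using a by (intro arg_cong2[where f = "(+)"] sum.cong) (auto simp: binomial_weight_def algebra_simps)
  also have "\<dots> = p * (\<Sum>k\<le>n. binomial_weight p r n k * f (Suc k)) + r * (binomial_weight p r n 0 * f 0 + (\<Sum>k\<le>n. binomial_weight p r n (Suc k) * f (Suc k)))"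
    by (simp add: distrib_right sum.distrib sum_distrib_left distrib_left ac_simps)
  also have "binomial_weight p r n 0 * f 0 + (\<Sum>k\<le>n. binomial_weight p r n (Suc k) * f (Suc k)) = (\<Sum>k\<le>Suc n. binomial_weight p r n k * f k)"
    by (rule sum.atMost_Suc_shift[symmetric])
  also have "\<dots> = (\<Sum>k\<le>n. binomial_weight p r n k * f k)" by (simp add: binomial_weight_def binomial_eq_0)
  finally show ?thesis .
qed

text \<open>The factorial moments of the binomial distribution; they make thinning diagonal in the
  basis \<open>n choose j\<close>.\<close>

lemma sum_binomial_weight_choose:
  fixes p r :: real assumes "p + r = 1"
  shows "(\<Sum>k\<le>n. binomial_weight p r n k * real (k choose j)) = real (n choose j) * p ^ j"
proof (induction n arbitrary: j)
  case 0 show ?case by (cases j) (simp_all add: binomial_weight_def)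
next
  case (Suc n)
  have r: "r = 1 - p" using assms by simp
  show ?case
  proof (cases j)
    case 0
    then show ?thesis using Suc[of 0] assms unfolding sum_binomial_weight_Suc by simp
  next
    case (Suc i)
    show ?thesis unfolding sum_binomial_weight_Suc Suc
      by (simp add: distrib_left sum.distrib Suc.IH) (simp add: r algebra_simps)
  qed
qed

lemma (in two_types) nn_integral_select_num:
  "(\<integral>\<^sup>+x. \<phi> (select_num A0 n x) \<partial>S) = (\<Sum>k\<le>n. binomial_weight p0 (emeasure M {q \<in> space M. \<not> A0 q}) n k * \<phi> k)"
proof (induction n arbitrary: \<phi>)
  case 0
  interpret S: prob_space S by (rule prob_space_stream_space)
  show ?case by (simp add: S.emeasure_space_1 binomial_weight_def)
next
  case (Suc n)
  show ?case unfolding sum_binomial_weight_Suc nn_integral_select_num_Suc Suc Suc[of "\<lambda>k. \<phi> (Suc k)"] ..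
qed

lemma (in two_types) nn_integral_select_num_binomial:
  assumes p: "p0 = ennreal p" "0 \<le> p" "p \<le> 1"
  shows "(\<integral>\<^sup>+x. \<phi> (select_num A0 n x) \<partial>S) = (\<Sum>k\<le>n. ennreal (binomial_weight p (1 - p) n k) * \<phi> k)"
proof -
  have "emeasure M {q \<in> space M. \<not> A0 q} = ennreal (1 - prob {q \<in> space M. A0 q})"
    by (simp add: emeasure_eq_measure prob_neg)
  also have "prob {q \<in> space M. A0 q} = p"
    using p0_eq p by (simp add: emeasure_eq_measure)
  finally have q: "emeasure M {q \<in> space M. \<not> A0 q} = ennreal (1 - p)" .
  have "ennreal (binomial_weight p (1 - p) n k) = binomial_weight (ennreal p) (ennreal (1 - p)) n k" for k
    using p by (simp add: binomial_weight_def ennreal_mult ennreal_power ennreal_of_nat_eq_real_of_nat)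
  then show ?thesis unfolding nn_integral_select_num q p(1) by simp
qed

text \<open>Every point inside the arc sees the outer chords over the collapsed position
  \<open>w\<close>; this produces the term with \<open>cross_mean\<close>.\<close>

lemma nn_integral_first_chord:
  assumes l: "0 < l" "l < 1" and w: "0 \<le> w" "w \<le> 1"
  shows "(\<integral>\<^sup>+x. \<integral>\<^sup>+s. ennreal (real (count_over ((w * (1 - l), w * (1 - l) + l) # stake n x) s)) \<partial>unif \<partial>SU) =
    (\<Sum>k\<le>n. ennreal (binomial_weight ((1 - l)\<^sup>2) (1 - (1 - l)\<^sup>2) n k) * (ennreal (1 - l) * mean_area k + ennreal l * cross_mean k w))
    + ennreal l * (1 + (\<Sum>k\<le>n. ennreal (binomial_weight (l\<^sup>2) (1 - l\<^sup>2) n k) * mean_area k))" (is "?L = ?R")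
proof -
  define u v where "u = w * (1 - l)" and "v = w * (1 - l) + l"
  have uv: "0 \<le> u" "u < v" "v \<le> 1" "v - u < 1" and vl: "v - u = l"
    using l mult_nonneg_nonneg[of w "1 - l"] mult_nonneg_nonneg[of "1 - w" "1 - l"] w by (simp_all add: u_def v_def algebra_simps)
  interpret two_types unif2 "outer_pair u v" "inner_pair u v" "outer_map u v" "inner_map u v" "ennreal ((1 - (v - u))\<^sup>2)" "ennreal ((v - u)\<^sup>2)"
    by (rule two_types_unif2[OF uv])
  interpret sw: two_types unif2 "inner_pair u v" "outer_pair u v" "inner_map u v" "outer_map u v" "ennreal ((v - u)\<^sup>2)" "ennreal ((1 - (v - u))\<^sup>2)"
    by (rule two_types_swap)
  let ?area = "\<lambda>k ys. \<integral>\<^sup>+s. ennreal (real (count_over (stake k ys) s)) \<partial>unif"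
  let ?K0 = "select_num (outer_pair u v) n" and ?K1 = "select_num (inner_pair u v) n"
  have glue: "(\<integral>\<^sup>+s. ennreal (count_glue k0 k1 ys zs u v s) \<partial>unif) =
    ennreal (1 - l) * ?area k0 ys + ennreal l * ennreal (real (count_over (stake k0 ys) w)) + ennreal l * (1 + ?area k1 zs)" for k0 k1 ys zs
    unfolding u_def v_def by (rule nn_integral_count_glue_unif[OF l w])
  have uv_eq: "(w * (1 - l), w * (1 - l) + l) = (u, v)" by (simp add: u_def v_def)
  have "?L = (\<integral>\<^sup>+x. \<integral>\<^sup>+ys. \<integral>\<^sup>+zs. (\<integral>\<^sup>+s. ennreal (count_glue (?K0 x) (?K1 x) ys zs u v s) \<partial>unif) \<partial>SU \<partial>SU \<partial>SU)"
    unfolding uv_eq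
    by (rule nn_integral_count_split[OF uv, of "\<lambda>g. \<integral>\<^sup>+s. ennreal (g s) \<partial>unif"]) (unfold glue, measurable)
  also have "\<dots> = (\<integral>\<^sup>+x. (ennreal (1 - l) * mean_area (?K0 x) + ennreal l * cross_mean (?K0 x) w) + ennreal l * (1 + mean_area (?K1 x)) \<partial>SU)"
  proof (rule nn_integral_cong)
    fix x
    have "(\<integral>\<^sup>+zs. (\<integral>\<^sup>+s. ennreal (count_glue k0 k1 ys zs u v s) \<partial>unif) \<partial>SU) =
       ennreal (1 - l) * ?area k0 ys + ennreal l * ennreal (real (count_over (stake k0 ys) w)) + ennreal l * (1 + mean_area k1)" for k0 k1 ys
      unfolding glue mean_area_eq
      by (subst nn_integral_add, measurable) (simp add: nn_integral_cmult nn_integral_add SU.emeasure_space_1)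
    then show "(\<integral>\<^sup>+ys. \<integral>\<^sup>+zs. (\<integral>\<^sup>+s. ennreal (count_glue (?K0 x) (?K1 x) ys zs u v s) \<partial>unif) \<partial>SU \<partial>SU) =
       (ennreal (1 - l) * mean_area (?K0 x) + ennreal l * cross_mean (?K0 x) w) + ennreal l * (1 + mean_area (?K1 x))"
      by (simp add: mean_area_eq[of "?K0 x"] cross_mean_def nn_integral_cmult nn_integral_add SU.emeasure_space_1)
  qed
  also have "\<dots> = (\<integral>\<^sup>+x. ennreal (1 - l) * mean_area (?K0 x) + ennreal l * cross_mean (?K0 x) w \<partial>SU) + ennreal l * (1 + (\<integral>\<^sup>+x. mean_area (?K1 x) \<partial>SU))"
  proof -
    have m: "(\<lambda>x. \<phi> (?K0 x)) \<in> borel_measurable SU" "(\<lambda>x. \<phi> (?K1 x)) \<in> borel_measurable SU" for \<phi> :: "nat \<Rightarrow> ennreal"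
    proof -
      have "?K0 \<in> measurable SU (count_space UNIV)" "?K1 \<in> measurable SU (count_space UNIV)" by measurable
      then show "(\<lambda>x. \<phi> (?K0 x)) \<in> borel_measurable SU" "(\<lambda>x. \<phi> (?K1 x)) \<in> borel_measurable SU"
        by (auto intro: measurable_compose)
    qed
    show ?thesis
      using m(1)[of "\<lambda>k. ennreal (1 - l) * mean_area k + ennreal l * cross_mean k w"] m(2)[of mean_area]
      by (simp add: nn_integral_add nn_integral_cmult SU.emeasure_space_1)
  qed
  also have "(\<integral>\<^sup>+x. ennreal (1 - l) * mean_area (?K0 x) + ennreal l * cross_mean (?K0 x) w \<partial>SU) =
     (\<Sum>k\<le>n. ennreal (binomial_weight ((1 - l)\<^sup>2) (1 - (1 - l)\<^sup>2) n k) * (ennreal (1 - l) * mean_area k + ennreal l * cross_mean k w))"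
    by (rule nn_integral_select_num_binomial) (use l in \<open>simp_all add: vl power_le_one\<close>)
  also have "(\<integral>\<^sup>+x. mean_area (?K1 x) \<partial>SU) = (\<Sum>k\<le>n. ennreal (binomial_weight (l\<^sup>2) (1 - l\<^sup>2) n k) * mean_area k)"
    by (rule sw.nn_integral_select_num_binomial) (use l in \<open>simp_all add: vl power_le_one\<close>)
  finally show ?thesis .
qed

lemma nn_integral_unif_Icc:
  assumes [measurable]: "f \<in> borel_measurable borel"
  shows "(\<integral>\<^sup>+x. f x \<partial>unif) = (\<integral>\<^sup>+x. f x * indicator {0..1} x \<partial>lborel)"
  unfolding nn_integral_unif[OF assms]
  by (rule nn_integral_cong_AE, rule eventually_mono[OF AE_lborel_singleton[of 1]]) (auto split: split_indicator)

text \<open>Averaging over the uniform \<open>w\<close> turns \<open>cross_mean k w\<close> into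
  \<open>mean_area k\<close>, so the weights \<open>1 - l\<close> and \<open>l\<close> of the outer
  side add up to 1.\<close>

lemma mean_area_Suc:
  "mean_area (Suc n) = (\<integral>\<^sup>+l. ennreal (2 * (1 - l)) *
     ((\<Sum>k\<le>n. ennreal (binomial_weight ((1 - l)\<^sup>2) (1 - (1 - l)\<^sup>2) n k) * mean_area k)
      + ennreal l * (1 + (\<Sum>k\<le>n. ennreal (binomial_weight (l\<^sup>2) (1 - l\<^sup>2) n k) * mean_area k))) * indicator {0..1} l \<partial>lborel)"
proof -
  let ?W0 = "\<lambda>l k. ennreal (binomial_weight ((1 - l)\<^sup>2) (1 - (1 - l)\<^sup>2) n k)" and ?W1 = "\<lambda>l k. ennreal (binomial_weight (l\<^sup>2) (1 - l\<^sup>2) n k)"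
  let ?F = "\<lambda>z. \<integral>\<^sup>+x. \<integral>\<^sup>+s. ennreal (real (count_over (z # stake n x) s)) \<partial>unif \<partial>SU"
  have m: "(\<lambda>x. \<integral>\<^sup>+s. ennreal (real (count_over (stake (Suc n) x) s)) \<partial>unif) \<in> borel_measurable SU"
    by (rule area_measurable) simp
  note first = nn_integral_count_first[of "\<lambda>g. \<integral>\<^sup>+s. ennreal (g s) \<partial>unif", OF m]
  have "mean_area (Suc n) = (\<integral>\<^sup>+z. ?F z \<partial>uv_law)" unfolding mean_area_eq by (rule first(1))
  also have "\<dots> = (\<integral>\<^sup>+l. \<integral>\<^sup>+w. ?F (w * (1 - l), w * (1 - l) + l) * ennreal (2 * (1 - l)) * indicator {0..1} w * indicator {0..<1} l \<partial>lborel \<partial>lborel)"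
    by (rule nn_integral_uv_law[OF first(2)])
  also have "\<dots> = (\<integral>\<^sup>+l. ennreal (2 * (1 - l)) *
     ((\<Sum>k\<le>n. ?W0 l k * mean_area k) + ennreal l * (1 + (\<Sum>k\<le>n. ?W1 l k * mean_area k))) * indicator {0..1} l \<partial>lborel)"
  proof (rule nn_integral_cong_AE, rule eventually_mono[OF AE_lborel_neq2[of 0 1]])
    fix l :: real assume l01: "l \<noteq> 0 \<and> l \<noteq> 1"
    show "(\<integral>\<^sup>+w. ?F (w * (1 - l), w * (1 - l) + l) * ennreal (2 * (1 - l)) * indicator {0..1} w * indicator {0..<1} l \<partial>lborel) =
       ennreal (2 * (1 - l)) * ((\<Sum>k\<le>n. ?W0 l k * mean_area k) + ennreal l * (1 + (\<Sum>k\<le>n. ?W1 l k * mean_area k))) * indicator {0..1} l"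
    proof (cases "0 < l \<and> l < 1")
      case False
      then show ?thesis using l01 by (auto split: split_indicator)
    next
      case True
      then have l: "0 < l" "l < 1" by auto
      let ?G = "\<lambda>w. (\<Sum>k\<le>n. ?W0 l k * (ennreal (1 - l) * mean_area k + ennreal l * cross_mean k w)) + ennreal l * (1 + (\<Sum>k\<le>n. ?W1 l k * mean_area k))"
      have "(\<integral>\<^sup>+w. ?F (w * (1 - l), w * (1 - l) + l) * ennreal (2 * (1 - l)) * indicator {0..1} w * indicator {0..<1} l \<partial>lborel)
         = (\<integral>\<^sup>+w. ennreal (2 * (1 - l)) * (?G w * indicator {0..1} w) \<partial>lborel)"
        by (intro nn_integral_cong) (auto simp: nn_integral_first_chord[OF l] l less_imp_le[OF l(1)] mult_ac split: split_indicator)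
      also have "\<dots> = ennreal (2 * (1 - l)) * (\<integral>\<^sup>+w. ?G w \<partial>unif)"
        by (subst nn_integral_cmult, measurable) (simp add: nn_integral_unif_Icc)
      also have "(\<integral>\<^sup>+w. ?G w \<partial>unif) = (\<Sum>k\<le>n. ?W0 l k * (ennreal (1 - l) * mean_area k + ennreal l * mean_area k)) + ennreal l * (1 + (\<Sum>k\<le>n. ?W1 l k * mean_area k))"
        unfolding mean_area_def[symmetric]
        by (simp add: nn_integral_add nn_integral_sum nn_integral_cmult measurable_unif emeasure_unif_UNIV flip: mean_area_def)
      also have "(\<Sum>k\<le>n. ?W0 l k * (ennreal (1 - l) * mean_area k + ennreal l * mean_area k)) = (\<Sum>k\<le>n. ?W0 l k * mean_area k)"
        using l by (simp add: distrib_right[symmetric] ennreal_plus[symmetric] del: ennreal_plus)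
      finally show ?thesis using l by simp
    qed
  qed
  finally show ?thesis .
qed

text \<open>Guarantees that \<open>ennreal (mean_count n - 1)\<close> involves no truncation; the
  term \<open>j = 0\<close> of the convolution alone is at least 1.\<close>

lemma mean_count_ge_1: "mean_count n \<ge> 1"
proof -
  have "1 \<le> growth n" using growth_mono[of 0 n] by (simp add: growth_def)
  also have "growth n = gauss_term (lam_beta / 2) (3 / 2) 0 * growth (n - 0)" by (simp add: gauss_term_def)
  also have "\<dots> \<le> mean_count n" unfolding mean_count_convolution
    by (rule member_le_sum) (auto intro!: mult_nonneg_nonneg gauss_term_nonneg less_imp_le[OF growth_pos])
  finally show ?thesis .
qed

lemma sum_binomial_weight_mean_count:
  fixes p :: real
  shows "(\<Sum>k\<le>n. binomial_weight p (1 - p) n k * (mean_count k - 1)) = (\<Sum>j\<le>n. real (n choose j) * binom_coeff j * p ^ j) - 1"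
proof -
  have mc: "mean_count k = (\<Sum>j\<le>n. real (k choose j) * binom_coeff j)" if "k \<le> n" for k
    unfolding mean_count_def by (rule sum.mono_neutral_left) (use that in \<open>auto simp: binomial_eq_0\<close>)
  have "(\<Sum>k\<le>n. binomial_weight p (1 - p) n k * mean_count k) = (\<Sum>k\<le>n. \<Sum>j\<le>n. binom_coeff j * (binomial_weight p (1 - p) n k * real (k choose j)))"
    by (intro sum.cong) (simp_all add: mc sum_distrib_left mult_ac)
  also have "\<dots> = (\<Sum>j\<le>n. binom_coeff j * (\<Sum>k\<le>n. binomial_weight p (1 - p) n k * real (k choose j)))"
    by (subst sum.swap) (simp add: sum_distrib_left)
  also have "\<dots> = (\<Sum>j\<le>n. real (n choose j) * binom_coeff j * p ^ j)"
    by (simp add: sum_binomial_weight_choose) (simp add: mult_ac)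
  finally show ?thesis
    using sum_binomial_weight_choose[of p "1 - p" n 0] by (simp add: right_diff_distrib sum_subtractf)
qed

text \<open>By the induction hypothesis the integrand of \<open>mean_area_Suc\<close> is a
  polynomial in \<open>l\<close>, since thinning multiplies the j-th coefficient by the j-th power
  of the survival probability. Its exact integral produces the factor of
  \<open>binom_coeff_rec\<close>, and \<open>mean_count_Suc\<close> concludes.\<close>

theorem mean_area_eq_mean_count: "mean_area n = ennreal (mean_count n - 1)"
proof (induction n rule: less_induct)
  case (less n)
  show ?case
  proof (cases n)
    case 0
    then show ?thesis by (simp add: mean_area_eq count_over_def mean_count_def binom_coeff_def)
  next
    case (Suc m)
    define a where "a j = real (m choose j) * binom_coeff j" for j
    define R where "R p = (\<Sum>j\<le>m. a j * p ^ j) - 1" for p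
    have W0: "binomial_weight p (1 - p) m k * (mean_count k - 1) \<ge> 0" "binomial_weight p (1 - p) m k \<ge> 0" if "0 \<le> p" "p \<le> 1" for p :: real and k
      using that mean_count_ge_1[of k] by (auto simp: binomial_weight_def)
    have Req: "(\<Sum>k\<le>m. binomial_weight p (1 - p) m k * (mean_count k - 1)) = R p" for p
      unfolding R_def a_def by (rule sum_binomial_weight_mean_count)
    have R0: "R p \<ge> 0" if "0 \<le> p" "p \<le> 1" for p
      unfolding Req[symmetric] using W0[OF that] by (intro sum_nonneg)
    have WA: "(\<Sum>k\<le>m. ennreal (binomial_weight p (1 - p) m k) * mean_area k) = ennreal (R p)" if p: "0 \<le> p" "p \<le> 1" for p
    proof -
      have "(\<Sum>k\<le>m. ennreal (binomial_weight p (1 - p) m k) * mean_area k) = (\<Sum>k\<le>m. ennreal (binomial_weight p (1 - p) m k * (mean_count k - 1)))"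
        using less W0[OF p] mean_count_ge_1 Suc by (intro sum.cong) (auto simp: ennreal_mult)
      also have "\<dots> = ennreal (R p)" unfolding Req[symmetric] by (rule sum_ennreal) (rule W0[OF p])
      finally show ?thesis .
    qed
    define g where "g l = 2 * (1 - l) * (R ((1 - l)\<^sup>2) + l * (1 + R (l\<^sup>2)))" for l
    \<comment> \<open>A primitive of \<open>g\<close>. In the inner term the added 1 cancels the 1
      subtracted in \<open>R\<close>; in the outer term that 1 remains and contributes
      \<open>(1 - l)\<^sup>2\<close>.\<close>
    define G where "G l = (\<Sum>j\<le>m. a j * (2 * (l ^ Suc (2 * j + 1) / real (Suc (2 * j + 1)) - (1 - l) ^ Suc (2 * j + 1) / real (Suc (2 * j + 1)) - l ^ Suc (2 * j + 2) / real (Suc (2 * j + 2))))) + (1 - l)\<^sup>2" for l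
    have "mean_area n = (\<integral>\<^sup>+l. ennreal (g l) * indicator {0..1} l \<partial>lborel)"
      unfolding Suc mean_area_Suc
    proof (intro nn_integral_cong)
      fix l :: real
      have e: "ennreal (2 * (1 - l)) * (ennreal x + ennreal l * (1 + ennreal y)) = ennreal (2 * (1 - l) * (x + l * (1 + y)))"
        if "0 \<le> x" "0 \<le> y" "0 \<le> l" "l \<le> 1" for x y
        using that by (simp add: ennreal_mult[symmetric] ennreal_plus[symmetric] ennreal_1[symmetric] mult_nonneg_nonneg del: ennreal_plus ennreal_1)
      show "ennreal (2 * (1 - l)) *
         ((\<Sum>k\<le>m. ennreal (binomial_weight ((1 - l)\<^sup>2) (1 - (1 - l)\<^sup>2) m k) * mean_area k)
         + ennreal l * (1 + (\<Sum>k\<le>m. ennreal (binomial_weight (l\<^sup>2) (1 - l\<^sup>2) m k) * mean_area k))) * indicator {0..1} l = ennreal (g l) * indicator {0..1} l"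
      proof (cases "l \<in> {0..1}")
        case True
        then have l: "0 \<le> l" "l \<le> 1" "0 \<le> 1 - l" "1 - l \<le> 1" by auto
        show ?thesis unfolding g_def WA[OF zero_le_power2 power_le_one[OF l(1,2)]] WA[OF zero_le_power2 power_le_one[OF l(3,4)]]
          by (subst e) (use l in \<open>auto intro!: R0 power_le_one\<close>)
      qed simp
    qed
    also have "\<dots> = G 1 - G 0"
    proof (rule nn_integral_FTC_Icc)
      show "g \<in> borel_measurable borel" unfolding g_def R_def by measurable
      fix l :: real
      show "0 \<le> g l" if "l \<in> {0..1}" using that unfolding g_def by (auto intro!: mult_nonneg_nonneg add_nonneg_nonneg R0 power_le_one)
      have d1: "((\<lambda>l. l ^ Suc k / real (Suc k)) has_real_derivative l ^ k) (at l)" for k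
        using DERIV_cdivide[OF DERIV_pow[of "Suc k" l UNIV], of "real (Suc k)"] by (simp del: of_nat_Suc power_Suc)
      have d2: "((\<lambda>l. (1 - l) ^ Suc k / real (Suc k)) has_real_derivative - ((1 - l) ^ k)) (at l)" for k
        using DERIV_cdivide[OF DERIV_chain2[OF DERIV_pow[of "Suc k" "1 - l" UNIV] DERIV_diff[OF DERIV_const[of 1] DERIV_ident]], of "real (Suc k)"]
        by (simp del: of_nat_Suc power_Suc)
      have d3: "((\<lambda>l. (1 - l)\<^sup>2) has_real_derivative (- 2 * (1 - l))) (at l)"
        by (auto intro!: derivative_eq_intros)
      have "(G has_real_derivative (\<Sum>j\<le>m. a j * (2 * (l ^ (2 * j + 1) - (- ((1 - l) ^ (2 * j + 1))) - l ^ (2 * j + 2)))) + (- 2 * (1 - l))) (at l)"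
        unfolding G_def by (intro DERIV_add DERIV_sum DERIV_cmult DERIV_diff d1 d2 d3)
      also have "(\<Sum>j\<le>m. a j * (2 * (l ^ (2 * j + 1) - (- ((1 - l) ^ (2 * j + 1))) - l ^ (2 * j + 2)))) + (- 2 * (1 - l)) = g l"
      proof -
        have "a j * (2 * (l ^ (2 * j + 1) - (- ((1 - l) ^ (2 * j + 1))) - l ^ (2 * j + 2))) =
          2 * (1 - l) * (a j * ((1 - l)\<^sup>2) ^ j) + 2 * (1 - l) * l * (a j * (l\<^sup>2) ^ j)" for j
          unfolding power_mult[symmetric] by (simp add: algebra_simps)
        then show ?thesis unfolding g_def R_def by (simp only: sum.distrib sum_distrib_left[symmetric]) (simp add: algebra_simps)
      qed
      finally show "(G has_real_derivative g l) (at l)" .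
    qed simp
    also have "G 1 - G 0 = (\<Sum>j\<le>m. real (m choose j) * ((1 / (real j + 1) + 1 / ((real j + 1) * (2 * real j + 3))) * binom_coeff j)) - 1"
    proof -
      have "a j * (2 * (1 / real (Suc (2 * j + 1)) - 1 / real (Suc (2 * j + 2)))) + a j * (2 * (1 / real (Suc (2 * j + 1)))) =
        real (m choose j) * ((1 / (real j + 1) + 1 / ((real j + 1) * (2 * real j + 3))) * binom_coeff j)" for j
      proof -
        have "2 * (1 / real (Suc (2 * j + 1)) - 1 / real (Suc (2 * j + 2))) + 2 * (1 / real (Suc (2 * j + 1))) = 1 / (real j + 1) + 1 / ((real j + 1) * (2 * real j + 3))"
          by (simp add: divide_simps) (simp add: algebra_simps)
        then show ?thesis unfolding a_def by (simp only: distrib_left[symmetric]) (simp add: mult_ac)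
      qed
      moreover have "G 1 - G 0 = (\<Sum>j\<le>m. a j * (2 * (1 / real (Suc (2 * j + 1)) - 1 / real (Suc (2 * j + 2)))) + a j * (2 * (1 / real (Suc (2 * j + 1))))) - 1"
        unfolding G_def by (simp add: sum.distrib sum_negf del: of_nat_Suc)
      ultimately show ?thesis by simp
    qed
    also have "\<dots> = mean_count n - 1"
      unfolding binom_coeff_rec Suc mean_count_Suc ..
    finally show ?thesis .
  qed
qed

subsection \<open>The mean of the limit process\<close>

lemma (in prob_space) distr_pair_snd: "prob_space N \<Longrightarrow> distr (N \<Otimes>\<^sub>M M) M snd = M"
proof (intro measure_eqI)
  assume "prob_space N"
  then interpret N: prob_space N .
  fix A assume A: "A \<in> sets (distr (N \<Otimes>\<^sub>M M) M snd)"
  then have "emeasure (distr (N \<Otimes>\<^sub>M M) M snd) A = emeasure (N \<Otimes>\<^sub>M M) (space N \<times> A)"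
    by (auto simp add: emeasure_distr space_pair_measure dest: sets.sets_into_space intro!: arg_cong2[where f=emeasure])
  with A show "emeasure (distr (N \<Otimes>\<^sub>M M) M snd) A = emeasure M A"
    by (simp add: emeasure_pair_measure_Times N.emeasure_space_1)
qed simp

lemma bump_continuous: "continuous_on {0..1} bump"
  unfolding bump_def using lam_beta_pos by (intro continuous_on_powr' continuous_intros) auto

lemma bump_has_integral: "(bump has_integral Beta (lam_beta + 1) (lam_beta + 1)) {0..1}"
proof -
  have "((\<lambda>t. t powr (lam_beta + 1 - 1) * (1 - t) powr (lam_beta + 1 - 1)) has_integral Beta (lam_beta + 1) (lam_beta + 1)) {0..1}"
    using lam_beta_pos by (intro has_integral_Beta_real) auto
  then show ?thesis by (rule has_integral_eq[rotated]) (auto simp: bump_def powr_mult)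
qed

lemma mean_fp_bump:
  assumes s: "0 < s" "s < 1"
  shows "integrable uv_law (\<lambda>z. (1 - (snd z - fst z)) powr lam_beta * bump (outer_pos (fst z) (snd z) s)
      + inner_wt (fst z) (snd z) s * bump (inner_pos (fst z) (snd z) s))" (is "integrable _ ?k")
    and "(\<integral>z. (1 - (snd z - fst z)) powr lam_beta * bump (outer_pos (fst z) (snd z) s)
      + inner_wt (fst z) (snd z) s * bump (inner_pos (fst z) (snd z) s) \<partial>uv_law) = bump s"
proof -
  have b: "bump y \<ge> 0" and w: "inner_wt u v s \<ge> 0" for y u v by (auto simp: bump_def inner_wt_def)
  have k0: "?k z \<ge> 0" for z by (intro add_nonneg_nonneg mult_nonneg_nonneg b w) simp
  have m: "?k \<in> borel_measurable uv_law" by (rule measurable_uv_lawI) measurable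
  have "(\<integral>\<^sup>+z. ennreal (?k z) \<partial>uv_law) = mean_op (\<lambda>y. ennreal (bump y)) s"
    unfolding mean_op_def mean_kernel_def by (intro nn_integral_cong) (simp add: b w ennreal_mult)
  then have e: "(\<integral>\<^sup>+z. ennreal (?k z) \<partial>uv_law) = ennreal (bump s)" by (simp add: mean_op_bump[OF s])
  show "integrable uv_law ?k" using e k0 m by (intro integrableI_nonneg) auto
  show "(\<integral>z. ?k z \<partial>uv_law) = bump s" using e k0 m b by (subst integral_eq_nn_integral) auto
qed

lemma lam_kappa_Beta: "lam_kappa * Beta (lam_beta + 1) (lam_beta + 1) = lam_c"
proof -
  have "Beta (lam_beta + 1) (lam_beta + 1) > 0" unfolding Beta_def
    using lam_beta_pos by (intro divide_pos_pos mult_pos_pos Gamma_real_pos) auto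
  then show ?thesis by (simp add: lam_kappa_def)
qed

lemma lam_c_pos: "lam_c > 0"
  unfolding lam_c_def lam_gamma_def using lam_beta_pos
  by (intro divide_pos_pos mult_pos_pos zero_less_power Gamma_real_pos) auto

context lamination_limit begin

definition mean :: "real \<Rightarrow> real" where
  "mean s = (\<integral>\<omega>. M \<omega> s \<partial>P)"

lemma M_integrable: "s \<in> {0..1} \<Longrightarrow> integrable P (\<lambda>\<omega>. M \<omega> s)"
  by (rule M.second_moment_bound(2)[OF M_sup_norm_square_integrable])

lemma mean_continuous: "continuous_on {0..1} mean"
proof -
  have int: "integrable P (\<lambda>\<omega>. sup_norm (M \<omega>))"
  proof (rule Bochner_Integration.integrable_bound)
    show "integrable P (\<lambda>\<omega>. 1 + (sup_norm (M \<omega>))\<^sup>2)" using M_sup_norm_square_integrable by simp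
    have "\<bar>x\<bar> \<le> 1 + x\<^sup>2" for x :: real
      using zero_le_power2[of "\<bar>x\<bar> - 1"] by (simp add: power2_diff)
    then show "AE \<omega> in P. norm (sup_norm (M \<omega>)) \<le> norm (1 + (sup_norm (M \<omega>))\<^sup>2)" by (auto intro: order_trans)
  qed (rule M.sup_norm_measurable)
  show ?thesis unfolding continuous_on_sequentially comp_def
  proof (intro allI ballI impI, elim conjE)
    fix x and a :: real assume a: "a \<in> {0..1}" and x: "\<forall>n. x n \<in> {0..1}" "x \<longlonglongrightarrow> a"
    show "(\<lambda>n. mean (x n)) \<longlonglongrightarrow> mean a" unfolding mean_def
    proof (rule integral_dominated_convergence[OF _ _ int])
      show "AE \<omega> in P. (\<lambda>n. M \<omega> (x n)) \<longlonglongrightarrow> M \<omega> a"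
        using AE_space
      proof eventually_elim
        case (elim \<omega>)
        show ?case using M_continuous[OF elim] a x unfolding continuous_on_sequentially comp_def by blast
      qed
      show "AE \<omega> in P. norm (M \<omega> (x n)) \<le> sup_norm (M \<omega>)" for n
        using AE_space by eventually_elim (use x in \<open>auto intro: abs_le_sup_norm M.paths\<close>)
    qed (use a x in \<open>auto intro: M.eval_measurable\<close>)
  qed
qed

lemma AE_M_nonneg: "AE \<omega> in P. \<forall>s\<in>{0..1}. 0 \<le> M \<omega> s"
  using AE_rescaled_tendsto
proof eventually_elim
  case (elim \<omega>)
  show ?case
  proof
    fix s :: real assume "s \<in> {0..1}"
    from elim[rule_format, OF this] show "0 \<le> M \<omega> s"
      by (rule LIMSEQ_le_const) (auto simp: rescaled_def)
  qed
qed

lemma nn_integral_M: "s \<in> {0..1} \<Longrightarrow> (\<integral>\<^sup>+\<omega>. ennreal (M \<omega> s) \<partial>P) = ennreal (mean s)"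
  unfolding mean_def by (rule nn_integral_eq_integral[OF M_integrable]) (use AE_M_nonneg in \<open>auto elim: eventually_mono\<close>)

lemma mean_nonneg: "s \<in> {0..1} \<Longrightarrow> mean s \<ge> 0"
  unfolding mean_def by (rule integral_nonneg_AE) (use AE_M_nonneg in \<open>auto elim: eventually_mono\<close>)

text \<open>\<open>gap\<close> is uniform in \<open>s\<close>, so its first moment bounds the
  difference between the mean of the rescaled count and \<open>mean\<close> at every point;
  integrating over \<open>s\<close> and applying \<open>mean_count_asymp\<close> fixes the
  mass.\<close>

lemma mean_has_integral: "(mean has_integral lam_c) {0..1}"
proof -
  define r where "r n = ennreal (real n powr (- (lam_beta / 2)))" for n :: nat
  define e where "e n = (\<integral>\<^sup>+\<omega>. ennreal (gap n \<omega>) \<partial>P)" for n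
  define J where "J = (\<integral>\<^sup>+s. ennreal (mean (clamp01 s)) \<partial>unif)"
  have resc: "(\<integral>\<^sup>+\<omega>. ennreal (rescaled n \<omega> s) \<partial>P) = r n * cross_mean n s" for n s
  proof -
    have "(\<lambda>x. ennreal (real (count_over (stake n x) s))) \<in> borel_measurable SU" by measurable
    from nn_integral_input_stream[OF this] show ?thesis
      unfolding rescaled_def r_def cross_mean_def by (simp add: ennreal_mult nn_integral_cmult)
  qed
  have [measurable]: "(\<lambda>\<omega>. rescaled n \<omega> s) \<in> borel_measurable P" for n s
    unfolding rescaled_def by measurable
  have diff: "(\<integral>\<^sup>+\<omega>. ennreal \<bar>rescaled n \<omega> s - M \<omega> s\<bar> \<partial>P) \<le> e n" if "s \<in> {0..1}" for n s
    unfolding e_def by (rule nn_integral_mono_AE) (use AE_gap that in \<open>auto elim!: eventually_mono intro!: ennreal_leI\<close>)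
  have up: "r n * cross_mean n s \<le> ennreal (mean s) + e n" and lo: "ennreal (mean s) \<le> r n * cross_mean n s + e n"
    if s: "s \<in> {0..1}" for n s
  proof -
    note [measurable] = M.eval_measurable[OF s]
    have tri: "ennreal a \<le> ennreal b + ennreal \<bar>a - b\<bar>" if "0 \<le> b" for a b :: real
      using that by (simp add: ennreal_plus[symmetric] ennreal_leI del: ennreal_plus)
    have "r n * cross_mean n s \<le> (\<integral>\<^sup>+\<omega>. ennreal (M \<omega> s) + ennreal \<bar>rescaled n \<omega> s - M \<omega> s\<bar> \<partial>P)"
      unfolding resc[symmetric] by (rule nn_integral_mono_AE) (use AE_M_nonneg s in \<open>auto elim!: eventually_mono intro!: tri\<close>)
    also have "\<dots> = ennreal (mean s) + (\<integral>\<^sup>+\<omega>. ennreal \<bar>rescaled n \<omega> s - M \<omega> s\<bar> \<partial>P)"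
      by (subst nn_integral_add) (simp_all add: nn_integral_M[OF s])
    also have "\<dots> \<le> ennreal (mean s) + e n" by (rule add_left_mono[OF diff[OF s]])
    finally show "r n * cross_mean n s \<le> ennreal (mean s) + e n" .
    have "ennreal (mean s) \<le> (\<integral>\<^sup>+\<omega>. ennreal (rescaled n \<omega> s) + ennreal \<bar>rescaled n \<omega> s - M \<omega> s\<bar> \<partial>P)"
      unfolding nn_integral_M[OF s, symmetric]
      by (rule nn_integral_mono) (subst abs_minus_commute, auto intro!: tri simp: rescaled_def)
    also have "\<dots> = r n * cross_mean n s + (\<integral>\<^sup>+\<omega>. ennreal \<bar>rescaled n \<omega> s - M \<omega> s\<bar> \<partial>P)"
      by (subst nn_integral_add) (simp_all add: resc)
    also have "\<dots> \<le> r n * cross_mean n s + e n" by (rule add_left_mono[OF diff[OF s]])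
    finally show "ennreal (mean s) \<le> r n * cross_mean n s + e n" .
  qed
  have "continuous_on UNIV clamp01" unfolding clamp01_def by (intro continuous_intros)
  then have "continuous_on UNIV (\<lambda>s. mean (clamp01 s))"
    by (intro continuous_on_compose2[OF mean_continuous]) auto
  then have mm [measurable]: "(\<lambda>s. mean (clamp01 s)) \<in> borel_measurable borel" by (rule borel_measurable_continuous_onI)
  have AE01: "AE s in unif. s \<in> {0..1}" using AE_unif_01 by eventually_elim auto
  have rq: "r n * mean_area n = ennreal ((mean_count n - 1) / real n powr (lam_beta / 2))" for n
    unfolding r_def mean_area_eq_mean_count using mean_count_ge_1[of n]
    by (subst ennreal_mult[symmetric]) (auto simp: powr_minus field_simps)
  have int_r: "(\<integral>\<^sup>+s. r n * cross_mean n s + c \<partial>unif) = r n * mean_area n + c" for n c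
    unfolding mean_area_def by (simp add: nn_integral_add nn_integral_cmult measurable_unif emeasure_unif_UNIV)
  have "J \<le> (\<integral>\<^sup>+s. r n * cross_mean n s + e n \<partial>unif)" for n
    unfolding J_def by (rule nn_integral_mono_AE) (use AE01 in eventually_elim, auto simp: clamp01_id intro!: lo)
  then have J1: "J \<le> r n * mean_area n + e n" for n unfolding int_r .
  have "(\<integral>\<^sup>+s. r n * cross_mean n s + 0 \<partial>unif) \<le> (\<integral>\<^sup>+s. ennreal (mean (clamp01 s)) + e n \<partial>unif)" for n
    by (rule nn_integral_mono_AE) (use AE01 in eventually_elim, auto simp: clamp01_id intro!: up)
  then have J2: "r n * mean_area n \<le> J + e n" for n
    unfolding int_r J_def by (simp add: nn_integral_add measurable_unif emeasure_unif_UNIV)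
  have e0: "e \<longlonglongrightarrow> 0" using M_moments[of 1] unfolding e_def by simp
  have "(\<lambda>n. 1 / real n powr (lam_beta / 2)) \<longlonglongrightarrow> 0" using lam_beta_pos by real_asymp
  from tendsto_diff[OF mean_count_asymp this]
  have "(\<lambda>n. (mean_count n - 1) / real n powr (lam_beta / 2)) \<longlonglongrightarrow> lam_c" by (simp add: diff_divide_distrib)
  then have lim: "(\<lambda>n. r n * mean_area n) \<longlonglongrightarrow> ennreal lam_c" unfolding rq by (rule tendsto_ennrealI)
  have "J \<le> ennreal lam_c + 0"
    by (rule LIMSEQ_le_const[OF tendsto_add[OF lim e0]]) (use J1 in auto)
  moreover have "ennreal lam_c \<le> J + 0"
    by (rule LIMSEQ_le[OF lim tendsto_add[OF tendsto_const e0]]) (use J2 in auto)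
  ultimately have J: "J = ennreal lam_c" by simp
  obtain c where c: "(mean has_integral c) {0..1}"
    using integrable_continuous_real[OF mean_continuous] by (auto simp: integrable_on_def)
  then have c': "((\<lambda>s. mean (clamp01 s)) has_integral c) {0..1}" by (rule has_integral_eq[rotated]) (simp add: clamp01_id)
  have "J = ennreal c" unfolding J_def
    by (subst nn_integral_unif_Icc, measurable, rule nn_integral_Icc_01[OF _ c']) (auto intro: mean_nonneg)
  moreover have "c \<ge> 0" by (rule has_integral_nonneg[OF c]) (rule mean_nonneg)
  ultimately have "c = lam_c" using J lam_c_pos by simp
  with c show ?thesis by simp
qed

text \<open>The fixed-point equation at a single point: both copies enter linearly, so their
  expectations can be taken separately for each chord.\<close>

lemma mean_fp_mean:
  assumes s: "0 < s" "s < 1"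
  shows "integrable uv_law (\<lambda>z. (1 - (snd z - fst z)) powr lam_beta * mean (outer_pos (fst z) (snd z) s)
      + inner_wt (fst z) (snd z) s * mean (inner_pos (fst z) (snd z) s))"
    and "mean s = (\<integral>z. (1 - (snd z - fst z)) powr lam_beta * mean (outer_pos (fst z) (snd z) s)
      + inner_wt (fst z) (snd z) s * mean (inner_pos (fst z) (snd z) s) \<partial>uv_law)"
proof -
  have s01: "s \<in> {0..1}" using s by simp
  have dist: "distr (P \<Otimes>\<^sub>M P) P fst = P" "distr (P \<Otimes>\<^sub>M P) P snd = P"
    by (rule distr_pair_fst) (rule distr_pair_snd[OF prob_space_axioms])
  have pair: "integrable (P \<Otimes>\<^sub>M P) (\<lambda>p. M (fst p) y)" "(\<integral>p. M (fst p) y \<partial>(P \<Otimes>\<^sub>M P)) = mean y"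
    "integrable (P \<Otimes>\<^sub>M P) (\<lambda>p. M (snd p) y)" "(\<integral>p. M (snd p) y \<partial>(P \<Otimes>\<^sub>M P)) = mean y" if y: "y \<in> {0..1}" for y
    using integrable_distr[of fst "P \<Otimes>\<^sub>M P" P "\<lambda>\<omega>. M \<omega> y"] integral_distr[of fst "P \<Otimes>\<^sub>M P" P "\<lambda>\<omega>. M \<omega> y"]
      integrable_distr[of snd "P \<Otimes>\<^sub>M P" P "\<lambda>\<omega>. M \<omega> y"] integral_distr[of snd "P \<Otimes>\<^sub>M P" P "\<lambda>\<omega>. M \<omega> y"]
      M_integrable[OF y] M.eval_measurable[OF y] by (simp_all add: dist mean_def)
  have inner: "(\<integral>p. restrict (glue (M (fst p)) (M (snd p)) (fst z) (snd z)) {0..1} s \<partial>(P \<Otimes>\<^sub>M P)) =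
     (1 - (snd z - fst z)) powr lam_beta * mean (outer_pos (fst z) (snd z) s) + inner_wt (fst z) (snd z) s * mean (inner_pos (fst z) (snd z) s)"
    if z: "z \<in> space uv_law" for z
  proof -
    have o: "outer_pos (fst z) (snd z) s \<in> {0..1}" using z s01 by (intro outer_pos_in) (auto simp: space_uv_law)
    note i = inner_pos_in[of "fst z" "snd z" s]
    show ?thesis using s01 pair[OF o] pair[OF i] by (simp add: glue_eq)
  qed
  have "integrable P (\<lambda>\<omega>. restrict (M \<omega>) {0..1} s)" using M_integrable[OF s01] s01 by simp
  note F = M.FP_integral[OF M_solves_FP measurable_component_singleton[OF s01] \<open>integrable P (\<lambda>\<omega>. restrict (M \<omega>) {0..1} s)\<close>]
  show "integrable uv_law (\<lambda>z. (1 - (snd z - fst z)) powr lam_beta * mean (outer_pos (fst z) (snd z) s)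
      + inner_wt (fst z) (snd z) s * mean (inner_pos (fst z) (snd z) s))"
    using F(2) by (subst (asm) Bochner_Integration.integrable_cong[OF refl inner]) auto
  show "mean s = (\<integral>z. (1 - (snd z - fst z)) powr lam_beta * mean (outer_pos (fst z) (snd z) s)
      + inner_wt (fst z) (snd z) s * mean (inner_pos (fst z) (snd z) s) \<partial>uv_law)"
  proof -
    have "mean s = (\<integral>\<omega>. restrict (M \<omega>) {0..1} s \<partial>P)" using s01 by (simp add: mean_def)
    also note F(1)
    also note Bochner_Integration.integral_cong[OF refl inner]
    finally show ?thesis .
  qed
qed

text \<open>\<open>lam_kappa\<close> gives \<open>lam_kappa * bump\<close> the mass
  \<open>lam_c\<close> of the mean; the difference is a continuous fixed point of mass 0.\<close>

theorem mean_eq: "s \<in> {0..1} \<Longrightarrow> mean s = lam_kappa * bump s"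
proof -
  define d where "d y = mean y - lam_kappa * bump y" for y
  assume s: "s \<in> {0..1}"
  have "d s = 0"
  proof (rule mean_fp_zero[OF _ _ _ s])
    show "mean_fp d" unfolding mean_fp_def
    proof
      fix t :: real assume "t \<in> {0<..<1}"
      then have t: "0 < t" "t < 1" by auto
      let ?km = "\<lambda>f z. (1 - (snd z - fst z)) powr lam_beta * f (outer_pos (fst z) (snd z) t)
        + inner_wt (fst z) (snd z) t * f (inner_pos (fst z) (snd z) t)"
      have "(\<integral>z. ?km d z \<partial>uv_law) = (\<integral>z. ?km mean z - lam_kappa * ?km bump z \<partial>uv_law)"
        unfolding d_def by (intro Bochner_Integration.integral_cong refl) (simp add: algebra_simps)
      also have "\<dots> = (\<integral>z. ?km mean z \<partial>uv_law) - lam_kappa * (\<integral>z. ?km bump z \<partial>uv_law)"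
        using mean_fp_mean(1)[OF t] mean_fp_bump(1)[OF t]
        by (subst Bochner_Integration.integral_diff) (auto intro!: integrable_mult_right)
      also have "\<dots> = d t" unfolding mean_fp_bump(2)[OF t] mean_fp_mean(2)[OF t, symmetric] d_def ..
      finally show "d t = (\<integral>z. ?km d z \<partial>uv_law)" ..
    qed
    show "continuous_on {0..1} d" unfolding d_def
      by (intro continuous_intros mean_continuous bump_continuous)
    show "(d has_integral 0) {0..1}"
      using has_integral_diff[OF mean_has_integral has_integral_mult_right[OF bump_has_integral, of lam_kappa]]
      unfolding d_def by (simp add: lam_kappa_Beta)
  qed
  then show "mean s = lam_kappa * bump s" by (simp add: d_def)
qed

lemma M_admissible: "admissible P M"
  unfolding admissible_def mean_profile_def
  using M_process M.paths M_sup_norm_square_integrable mean_eq by (auto simp: mean_def bump_def)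

lemma M_unique:
  fixes Q :: "'b measure"
  assumes "prob_space Q" "admissible Q X" "solves_FP Q X"
  shows "path_law Q X = path_law P M"
proof -
  interpret Q: prob_space Q by fact
  interpret two_solutions Q X P M
    using assms M_admissible M_solves_FP unfolding admissible_def by unfold_locales auto
  show ?thesis by (rule path_law_unique)
qed

end

subsection \<open>Numerical bounds\<close>

text \<open>The logarithm of Gamma minus its Stirling main part. The limit at infinity is never
  computed, as it cancels in the quotient considered later.\<close>

definition stirling_rem :: "real \<Rightarrow> real" where
  "stirling_rem x = ln (Gamma x) - ((x - 1 / 2) * ln x - x)"

text \<open>The first two terms of the asymptotic series with Bernoulli numbers;
  \<open>stirling_upper\<close> adds the third.\<close>

definition stirling_lower :: "real \<Rightarrow> real" where
  "stirling_lower x = 1 / (12 * x) - 1 / (360 * x ^ 3)"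

definition stirling_upper :: "real \<Rightarrow> real" where
  "stirling_upper x = stirling_lower x + 1 / (1260 * x ^ 5)"

text \<open>The logarithm is twice the inverse hyperbolic tangent of \<open>y\<close>; the tail of
  its series is bounded by a geometric series with ratio y^2.\<close>

lemma atanh_series_bounds:
  fixes y :: real
  assumes y: "0 < y" "y < 1"
  shows "2 * y + 2 * y ^ 3 / 3 + 2 * y ^ 5 / 5 + 2 * y ^ 7 / 7 \<le> ln ((1 + y) / (1 - y))"
    and "ln ((1 + y) / (1 - y)) \<le> 2 * y + 2 * y ^ 3 / 3 + 2 * y ^ 5 / 5 + 2 * y ^ 7 / 7 + 2 * y ^ 9 / (9 * (1 - y\<^sup>2))"
proof -
  let ?x = "(1 + y) / (1 - y)"
  have x: "?x > 1" and q: "(?x - 1) / (?x + 1) = y" using y by (simp_all add: field_simps)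
  have "(\<Sum>k<4. 2 * y ^ (2 * k + 1) / real (2 * k + 1)) = 2 * y + 2 * y ^ 3 / 3 + 2 * y ^ 5 / 5 + 2 * y ^ 7 / 7"
    by (simp add: eval_nat_numeral)
  moreover have "2 * (y ^ (2 * 4 + 1) / (1 - y\<^sup>2) / real (2 * 4 + 1)) = 2 * y ^ 9 / (9 * (1 - y\<^sup>2))" by simp
  ultimately have "ln ?x \<in> {2 * y + 2 * y ^ 3 / 3 + 2 * y ^ 5 / 5 + 2 * y ^ 7 / 7..2 * y + 2 * y ^ 3 / 3 + 2 * y ^ 5 / 5 + 2 * y ^ 7 / 7 + 2 * y ^ 9 / (9 * (1 - y\<^sup>2))}"
    using ln_approx_bounds[OF x, of 4, unfolded q] by (simp only:)
  then show "2 * y + 2 * y ^ 3 / 3 + 2 * y ^ 5 / 5 + 2 * y ^ 7 / 7 \<le> ln ?x"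
    and "ln ?x \<le> 2 * y + 2 * y ^ 3 / 3 + 2 * y ^ 5 / 5 + 2 * y ^ 7 / 7 + 2 * y ^ 9 / (9 * (1 - y\<^sup>2))"
    by (simp_all only: atLeastAtMost_iff)
qed

text \<open>The rational \<open>y\<close> is to be supplied at or just below
  \<open>(x - 1) / (x + 1)\<close>, where \<open>(1 + y) / (1 - y)\<close> would be \<open>x\<close>
  itself; in \<open>ln_upper\<close> it lies at or just above.\<close>

lemma ln_lower:
  fixes y :: real
  assumes y: "0 < y" "y < 1" and x: "1 + y \<le> x * (1 - y)" and l: "l \<le> 2 * y + 2 * y ^ 3 / 3 + 2 * y ^ 5 / 5 + 2 * y ^ 7 / 7"
  shows "l \<le> ln x"
proof -
  have "(1 + y) / (1 - y) \<le> x" using x y by (simp add: pos_divide_le_eq)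
  then have "ln ((1 + y) / (1 - y)) \<le> ln x" using y by (intro ln_mono) auto
  then show ?thesis using atanh_series_bounds(1)[OF y] l by linarith
qed

lemma ln_upper:
  fixes y :: real
  assumes y: "0 < y" "y < 1" and x: "0 < x" "x * (1 - y) \<le> 1 + y"
    and u: "2 * y + 2 * y ^ 3 / 3 + 2 * y ^ 5 / 5 + 2 * y ^ 7 / 7 + 2 * y ^ 9 / (9 * (1 - y\<^sup>2)) \<le> u"
  shows "ln x \<le> u"
proof -
  have "x \<le> (1 + y) / (1 - y)" using x y by (simp add: pos_le_divide_eq)
  then have "ln x \<le> ln ((1 + y) / (1 - y))" using x by (intro ln_mono) auto
  then show ?thesis using atanh_series_bounds(2)[OF y] u by linarith
qed

text \<open>Only differences over a unit step are compared. With \<open>y = 1 / (2 * x + 1)\<close>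
  the step of the remainder is governed by the series of \<open>atanh_series_bounds\<close>, and the
  bounds become rational in \<open>p = x * (x + 1)\<close> because 1/y^2 = 4p + 1. Both inequalities
  reduce to polynomials in \<open>p\<close> with positive coefficients.\<close>

lemma stirling_rem_step:
  assumes x: "x > 0"
  shows "stirling_lower x - stirling_lower (x + 1) \<le> stirling_rem x - stirling_rem (x + 1)"
    and "stirling_rem x - stirling_rem (x + 1) \<le> stirling_upper x - stirling_upper (x + 1)"
proof -
  define p where "p = x * (x + 1)"
  define y where "y = 1 / (2 * x + 1)"
  define q where "q = 4 * p + 1"
  have p: "p > 0" and y: "0 < y" "y < 1" using x by (auto simp: p_def y_def)
  then have q: "q > 0" by (simp add: q_def)
  have yq: "y\<^sup>2 = 1 / q" by (simp add: y_def q_def p_def power2_eq_square field_simps)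
  have y4: "y ^ 4 = 1 / q ^ 2" "y ^ 6 = 1 / q ^ 3" "y ^ 8 = 1 / q ^ 4"
    using arg_cong[OF yq, of "\<lambda>t. t ^ 2"] arg_cong[OF yq, of "\<lambda>t. t ^ 3"] arg_cong[OF yq, of "\<lambda>t. t ^ 4"]
    by (simp_all add: power_mult[symmetric] power_one_over)
  have "Gamma (x + 1) = x * Gamma x" using x by (intro Gamma_plus1) (auto dest: nonpos_Ints_nonpos)
  then have "ln (Gamma (x + 1)) = ln x + ln (Gamma x)" using x by (simp add: ln_mult Gamma_real_pos less_imp_neq[symmetric])
  then have "stirling_rem x - stirling_rem (x + 1) = (x + 1 / 2) * (ln (x + 1) - ln x) - 1"
    unfolding stirling_rem_def by (simp add: algebra_simps)
  also have "ln (x + 1) - ln x = ln ((1 + y) / (1 - y))"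
  proof -
    have "1 + y = 2 * (x + 1) / (2 * x + 1)" "1 - y = 2 * x / (2 * x + 1)" using x by (simp_all add: y_def field_simps)
    then have "(1 + y) / (1 - y) = (2 * (x + 1)) / (2 * x)" using x by (simp only: divide_divide_eq_left) simp
    also have "\<dots> = (x + 1) / x" by (rule mult_divide_mult_cancel_left) simp
    finally have "(1 + y) / (1 - y) = (x + 1) / x" .
    then show ?thesis using x by (simp add: ln_div)
  qed
  also have "x + 1 / 2 = 1 / (2 * y)" using x by (simp add: y_def field_simps)
  finally have D: "stirling_rem x - stirling_rem (x + 1) = 1 / (2 * y) * ln ((1 + y) / (1 - y)) - 1" .
  have lo: "1 / (2 * y) * (2 * y + 2 * y ^ 3 / 3 + 2 * y ^ 5 / 5 + 2 * y ^ 7 / 7) - 1 = 1 / (3 * q) + 1 / (5 * q\<^sup>2) + 1 / (7 * q ^ 3)"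
  proof -
    have "1 / (2 * y) * (2 * y + 2 * y ^ 3 / 3 + 2 * y ^ 5 / 5 + 2 * y ^ 7 / 7) - 1 = y\<^sup>2 / 3 + y ^ 4 / 5 + y ^ 6 / 7"
      using y by (simp add: field_simps eval_nat_numeral)
    then show ?thesis by (simp add: yq y4)
  qed
  have hi: "1 / (2 * y) * (2 * y ^ 9 / (9 * (1 - y\<^sup>2))) = 1 / (36 * p * q ^ 3)"
  proof -
    have "1 / (2 * y) * (2 * y ^ 9 / (9 * (1 - y\<^sup>2))) = y ^ 8 / (9 * (1 - y\<^sup>2))"
      using y by (simp add: eval_nat_numeral)
    also have "\<dots> = 1 / (36 * p * q ^ 3)" unfolding y4 yq using p q by (simp add: q_def divide_simps) (simp add: algebra_simps eval_nat_numeral)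
    finally show ?thesis .
  qed
  have "1 / (2 * y) > 0" using y by simp
  note mult_left_mono[OF atanh_series_bounds(1)[OF y] less_imp_le[OF this]] mult_left_mono[OF atanh_series_bounds(2)[OF y] less_imp_le[OF this]]
  then have b: "1 / (3 * q) + 1 / (5 * q\<^sup>2) + 1 / (7 * q ^ 3) \<le> stirling_rem x - stirling_rem (x + 1)"
     "stirling_rem x - stirling_rem (x + 1) \<le> 1 / (3 * q) + 1 / (5 * q\<^sup>2) + 1 / (7 * q ^ 3) + 1 / (36 * p * q ^ 3)"
    unfolding D lo[symmetric] hi[symmetric] by (simp_all only: distrib_left)
  have inv1: "1 / x - 1 / (x + 1) = 1 / p" using x by (simp add: p_def field_simps)
  have inv3: "1 / x ^ 3 - 1 / (x + 1) ^ 3 = (3 * p + 1) / p ^ 3"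
    using x by (simp add: p_def power_mult_distrib divide_simps) (simp add: algebra_simps eval_nat_numeral)
  have inv5: "1 / x ^ 5 - 1 / (x + 1) ^ 5 = (5 * p\<^sup>2 + 5 * p + 1) / p ^ 5"
    using x by (simp add: p_def power_mult_distrib divide_simps) (simp add: algebra_simps eval_nat_numeral)
  have cd: "1 / (k * t) = 1 / t / k" for k t :: real by simp
  have lin1: "a / 12 - c / 360 - (b / 12 - d / 360) = (a - b) / 12 - (c - d) / 360"
    and lin2: "e + a / 1260 - (f + b / 1260) = e - f + (a - b) / 1260" for a b c d e f :: real
    by (simp_all add: diff_divide_distrib)
  have L: "stirling_lower x - stirling_lower (x + 1) = 1 / (12 * p) - (3 * p + 1) / (360 * p ^ 3)"
  proof -
    have "stirling_lower x - stirling_lower (x + 1) = (1 / x - 1 / (x + 1)) / 12 - (1 / x ^ 3 - 1 / (x + 1) ^ 3) / 360"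
      unfolding stirling_lower_def cd by (rule lin1)
    then show ?thesis unfolding inv1 inv3 by simp
  qed
  have U: "stirling_upper x - stirling_upper (x + 1) = 1 / (12 * p) - (3 * p + 1) / (360 * p ^ 3) + (5 * p\<^sup>2 + 5 * p + 1) / (1260 * p ^ 5)"
  proof -
    have "stirling_upper x - stirling_upper (x + 1) = stirling_lower x - stirling_lower (x + 1) + (1 / x ^ 5 - 1 / (x + 1) ^ 5) / 1260"
      unfolding stirling_upper_def cd by (rule lin2)
    then show ?thesis unfolding L inv5 by simp
  qed
  have "1 / (3 * q) + 1 / (5 * q\<^sup>2) + 1 / (7 * q ^ 3) - (1 / (12 * p) - (3 * p + 1) / (360 * p ^ 3))
      = (7 + 105 * p + 378 * p\<^sup>2 + 640 * p ^ 3) / (2520 * p ^ 3 * q ^ 3)"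
    using p q by (simp add: divide_simps) (simp add: q_def algebra_simps eval_nat_numeral)
  moreover have "\<dots> \<ge> 0" using p q by (intro divide_nonneg_nonneg add_nonneg_nonneg mult_nonneg_nonneg) auto
  ultimately show "stirling_lower x - stirling_lower (x + 1) \<le> stirling_rem x - stirling_rem (x + 1)"
    using b(1) unfolding L by linarith
  have "1 / (12 * p) - (3 * p + 1) / (360 * p ^ 3) + (5 * p\<^sup>2 + 5 * p + 1) / (1260 * p ^ 5)
      - (1 / (3 * q) + 1 / (5 * q\<^sup>2) + 1 / (7 * q ^ 3) + 1 / (36 * p * q ^ 3))
      = (2 + 34 * p + 219 * p\<^sup>2 + 623 * p ^ 3 + 672 * p ^ 4) / (2520 * p ^ 5 * q ^ 3)"
    using p q by (simp add: divide_simps) (simp add: q_def algebra_simps eval_nat_numeral)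
  moreover have "\<dots> \<ge> 0" using p q by (intro divide_nonneg_nonneg add_nonneg_nonneg mult_nonneg_nonneg) auto
  ultimately show "stirling_rem x - stirling_rem (x + 1) \<le> stirling_upper x - stirling_upper (x + 1)"
    using b(2) unfolding U by linarith
qed

text \<open>Remainders along \<open>x + real n\<close> and along the integers have the same limit,
  so one constant serves all \<open>x\<close>.\<close>

lemma stirling_rem_shift: 
  assumes x: "x > 0" shows "(\<lambda>n. stirling_rem (x + real n) - stirling_rem (real n)) \<longlonglongrightarrow> 0"
proof -
  have G0: "Gamma x > 0" using x by (rule Gamma_real_pos)
  have "(\<lambda>n. ln (Gamma x / Gamma_series' x n)) \<longlonglongrightarrow> ln (Gamma x / Gamma x)"
    using G0 by (intro tendsto_intros Gamma_series'_LIMSEQ) auto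
  then have 1: "(\<lambda>n. ln (Gamma x / Gamma_series' x n)) \<longlonglongrightarrow> 0" using G0 by simp
  have 2: "(\<lambda>n. x * ln (real n) - (x + real n - 1 / 2) * ln (x + real n) + x + (real n - 1 / 2) * ln (real n)) \<longlonglongrightarrow> 0"
    using x by real_asymp
  have "\<forall>\<^sub>F n in sequentially. ln (Gamma x / Gamma_series' x n) + (x * ln (real n) - (x + real n - 1 / 2) * ln (x + real n) + x + (real n - 1 / 2) * ln (real n))
      = stirling_rem (x + real n) - stirling_rem (real n)"
    using eventually_gt_at_top[of 0]
  proof eventually_elim
    case (elim n)
    have "x \<notin> \<int>\<^sub>\<le>\<^sub>0" using x by (auto dest: nonpos_Ints_nonpos)
    then have P: "pochhammer x n = Gamma (x + real n) / Gamma x" by (simp add: pochhammer_Gamma)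
    have F: "fact (n - 1) = Gamma (real n)" using elim Gamma_fact[of "n - 1", where 'a = real] by (simp add: of_nat_diff)
    have g: "Gamma (x + real n) > 0" "Gamma (real n) > 0" using x elim by (auto intro: Gamma_real_pos)
    have "Gamma x / Gamma_series' x n = Gamma (x + real n) / (Gamma (real n) * exp (x * ln (real n)))"
      unfolding Gamma_series'_def P F using G0 by simp
    then have "ln (Gamma x / Gamma_series' x n) = ln (Gamma (x + real n)) - ln (Gamma (real n)) - x * ln (real n)"
      using g by (simp add: ln_div ln_mult)
    then show ?case unfolding stirling_rem_def by simp
  qed
  from Lim_transform_eventually[OF tendsto_add[OF 1 2] this] show ?thesis by simp
qed

lemma stirling_bounds_tendsto:
  "(\<lambda>n. stirling_lower (x + real n)) \<longlonglongrightarrow> 0" "(\<lambda>n. stirling_upper (x + real n)) \<longlonglongrightarrow> 0"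
  unfolding stirling_upper_def stirling_lower_def by real_asymp+

lemma stirling_rem_mono:
  assumes x: "x > 0"
  shows "stirling_rem (x + real n) - stirling_lower (x + real n) \<le> stirling_rem x - stirling_lower x"
    and "stirling_rem x - stirling_upper x \<le> stirling_rem (x + real n) - stirling_upper (x + real n)"
proof (induction n)
  case (Suc n)
  have "x + real n > 0" using x by simp
  note step = stirling_rem_step[OF this]
  { case 1 show ?case using step(1) Suc(1) by (simp add: algebra_simps) }
  { case 2 show ?case using step(2) Suc(2) by (simp add: algebra_simps) }
qed simp_all

text \<open>The remainder with the lower correction decreases along the integers and is bounded
  below through the upper correction; its limit is \<open>C\<close>. Monotonicity along
  \<open>x + real n\<close> transfers both bounds back to \<open>x\<close>.\<close>

lemma stirling_formula:
  obtains C where "\<And>x. x > 0 \<Longrightarrow> C + stirling_lower x \<le> stirling_rem x" "\<And>x. x > 0 \<Longrightarrow> stirling_rem x \<le> C + stirling_upper x"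
proof -
  define a where "a n = stirling_rem (1 + real n) - stirling_lower (1 + real n)" for n
  have "decseq a" unfolding decseq_Suc_iff a_def
    using stirling_rem_mono(1)[of "1 + real n" 1 for n] by (auto simp: add_ac)
  moreover have "bounded (range a)"
  proof (rule boundedI)
    fix y assume "y \<in> range a"
    then obtain n where y: "y = a n" by auto
    have "a n \<le> a 0" using stirling_rem_mono(1)[of 1 n] by (simp add: a_def)
    moreover have "stirling_rem 1 - stirling_upper 1 \<le> a n"
    proof -
      have "0 \<le> 1 / (1260 * (1 + real n) ^ 5)" by simp
      then show ?thesis using stirling_rem_mono(2)[OF zero_less_one, of n] unfolding a_def stirling_upper_def[of "1 + real n"] by linarith
    qed
    ultimately show "norm y \<le> \<bar>a 0\<bar> + \<bar>stirling_rem 1 - stirling_upper 1\<bar>" unfolding y by auto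
  qed
  ultimately have "convergent a" by (intro Bseq_monoseq_convergent) (auto simp: Bseq_eq_bounded monoseq_iff)
  then obtain C where "a \<longlonglongrightarrow> C" by (auto simp: convergent_def)
  from tendsto_add[OF this stirling_bounds_tendsto(1)[of 1]]
  have "(\<lambda>n. stirling_rem (real (Suc n))) \<longlonglongrightarrow> C" by (simp add: a_def add_ac)
  then have "(\<lambda>n. stirling_rem (real n)) \<longlonglongrightarrow> C" by (subst (asm) filterlim_sequentially_Suc)
  then have lim: "(\<lambda>n. stirling_rem (x + real n)) \<longlonglongrightarrow> C" if "x > 0" for x
    using tendsto_add[OF stirling_rem_shift[OF that]] by fastforce
  show ?thesis
  proof (rule that[of C])
    fix x :: real assume x: "x > 0"
    have "C - 0 \<le> stirling_rem x - stirling_lower x"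
      by (rule LIMSEQ_le_const2[OF tendsto_diff[OF lim[OF x] stirling_bounds_tendsto(1)[of x]]]) (use stirling_rem_mono(1)[OF x] in auto)
    then show "C + stirling_lower x \<le> stirling_rem x" by simp
    have "stirling_rem x - stirling_upper x \<le> C - 0"
      by (rule LIMSEQ_le_const[OF tendsto_diff[OF lim[OF x] stirling_bounds_tendsto(2)[of x]]]) (use stirling_rem_mono(2)[OF x] in auto)
    then show "stirling_rem x \<le> C + stirling_upper x" by simp
  qed
qed

text \<open>From 15 on the main term is increasing, so on an interval it is bounded by its values at
  the ends.\<close>

lemma log_term_mono:
  assumes "15 \<le> a" "a \<le> (b::real)"
  shows "(a - 1 / 2) * ln (a / 16) \<le> (b - 1 / 2) * ln (b / 16)"
proof -
  have pos: "a > 0" "b > 0" using assms by auto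
  have l1: "ln (b / 16) \<ge> 1 - 16 / b" using ln_le_minus_one[of "16 / b"] pos by (simp add: ln_div)
  have l2: "ln (b / a) \<ge> 1 - a / b" using ln_le_minus_one[of "a / b"] pos by (simp add: ln_div)
  have "0 \<le> (b - a) * ((b - 16 + a - 1 / 2) / b)" using assms by (intro mult_nonneg_nonneg divide_nonneg_nonneg) auto
  also have "\<dots> = (b - a) * (1 - 16 / b) + (a - 1 / 2) * (1 - a / b)" using pos by (simp add: field_simps)
  also have "\<dots> \<le> (b - a) * ln (b / 16) + (a - 1 / 2) * ln (b / a)"
    using assms l1 l2 by (intro add_mono mult_left_mono) auto
  also have "\<dots> = (b - 1 / 2) * ln (b / 16) - (a - 1 / 2) * ln (a / 16)" using pos by (simp add: ln_div algebra_simps diff_divide_distrib)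
  finally show ?thesis by simp
qed

text \<open>Arguments are normalised by 16, a power of 2: the remaining logarithms are small, where
  few terms of the series suffice, and the powers of 2 are collected into a multiple of
  \<open>ln 2\<close>.\<close>

lemma ln_Gamma_interval:
  fixes C :: real
  assumes C: "\<And>x. x > 0 \<Longrightarrow> C + stirling_lower x \<le> stirling_rem x" "\<And>x. x > 0 \<Longrightarrow> stirling_rem x \<le> C + stirling_upper x"
    and X: "15 \<le> a" "a \<le> X" "X \<le> b" and l: "l \<le> ln (a / 16)" and u: "ln (b / 16) \<le> u"
    and lo: "lo \<le> (a - 1 / 2) * l + 1 / (12 * b) - 1 / (360 * a ^ 3)"
    and hi: "(b - 1 / 2) * u + 1 / (12 * a) - 1 / (360 * b ^ 3) + 1 / (1260 * a ^ 5) \<le> hi"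
  shows "lo \<le> ln (Gamma X) - (X - 1 / 2) * (4 * ln 2) + X - C \<and> ln (Gamma X) - (X - 1 / 2) * (4 * ln 2) + X - C \<le> hi"
proof -
  have pos: "a > 0" "X > 0" "b > 0" using X by auto
  have ln16: "ln X = ln (X / 16) + 4 * ln 2"
    using pos ln_realpow[of 2 4] by (simp add: ln_div)
  have e: "ln (Gamma X) - (X - 1 / 2) * (4 * ln 2) + X - C = (X - 1 / 2) * ln (X / 16) + (stirling_rem X - C)"
    unfolding stirling_rem_def ln16 by (simp add: algebra_simps)
  have "(a - 1 / 2) * l \<le> (a - 1 / 2) * ln (a / 16)" using X l by (intro mult_left_mono) auto
  also have "\<dots> \<le> (X - 1 / 2) * ln (X / 16)" using X by (intro log_term_mono) auto
  finally have 1: "(a - 1 / 2) * l \<le> (X - 1 / 2) * ln (X / 16)" .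
  have "(X - 1 / 2) * ln (X / 16) \<le> (b - 1 / 2) * ln (b / 16)" using X by (intro log_term_mono) auto
  also have "\<dots> \<le> (b - 1 / 2) * u" using X u by (intro mult_left_mono) auto
  finally have 2: "(X - 1 / 2) * ln (X / 16) \<le> (b - 1 / 2) * u" .
  have p: "1 / (12 * b) \<le> 1 / (12 * X)" "1 / (12 * X) \<le> 1 / (12 * a)" "1 / (360 * X ^ 3) \<le> 1 / (360 * a ^ 3)"
    "1 / (360 * b ^ 3) \<le> 1 / (360 * X ^ 3)" "1 / (1260 * X ^ 5) \<le> 1 / (1260 * a ^ 5)"
    using pos X by (auto intro!: divide_left_mono mult_left_mono power_mono)
  show ?thesis unfolding e using 1 2 p C[OF pos(2)] lo hi unfolding stirling_upper_def stirling_lower_def by linarith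
qed

lemma pochhammer_mono:
  fixes x y :: real assumes "0 \<le> x" "x \<le> y" shows "pochhammer x n \<le> pochhammer y n"
  unfolding pochhammer_prod using assms by (intro prod_mono) auto

lemma pochhammer_numeral:
  "pochhammer a (numeral k) = pochhammer a (pred_numeral k) * (a + of_nat (pred_numeral k))"
  by (simp add: numeral_eq_Suc pochhammer_Suc)

lemma lam_beta_interval: "561552812 / 1000000000 \<le> lam_beta" "lam_beta \<le> 561552813 / 1000000000"
proof -
  have "4123105624 / 1000000000 \<le> sqrt 17" by (rule real_le_rsqrt) (simp add: power_divide)
  then show "561552812 / 1000000000 \<le> lam_beta" by (simp add: lam_beta_def)
  have "sqrt 17 \<le> 4123105626 / 1000000000" by (rule real_le_lsqrt) (simp_all add: power_divide)
  then show "lam_beta \<le> 561552813 / 1000000000" by (simp add: lam_beta_def)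
qed

lemma lam_kappa_bounds: "3.34443 \<le> lam_kappa" "lam_kappa < 3.34444"
proof -
  note b = lam_beta_interval
  obtain C where C: "\<And>x. x > 0 \<Longrightarrow> C + stirling_lower x \<le> stirling_rem x" "\<And>x. x > 0 \<Longrightarrow> stirling_rem x \<le> C + stirling_upper x"
    using stirling_formula by blast
  \<comment> \<open>Here and for the other arguments, \<open>y\<close> is
    \<open>(x - 1) / (x + 1)\<close> for the ratio \<open>x\<close> of the argument to 16, rounded
    down for the lower and up for the upper bound.\<close>
  have l_a0: "307716586667 / 10000000000000 \<le> ln (165 / 10 / 16 :: real)"
    by (rule ln_lower[where y = "15384615384615 / 1000000000000000"]) (simp_all add: power_divide)
  have u_a0: "ln (165 / 10 / 16 :: real) \<le> 307716586668 / 10000000000000"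
    by (rule ln_upper[where y = "15384615384616 / 1000000000000000"]) (simp_all add: power_divide)
  have g_a0: "497396425351 / 1000000000000 \<le> ln (Gamma ((33 / 2 :: real))) - ((33 / 2 :: real) - 1 / 2) * (4 * ln 2) + ((33 / 2 :: real)) - C \<and> ln (Gamma ((33 / 2 :: real))) - ((33 / 2 :: real) - 1 / 2) * (4 * ln 2) + ((33 / 2 :: real)) - C \<le> 497396426003 / 1000000000000"
    by (rule ln_Gamma_interval[OF C _ _ _ l_a0 u_a0]) (use b in \<open>simp_all add: power_divide\<close>)
  have q_a0: "pochhammer ((1 / 2 :: real) :: real) 16 = 191898783962510625 / 65536" by (simp add: pochhammer_numeral)
  have l_a1: "38396697741 / 10000000000000 \<le> ln (16061552812 / 1000000000 / 16 :: real)"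
    by (rule ln_lower[where y = "1919832528415 / 1000000000000000"]) (simp_all add: power_divide)
  have u_a1: "ln (16061552813 / 1000000000 / 16 :: real) \<le> 38396698365 / 10000000000000"
    by (rule ln_upper[where y = "1919832559546 / 1000000000000000"]) (simp_all add: power_divide)
  have g_a1: "64938926966 / 1000000000000 \<le> ln (Gamma (lam_beta + 31 / 2)) - (lam_beta + 31 / 2 - 1 / 2) * (4 * ln 2) + (lam_beta + 31 / 2) - C \<and> ln (Gamma (lam_beta + 31 / 2)) - (lam_beta + 31 / 2 - 1 / 2) * (4 * ln 2) + (lam_beta + 31 / 2) - C \<le> 64938928684 / 1000000000000"
    by (rule ln_Gamma_interval[OF C _ _ _ l_a1 u_a1]) (use b in \<open>simp_all add: power_divide\<close>)
  have "pochhammer (2061552812 / 1000000000 :: real) 14 \<ge> 1506606042193" by (simp add: pochhammer_numeral)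
  moreover have "pochhammer (2061552812 / 1000000000) 14 \<le> pochhammer (lam_beta + 3 / 2) 14" by (rule pochhammer_mono) (use b in auto)
  ultimately have q_a1: "1506606042193 \<le> pochhammer (lam_beta + 3 / 2) 14" by linarith
  have "pochhammer (2061552813 / 1000000000 :: real) 14 \<le> 1506606045634" by (simp add: pochhammer_numeral)
  moreover have "pochhammer (lam_beta + 3 / 2) 14 \<le> pochhammer (2061552813 / 1000000000) 14" by (rule pochhammer_mono) (use b in auto)
  ultimately have r_a1: "pochhammer (lam_beta + 3 / 2) 14 \<le> 1506606045634" by linarith
  have l_a2: "76646528584 / 10000000000000 \<le> ln (16123105624 / 1000000000 / 16 :: real)"
    by (rule ln_lower[where y = "3832307667911 / 1000000000000000"]) (simp_all add: power_divide)
  have u_a2: "ln (16123105626 / 1000000000 / 16 :: real) \<le> 76646529826 / 10000000000000"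
    by (rule ln_upper[where y = "3832307729934 / 1000000000000000"]) (simp_all add: power_divide)
  have g_a2: "124913584287 / 1000000000000 \<le> ln (Gamma (2 * lam_beta + 15)) - (2 * lam_beta + 15 - 1 / 2) * (4 * ln 2) + (2 * lam_beta + 15) - C \<and> ln (Gamma (2 * lam_beta + 15)) - (2 * lam_beta + 15 - 1 / 2) * (4 * ln 2) + (2 * lam_beta + 15) - C \<le> 124913586973 / 1000000000000"
    by (rule ln_Gamma_interval[OF C _ _ _ l_a2 u_a2]) (use b in \<open>simp_all add: power_divide\<close>)
  have "pochhammer (3123105624 / 1000000000 :: real) 13 \<ge> 815853004068" by (simp add: pochhammer_numeral)
  moreover have "pochhammer (3123105624 / 1000000000) 13 \<le> pochhammer (2 * lam_beta + 2) 13" by (rule pochhammer_mono) (use b in auto)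
  ultimately have q_a2: "815853004068 \<le> pochhammer (2 * lam_beta + 2) 13" by linarith
  have "pochhammer (3123105626 / 1000000000 :: real) 13 \<le> 815853006972" by (simp add: pochhammer_numeral)
  moreover have "pochhammer (2 * lam_beta + 2) 13 \<le> pochhammer (3123105626 / 1000000000) 13" by (rule pochhammer_mono) (use b in auto)
  ultimately have r_a2: "pochhammer (2 * lam_beta + 2) 13 \<le> 815853006972" by linarith
  have l_a3: "ln (16 / 16 :: real) = 0" by simp
  have u_a3: "ln (16 / 16 :: real) = 0" by simp
  have g_a3: "5207655164 / 1000000000000 \<le> ln (Gamma ((16 :: real))) - ((16 :: real) - 1 / 2) * (4 * ln 2) + ((16 :: real)) - C \<and> ln (Gamma ((16 :: real))) - ((16 :: real) - 1 / 2) * (4 * ln 2) + ((16 :: real)) - C \<le> 5207655922 / 1000000000000"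
    by (rule ln_Gamma_interval[OF C _ _ _ eq_refl[OF l_a3[symmetric]] eq_refl[OF u_a3]]) (use b in \<open>simp_all add: power_divide\<close>)
  have q_a3: "pochhammer ((1 :: real) :: real) 15 = 1307674368000" by (simp add: pochhammer_numeral)
  have l_b0: "173963279836 / 10000000000000 \<le> ln (16280776406 / 1000000000 / 16 :: real)"
    by (rule ln_lower[where y = "8697944636418 / 1000000000000000"]) (simp_all add: power_divide)
  have u_b0: "ln (162807764065 / 10000000000 / 16 :: real) \<le> 173963280144 / 10000000000000"
    by (rule ln_upper[where y = "8697944651774 / 1000000000000000"]) (simp_all add: power_divide)
  have g_b0: "279645429524 / 1000000000000 \<le> ln (Gamma (lam_beta / 2 + 16)) - (lam_beta / 2 + 16 - 1 / 2) * (4 * ln 2) + (lam_beta / 2 + 16) - C \<and> ln (Gamma (lam_beta / 2 + 16)) - (lam_beta / 2 + 16 - 1 / 2) * (4 * ln 2) + (lam_beta / 2 + 16) - C \<le> 279645430713 / 1000000000000"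
    by (rule ln_Gamma_interval[OF C _ _ _ l_b0 u_b0]) (use b in \<open>simp_all add: power_divide\<close>)
  have "pochhammer (1280776406 / 1000000000 :: real) 15 \<ge> 3142757103147" by (simp add: pochhammer_numeral)
  moreover have "pochhammer (1280776406 / 1000000000) 15 \<le> pochhammer (lam_beta / 2 + 1) 15" by (rule pochhammer_mono) (use b in auto)
  ultimately have q_b0: "3142757103147 \<le> pochhammer (lam_beta / 2 + 1) 15" by linarith
  have "pochhammer (12807764065 / 10000000000 :: real) 15 \<le> 3142757107784" by (simp add: pochhammer_numeral)
  moreover have "pochhammer (lam_beta / 2 + 1) 15 \<le> pochhammer (12807764065 / 10000000000) 15" by (rule pochhammer_mono) (use b in auto)
  ultimately have r_b0: "pochhammer (lam_beta / 2 + 1) 15 \<le> 3142757107784" by linarith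
  \<comment> \<open>For arguments below 16 the reciprocal ratio is used, since the bounds need a
    number above 1.\<close>
  have "ln (16 / (15780776406 / 1000000000) :: real) \<le> 137962061313 / 10000000000000"
    by (rule ln_upper[where y = "6897993655014 / 1000000000000000"]) (simp_all add: power_divide)
  then have l_b1: "- (137962061313 / 10000000000000) \<le> ln (15780776406 / 1000000000 / 16 :: real)" by (simp add: ln_div)
  have "137962060996 / 10000000000000 \<le> ln (16 / (157807764065 / 10000000000) :: real)"
    by (rule ln_lower[where y = "6897993639172 / 1000000000000000"]) (simp_all add: power_divide)
  then have u_b1: "ln (157807764065 / 10000000000 / 16 :: real) \<le> - (137962060996 / 10000000000000)" by (simp add: ln_div)
  have g_b1: "- (205536761444 / 1000000000000) \<le> ln (Gamma (lam_beta / 2 + 31 / 2)) - (lam_beta / 2 + 31 / 2 - 1 / 2) * (4 * ln 2) + (lam_beta / 2 + 31 / 2) - C \<and> ln (Gamma (lam_beta / 2 + 31 / 2)) - (lam_beta / 2 + 31 / 2 - 1 / 2) * (4 * ln 2) + (lam_beta / 2 + 31 / 2) - C \<le> - (205536760155 / 1000000000000)"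
    by (rule ln_Gamma_interval[OF C _ _ _ l_b1 u_b1]) (use b in \<open>simp_all add: power_divide\<close>)
  have "pochhammer (1780776406 / 1000000000 :: real) 14 \<ge> 775178631425" by (simp add: pochhammer_numeral)
  moreover have "pochhammer (1780776406 / 1000000000) 14 \<le> pochhammer (lam_beta / 2 + 3 / 2) 14" by (rule pochhammer_mono) (use b in auto)
  ultimately have q_b1: "775178631425 \<le> pochhammer (lam_beta / 2 + 3 / 2) 14" by linarith
  have "pochhammer (17807764065 / 10000000000 :: real) 14 \<le> 775178632378" by (simp add: pochhammer_numeral)
  moreover have "pochhammer (lam_beta / 2 + 3 / 2) 14 \<le> pochhammer (17807764065 / 10000000000) 14" by (rule pochhammer_mono) (use b in auto)
  ultimately have r_b1: "pochhammer (lam_beta / 2 + 3 / 2) 14 \<le> 775178632378" by linarith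
  have "ln (16 / (15561552812 / 1000000000) :: real) \<le> 277854133531 / 10000000000000"
    by (rule ln_upper[where y = "13891812947597 / 1000000000000000"]) (simp_all add: power_divide)
  then have l_b2: "- (277854133531 / 10000000000000) \<le> ln (15561552812 / 1000000000 / 16 :: real)" by (simp add: ln_div)
  have "277854132887 / 10000000000000 \<le> ln (16 / (15561552813 / 1000000000) :: real)"
    by (rule ln_lower[where y = "13891812915472 / 1000000000000000"]) (simp_all add: power_divide)
  then have u_b2: "ln (15561552813 / 1000000000 / 16 :: real) \<le> - (277854132887 / 10000000000000)" by (simp add: ln_div)
  have g_b2: "- (413137129471 / 1000000000000) \<le> ln (Gamma (lam_beta + 15)) - (lam_beta + 15 - 1 / 2) * (4 * ln 2) + (lam_beta + 15) - C \<and> ln (Gamma (lam_beta + 15)) - (lam_beta + 15 - 1 / 2) * (4 * ln 2) + (lam_beta + 15) - C \<le> - (413137127658 / 1000000000000)"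
    by (rule ln_Gamma_interval[OF C _ _ _ l_b2 u_b2]) (use b in \<open>simp_all add: power_divide\<close>)
  have "pochhammer (1561552812 / 1000000000 :: real) 14 \<ge> 444642651453" by (simp add: pochhammer_numeral)
  moreover have "pochhammer (1561552812 / 1000000000) 14 \<le> pochhammer (lam_beta + 1) 14" by (rule pochhammer_mono) (use b in auto)
  ultimately have q_b2: "444642651453 \<le> pochhammer (lam_beta + 1) 14" by linarith
  have "pochhammer (1561552813 / 1000000000 :: real) 14 \<le> 444642652619" by (simp add: pochhammer_numeral)
  moreover have "pochhammer (lam_beta + 1) 14 \<le> pochhammer (1561552813 / 1000000000) 14" by (rule pochhammer_mono) (use b in auto)
  ultimately have r_b2: "pochhammer (lam_beta + 1) 14 \<le> 444642652619" by linarith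
  have l43: "287682066851 / 1000000000000 \<le> ln (4 / 3 :: real)" by (rule ln_lower[where y = "1 / 7"]) (simp_all add: power_divide)
  have u43: "ln (4 / 3 :: real) \<le> 287682072473 / 1000000000000" by (rule ln_upper[where y = "1 / 7"]) (simp_all add: power_divide)
  have l98: "117783035654 / 1000000000000 \<le> ln (9 / 8 :: real)" by (rule ln_lower[where y = "1 / 17"]) (simp_all add: power_divide)
  have u98: "ln (9 / 8 :: real) \<le> 117783035657 / 1000000000000" by (rule ln_upper[where y = "1 / 17"]) (simp_all add: power_divide)
  \<comment> \<open>The ratios 4/3 and 9/8 lead to the small values 1/7 and 1/17 of
    \<open>y\<close>.\<close>
  have "ln 2 = 2 * ln (4 / 3) + ln (9 / 8 :: real)" using ln_realpow[of 2 2] ln_realpow[of 3 2] ln_realpow[of 2 3] by (simp add: ln_div)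
  then have ln2: "693147169356 / 1000000000000 \<le> ln (2 :: real)" "ln (2 :: real) \<le> 693147180603 / 1000000000000" using l43 u43 l98 u98 by linarith+
  have ln128: "ln (128 / x) = 7 * ln 2 - ln x" if "x > 0" for x :: real using that ln_realpow[of 2 7] by (simp add: ln_div)
  \<comment> \<open>The target bounds for \<open>E\<close> are compared with 128, so that again only
    a small logarithm has to be computed.\<close>
  have "149187626836 / 1000000000000 \<le> ln (128 / (110260157 / 1000000) :: real)" by (rule ln_lower[where y = "744557681123 / 10000000000000"]) (simp_all add: power_divide)
  then have e1: "ln (110260157 / 1000000 :: real) \<le> 7 * ln 2 - 149187626836 / 1000000000000" using ln128[of "110260157 / 1000000"] by linarith
  have "ln (128 / (110260484 / 1000000) :: real) \<le> 149184661144 / 1000000000000" by (rule ln_upper[where y = "744542934783 / 10000000000000"]) (simp_all add: power_divide)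
  then have e2: "7 * ln 2 - 149184661144 / 1000000000000 \<le> ln (110260484 / 1000000 :: real)" using ln128[of "110260484 / 1000000"] by linarith
  \<comment> \<open>\<open>E\<close> is the quotient of Gamma values at the shifted arguments near
    16, and \<open>Q\<close> collects the factors of the shifts. To have five Gamma factors above
    and below, \<open>sqrt pi\<close> is read as \<open>Gamma (1 / 2)\<close> and the trivial factor
    \<open>Gamma 1 ^ 2\<close> is inserted.\<close>
  define E where "E = Gamma ((33 / 2 :: real)) * Gamma (lam_beta + 31 / 2) * Gamma (2 * lam_beta + 15) * Gamma ((16 :: real)) ^ 2 / (Gamma (lam_beta / 2 + 16) * Gamma (lam_beta / 2 + 31 / 2) ^ 2 * Gamma (lam_beta + 15) ^ 2)"
  define Q :: real where "Q = pochhammer (lam_beta / 2 + 1) 15 * pochhammer (lam_beta / 2 + 3 / 2) 14 ^ 2 * pochhammer (lam_beta + 1) 14 ^ 2 / (pochhammer ((1 / 2 :: real)) 16 * pochhammer (lam_beta + 3 / 2) 14 * pochhammer (2 * lam_beta + 2) 13 * (pochhammer ((1 :: real)) 15) ^ 2)"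
  have G_a0: "Gamma ((33 / 2 :: real)) > 0" by (rule Gamma_real_pos) (use b in simp)
  have G_a1: "Gamma (lam_beta + 31 / 2) > 0" by (rule Gamma_real_pos) (use b in simp)
  have G_a2: "Gamma (2 * lam_beta + 15) > 0" by (rule Gamma_real_pos) (use b in simp)
  have G_a3: "Gamma ((16 :: real)) > 0" by (rule Gamma_real_pos) (use b in simp)
  have G_b0: "Gamma (lam_beta / 2 + 16) > 0" by (rule Gamma_real_pos) (use b in simp)
  have G_b1: "Gamma (lam_beta / 2 + 31 / 2) > 0" by (rule Gamma_real_pos) (use b in simp)
  have G_b2: "Gamma (lam_beta + 15) > 0" by (rule Gamma_real_pos) (use b in simp)
  have lE: "ln E = ln (Gamma ((33 / 2 :: real))) + ln (Gamma (lam_beta + 31 / 2)) + ln (Gamma (2 * lam_beta + 15)) + 2 * ln (Gamma ((16 :: real))) - ln (Gamma (lam_beta / 2 + 16)) - 2 * ln (Gamma (lam_beta / 2 + 31 / 2)) - 2 * ln (Gamma (lam_beta + 15))"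
    unfolding E_def using G_a0 G_a1 G_a2 G_a3 G_b0 G_b1 G_b2 by (simp add: ln_mult ln_div ln_realpow less_imp_neq[symmetric])
  have E0: "E > 0" unfolding E_def using G_a0 G_a1 G_a2 G_a3 G_b0 G_b1 G_b2 by (intro divide_pos_pos mult_pos_pos zero_less_power)
  have "lam_beta * ln 2 \<le> lam_beta * (693147180603 / 1000000000000)" "lam_beta * (693147169356 / 1000000000000) \<le> lam_beta * ln 2" using ln2 b by (auto intro!: mult_left_mono)
  note B2 = this
  have m_a0: "((33 / 2 :: real) - 1 / 2) * (4 * ln 2) = 0 * (lam_beta * ln 2) + 64 * ln 2" by (simp add: algebra_simps)
  have m_a1: "(lam_beta + 31 / 2 - 1 / 2) * (4 * ln 2) = 4 * (lam_beta * ln 2) + 60 * ln 2" by (simp add: algebra_simps)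
  have m_a2: "(2 * lam_beta + 15 - 1 / 2) * (4 * ln 2) = 8 * (lam_beta * ln 2) + 58 * ln 2" by (simp add: algebra_simps)
  have m_a3: "((16 :: real) - 1 / 2) * (4 * ln 2) = 0 * (lam_beta * ln 2) + 62 * ln 2" by (simp add: algebra_simps)
  have m_b0: "(lam_beta / 2 + 16 - 1 / 2) * (4 * ln 2) = 2 * (lam_beta * ln 2) + 62 * ln 2" by (simp add: algebra_simps)
  have m_b1: "(lam_beta / 2 + 31 / 2 - 1 / 2) * (4 * ln 2) = 2 * (lam_beta * ln 2) + 60 * ln 2" by (simp add: algebra_simps)
  have m_b2: "(lam_beta + 15 - 1 / 2) * (4 * ln 2) = 4 * (lam_beta * ln 2) + 58 * ln 2" by (simp add: algebra_simps)
  note lin = g_a0[unfolded m_a0, THEN conjunct1] g_a0[unfolded m_a0, THEN conjunct2] g_a1[unfolded m_a1, THEN conjunct1] g_a1[unfolded m_a1, THEN conjunct2] g_a2[unfolded m_a2, THEN conjunct1] g_a2[unfolded m_a2, THEN conjunct2] g_a3[unfolded m_a3, THEN conjunct1] g_a3[unfolded m_a3, THEN conjunct2] g_b0[unfolded m_b0, THEN conjunct1] g_b0[unfolded m_b0, THEN conjunct2] g_b1[unfolded m_b1, THEN conjunct1] g_b1[unfolded m_b1, THEN conjunct2] g_b2[unfolded m_b2, THEN conjunct1] g_b2[unfolded m_b2, THEN conjunct2] ln2 b B2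
  have "ln (110260157 / 1000000) \<le> ln E" unfolding lE using lin e1 by linarith
  then have E1: "110260157 / 1000000 \<le> E" using E0 by (subst (asm) ln_le_cancel_iff) auto
  have "ln E \<le> ln (110260484 / 1000000)" unfolding lE using lin e2 by linarith
  then have E2: "E \<le> 110260484 / 1000000" using E0 by (subst (asm) ln_le_cancel_iff) auto
  have Q1: "(3142757103147 * 775178631425 ^ 2 * 444642651453 ^ 2) / ((191898783962510625 / 65536) * 1506606045634 * 815853006972 * 1307674368000 ^ 2) \<le> Q" unfolding Q_def using q_a0 q_a1 q_a2 q_a3 q_b0 q_b1 q_b2 r_a1 r_a2 r_b0 r_b1 r_b2
    by (intro frac_le mult_mono power_mono mult_nonneg_nonneg mult_pos_pos zero_less_power) auto
  have Q2: "Q \<le> (3142757107784 * 775178632378 ^ 2 * 444642652619 ^ 2) / ((191898783962510625 / 65536) * 1506606042193 * 815853004068 * 1307674368000 ^ 2)" unfolding Q_def using q_a0 q_a1 q_a2 q_a3 q_b0 q_b1 q_b2 r_a1 r_a2 r_b0 r_b1 r_b2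
    by (intro frac_le mult_mono power_mono mult_nonneg_nonneg mult_pos_pos zero_less_power) auto
  have kappa: "2 * lam_kappa = E * Q"
  proof -
    have sh: "Gamma x = Gamma (x + real n) / pochhammer x n" "pochhammer x n > 0" if "x > 0" for x :: real and n
    proof -
      have "x \<notin> \<int>\<^sub>\<le>\<^sub>0" using that by (auto dest: nonpos_Ints_nonpos)
      moreover have "Gamma x > 0" "Gamma (x + real n) > 0" using that by (auto intro: Gamma_real_pos)
      ultimately show "Gamma x = Gamma (x + real n) / pochhammer x n" by (simp add: pochhammer_Gamma)
      show "pochhammer x n > 0" by (rule pochhammer_pos[OF that])
    qed
    have s_a0: "Gamma ((1 / 2 :: real)) = Gamma ((33 / 2 :: real)) / pochhammer ((1 / 2 :: real)) 16" "pochhammer ((1 / 2 :: real)) 16 > 0" using sh[of "(1 / 2 :: real)" 16] b by (simp_all add: algebra_simps)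
    have s_a1: "Gamma (lam_beta + 3 / 2) = Gamma (lam_beta + 31 / 2) / pochhammer (lam_beta + 3 / 2) 14" "pochhammer (lam_beta + 3 / 2) 14 > 0" using sh[of "lam_beta + 3 / 2" 14] b by (simp_all add: algebra_simps)
    have s_a2: "Gamma (2 * lam_beta + 2) = Gamma (2 * lam_beta + 15) / pochhammer (2 * lam_beta + 2) 13" "pochhammer (2 * lam_beta + 2) 13 > 0" using sh[of "2 * lam_beta + 2" 13] b by (simp_all add: algebra_simps)
    have s_a3: "Gamma ((1 :: real)) = Gamma ((16 :: real)) / pochhammer ((1 :: real)) 15" "pochhammer ((1 :: real)) 15 > 0" using sh[of "(1 :: real)" 15] b by (simp_all add: algebra_simps)
    have s_b0: "Gamma (lam_beta / 2 + 1) = Gamma (lam_beta / 2 + 16) / pochhammer (lam_beta / 2 + 1) 15" "pochhammer (lam_beta / 2 + 1) 15 > 0" using sh[of "lam_beta / 2 + 1" 15] b by (simp_all add: algebra_simps)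
    have s_b1: "Gamma (lam_beta / 2 + 3 / 2) = Gamma (lam_beta / 2 + 31 / 2) / pochhammer (lam_beta / 2 + 3 / 2) 14" "pochhammer (lam_beta / 2 + 3 / 2) 14 > 0" using sh[of "lam_beta / 2 + 3 / 2" 14] b by (simp_all add: algebra_simps)
    have s_b2: "Gamma (lam_beta + 1) = Gamma (lam_beta + 15) / pochhammer (lam_beta + 1) 14" "pochhammer (lam_beta + 1) 14 > 0" using sh[of "lam_beta + 1" 14] b by (simp_all add: algebra_simps)
    have pi: "sqrt pi = Gamma (1 / 2)" by (simp add: Gamma_one_half_real)
    have "2 * lam_kappa = Gamma (1 / 2) * Gamma (lam_beta + 3 / 2) * Gamma (2 * lam_beta + 2) * Gamma 1 ^ 2 / (Gamma (lam_beta / 2 + 1) * Gamma (lam_beta / 2 + 3 / 2) ^ 2 * Gamma (lam_beta + 1) ^ 2)"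
    proof -
      have "2 * (lam_beta / 2 + 1) - 1 / 2 = lam_beta + 3 / 2" "lam_beta / 2 + 1 + 1 / 2 = lam_beta / 2 + 3 / 2" "lam_beta + 1 + (lam_beta + 1) = 2 * lam_beta + 2" by simp_all
      then show ?thesis unfolding lam_kappa_def lam_c_def lam_gamma_def Beta_def pi by (simp only:) (simp add: power2_eq_square)
    qed
    also have "\<dots> = E * Q" unfolding s_a0 s_a1 s_a2 s_a3 s_b0 s_b1 s_b2 E_def Q_def
      by (simp add: power_divide)
    finally show ?thesis .
  qed
  \<comment> \<open>Twice the claimed lower bound.\<close>
  have "668886 / 100000 \<le> (110260157 / 1000000) * ((3142757103147 * 775178631425 ^ 2 * 444642651453 ^ 2) / ((191898783962510625 / 65536) * 1506606045634 * 815853006972 * 1307674368000 ^ 2) :: real)" by simp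
  also have "\<dots> \<le> E * Q" using E1 Q1 E0 by (intro mult_mono) auto
  finally show "3.34443 \<le> lam_kappa" using kappa by simp
  have "Q \<ge> 0" using Q1 by (rule order_trans[rotated]) simp
  then have "E * Q \<le> (110260484 / 1000000) * ((3142757107784 * 775178632378 ^ 2 * 444642652619 ^ 2) / ((191898783962510625 / 65536) * 1506606042193 * 815853004068 * 1307674368000 ^ 2) :: real)" using E2 Q2 E0 by (intro mult_mono) auto
  also have "\<dots> < 668888 / 100000" by simp
  finally show "lam_kappa < 3.34444" using kappa by simp
qed

theorem corollary1p4:
  fixes P :: "'a measure" and U V :: "nat \<Rightarrow> 'a \<Rightarrow> real" and M :: "'a \<Rightarrow> real \<Rightarrow> real"
  assumes "lamination_input P U V"
    and "is_lamination_limit P U V M"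
  shows "(\<forall>s\<in>{0..1}. integrable P (\<lambda>\<omega>. M \<omega> s) \<and>
            prob_space.expectation P (\<lambda>\<omega>. M \<omega> s) = lam_kappa * (s * (1 - s)) powr lam_beta)
       \<and> 3.34443 \<le> lam_kappa \<and> lam_kappa < 3.34444
       \<and> admissible P M \<and> solves_FP P M
       \<and> (\<forall>(Q :: 'b measure) X. prob_space Q \<longrightarrow> admissible Q X \<longrightarrow> solves_FP Q X
             \<longrightarrow> path_law Q X = path_law P M)"
proof -
  interpret lamination_limit P U V M
    using assms by (simp add: lamination_limit_def lamination_limit_axioms_def)
  have mean: "integrable P (\<lambda>\<omega>. M \<omega> s) \<and> prob_space.expectation P (\<lambda>\<omega>. M \<omega> s) = lam_kappa * (s * (1 - s)) powr lam_beta" if "s \<in> {0..1}" for s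
    using M_integrable[OF that] mean_eq[OF that] by (simp add: mean_def bump_def)
  show ?thesis
    by (intro conjI ballI allI impI mean M_admissible M_solves_FP M_unique lam_kappa_bounds)
qed

end
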